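(* Let $\Omega\subseteq\mathbb{R}^d$, $d\ge2$, be a bounded Lipschitz domain, $I=(0,T)$ with $0<T<\infty$, $Q_T=I\times\Omega$, and $q,p\in\mathcal{P}^{\log}(Q_T)$ with $q^-,p^->1$. Let $(\varphi_h)_{h>0}\subseteq C_0^\infty(I)$ be a family of cut-off functions such that for every $h>0$ it holds $\operatorname{supp}(\varphi_h)\subset I_{2h}:=(2h,T-2h)$, $0\le\varphi_h\le1$, and $\varphi_h\to1$ $(h\to0)$ almost everywhere in $I$. For $\boldsymbol{u}\in\mathcal{X}^{q,p}_{\boldsymbol\varepsilon}(Q_T)$ and $h>0$ define $\mathring{\mathcal{R}}^h_{Q_T}\boldsymbol{u}:=\mathcal{R}^h_{Q_T}(\varphi_h\boldsymbol{u})\in C_0^\infty(\mathbb{R}^{d+1})^d$, with $\mathcal{R}^h_{Q_T}$ and $h_1>0$ as in the context. Then for every $\boldsymbol{u}\in\mathcal{X}^{q,p}_{\boldsymbol\varepsilon}(Q_T)$ it holds: (i) $(\mathring{\mathcal{R}}^h_{Q_T}\boldsymbol{u})_{h>0}\subseteq C_0^\infty(Q_T)^d$ with $\operatorname{supp}(\mathring{\mathcal{R}}^h_{Q_T}\boldsymbol{u})\subseteq(h,T-h)\times\Omega_h$ for every $h>0$, where $\Omega_h:=\{x\in\Omega:\operatorname{dist}(x,\partial\Omega)>h\}$. (ii) There exists a constant $c_d>0$ (depending neither on $q,p$ nor on $\boldsymbol{u}$) such that $\sup_{h>0}|\mathring{\mathcal{R}}^h_{Q_T}\boldsymbol{u}|\le2M_{d+1}(\mathcal{F}_{Q_T}\boldsymbol{u})$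 and $\sup_{h\in(0,h_1)}|\boldsymbol\varepsilon(\mathring{\mathcal{R}}^h_{Q_T}\boldsymbol{u})|\le c_dM_{d+1}(\mathcal{F}_{Q_T}\boldsymbol\varepsilon(\boldsymbol{u}))$ a.e. in $Q_T$. (iii) For extensions $\overline{q},\overline{p}\in\mathcal{P}^{\log}(\mathbb{R}^{d+1})$ of $q,p$, respectively, with $q^-\le\overline{q}\le q^+$ and $p^-\le\overline{p}\le p^+$ in $\mathbb{R}^{d+1}$, there exist constants $c_{\overline{q}},c_{\overline{p}}>0$ (depending on $\overline{q},\overline{p}$, not on $\boldsymbol{u}$) such that $$\sup_{h>0}\|\mathring{\mathcal{R}}^h_{Q_T}\boldsymbol{u}\|_{L^{q(\cdot,\cdot)}(Q_T)^d}\le\sup_{h>0}\|\mathring{\mathcal{R}}^h_{Q_T}\boldsymbol{u}\|_{L^{\overline{q}(\cdot,\cdot)}(\mathbb{R}^{d+1})^d}\le c_{\overline{q}}\|\boldsymbol{u}\|_{L^{q(\cdot,\cdot)}(Q_T)^d},$$ $$\sup_{h\in(0,h_1)}\|\boldsymbol\varepsilon(\mathring{\mathcal{R}}^h_{Q_T}\boldsymbol{u})\|_{L^{p(\cdot,\cdot)}(Q_T)^{d\times d}}\le\sup_{h\in(0,h_1)}\|\boldsymbol\varepsilon(\mathring{\mathcal{R}}^h_{Q_T}\boldsymbol{u})\|_{L^{\overline{p}(\cdot,\cdot)}(\mathbb{R}^{d+1})^{d\times d}}\le c_{\overline{p}}\|\boldsymbol\varepsilon(\boldsymbol{u})\|_{L^{p(\cdot,\cdot)}(Q_T)^{d\times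 d}}.$$ In particular, $\mathring{\mathcal{R}}^h_{Q_T}:\mathcal{X}^{q,p}_{\boldsymbol\varepsilon}(Q_T)\to\mathcal{X}^{q,p}_{\boldsymbol\varepsilon}(Q_T)$ is linear and bounded for every $h\in(0,h_1)$. (iv) $\mathring{\mathcal{R}}^h_{Q_T}\boldsymbol{u}\to\boldsymbol{u}$ in $\mathcal{X}^{q,p}_{\boldsymbol\varepsilon}(Q_T)$ as $h\to0$; i.e. $C_0^\infty(Q_T)^d$ is dense in $\mathcal{X}^{q,p}_{\boldsymbol\varepsilon}(Q_T)$.
   Context: Exponents: for $G\subseteq\mathbb{R}^n$, $\mathcal{P}^{\log}(G)$ is the set of bounded measurable $p:G\to[1,\infty)$ for which there are $c_1,c_2>0$, $p_\infty\in\mathbb{R}$ with $|p(x)-p(y)|\le c_1/\log(e+1/|x-y|)$ for all $x\neq y$ in $G$ and $|p(x)-p_\infty|\le c_2/\log(e+|x|)$ for all $x\in G$; $p^-:=\operatorname{ess\,inf}p$ and $p^+:=\operatorname{ess\,sup}p$. $L^{p(\cdot)}(G)$ is the space of measurable $f$ with $\rho(f)=\int_G|f|^{p(x)}dx<\infty$ and Luxemburg norm $\inf\{\lambda>0:\rho(f/\lambda)\le1\}$ (Euclidean norm for vector/matrix values). Spaces: $\boldsymbol\varepsilon(\mathbf{u})=\frac12(\nabla\mathbf{u}+\nabla\mathbf{u}^\top)$ (spatial, distributional); $\mathbb{M}^{d\times d}_{\mathrm{sym}}$ is the space of symmetric $d\times d$ matrices. $X^{q(\cdot),p(\cdot)}_{\boldsymbol\varepsilon}(\Omega)$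 is the closure of $C_0^\infty(\Omega)^d$ with respect to $\|\mathbf{u}\|_{L^{q(\cdot)}}+\|\boldsymbol\varepsilon(\mathbf{u})\|_{L^{p(\cdot)}}$. $\mathcal{X}^{q,p}_{\boldsymbol\varepsilon}(Q_T):=\{\boldsymbol{u}\in L^{q(\cdot,\cdot)}(Q_T)^d:\boldsymbol\varepsilon(\boldsymbol{u})\in L^{p(\cdot,\cdot)}(Q_T,\mathbb{M}^{d\times d}_{\mathrm{sym}}),\ \boldsymbol{u}(t)\in X^{q(t,\cdot),p(t,\cdot)}_{\boldsymbol\varepsilon}(\Omega)\text{ for a.e. }t\in I\}$ with norm $\|\boldsymbol{u}\|_{L^{q(\cdot,\cdot)}(Q_T)^d}+\|\boldsymbol\varepsilon(\boldsymbol{u})\|_{L^{p(\cdot,\cdot)}(Q_T)^{d\times d}}$. Smoothing: let $h_0,c_0>0$ be constants (depending only on $d,\Omega$; such constants exist) such that $|\mathbf{u}(x)|\le c_0\int_{B^d_{2r(x)}(x)\cap\Omega}|\boldsymbol\varepsilon(\mathbf{u})(y)||x-y|^{1-d}dy$ for all $\mathbf{u}\in X^{1,1}_{\boldsymbol\varepsilon}(\Omega)$ and a.e. $x\in\Omega$ with $r(x):=\operatorname{dist}(x,\partial\Omega)\le h_0$; set $h_1:=h_0/4$. $\omega^n$ is the standard mollifier on $\mathbb{R}^n$, $\omega^n(x)=c\exp(-1/(1-|x|^2))$ for $|x|<1$, $0$ otherwise, $\int\omega^n=1$, and $\omega^n_h(x)=h^{-n}\omega^n(x/h)$; $\boldsymbol\omega_h:=\omega^{d+1}_h$.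 $\Omega_\delta:=\{x\in\Omega:\operatorname{dist}(x,\partial\Omega)>\delta\}$ for $\delta>0$ and $\eta_h:=\omega^d_{h/2}*\chi_{\Omega_{5h/2}}$. $\mathcal{F}_{Q_T}$ is extension by zero from $Q_T$ to $\mathbb{R}^{d+1}$. For $\boldsymbol{u}\in L^{q(\cdot,\cdot)}(Q_T)^d$, $\mathcal{R}^h_{Q_T}\boldsymbol{u}:=\boldsymbol\omega_h*(\eta_h\mathcal{F}_{Q_T}\boldsymbol{u})$ (with $\eta_h$ acting in $x$). $M_{d+1}(f)(z)=\sup_{r>0}\frac1{|B_r(z)|}\int_{B_r(z)}|f|$ is the Hardy–Littlewood maximal operator on $\mathbb{R}^{d+1}$.
   Formalization: In (i) the inclusion in (h,T−h)×Ω_h is proved for the set where the smoothed function is non-zero; for the closed support, which can reach dist(x,∂Ω)=h (e.g. in a ball), it is proved with dist(x,∂Ω) ≥ h instead of > h. *)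

theory Defs
  imports "HOL-Analysis.Analysis" "HOL-Probability.Essential_Supremum"
begin

text \<open>
  Space is \<^typ>\<open>real^'d\<close> and space-time is \<^typ>\<open>real \<times> (real^'d)\<close>, time first; the norms of these
  types, and of \<^typ>\<open>real^'d^'d\<close>, are the Euclidean ones. Elements of function spaces are total
  functions, of which only the values on the underlying set matter (up to null sets). Norms,
  modulars and maximal functions take values in \<^typ>\<open>ennreal\<close>.
\<close>

section \<open>Lipschitz domains\<close>

text \<open>Near each boundary point the set is the strict epigraph, in some direction \<open>n\<close>, of a Lipschitz
  function \<open>g\<close> on the hyperplane orthogonal to \<open>n\<close>.\<close>

definition lipschitz_domain :: "'a::euclidean_space set \<Rightarrow> bool" where
  "lipschitz_domain \<Omega> \<longleftrightarrow> open \<Omega> \<and> connected \<Omega> \<and> \<Omega> \<noteq> {} \<and>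
     (\<forall>z\<in>frontier \<Omega>. \<exists>n g L r. norm n = 1 \<and> 0 < r \<and> L-lipschitz_on {y. y \<bullet> n = 0} g \<and>
        \<Omega> \<inter> ball z r = {x \<in> ball z r. g (x - (x \<bullet> n) *\<^sub>R n) < x \<bullet> n})"

definition inner_part :: "'a::euclidean_space set \<Rightarrow> real \<Rightarrow> 'a set" where
  "inner_part \<Omega> \<delta> = {x \<in> \<Omega>. \<delta> < infdist x (frontier \<Omega>)}"

definition cylinder :: "real \<Rightarrow> 'a set \<Rightarrow> (real \<times> 'a) set" where
  "cylinder T \<Omega> = {0<..<T} \<times> \<Omega>"

section \<open>Smooth functions with compact support\<close>

fun iter_deriv :: "'a::real_normed_vector list \<Rightarrow> ('a \<Rightarrow> 'b::real_normed_vector) \<Rightarrow> 'a \<Rightarrow> 'b" where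
  "iter_deriv [] f = f"
| "iter_deriv (v # vs) f = (\<lambda>x. frechet_derivative (iter_deriv vs f) (at x) v)"

text \<open>Differentiability of every iterated partial derivative makes all of them continuous.\<close>

definition smooth :: "('a::euclidean_space \<Rightarrow> 'b::real_normed_vector) \<Rightarrow> bool" where
  "smooth f \<longleftrightarrow> (\<forall>vs. set vs \<subseteq> Basis \<longrightarrow> (\<forall>x. iter_deriv vs f differentiable (at x)))"

definition closed_supp :: "('a::topological_space \<Rightarrow> 'b::zero) \<Rightarrow> 'a set" where
  "closed_supp f = closure {x. f x \<noteq> 0}"

definition C0_infty :: "'a::euclidean_space set \<Rightarrow> ('a \<Rightarrow> 'b::real_normed_vector) set" where
  "C0_infty G = {f. smooth f \<and> compact (closed_supp f) \<and> closed_supp f \<subseteq> G}"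

section \<open>Variable exponents and variable exponent Lebesgue spaces\<close>

definition P_log :: "'a::euclidean_space set \<Rightarrow> ('a \<Rightarrow> real) set" where
  "P_log G = {p. p \<in> borel_measurable (lebesgue_on G) \<and> bounded (p ` G) \<and> (\<forall>x\<in>G. 1 \<le> p x) \<and>
     (\<exists>c1>0. \<exists>c2>0. \<exists>pinf.
        (\<forall>x\<in>G. \<forall>y\<in>G. x \<noteq> y \<longrightarrow> \<bar>p x - p y\<bar> \<le> c1 / ln (exp 1 + 1 / norm (x - y))) \<and>
        (\<forall>x\<in>G. \<bar>p x - pinf\<bar> \<le> c2 / ln (exp 1 + norm x)))}"

definition ess_plus :: "'a::euclidean_space set \<Rightarrow> ('a \<Rightarrow> real) \<Rightarrow> ereal" where
  "ess_plus G p = esssup (lebesgue_on G) (\<lambda>x. ereal (p x))"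

definition ess_minus :: "'a::euclidean_space set \<Rightarrow> ('a \<Rightarrow> real) \<Rightarrow> ereal" where
  "ess_minus G p = - esssup (lebesgue_on G) (\<lambda>x. ereal (- p x))"

definition modular ::
    "'a::euclidean_space set \<Rightarrow> ('a \<Rightarrow> real) \<Rightarrow> ('a \<Rightarrow> 'b::real_normed_vector) \<Rightarrow> ennreal" where
  "modular G p f = (\<integral>\<^sup>+ x. ennreal (norm (f x) powr p x) \<partial>lebesgue_on G)"

definition Lvar ::
    "'a::euclidean_space set \<Rightarrow> ('a \<Rightarrow> real) \<Rightarrow> ('a \<Rightarrow> 'b::real_normed_vector) set" where
  "Lvar G p = {f \<in> borel_measurable (lebesgue_on G). modular G p f < \<infinity>}"

definition lux_norm ::
    "'a::euclidean_space set \<Rightarrow> ('a \<Rightarrow> real) \<Rightarrow> ('a \<Rightarrow> 'b::real_normed_vector) \<Rightarrow> ennreal" where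
  "lux_norm G p f = Inf {ennreal l | l. 0 < l \<and> modular G p (\<lambda>x. f x /\<^sub>R l) \<le> 1}"

section \<open>Symmetric gradients\<close>

text \<open>Both gradients take the directions \<open>e\<close> of the \<open>d\<close> spatial coordinates as a parameter,
  so that they apply on \<open>\<Omega>\<close> (with \<open>space_dir\<close>) and, differentiating in \<open>x\<close> only, on \<open>Q\<^sub>T\<close>
  (with \<open>st_dir\<close>).\<close>

definition space_dir :: "'d::finite \<Rightarrow> real^'d" where
  "space_dir i = axis i 1"

definition st_dir :: "'d::finite \<Rightarrow> real \<times> (real^'d)" where
  "st_dir i = (0, axis i 1)"

definition sym_grad ::
    "('d::finite \<Rightarrow> 'a::euclidean_space) \<Rightarrow> ('a \<Rightarrow> real^'d) \<Rightarrow> 'a \<Rightarrow> real^'d^'d" where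
  "sym_grad e u z = (\<chi> i j. (frechet_derivative u (at z) (e i) $ j
                              + frechet_derivative u (at z) (e j) $ i) / 2)"

definition loc_integrable ::
    "'a::euclidean_space set \<Rightarrow> ('a \<Rightarrow> 'b::{banach, second_countable_topology}) \<Rightarrow> bool" where
  "loc_integrable G f \<longleftrightarrow> (\<forall>K. compact K \<and> K \<subseteq> G \<longrightarrow> set_integrable lebesgue K f)"

definition has_distr_sym_grad ::
    "('d::finite \<Rightarrow> 'a::euclidean_space) \<Rightarrow> 'a set \<Rightarrow> ('a \<Rightarrow> real^'d) \<Rightarrow> ('a \<Rightarrow> real^'d^'d) \<Rightarrow> bool"
  where
  "has_distr_sym_grad e G u E \<longleftrightarrow> loc_integrable G u \<and> loc_integrable G E \<and>
     (\<forall>\<zeta> :: 'a \<Rightarrow> real. \<zeta> \<in> C0_infty G \<longrightarrow> (\<forall>i j.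
        (LINT z:G|lebesgue. E z $ i $ j * \<zeta> z) =
        - (LINT z:G|lebesgue. (u z $ j * frechet_derivative \<zeta> (at z) (e i)
                                + u z $ i * frechet_derivative \<zeta> (at z) (e j)) / 2)))"

text \<open>A representative; it is determined up to a null subset of \<open>G\<close>.\<close>

definition distr_sym_grad ::
    "('d::finite \<Rightarrow> 'a::euclidean_space) \<Rightarrow> 'a set \<Rightarrow> ('a \<Rightarrow> real^'d) \<Rightarrow> 'a \<Rightarrow> real^'d^'d" where
  "distr_sym_grad e G u = (SOME E. has_distr_sym_grad e G u E)"

section \<open>Symmetric variable exponent Sobolev and Bochner--Lebesgue spaces\<close>

definition W_eps :: "('d::finite \<Rightarrow> 'a::euclidean_space) \<Rightarrow> 'a set \<Rightarrow> ('a \<Rightarrow> real) \<Rightarrow> ('a \<Rightarrow> real)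
    \<Rightarrow> ('a \<Rightarrow> real^'d) set" where
  "W_eps e G q p = {u \<in> Lvar G q. \<exists>E \<in> Lvar G p. has_distr_sym_grad e G u E}"

definition eps_norm :: "('d::finite \<Rightarrow> 'a::euclidean_space) \<Rightarrow> 'a set \<Rightarrow> ('a \<Rightarrow> real) \<Rightarrow> ('a \<Rightarrow> real)
    \<Rightarrow> ('a \<Rightarrow> real^'d) \<Rightarrow> ennreal" where
  "eps_norm e G q p u = lux_norm G q u + lux_norm G p (distr_sym_grad e G u)"

definition X_eps ::
    "(real^'d::finite) set \<Rightarrow> (real^'d \<Rightarrow> real) \<Rightarrow> (real^'d \<Rightarrow> real) \<Rightarrow> (real^'d \<Rightarrow> real^'d) set" where
  "X_eps \<Omega> q p = {u \<in> W_eps space_dir \<Omega> q p.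
     \<forall>\<epsilon>>0. \<exists>v \<in> C0_infty \<Omega>. eps_norm space_dir \<Omega> q p (\<lambda>x. u x - v x) < \<epsilon>}"

definition XX_eps :: "real \<Rightarrow> (real^'d::finite) set \<Rightarrow> (real \<times> (real^'d) \<Rightarrow> real)
    \<Rightarrow> (real \<times> (real^'d) \<Rightarrow> real) \<Rightarrow> (real \<times> (real^'d) \<Rightarrow> real^'d) set" where
  "XX_eps T \<Omega> q p = {u \<in> W_eps st_dir (cylinder T \<Omega>) q p.
     AE t in lebesgue_on {0<..<T}. (\<lambda>x. u (t, x)) \<in> X_eps \<Omega> (\<lambda>x. q (t, x)) (\<lambda>x. p (t, x))}"

definition XX_norm :: "real \<Rightarrow> (real^'d::finite) set \<Rightarrow> (real \<times> (real^'d) \<Rightarrow> real)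
    \<Rightarrow> (real \<times> (real^'d) \<Rightarrow> real) \<Rightarrow> (real \<times> (real^'d) \<Rightarrow> real^'d) \<Rightarrow> ennreal" where
  "XX_norm T \<Omega> = eps_norm st_dir (cylinder T \<Omega>)"

section \<open>Smoothing and the maximal operator\<close>

text \<open>The pointwise estimate near the boundary that defines the constants \<open>h\<^sub>0\<close> and \<open>c\<^sub>0\<close>.\<close>

definition boundary_estimate :: "(real^'d::finite) set \<Rightarrow> real \<Rightarrow> real \<Rightarrow> bool" where
  "boundary_estimate \<Omega> h0 c0 \<longleftrightarrow> (\<forall>u \<in> X_eps \<Omega> (\<lambda>_. 1) (\<lambda>_. 1). AE x in lebesgue_on \<Omega>.
     infdist x (frontier \<Omega>) \<le> h0 \<longrightarrow>
     ennreal (norm (u x)) \<le> ennreal c0 *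
       (\<integral>\<^sup>+ y. ennreal (norm (distr_sym_grad space_dir \<Omega> u y) * norm (x - y) powr (1 - real CARD('d)))
          \<partial>lebesgue_on (ball x (2 * infdist x (frontier \<Omega>)) \<inter> \<Omega>)))"

definition zero_ext :: "'a set \<Rightarrow> ('a \<Rightarrow> 'b::zero) \<Rightarrow> 'a \<Rightarrow> 'b" where
  "zero_ext G f z = (if z \<in> G then f z else 0)"

definition bump :: "'a::euclidean_space \<Rightarrow> real" where
  "bump x = (if norm x < 1 then exp (- 1 / (1 - (norm x)\<^sup>2)) else 0)"

definition mollifier :: "real \<Rightarrow> 'a::euclidean_space \<Rightarrow> real" where
  "mollifier h x = bump (x /\<^sub>R h) / (LINT y|lebesgue. bump (y :: 'a)) / h ^ DIM('a)"

definition convolve :: "('a::euclidean_space \<Rightarrow> real)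
    \<Rightarrow> ('a \<Rightarrow> 'b::{banach, second_countable_topology}) \<Rightarrow> 'a \<Rightarrow> 'b" where
  "convolve w f z = (LINT y|lebesgue. w (z - y) *\<^sub>R f y)"

definition eta :: "(real^'d::finite) set \<Rightarrow> real \<Rightarrow> real^'d \<Rightarrow> real" where
  "eta \<Omega> h = convolve (mollifier (h / 2)) (indicator (inner_part \<Omega> (5 * h / 2)))"

definition R_smooth :: "real \<Rightarrow> (real^'d::finite) set \<Rightarrow> real
    \<Rightarrow> (real \<times> (real^'d) \<Rightarrow> real^'d) \<Rightarrow> real \<times> (real^'d) \<Rightarrow> real^'d" where
  "R_smooth T \<Omega> h u =
     convolve (mollifier h) (\<lambda>z. eta \<Omega> h (snd z) *\<^sub>R zero_ext (cylinder T \<Omega>) u z)"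

definition R_ring :: "(real \<Rightarrow> real \<Rightarrow> real) \<Rightarrow> real \<Rightarrow> (real^'d::finite) set \<Rightarrow> real
    \<Rightarrow> (real \<times> (real^'d) \<Rightarrow> real^'d) \<Rightarrow> real \<times> (real^'d) \<Rightarrow> real^'d" where
  "R_ring \<phi> T \<Omega> h u = R_smooth T \<Omega> h (\<lambda>z. \<phi> h (fst z) *\<^sub>R u z)"

definition maximal_fn :: "('a::euclidean_space \<Rightarrow> 'b::real_normed_vector) \<Rightarrow> 'a \<Rightarrow> ennreal" where
  "maximal_fn f z = (SUP r\<in>{0<..}.
     (\<integral>\<^sup>+ y. ennreal (norm (f y)) \<partial>lebesgue_on (ball z r)) / emeasure lebesgue (ball z r))"

end

theory Submission
  imports Defs
begin

text \<open>
  The maximal theorem on variable exponent spaces is not needed: the operators involved are dominated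
  by averages \<open>A\<^sub>h f\<close> of \<open>|f|\<close> over balls of one radius of order \<open>h\<close>. If the modular of \<open>f\<close> is at most 1,
  the average over a ball of radius \<open>h\<close> is at most of order \<open>1 + h^(-n)\<close>, so by log-Hoelder continuity the
  exponent may be frozen on that ball, and Fubini bounds \<open>A\<^sub>h\<close> on \<open>L^{q(.)}\<close> uniformly in \<open>h\<close>. Convergence of the
  smoothing follows by truncation: bounded functions converge in \<open>L^{q(.)}\<close> because they do so in \<open>L\<^sup>1\<close>.

  The symmetric gradient of the smoothing is the smoothing of the symmetric gradient plus a commutator
  in which the gradient of \<open>\<eta>\<^sub>h\<close>, of size \<open>1 / h\<close>, multiplies \<open>u\<close> in the strip of width of order \<open>h\<close> along
  the boundary. There the boundary estimate on almost every time slice bounds \<open>u\<close> by a Riesz potential of its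
  symmetric gradient, so that the commutator is dominated by an average of the symmetric gradient restricted to
  a slightly larger strip; as \<open>h\<close> tends to 0 the strips shrink to the empty set and the commutator vanishes.
\<close>

section \<open>Smooth functions\<close>

text \<open>The obstacle is the derivative of the cutoffs: that of \<open>\<phi> h\<close> comes
  with no bound at all, and that of \<open>eta\<close> grows like 1/h. The former is harmless
  because the symmetric gradient differentiates in space only. For the latter the geometry decides:
  the gradient of \<open>eta\<close> lives where the distance to the boundary is at most 3h, so the
  Riesz ball, of twice that radius, has radius at most 6h; with the spread h of the mollifier this
  fits into averages of radius 8h, and the strip grows to 3h + 6h = 9h. The choice h1 = h0/4 ensures
  3h \<le> h0. The boundary estimate concerns single time slices and a gradient chosen slice by
  slice. To identify it with the slice of the space-time gradient, the exceptional null set of times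
  must not depend on the test function; hence distributional identities on slices are tested only
  against mollifiers of radius 1/(n+1) centred at a countable dense set. Smoothed functions vanish
  outside the cylinder, so their norms with extended exponents on the whole space-time are the norms
  on the cylinder.\<close>

fun Ck :: "nat \<Rightarrow> ('a::euclidean_space \<Rightarrow> 'b::real_normed_vector) \<Rightarrow> bool" where
  "Ck 0 f = (\<forall>x. f differentiable (at x))"
| "Ck (Suc k) f = ((\<forall>x. f differentiable (at x)) \<and>
     (\<forall>b\<in>Basis. Ck k (\<lambda>x. frechet_derivative f (at x) b)))"

lemma iter_deriv_snoc:
  "iter_deriv (vs @ [v]) f = iter_deriv vs (\<lambda>x. frechet_derivative f (at x) v)"
  by (induction vs) auto

text \<open>The last entry of a list in \<open>iter_deriv\<close> is differentiated first, so
  splitting lists at the end matches one unfolding of \<open>Ck\<close>. The recursion on the order,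
  unlike the quantification over lists in \<open>smooth\<close>, lends itself to proving sum,
  product and chain rules by induction.\<close>

lemma Ck_iff:
  fixes f :: "'a::euclidean_space \<Rightarrow> 'b::real_normed_vector"
  shows "Ck k f \<longleftrightarrow> (\<forall>vs. set vs \<subseteq> Basis \<and> length vs \<le> k \<longrightarrow> (\<forall>x. iter_deriv vs f differentiable (at x)))"
proof (induction k arbitrary: f)
  case 0
  then show ?case by auto
next
  case (Suc k)
  show ?case (is "?L = ?R")
  proof
    assume L: ?L
    show ?R
    proof (intro allI impI)
      fix vs :: "'a list" and x assume vs: "set vs \<subseteq> Basis \<and> length vs \<le> Suc k"
      show "iter_deriv vs f differentiable (at x)"
      proof (cases vs rule: rev_cases)
        case Nil
        then show ?thesis using L by simp
      next
        case (snoc ws b)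
        have b: "b \<in> Basis" and ws: "set ws \<subseteq> Basis" "length ws \<le> k" using vs snoc by auto
        have "Ck k (\<lambda>x. frechet_derivative f (at x) b)" using L b by simp
        then show ?thesis using ws unfolding Suc snoc iter_deriv_snoc by blast
      qed
    qed
  next
    assume R: ?R
    have "Ck k (\<lambda>x. frechet_derivative f (at x) b)" if b: "b \<in> Basis" for b
      unfolding Suc
    proof (intro allI impI)
      fix vs :: "'a list" and x assume vs: "set vs \<subseteq> Basis \<and> length vs \<le> k"
      then have "set (vs @ [b]) \<subseteq> Basis \<and> length (vs @ [b]) \<le> Suc k" using b by simp
      then show "iter_deriv vs (\<lambda>x. frechet_derivative f (at x) b) differentiable (at x)"
        using R unfolding iter_deriv_snoc[symmetric] by blast
    qed
    moreover have "\<forall>x. f differentiable (at x)"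
      using R[rule_format, of "[]"] by simp
    ultimately show ?L by simp
  qed
qed

lemma smooth_iff_Ck: "smooth f \<longleftrightarrow> (\<forall>k. Ck k f)"
  unfolding smooth_def Ck_iff by blast

lemma Ck_differentiable: "Ck k f \<Longrightarrow> f differentiable (at x)"
  by (cases k) auto

lemma Ck_SucD: "Ck (Suc k) f \<Longrightarrow> Ck k f"
  unfolding Ck_iff by auto

lemma Ck_derivD: "Ck (Suc k) f \<Longrightarrow> b \<in> Basis \<Longrightarrow> Ck k (\<lambda>x. frechet_derivative f (at x) b)"
  by simp

lemma has_derivative_frechet: "f differentiable (at x) \<Longrightarrow> (f has_derivative frechet_derivative f (at x)) (at x)"
  by (simp add: frechet_derivative_works)

lemma frechet_eq: "(f has_derivative D) (at x) \<Longrightarrow> frechet_derivative f (at x) = D"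
  using frechet_derivative_at by metis

lemma Ck_SucI:
  assumes "\<And>x. (f has_derivative D x) (at x)" "\<And>b. b \<in> Basis \<Longrightarrow> Ck k (\<lambda>x. D x b)"
  shows "Ck (Suc k) f"
proof -
  have "frechet_derivative f (at x) = D x" for x
    using assms(1) by (rule frechet_eq)
  then show ?thesis using assms by (auto simp: differentiable_def)
qed

section \<open>Closure of \<open>Ck\<close> under algebraic operations and composition\<close>

lemma Ck_const: "Ck k (\<lambda>x. c)"
proof (induction k arbitrary: c)
  case (Suc k)
  show ?case by (rule Ck_SucI[where D="\<lambda>x v. 0"]) (auto intro: Suc)
qed auto

lemma Ck_add: "Ck k f \<Longrightarrow> Ck k g \<Longrightarrow> Ck k (\<lambda>x. f x + g x)"
proof (induction k arbitrary: f g)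
  case (Suc k)
  show ?case
    by (rule Ck_SucI[OF has_derivative_add[OF has_derivative_frechet has_derivative_frechet]])
      (use Suc in \<open>auto intro: Ck_differentiable\<close>)
qed auto

lemma Ck_bilinear:
  assumes "bounded_bilinear B"
  shows "Ck k f \<Longrightarrow> Ck k g \<Longrightarrow> Ck k (\<lambda>x. B (f x) (g x))"
proof (induction k arbitrary: f g)
  case 0
  then show ?case
    using bounded_bilinear.FDERIV[OF assms has_derivative_frechet has_derivative_frechet, of f _ g]
    unfolding Ck.simps differentiable_def[of "\<lambda>x. B (f x) (g x)"] by blast
next
  case (Suc k)
  have "Ck k (\<lambda>x. B (f x) (frechet_derivative g (at x) b) + B (frechet_derivative f (at x) b) (g x))"
    if "b \<in> Basis" for b
    by (intro Ck_add Suc.IH Ck_derivD[OF Suc.prems(1)] Ck_derivD[OF Suc.prems(2)]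
        Ck_SucD[OF Suc.prems(1)] Ck_SucD[OF Suc.prems(2)] that)
  then show ?case
    by (rule Ck_SucI[OF bounded_bilinear.FDERIV[OF assms has_derivative_frechet has_derivative_frechet], rotated 2])
      (assumption | rule Ck_differentiable[OF Suc.prems(1)] Ck_differentiable[OF Suc.prems(2)])+
qed

lemmas Ck_scaleR = Ck_bilinear[OF bounded_bilinear_scaleR]
lemmas Ck_mult = Ck_bilinear[OF bounded_bilinear_mult]
lemmas Ck_inner = Ck_bilinear[OF bounded_bilinear_inner]

lemma Ck_sum: "(\<And>i. i \<in> I \<Longrightarrow> Ck k (f i)) \<Longrightarrow> Ck k (\<lambda>x. \<Sum>i\<in>I. f i x)"
  by (induction I rule: infinite_finite_induct) (auto intro!: Ck_const Ck_add)

lemma Ck_linear: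
  assumes "bounded_linear A"
  shows "Ck k A"
proof (cases k)
  case 0
  then show ?thesis
    using assms by (auto simp: differentiable_def intro: bounded_linear_imp_has_derivative)
next
  case (Suc j)
  show ?thesis unfolding Suc
    by (rule Ck_SucI[where D="\<lambda>x. A"]) (auto intro: Ck_const assms bounded_linear_imp_has_derivative)
qed

lemma Ck_minus: "Ck k f \<Longrightarrow> Ck k (\<lambda>x. - f x)"
  using Ck_scaleR[OF Ck_const[of k "-1"], of f] by simp

lemma Ck_diff: "Ck k f \<Longrightarrow> Ck k g \<Longrightarrow> Ck k (\<lambda>x. f x - g x)"
  using Ck_add[OF _ Ck_minus, of k f g] by simp

lemma linear_basis_expand:
  assumes "bounded_linear D"
  shows "D (v::'a::euclidean_space) = (\<Sum>b\<in>Basis. (v \<bullet> b) *\<^sub>R D b)"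
proof -
  interpret bounded_linear D by fact
  have "D v = D (\<Sum>b\<in>Basis. (v \<bullet> b) *\<^sub>R b)" by (simp add: euclidean_representation)
  then show ?thesis by (simp add: sum scaleR)
qed

lemma has_derivative_affine:
  "bounded_linear A \<Longrightarrow> ((\<lambda>x. c + A x) has_derivative A) (at x)"
  using has_derivative_add[OF has_derivative_const bounded_linear_imp_has_derivative, of A c "at x"] by simp

lemma Ck_affine:
  assumes "bounded_linear A"
  shows "Ck k f \<Longrightarrow> Ck k (\<lambda>x. f (c + A x))"
proof (induction k arbitrary: f)
  case 0
  have "(\<lambda>x. f (c + A x)) differentiable (at x)" for x
    using has_derivative_compose[OF has_derivative_affine[OF assms] has_derivative_frechet, of f c x] 0
    by (auto simp: differentiable_def)
  then show ?case by simp
next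
  case (Suc k)
  have d: "((\<lambda>x. f (c + A x)) has_derivative (\<lambda>v. frechet_derivative f (at (c + A x)) (A v))) (at x)" for x
    by (rule has_derivative_compose[OF has_derivative_affine[OF assms] has_derivative_frechet[OF Ck_differentiable[OF Suc.prems]]])
  \<comment> \<open>\<open>A v\<close> need not be a basis vector, while \<open>Ck\<close> controls
    basis directions only; the expansion has coefficients that do not depend on x.\<close>
  have e: "frechet_derivative f (at (c + A x)) (A v) =
      (\<Sum>b\<in>Basis. (A v \<bullet> b) *\<^sub>R frechet_derivative f (at (c + A x)) b)" for x v
    by (intro linear_basis_expand has_derivative_bounded_linear[OF has_derivative_frechet[OF Ck_differentiable[OF Suc.prems]]])
  show ?case
    by (rule Ck_SucI[OF d], subst e)
       (rule Ck_sum, rule Ck_scaleR[OF Ck_const], rule Suc.IH, erule Ck_derivD[OF Suc.prems])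
qed

lemma Ck_compose_real:
  fixes \<psi> :: "real \<Rightarrow> real"
  shows "Ck k \<psi> \<Longrightarrow> Ck k g \<Longrightarrow> Ck k (\<lambda>x. \<psi> (g x))"
proof (induction k arbitrary: \<psi> g)
  case 0
  then show ?case using has_derivative_compose[OF has_derivative_frechet has_derivative_frechet, of g _ \<psi>]
    unfolding Ck.simps differentiable_def[of "\<lambda>x. \<psi> (g x)"] by blast
next
  case (Suc k)
  have d: "((\<lambda>x. \<psi> (g x)) has_derivative (\<lambda>v. frechet_derivative \<psi> (at (g x)) (frechet_derivative g (at x) v))) (at x)" for x
    by (rule has_derivative_compose[OF has_derivative_frechet has_derivative_frechet])
       (use Suc.prems in \<open>auto intro: Ck_differentiable\<close>)
  have e: "frechet_derivative \<psi> (at (g x)) v = v * frechet_derivative \<psi> (at (g x)) 1" for x v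
    using linear_basis_expand[OF has_derivative_bounded_linear[OF has_derivative_frechet[OF Ck_differentiable[OF Suc.prems(1)]]], of "g x" v]
    by simp
  show ?case
    by (rule Ck_SucI[OF d], subst e, rule Ck_mult, erule Ck_derivD[OF Suc.prems(2)],
        rule Suc.IH[OF Ck_derivD[OF Suc.prems(1)] Ck_SucD[OF Suc.prems(2)]]) simp
qed

text \<open>The functions P(1/s) exp(-1/s), continued by 0 to s \<le> 0. The family over all
  polynomials P is closed under differentiation, which turns smoothness at 0 into an
  induction.\<close>

definition flat_exp :: "real poly \<Rightarrow> real \<Rightarrow> real" where
  "flat_exp p s = (if s > 0 then poly p (1/s) * exp (- 1 / s) else 0)"

text \<open>This is the difference quotient at 0 from the right; with x = 1/s it becomes a
  polynomial divided by exp x.\<close>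

lemma flat_exp_limit: "((\<lambda>s. poly p (1/s) * exp (- 1 / s) / s) \<longlongrightarrow> 0) (at_right (0::real))"
proof -
  have *: "((\<lambda>x. poly p x * x / exp x) \<longlongrightarrow> (0::real)) at_top"
  proof (induction p)
    case (pCons a p)
    have "((\<lambda>x. x ^ k / exp x) \<longlongrightarrow> (0::real)) at_top" for k
      by (rule tendsto_power_div_exp_0)
    then have 1: "((\<lambda>x. a * (x ^ 1 / exp x) + 0) \<longlongrightarrow> a * 0 + (0::real)) at_top"
      by (intro tendsto_intros)
    \<comment> \<open>The extra power x^k carries the induction: splitting off the constant
      coefficient multiplies the remaining polynomial by x.\<close>
    have 2: "((\<lambda>x. poly q x * x^k / exp x) \<longlongrightarrow> (0::real)) at_top" for q k
    proof (induction q arbitrary: k)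
      case (pCons a q)
      have "((\<lambda>x. a * (x ^ k / exp x) + poly q x * x^(Suc k) / exp x) \<longlongrightarrow> a * 0 + (0::real)) at_top"
        by (intro tendsto_intros pCons tendsto_power_div_exp_0)
      then show ?case by (simp add: algebra_simps add_divide_distrib)
    qed simp
    show ?case using 2[of "pCons a p" 1] by simp
  qed simp
  have "filterlim (\<lambda>s::real. 1 / s) at_top (at_right 0)"
    using filterlim_inverse_at_top_right by (simp add: inverse_eq_divide)
  from filterlim_compose[OF * this] show ?thesis
    by (simp add: exp_minus field_simps)
qed

text \<open>With t = 1/s one has dt/ds = -t^2, so P(t) exp(-t) has derivative t^2 (P - P')(t)
  exp(-t); \<open>[:0,0,1:]\<close> is t^2. At s = 0 both one-sided difference quotients tend to
  0.\<close>

lemma flat_exp_has_deriv: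
  "(flat_exp p has_real_derivative flat_exp ([:0,0,1:] * (p - pderiv p)) s) (at s)"
proof (cases "s = 0")
  case False
  show ?thesis
  proof (cases "s > 0")
    case True
    have "((\<lambda>s. poly p (1/s) * exp (- 1 / s)) has_real_derivative
       flat_exp ([:0,0,1:] * (p - pderiv p)) s) (at s)"
      using True by (auto intro!: derivative_eq_intros DERIV_chain2[OF poly_DERIV]
         simp: flat_exp_def field_simps power2_eq_square)
    moreover have "eventually (\<lambda>s. poly p (1/s) * exp (- 1 / s) = flat_exp p s) (nhds s)"
      using eventually_nhds_in_open[of "{0<..}" s] True
      by (auto simp: flat_exp_def elim!: eventually_mono)
    ultimately show ?thesis
      by (subst (asm) DERIV_cong_ev[OF refl _ refl]) auto
  next
    case False
    with \<open>s \<noteq> 0\<close> have "s < 0" by simp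
    have "eventually (\<lambda>s. 0 = flat_exp p s) (nhds s)"
      using eventually_nhds_in_open[of "{..<0}" s] \<open>s < 0\<close>
      by (auto simp: flat_exp_def elim!: eventually_mono)
    moreover have "((\<lambda>s. 0) has_real_derivative flat_exp ([:0,0,1:] * (p - pderiv p)) s) (at s)"
      using \<open>s < 0\<close> by (auto simp: flat_exp_def)
    ultimately show ?thesis
      by (subst (asm) DERIV_cong_ev[OF refl _ refl]) auto
  qed
next
  case True
  have l: "((\<lambda>y. (flat_exp p y - flat_exp p 0) / (y - 0)) \<longlongrightarrow> 0) (at_left 0)"
    by (rule tendsto_eventually) (auto simp: flat_exp_def eventually_at_left_field intro: exI[of _ "-1"])
  have r: "((\<lambda>y. (flat_exp p y - flat_exp p 0) / (y - 0)) \<longlongrightarrow> 0) (at_right 0)"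
    by (rule Lim_transform_eventually[OF flat_exp_limit[of p]])
       (auto simp: flat_exp_def eventually_at_right_field intro: exI[of _ 1])
  show ?thesis unfolding True has_field_derivative_iff
    using l r by (auto simp: flat_exp_def[of _ 0] filterlim_split_at)
qed

lemma Ck_flat_exp: "Ck k (flat_exp p)"
proof (induction k arbitrary: p)
  case 0
  then show ?case using flat_exp_has_deriv[of p]
    by (auto simp: has_field_derivative_def differentiable_def)
next
  case (Suc k)
  show ?case
    by (rule Ck_SucI[OF has_field_derivative_imp_has_derivative[OF flat_exp_has_deriv]])
       (auto intro!: Suc)
qed

text \<open>Using the inner product in place of the norm displays the bump as a composition of
  smooth maps.\<close>

lemma bump_eq_flat_exp: "bump x = flat_exp 1 (1 - x \<bullet> x)"
  by (auto simp: bump_def flat_exp_def power2_norm_eq_inner norm_lt_square[of x 1])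

lemma Ck_bump: "Ck k bump"
proof -
  have "Ck k (\<lambda>x::'a. flat_exp 1 (1 - x \<bullet> x))"
    by (intro Ck_compose_real[OF Ck_flat_exp] Ck_diff Ck_const Ck_inner Ck_linear bounded_linear_ident)
  then show ?thesis unfolding bump_eq_flat_exp[abs_def] .
qed


section \<open>Smooth functions and test functions\<close>

lemma smooth_Ck: "smooth f \<Longrightarrow> Ck k f"
  by (simp add: smooth_iff_Ck)

lemma smooth_mult: "smooth f \<Longrightarrow> smooth g \<Longrightarrow> smooth (\<lambda>x. f x * g x :: real)"
  by (simp add: smooth_iff_Ck Ck_mult)

lemma smooth_const: "smooth (\<lambda>x. c)"
  by (simp add: smooth_iff_Ck Ck_const)

lemma smooth_affine: "smooth f \<Longrightarrow> bounded_linear A \<Longrightarrow> smooth (\<lambda>x. f (c + A x))"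
  by (simp add: smooth_iff_Ck Ck_affine)

lemma smooth_differentiable: "smooth f \<Longrightarrow> f differentiable (at x)"
  by (rule Ck_differentiable[OF smooth_Ck])

lemma smooth_deriv: "smooth f \<Longrightarrow> b \<in> Basis \<Longrightarrow> smooth (\<lambda>x. frechet_derivative f (at x) b)"
  unfolding smooth_iff_Ck using Ck_derivD by blast

lemma smooth_has_derivative: "smooth f \<Longrightarrow> (f has_derivative frechet_derivative f (at x)) (at x)"
  by (rule has_derivative_frechet[OF smooth_differentiable])

lemma smooth_continuous: "smooth f \<Longrightarrow> continuous_on A f"
  by (intro continuous_at_imp_continuous_on ballI differentiable_imp_continuous_within smooth_differentiable)

lemma closed_supp_subset: "closed K \<Longrightarrow> (\<And>x. x \<notin> K \<Longrightarrow> f x = 0) \<Longrightarrow> closed_supp f \<subseteq> K"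
  unfolding closed_supp_def by (rule closure_minimal) auto

lemma C0_inftyI:
  assumes "smooth f" "compact K" "K \<subseteq> G" "\<And>x. x \<notin> K \<Longrightarrow> f x = 0"
  shows "f \<in> C0_infty G"
proof -
  have "closed_supp f \<subseteq> K"
    using assms(2,4) by (intro closed_supp_subset compact_imp_closed)
  moreover have "compact (closed_supp f)"
    using calculation assms(2) unfolding closed_supp_def
    by (metis closed_closure compact_Int_closed inf.absorb_iff2)
  ultimately show ?thesis using assms(1,3) by (auto simp: C0_infty_def)
qed

lemma C0_inftyD:
  assumes "f \<in> C0_infty G"
  shows "smooth f" "compact (closed_supp f)" "closed_supp f \<subseteq> G" "x \<notin> closed_supp f \<Longrightarrow> f x = 0"
  using assms closure_subset[of "{x. f x \<noteq> 0}"] by (auto simp: C0_infty_def closed_supp_def)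

lemma C0_infty_mono: "f \<in> C0_infty G \<Longrightarrow> G \<subseteq> H \<Longrightarrow> f \<in> C0_infty H"
  by (auto simp: C0_infty_def)

lemma closed_supp_deriv:
  assumes "x \<notin> closed_supp f"
  shows "frechet_derivative f (at x) b = 0"
proof -
  have "open (- closed_supp f)" by (simp add: closed_supp_def open_Compl)
  moreover have "((\<lambda>x. 0) has_derivative (\<lambda>v. 0)) (at x)" by simp
  moreover have "\<And>y. y \<in> - closed_supp f \<Longrightarrow> 0 = f y"
    using closure_subset[of "{x. f x \<noteq> 0}"] by (auto simp: closed_supp_def)
  ultimately have "(f has_derivative (\<lambda>v. 0)) (at x)"
    using assms by (metis has_derivative_transform_within_open ComplI)
  then show ?thesis by (simp add: frechet_eq)
qed

lemma C0_infty_deriv: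
  assumes "f \<in> C0_infty G" "b \<in> Basis"
  shows "(\<lambda>x. frechet_derivative f (at x) b) \<in> C0_infty G"
  by (rule C0_inftyI[OF smooth_deriv[OF C0_inftyD(1)[OF assms(1)] assms(2)] C0_inftyD(2,3)[OF assms(1)]])
     (rule closed_supp_deriv)

lemma C0_infty_bounded:
  assumes "f \<in> C0_infty G"
  obtains B where "0 < B" "\<And>x. norm (f x) \<le> B"
proof -
  have "bounded (f ` closed_supp f)"
    by (intro compact_imp_bounded compact_continuous_image smooth_continuous C0_inftyD[OF assms])
  then obtain B where B: "0 < B" "\<And>x. x \<in> closed_supp f \<Longrightarrow> norm (f x) \<le> B"
    unfolding bounded_pos by auto
  have "norm (f x) \<le> B" for x
    using B C0_inftyD(4)[OF assms, of x] by (cases "x \<in> closed_supp f") auto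
  then show ?thesis using B that by blast
qed

lemma frechet_derivative_expand:
  fixes f :: "'a::euclidean_space \<Rightarrow> 'b::real_normed_vector"
  assumes "f differentiable (at x)"
  shows "frechet_derivative f (at x) v = (\<Sum>b\<in>Basis. (v \<bullet> b) *\<^sub>R frechet_derivative f (at x) b)"
  by (intro linear_basis_expand has_derivative_bounded_linear[OF has_derivative_frechet] assms)

lemma C0_infty_lipschitz:
  assumes "f \<in> C0_infty G"
  obtains L where "0 < L" "\<And>x y. norm (f x - f y) \<le> L * norm (x - y)"
    "\<And>x v. norm (frechet_derivative f (at x) v) \<le> L * norm v"
proof -
  have "\<exists>B. \<forall>b\<in>Basis. 0 < B b \<and> (\<forall>x. norm (frechet_derivative f (at x) b) \<le> B b)"
    using C0_infty_bounded[OF C0_infty_deriv[OF assms]] by (intro bchoice) metis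
  then obtain B where B: "\<And>b x. b \<in> Basis \<Longrightarrow> norm (frechet_derivative f (at x) b) \<le> B b"
    "\<And>b. b \<in> Basis \<Longrightarrow> 0 < B b" by blast
  \<comment> \<open>The sum of the bounds on the partial derivatives bounds the whole derivative
    and, by the mean value inequality, is a Lipschitz constant.\<close>
  define L where "L = (\<Sum>b\<in>Basis. B b)"
  have L: "norm (frechet_derivative f (at x) v) \<le> L * norm v" for x v
  proof -
    have "frechet_derivative f (at x) v = (\<Sum>b\<in>Basis. (v \<bullet> b) *\<^sub>R frechet_derivative f (at x) b)"
      by (intro frechet_derivative_expand smooth_differentiable C0_inftyD(1)[OF assms])
    also have "norm \<dots> \<le> (\<Sum>b\<in>Basis. norm v * B b)"
      by (rule sum_norm_le) (auto intro!: mult_mono B Basis_le_norm)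
    finally have "norm (frechet_derivative f (at x) v) \<le> (\<Sum>b\<in>Basis. norm v * B b)" .
    then show ?thesis by (simp add: L_def sum_distrib_left mult.commute)
  qed
  have "0 < L" unfolding L_def by (intro sum_pos B) auto
  moreover have "norm (f x - f y) \<le> L * norm (x - y)" for x y
    by (rule differentiable_bound[OF convex_UNIV, where f'="\<lambda>x. frechet_derivative f (at x)"])
       (auto intro!: smooth_has_derivative C0_inftyD[OF assms] onorm_le L)
  ultimately show ?thesis using L that by blast
qed

section \<open>Mollification\<close>

lemma continuous_lebesgue_measurable:
  fixes f :: "'a::euclidean_space \<Rightarrow> 'b::topological_space"
  shows "continuous_on UNIV f \<Longrightarrow> f \<in> borel_measurable lebesgue"
  by (intro measurable_completion) (simp add: borel_measurable_continuous_onI)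

lemma ennreal_tendsto_0_iff:
  fixes f :: "'a \<Rightarrow> ennreal"
  shows "(f \<longlongrightarrow> 0) F \<longleftrightarrow> (\<forall>e>0. \<forall>\<^sub>F x in F. f x \<le> ennreal e)"
proof
  assume "(f \<longlongrightarrow> 0) F"
  then show "\<forall>e>0. \<forall>\<^sub>F x in F. f x \<le> ennreal e"
    unfolding order_tendsto_iff by (metis (mono_tags, lifting) ennreal_less_zero_iff eventually_mono less_imp_le)
next
  assume *: "\<forall>e>0. \<forall>\<^sub>F x in F. f x \<le> ennreal e"
  show "(f \<longlongrightarrow> 0) F"
    unfolding order_tendsto_iff
  proof (intro conjI allI impI)
    fix u :: ennreal assume "0 < u"
    have "\<exists>e>0. ennreal e < u"
    proof (cases u)
      case (real r)
      with \<open>0 < u\<close> show ?thesis by (intro exI[of _ "r / 2"]) (auto simp: ennreal_less_iff ennreal_less_zero_iff)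
    next
      case top
      then show ?thesis by (intro exI[of _ 1]) simp
    qed
    then obtain e where "0 < e" "ennreal e < u" by blast
    then show "\<forall>\<^sub>F x in F. f x < u"
      using * by (auto elim!: eventually_mono)
  qed simp
qed

text \<open>Reduces limits as h tends to 0 to sequences, to which dominated convergence
  applies.\<close>

lemma tendsto_at_right_0_sequentially:
  fixes f :: "real \<Rightarrow> 'b::first_countable_topology"
  assumes "\<And>X. (\<And>n. 0 < X n) \<Longrightarrow> X \<longlonglongrightarrow> 0 \<Longrightarrow> (\<lambda>n. f (X n)) \<longlonglongrightarrow> l"
  shows "(f \<longlongrightarrow> l) (at_right 0)"
  unfolding tendsto_at_iff_sequentially comp_def using assms by auto

lemma nn_integral_lborel_affine:
  fixes f :: "'a::euclidean_space \<Rightarrow> ennreal"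
  assumes [measurable]: "f \<in> borel_measurable borel" and c: "c \<noteq> 0"
  shows "(\<integral>\<^sup>+x. f x \<partial>lborel) = ennreal (\<bar>c\<bar> ^ DIM('a)) * (\<integral>\<^sup>+x. f (t + c *\<^sub>R x) \<partial>lborel)"
  by (subst lborel_affine[OF c, of t])
     (simp add: nn_integral_density nn_integral_distr nn_integral_cmult)

lemma nn_integral_lborel_reflect:
  fixes f :: "'a::euclidean_space \<Rightarrow> ennreal"
  assumes "f \<in> borel_measurable borel"
  shows "(\<integral>\<^sup>+x. f (z - x) \<partial>lborel) = (\<integral>\<^sup>+x. f x \<partial>lborel)"
  using nn_integral_lborel_affine[OF assms, of "-1" z] by simp

lemma convolve_integrable:
  fixes f :: "'a::euclidean_space \<Rightarrow> 'b::{banach, second_countable_topology}"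
  assumes w: "w \<in> C0_infty UNIV" and f: "integrable lebesgue f"
  shows "integrable lebesgue (\<lambda>y. w (z - y) *\<^sub>R f y)"
proof -
  obtain B where B: "0 < B" "\<And>x. norm (w x) \<le> B" by (rule C0_infty_bounded[OF w]) blast
  have [measurable]: "(\<lambda>y. w (z - y)) \<in> borel_measurable lebesgue"
    by (intro continuous_lebesgue_measurable continuous_on_compose2[OF smooth_continuous[OF C0_inftyD(1)[OF w], of UNIV]] continuous_intros) auto
  have [measurable]: "f \<in> borel_measurable lebesgue" using f by auto
  show ?thesis
    by (rule Bochner_Integration.integrable_bound[of _ "\<lambda>y. B *\<^sub>R f y"])
       (use f B in \<open>auto intro!: mult_right_mono\<close>)
qed

text \<open>If the integrand is not integrable, the Bochner integral is 0 by convention and the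
  bound is trivial.\<close>

lemma convolve_norm_le:
  fixes f :: "'a::euclidean_space \<Rightarrow> 'b::{banach, second_countable_topology}"
  shows "ennreal (norm (convolve w f z)) \<le> (\<integral>\<^sup>+y. ennreal \<bar>w (z - y)\<bar> * ennreal (norm (f y)) \<partial>lborel)"
proof (cases "integrable lebesgue (\<lambda>y. w (z - y) *\<^sub>R f y)")
  case True
  have "ennreal (norm (convolve w f z)) \<le> (\<integral>\<^sup>+y. ennreal (norm (w (z - y) *\<^sub>R f y)) \<partial>lebesgue)"
    unfolding convolve_def by (rule integral_norm_bound_ennreal[OF True])
  then show ?thesis by (simp add: nn_integral_completion ennreal_mult)
next
  case False
  then show ?thesis by (simp add: convolve_def not_integrable_integral_eq)
qed

text \<open>Differentiation under the integral sign by dominated convergence: along a sequence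
  tending to 0 the remainder quotient of w is bounded by 2 L, with L a Lipschitz constant of w, and
  tends to 0 pointwise; the dominating function is 2 L |f|.\<close>

lemma convolve_has_derivative:
  fixes f :: "'a::euclidean_space \<Rightarrow> 'b::{banach, second_countable_topology}"
  assumes w: "w \<in> C0_infty UNIV" and f: "integrable lebesgue f"
  shows "(convolve w f has_derivative (\<lambda>v. convolve (\<lambda>x. frechet_derivative w (at x) v) f z)) (at z)"
proof -
  obtain L where L: "0 < L" "\<And>x y. norm (w x - w y) \<le> L * norm (x - y)"
    "\<And>x v. norm (frechet_derivative w (at x) v) \<le> L * norm v"
    by (rule C0_infty_lipschitz[OF w]) blast
  note sw = C0_inftyD(1)[OF w]
  have bl: "bounded_linear (frechet_derivative w (at x))" for x
    by (rule has_derivative_bounded_linear[OF smooth_has_derivative[OF sw]])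
  have [measurable]: "f \<in> borel_measurable lebesgue" using f by auto
  have cw: "continuous_on UNIV (\<lambda>y. w (g y))" if "continuous_on UNIV g" for g :: "'a \<Rightarrow> 'a"
    by (rule continuous_on_compose2[OF smooth_continuous[OF sw, of UNIV]]) (use that in auto)
  have cd: "continuous_on UNIV (\<lambda>y. frechet_derivative w (at (z - y)) v)" for v
    unfolding frechet_derivative_expand[OF smooth_differentiable[OF sw], of _ v]
    by (intro continuous_intros continuous_on_compose2[OF smooth_continuous[OF smooth_deriv[OF sw], of _ UNIV]]) auto
  have [measurable]: "(\<lambda>y. frechet_derivative w (at (z - y)) v) \<in> borel_measurable lebesgue" for v
    by (intro continuous_lebesgue_measurable cd)
  have id: "integrable lebesgue (\<lambda>y. frechet_derivative w (at (z - y)) v *\<^sub>R f y)" for v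
    by (rule Bochner_Integration.integrable_bound[of _ "\<lambda>y. (L * norm v) *\<^sub>R f y"])
       (use f L in \<open>auto intro!: mult_right_mono\<close>)
  let ?D = "\<lambda>v. convolve (\<lambda>x. frechet_derivative w (at x) v) f z"
  have lin: "bounded_linear ?D"
  proof
    show "?D (u + v) = ?D u + ?D v" for u v
      unfolding convolve_def
      by (subst Bochner_Integration.integral_add[OF id id, symmetric])
         (simp add: bounded_linear.linear[OF bl, THEN linear_add] scaleR_left_distrib)
    show "?D (r *\<^sub>R v) = r *\<^sub>R ?D v" for r v
      unfolding convolve_def
      by (simp add: bounded_linear.linear[OF bl, THEN linear_scale] flip: scaleR_scaleR)
    have "norm (?D v) \<le> norm v * (L * integral\<^sup>L lebesgue (\<lambda>y. norm (f y)))" for v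
    proof -
      have "norm (?D v) \<le> integral\<^sup>L lebesgue (\<lambda>y. norm (frechet_derivative w (at (z - y)) v *\<^sub>R f y))"
        unfolding convolve_def by (rule integral_norm_bound)
      also have "\<dots> \<le> integral\<^sup>L lebesgue (\<lambda>y. (L * norm v) * norm (f y))"
        by (rule integral_mono) (use id[THEN integrable_norm] f L in \<open>auto intro!: mult_right_mono\<close>)
      finally show ?thesis by (simp add: mult_ac)
    qed
    then show "\<exists>K. \<forall>v. norm (?D v) \<le> norm v * K" by blast
  qed
  have "((\<lambda>v. norm (convolve w f (z + v) - convolve w f z - ?D v) / norm v) \<longlongrightarrow> 0) (at 0)"
    unfolding tendsto_at_iff_sequentially comp_def
  proof (intro allI impI)
    fix X :: "nat \<Rightarrow> 'a" assume X0: "\<forall>i. X i \<in> UNIV - {0}" and X: "X \<longlonglongrightarrow> 0"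
    have nz: "norm (X i) > 0" for i using X0 by auto
    define r where "r i y = (w (z + X i - y) - w (z - y) - frechet_derivative w (at (z - y)) (X i)) / norm (X i)" for i y
    have [measurable]: "r i \<in> borel_measurable lebesgue" for i
    proof -
      have "continuous_on UNIV (r i)" unfolding r_def by (intro continuous_intros cw cd) (use nz[of i] in auto)
      then show ?thesis by (rule continuous_lebesgue_measurable)
    qed
    have rb: "norm (r i y) \<le> 2 * L" for i y
    proof -
      have "norm (w (z + X i - y) - w (z - y) - frechet_derivative w (at (z - y)) (X i)) \<le> L * norm (X i) + L * norm (X i)"
        by (rule order_trans[OF norm_triangle_ineq4 add_mono]) (use L(2)[of "z + X i - y" "z - y"] L(3) in auto)
      then show ?thesis using nz[of i] by (simp add: r_def divide_le_eq)
    qed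
    have rl: "(\<lambda>i. r i y) \<longlonglongrightarrow> 0" for y
    proof -
      have "((\<lambda>v. norm (w ((z - y) + v) - w (z - y) - frechet_derivative w (at (z - y)) v) / norm v) \<longlongrightarrow> 0) (at 0)"
        using smooth_has_derivative[OF sw, of "z - y"] by (simp add: has_derivative_at)
      then have "(\<lambda>i. norm (w ((z - y) + X i) - w (z - y) - frechet_derivative w (at (z - y)) (X i)) / norm (X i)) \<longlonglongrightarrow> 0"
        unfolding tendsto_at_iff_sequentially comp_def using X0 X by blast
      then show ?thesis by (intro tendsto_norm_zero_cancel[where f="\<lambda>i. r i y"]) (simp add: r_def algebra_simps)
    qed
    have "(\<lambda>i. integral\<^sup>L lebesgue (\<lambda>y. r i y *\<^sub>R f y)) \<longlonglongrightarrow> integral\<^sup>L lebesgue (\<lambda>y::'a. 0 :: 'b)"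
    proof (rule integral_dominated_convergence[where w="\<lambda>y. 2 * L * norm (f y)"])
      show "AE y in lebesgue. (\<lambda>i. r i y *\<^sub>R f y) \<longlonglongrightarrow> 0"
        using tendsto_scaleR[OF rl tendsto_const, of _ "f _"] by auto
      show "AE y in lebesgue. norm (r i y *\<^sub>R f y) \<le> 2 * L * norm (f y)" for i
        using rb by (auto intro!: mult_right_mono)
    qed (use f in auto)
    moreover have "integral\<^sup>L lebesgue (\<lambda>y. r i y *\<^sub>R f y) =
        (convolve w f (z + X i) - convolve w f z - ?D (X i)) /\<^sub>R norm (X i)" for i
    proof -
      have "r i y *\<^sub>R f y = (w (z + X i - y) *\<^sub>R f y - w (z - y) *\<^sub>R f y - frechet_derivative w (at (z - y)) (X i) *\<^sub>R f y) /\<^sub>R norm (X i)" for y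
        by (simp add: r_def scaleR_diff_left divide_inverse_commute flip: scaleR_scaleR)
      then show ?thesis unfolding convolve_def
        by (simp add: convolve_integrable[OF w f] id)
    qed
    ultimately have "(\<lambda>i. (convolve w f (z + X i) - convolve w f z - ?D (X i)) /\<^sub>R norm (X i)) \<longlonglongrightarrow> 0"
      by simp
    from tendsto_norm_zero[OF this]
    show "(\<lambda>i. norm (convolve w f (z + X i) - convolve w f z - ?D (X i)) / norm (X i)) \<longlonglongrightarrow> 0"
      by (simp add: divide_inverse_commute)
  qed
  with lin show ?thesis by (simp add: has_derivative_at)
qed

lemma convolve_smooth:
  fixes f :: "'a::euclidean_space \<Rightarrow> 'b::{banach, second_countable_topology}"
  assumes "w \<in> C0_infty UNIV" and f: "integrable lebesgue f"
  shows "smooth (convolve w f)"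
proof -
  have "Ck k (convolve w f)" for k
    using assms(1)
  proof (induction k arbitrary: w)
    case 0
    show ?case using convolve_has_derivative[OF 0 f] by (auto simp: differentiable_def)
  next
    case (Suc k)
    show ?case
      by (rule Ck_SucI[OF convolve_has_derivative[OF Suc.prems f]])
         (intro Suc.IH C0_infty_deriv[OF Suc.prems])
  qed
  then show ?thesis by (simp add: smooth_iff_Ck)
qed

section \<open>The standard mollifier: support, mass and size\<close>

lemma bump_support: "1 \<le> norm x \<Longrightarrow> bump x = 0"
  by (simp add: bump_def)

lemma bump_nonneg: "0 \<le> bump x"
  by (simp add: bump_def)

lemma bump_C0_infty: "(bump :: 'a::euclidean_space \<Rightarrow> real) \<in> C0_infty UNIV"
  by (rule C0_inftyI[of _ "cball 0 1"]) (auto simp: smooth_iff_Ck Ck_bump bump_support)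

lemma C0_infty_integrable:
  fixes f :: "'a::euclidean_space \<Rightarrow> 'b::{banach, second_countable_topology}"
  assumes "f \<in> C0_infty G"
  shows "integrable lebesgue f" "integrable lborel f"
proof -
  note c = smooth_continuous[OF C0_inftyD(1)[OF assms]]
  have "integrable lborel (\<lambda>x. indicator (closed_supp f) x *\<^sub>R f x)"
    by (rule borel_integrable_compact[OF C0_inftyD(2)[OF assms] c, folded set_integrable_def, unfolded set_integrable_def])
  also have "(\<lambda>x. indicator (closed_supp f) x *\<^sub>R f x) = f"
    using C0_inftyD(4)[OF assms] by (auto simp: fun_eq_iff indicator_def)
  finally show "integrable lborel f" .
  then show "integrable lebesgue f"
    by (subst integrable_completion) auto
qed

lemma C0_infty_lebesgue_integral:
  fixes f :: "'a::euclidean_space \<Rightarrow> 'b::{banach, second_countable_topology}"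
  assumes "f \<in> C0_infty G"
  shows "integral\<^sup>L lebesgue f = integral\<^sup>L lborel f"
  using C0_infty_integrable(2)[OF assms] by (intro integral_completion) auto

definition bump_mass :: "'a::euclidean_space itself \<Rightarrow> real" where
  "bump_mass _ = (LINT y|lebesgue. bump (y :: 'a))"

lemma bump_mass_pos: "0 < bump_mass TYPE('a::euclidean_space)"
proof -
  have "\<not> (AE x in lborel. bump (x::'a) = 0)"
  proof
    assume "AE x in lborel. bump (x::'a) = 0"
    then have "AE x in lborel. x \<notin> ball (0::'a) 1"
      by eventually_elim (auto simp: bump_def)
    then have "emeasure lborel (ball (0::'a) 1) = 0"
      by (subst (asm) AE_iff_measurable[of "ball (0::'a) 1"]) auto
    then show False using unit_ball_vol_pos[of "DIM('a)"] by (simp add: emeasure_ball)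
  qed
  then have "integral\<^sup>L lborel (bump :: 'a \<Rightarrow> real) \<noteq> 0"
    by (subst integral_nonneg_eq_0_iff_AE) (auto simp: bump_nonneg C0_infty_integrable[OF bump_C0_infty])
  moreover have "0 \<le> integral\<^sup>L lborel (bump :: 'a \<Rightarrow> real)"
    by (simp add: bump_nonneg)
  ultimately show ?thesis
    by (simp add: bump_mass_def C0_infty_lebesgue_integral[OF bump_C0_infty])
qed

lemma mollifier_eq:
  "mollifier h (x::'a::euclidean_space) = bump (x /\<^sub>R h) / (bump_mass TYPE('a) * h ^ DIM('a))"
  by (simp add: mollifier_def bump_mass_def)

lemma mollifier_nonneg: "0 < h \<Longrightarrow> 0 \<le> mollifier h (x::'a::euclidean_space)"
  using bump_mass_pos[where 'a='a] by (simp add: mollifier_eq bump_nonneg)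

lemma mollifier_support: "0 < h \<Longrightarrow> h \<le> norm x \<Longrightarrow> mollifier h (x::'a::euclidean_space) = 0"
  by (simp add: mollifier_eq bump_support field_simps)

lemma mollifier_C0_infty:
  assumes "0 < h"
  shows "(mollifier h :: 'a::euclidean_space \<Rightarrow> real) \<in> C0_infty UNIV"
proof (rule C0_inftyI[of _ "cball 0 h"])
  have "smooth (\<lambda>x::'a. (1 / (bump_mass TYPE('a) * h ^ DIM('a))) * bump (0 + x /\<^sub>R h))"
    by (intro smooth_mult smooth_const smooth_affine[of bump "\<lambda>x. x /\<^sub>R h"] C0_inftyD[OF bump_C0_infty] bounded_linear_scaleR_right)
  then show "smooth (mollifier h :: 'a \<Rightarrow> real)"
    by (simp add: mollifier_eq[abs_def])
qed (auto simp: mollifier_support assms)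

lemma mollifier_borel [measurable]:
  "(mollifier h :: 'a::euclidean_space \<Rightarrow> real) \<in> borel_measurable borel"
proof -
  have "(bump :: 'a \<Rightarrow> real) \<in> borel_measurable borel"
    using C0_infty_integrable(2)[OF bump_C0_infty] by auto
  note [measurable] = this
  show ?thesis unfolding mollifier_eq[abs_def] by measurable
qed

lemma nn_integral_mollifier:
  assumes h: "0 < h"
  shows "(\<integral>\<^sup>+x. ennreal (mollifier h (x::'a::euclidean_space)) \<partial>lborel) = 1"
proof -
  let ?m = "bump_mass TYPE('a)"
  have [measurable]: "(bump :: 'a \<Rightarrow> real) \<in> borel_measurable borel"
    using C0_infty_integrable(2)[OF bump_C0_infty] by auto
  have "(\<integral>\<^sup>+x. ennreal (mollifier h (x::'a)) \<partial>lborel) =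
      ennreal (h ^ DIM('a)) * (\<integral>\<^sup>+x. ennreal (mollifier h (h *\<^sub>R x :: 'a)) \<partial>lborel)"
    using h by (subst nn_integral_lborel_affine[where c=h and t=0]) auto
  also have "(\<integral>\<^sup>+x. ennreal (mollifier h (h *\<^sub>R x :: 'a)) \<partial>lborel)
     = (\<integral>\<^sup>+x. ennreal (1 / (?m * h ^ DIM('a))) * ennreal (bump (x :: 'a)) \<partial>lborel)"
    using h bump_mass_pos[where 'a='a]
    by (intro nn_integral_cong) (simp add: mollifier_eq bump_nonneg flip: ennreal_mult)
  also have "\<dots> = ennreal (1 / (?m * h ^ DIM('a))) * ennreal ?m"
    by (subst nn_integral_cmult) (auto simp: bump_mass_def C0_infty_lebesgue_integral[OF bump_C0_infty]
       nn_integral_eq_integral[OF C0_infty_integrable(2)[OF bump_C0_infty]] bump_nonneg)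
  finally show ?thesis
    using h bump_mass_pos[where 'a='a] by (simp flip: ennreal_mult)
qed

lemma nn_integral_mollifier_reflect:
  "0 < h \<Longrightarrow> (\<integral>\<^sup>+y. ennreal (mollifier h (z - y :: 'a::euclidean_space)) \<partial>lborel) = 1"
  by (subst nn_integral_lborel_reflect) (auto simp: nn_integral_mollifier)

lemma nn_integral_mollifier_shift:
  assumes "0 < h"
  shows "(\<integral>\<^sup>+z. ennreal (mollifier h (z - y :: 'a::euclidean_space)) \<partial>lborel) = 1"
proof -
  have "(\<integral>\<^sup>+z. ennreal (mollifier h (z :: 'a)) \<partial>lborel) = (\<integral>\<^sup>+z. ennreal (mollifier h (z - y :: 'a)) \<partial>lborel)"
    by (subst nn_integral_lborel_affine[where c=1 and t="-y"]) auto
  then show ?thesis using nn_integral_mollifier[OF assms] by metis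
qed

lemma mollifier_bounds:
  obtains C where "0 < C" "\<And>h x. 0 < h \<Longrightarrow> mollifier h (x::'a::euclidean_space) \<le> C / h ^ DIM('a)"
    "\<And>h x b. 0 < h \<Longrightarrow> \<bar>frechet_derivative (mollifier h) (at (x::'a)) b\<bar> \<le> C / h ^ Suc DIM('a) * norm b"
proof -
  let ?m = "bump_mass TYPE('a)"
  obtain B where B: "0 < B" "\<And>x::'a. norm (bump x) \<le> B" by (rule C0_infty_bounded[OF bump_C0_infty]) blast
  obtain L where L: "0 < L" "\<And>(x::'a) v. norm (frechet_derivative bump (at x) v) \<le> L * norm v"
    by (rule C0_infty_lipschitz[OF bump_C0_infty]) blast
  \<comment> \<open>B bounds the bump and L its derivative; rescaling by h contributes h^(-n) from
    the normalisation and one more 1/h for the derivative.\<close>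
  define C where "C = max B L / ?m"
  have mp: "0 < ?m" by (rule bump_mass_pos)
  have "0 < C" using B mp by (auto simp: C_def)
  moreover have "mollifier h (x::'a) \<le> C / h ^ DIM('a)" if "0 < h" for h x
  proof -
    have "bump (x /\<^sub>R h) \<le> max B L" using B(2)[of "x /\<^sub>R h"] by (simp add: bump_nonneg)
    then have "bump (x /\<^sub>R h) / (?m * h ^ DIM('a)) \<le> max B L / (?m * h ^ DIM('a))"
      using that mp by (intro divide_right_mono) auto
    then show ?thesis by (simp add: mollifier_eq C_def)
  qed
  moreover have "\<bar>frechet_derivative (mollifier h) (at (x::'a)) b\<bar> \<le> C / h ^ Suc DIM('a) * norm b" if h: "0 < h" for h x b
  proof -
    have "((\<lambda>x. bump (0 + x /\<^sub>R h)) has_derivative (\<lambda>v. frechet_derivative bump (at (0 + x /\<^sub>R h)) (v /\<^sub>R h))) (at x)"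
      by (rule has_derivative_compose[OF has_derivative_affine smooth_has_derivative[OF C0_inftyD(1)[OF bump_C0_infty]]])
         (rule bounded_linear_scaleR_right)
    from has_derivative_mult_right[OF this, of "1 / (?m * h ^ DIM('a))"]
    have "(mollifier h has_derivative (\<lambda>v. 1 / (?m * h ^ DIM('a)) * frechet_derivative bump (at (x /\<^sub>R h)) (v /\<^sub>R h))) (at x)"
      by (simp add: mollifier_eq[abs_def])
    then have "\<bar>frechet_derivative (mollifier h) (at x) b\<bar> = 1 / (?m * h ^ DIM('a)) * \<bar>frechet_derivative bump (at (x /\<^sub>R h)) (b /\<^sub>R h)\<bar>"
      using mp h by (simp add: frechet_eq abs_mult)
    also have "\<dots> \<le> 1 / (?m * h ^ DIM('a)) * (max B L * norm (b /\<^sub>R h))"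
    proof (intro mult_left_mono)
      have "\<bar>frechet_derivative bump (at (x /\<^sub>R h)) (b /\<^sub>R h)\<bar> \<le> L * norm (b /\<^sub>R h)"
        using L(2)[of "x /\<^sub>R h" "b /\<^sub>R h"] by simp
      also have "\<dots> \<le> max B L * norm (b /\<^sub>R h)" by (intro mult_right_mono) auto
      finally show "\<bar>frechet_derivative bump (at (x /\<^sub>R h)) (b /\<^sub>R h)\<bar> \<le> max B L * norm (b /\<^sub>R h)" .
    qed (use mp h in simp)
    finally show ?thesis using h by (simp add: C_def field_simps)
  qed
  ultimately show ?thesis using that by blast
qed

text \<open>The convolution of w with the indicator of a ball whose radius exceeds that of the
  support by 1 is constant near 0, equal to the integral of w. Its derivative at 0, which is the
  convolution with the derivative of w, therefore vanishes.\<close>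

lemma C0_infty_deriv_integral:
  fixes w :: "'a::euclidean_space \<Rightarrow> real"
  assumes w: "w \<in> C0_infty G"
  shows "(LINT y|lebesgue. frechet_derivative w (at y) b) = 0"
proof -
  note w' = C0_infty_mono[OF w subset_UNIV]
  obtain R where R: "0 < R" "closed_supp w \<subseteq> ball 0 R"
    using compact_imp_bounded[OF C0_inftyD(2)[OF w]] bounded_subset_ballD by blast
  let ?f = "indicator (ball (0::'a) (R + 1)) :: 'a \<Rightarrow> real"
  have f: "integrable lebesgue ?f"
    by (intro integrable_real_indicator) (auto simp: emeasure_lborel_ball_finite[unfolded infinity_ennreal_def])
  have L: "integral\<^sup>L lebesgue (\<lambda>y. g (z - y) * ?f y) = integral\<^sup>L lborel g"
    if g: "continuous_on UNIV g" "\<And>x. x \<notin> closed_supp w \<Longrightarrow> g x = 0" and z: "norm z < 1" for g :: "'a \<Rightarrow> real" and z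
  proof -
    have e: "g (z - y) * ?f y = g (z - y)" for y
    proof (cases "z - y \<in> closed_supp w")
      case True
      then have "norm (z - y) < R" using R by auto
      then have "norm y < R + 1" using z norm_triangle_ineq4[of z "z - y"] by simp
      then show ?thesis by simp
    qed (simp add: g)
    moreover have [measurable]: "g \<in> borel_measurable borel"
      by (rule borel_measurable_continuous_onI[OF g(1)])
    have "integral\<^sup>L lebesgue (\<lambda>y. g (z - y)) = integral\<^sup>L lborel (\<lambda>y. g (z - y))"
      by (rule integral_completion) measurable
    moreover have "integral\<^sup>L lborel (\<lambda>y. g (z - y)) = integral\<^sup>L lborel g"
      by (subst (2) lborel_affine[of "-1" z]) (simp_all add: density_1 integral_distr)
    ultimately show ?thesis unfolding e by simp
  qed
  have "(convolve w ?f has_derivative (\<lambda>v. 0)) (at 0)"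
  proof (rule has_derivative_transform_within_open[of "\<lambda>_. integral\<^sup>L lborel w" _ _ _ "ball 0 1"])
    show "integral\<^sup>L lborel w = convolve w ?f z" if "z \<in> ball 0 1" for z
      unfolding convolve_def using that
      by (simp add: L smooth_continuous[OF C0_inftyD(1)[OF w]] C0_inftyD(4)[OF w])
  qed auto
  then have "0 = convolve (\<lambda>x. frechet_derivative w (at x) b) ?f 0"
    using convolve_has_derivative[OF w' f, of 0] has_derivative_unique by metis
  moreover have c: "continuous_on UNIV (\<lambda>y. frechet_derivative w (at y) b)"
    unfolding frechet_derivative_expand[OF smooth_differentiable[OF C0_inftyD(1)[OF w]], of _ b]
    by (intro continuous_intros smooth_continuous smooth_deriv C0_inftyD(1)[OF w])
  then have "convolve (\<lambda>x. frechet_derivative w (at x) b) ?f 0 = (LINT y|lborel. frechet_derivative w (at y) b)"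
    unfolding convolve_def
    using L[of "\<lambda>x. frechet_derivative w (at x) b" 0] by (simp add: closed_supp_deriv)
  ultimately show ?thesis
    using c by (subst integral_completion) (auto intro: borel_measurable_continuous_onI)
qed

text \<open>Fubini and affine substitution work with Borel functions; a Borel representative of the
  norm makes them available for Lebesgue measurable f.\<close>

lemma lebesgue_measurable_norm_rep:
  fixes f :: "'a::euclidean_space \<Rightarrow> 'b::real_normed_vector"
  assumes "f \<in> borel_measurable lebesgue"
  obtains F where "F \<in> borel_measurable borel" "AE y in lborel. ennreal (norm (f y)) = F y"
proof -
  have "(\<lambda>y. ennreal (norm (f y))) \<in> borel_measurable lebesgue" using assms by measurable
  from completion_ex_borel_measurable[OF this] show ?thesis
    using that by (auto simp: borel_def)
qed

section \<open>Mollification in L^1: contraction and convergence\<close>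

lemma convolve_L1_le:
  fixes f :: "'a::euclidean_space \<Rightarrow> 'b::{banach, second_countable_topology}"
  assumes h: "0 < h" and f: "f \<in> borel_measurable lebesgue"
  shows "(\<integral>\<^sup>+z. ennreal (norm (convolve (mollifier h) f z)) \<partial>lborel) \<le> (\<integral>\<^sup>+z. ennreal (norm (f z)) \<partial>lborel)"
proof -
  obtain F where [measurable]: "F \<in> borel_measurable borel" and F: "AE y in lborel. ennreal (norm (f y)) = F y"
    using lebesgue_measurable_norm_rep[OF f] by blast
  have "(\<integral>\<^sup>+z. ennreal (norm (convolve (mollifier h) f z)) \<partial>lborel) \<le>
      (\<integral>\<^sup>+z. (\<integral>\<^sup>+y. ennreal (mollifier h (z - y)) * F y \<partial>lborel) \<partial>lborel)"
  proof (rule nn_integral_mono)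
    fix z :: 'a
    have "ennreal (norm (convolve (mollifier h) f z)) \<le> (\<integral>\<^sup>+y. ennreal \<bar>mollifier h (z - y)\<bar> * ennreal (norm (f y)) \<partial>lborel)"
      by (rule convolve_norm_le)
    also have "\<dots> = (\<integral>\<^sup>+y. ennreal (mollifier h (z - y)) * F y \<partial>lborel)"
      by (rule nn_integral_cong_AE) (use F in \<open>eventually_elim, simp add: mollifier_nonneg h\<close>)
    finally show "ennreal (norm (convolve (mollifier h) f z)) \<le> \<dots>" .
  qed
  also have "\<dots> = (\<integral>\<^sup>+y. (\<integral>\<^sup>+z. ennreal (mollifier h (z - y)) * F y \<partial>lborel) \<partial>lborel)"
    by (rule lborel_pair.Fubini') measurable
  also have "\<dots> = (\<integral>\<^sup>+y. F y \<partial>lborel)"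
    by (simp add: nn_integral_multc nn_integral_mollifier_shift h)
  also have "\<dots> = (\<integral>\<^sup>+z. ennreal (norm (f z)) \<partial>lborel)"
    by (rule nn_integral_cong_AE) (use F in auto)
  finally show ?thesis .
qed

lemma integrable_lebesgue_nn_integral:
  fixes f :: "'a::euclidean_space \<Rightarrow> 'b::{banach, second_countable_topology}"
  shows "integrable lebesgue f \<longleftrightarrow> f \<in> borel_measurable lebesgue \<and> (\<integral>\<^sup>+x. ennreal (norm (f x)) \<partial>lborel) < \<infinity>"
  by (simp add: integrable_iff_bounded nn_integral_completion)

lemma convolve_add:
  fixes f :: "'a::euclidean_space \<Rightarrow> 'b::{banach, second_countable_topology}"
  assumes "w \<in> C0_infty UNIV" "integrable lebesgue f" "integrable lebesgue g"
  shows "convolve w (\<lambda>x. f x + g x) z = convolve w f z + convolve w g z"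
  unfolding convolve_def scaleR_add_right
  by (intro Bochner_Integration.integral_add convolve_integrable assms)

lemma convolve_scaleR:
  fixes f :: "'a::euclidean_space \<Rightarrow> 'b::{banach, second_countable_topology}"
  shows "convolve w (\<lambda>x. a *\<^sub>R f x) z = a *\<^sub>R convolve w f z"
proof -
  have "(\<lambda>y. w (z - y) *\<^sub>R a *\<^sub>R f y) = (\<lambda>y. a *\<^sub>R (w (z - y) *\<^sub>R f y))"
    by (simp add: mult.commute)
  then show ?thesis unfolding convolve_def by (simp only: integral_scaleR_right)
qed

lemma convolve_diff:
  fixes f :: "'a::euclidean_space \<Rightarrow> 'b::{banach, second_countable_topology}"
  assumes "w \<in> C0_infty UNIV" "integrable lebesgue f" "integrable lebesgue g"
  shows "convolve w (\<lambda>x. f x - g x) z = convolve w f z - convolve w g z"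
  unfolding convolve_def scaleR_diff_right
  by (intro Bochner_Integration.integral_diff convolve_integrable assms)

lemma convolve_measurable:
  fixes f :: "'a::euclidean_space \<Rightarrow> 'b::{banach, second_countable_topology}"
  assumes "w \<in> C0_infty UNIV" "integrable lebesgue f"
  shows "convolve w f \<in> borel_measurable borel"
  by (intro borel_measurable_continuous_onI smooth_continuous convolve_smooth assms)

lemma mollify_L1_add:
  fixes f :: "'a::euclidean_space \<Rightarrow> 'b::{banach, second_countable_topology}"
  assumes h: "0 < h" and f: "integrable lebesgue f" and g: "integrable lebesgue g"
  shows "(\<integral>\<^sup>+z. ennreal (norm (convolve (mollifier h) (\<lambda>x. f x + g x) z - (f z + g z))) \<partial>lborel) \<le>
     (\<integral>\<^sup>+z. ennreal (norm (convolve (mollifier h) f z - f z)) \<partial>lborel) +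
     (\<integral>\<^sup>+z. ennreal (norm (convolve (mollifier h) g z - g z)) \<partial>lborel)"
proof -
  note w = mollifier_C0_infty[OF h]
  have m: "(\<lambda>z. ennreal (norm (convolve (mollifier h) k z - k z))) \<in> borel_measurable lebesgue"
    if "integrable lebesgue k" for k :: "'a \<Rightarrow> 'b"
  proof -
    have [measurable]: "convolve (mollifier h) k \<in> borel_measurable lebesgue"
      by (intro measurable_completion) (simp add: convolve_measurable[OF w that])
    have [measurable]: "k \<in> borel_measurable lebesgue" using that by auto
    show ?thesis by measurable
  qed
  have "(\<integral>\<^sup>+z. ennreal (norm (convolve (mollifier h) (\<lambda>x. f x + g x) z - (f z + g z))) \<partial>lebesgue) \<le>
     (\<integral>\<^sup>+z. ennreal (norm (convolve (mollifier h) f z - f z)) + ennreal (norm (convolve (mollifier h) g z - g z)) \<partial>lebesgue)"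
  proof (rule nn_integral_mono)
    fix z
    have "norm (convolve (mollifier h) (\<lambda>x. f x + g x) z - (f z + g z)) =
        norm ((convolve (mollifier h) f z - f z) + (convolve (mollifier h) g z - g z))"
      by (simp add: convolve_add[OF w f g] algebra_simps)
    also have "\<dots> \<le> norm (convolve (mollifier h) f z - f z) + norm (convolve (mollifier h) g z - g z)"
      by (rule norm_triangle_ineq)
    finally show "ennreal (norm (convolve (mollifier h) (\<lambda>x. f x + g x) z - (f z + g z))) \<le>
       ennreal (norm (convolve (mollifier h) f z - f z)) + ennreal (norm (convolve (mollifier h) g z - g z))"
      by (simp flip: ennreal_plus)
  qed
  also have "\<dots> = (\<integral>\<^sup>+z. ennreal (norm (convolve (mollifier h) f z - f z)) \<partial>lebesgue) +
     (\<integral>\<^sup>+z. ennreal (norm (convolve (mollifier h) g z - g z)) \<partial>lebesgue)"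
    by (rule nn_integral_add[OF m[OF f] m[OF g]])
  finally show ?thesis by (simp add: nn_integral_completion)
qed

lemma mollify_L1_le:
  fixes f :: "'a::euclidean_space \<Rightarrow> 'b::{banach, second_countable_topology}"
  assumes h: "0 < h" and f: "integrable lebesgue f"
  shows "(\<integral>\<^sup>+z. ennreal (norm (convolve (mollifier h) f z - f z)) \<partial>lborel) \<le> 2 * (\<integral>\<^sup>+z. ennreal (norm (f z)) \<partial>lborel)"
proof -
  note w = mollifier_C0_infty[OF h]
  have [measurable]: "convolve (mollifier h) f \<in> borel_measurable lebesgue"
    by (intro measurable_completion) (simp add: convolve_measurable[OF w f])
  have [measurable]: "f \<in> borel_measurable lebesgue" using f by auto
  have "(\<integral>\<^sup>+z. ennreal (norm (convolve (mollifier h) f z - f z)) \<partial>lebesgue) \<le>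
     (\<integral>\<^sup>+z. ennreal (norm (convolve (mollifier h) f z)) + ennreal (norm (f z)) \<partial>lebesgue)"
    by (intro nn_integral_mono) (simp add: norm_triangle_ineq4 flip: ennreal_plus)
  also have "\<dots> = (\<integral>\<^sup>+z. ennreal (norm (convolve (mollifier h) f z)) \<partial>lebesgue) + (\<integral>\<^sup>+z. ennreal (norm (f z)) \<partial>lebesgue)"
    by (rule nn_integral_add) measurable
  also have "\<dots> \<le> (\<integral>\<^sup>+z. ennreal (norm (f z)) \<partial>lebesgue) + (\<integral>\<^sup>+z. ennreal (norm (f z)) \<partial>lebesgue)"
    using convolve_L1_le[OF h, of f] f by (intro add_mono) (auto simp: nn_integral_completion)
  finally show ?thesis by (simp add: nn_integral_completion mult_2)
qed

text \<open>The mollified indicator \<open>a n\<close> has values in [0,1] and the same integral as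
  the indicator, so the mass that leaks out of U equals the mass missing inside, and the L^1
  distance is twice the deficit on U. Since U is open, \<open>a n z = 1\<close> eventually for each
  z in U, and dominated convergence applies.\<close>

lemma mollify_L1_open:
  fixes U :: "'a::euclidean_space set"
  assumes U: "open U" "emeasure lborel U < \<infinity>" and X: "\<And>n. 0 < X n" "X \<longlonglongrightarrow> (0::real)"
  shows "(\<lambda>n. \<integral>\<^sup>+z. ennreal \<bar>convolve (mollifier (X n)) (indicat_real U) z - indicat_real U z\<bar> \<partial>lborel) \<longlonglongrightarrow> 0"
proof -
  define a where "a n = convolve (mollifier (X n)) (indicat_real U)" for n
  have Um [measurable]: "U \<in> sets borel" using U by auto
  have iU: "integrable lebesgue (indicat_real U)"
    using U by (intro integrable_real_indicator) auto
  have [measurable]: "a n \<in> borel_measurable borel" for n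
    unfolding a_def by (rule convolve_measurable[OF mollifier_C0_infty[OF X(1)] iU])
  have a_eq: "ennreal (a n z) = (\<integral>\<^sup>+y. ennreal (mollifier (X n) (z - y)) * indicator U y \<partial>lborel)"
    and a0: "0 \<le> a n z" for n z
  proof -
    have i: "integrable lebesgue (\<lambda>y. mollifier (X n) (z - y) *\<^sub>R indicat_real U y)"
      by (rule convolve_integrable[OF mollifier_C0_infty[OF X(1)] iU])
    show "0 \<le> a n z" unfolding a_def convolve_def
      by (rule integral_nonneg_AE) (simp add: mollifier_nonneg X)
    have "ennreal (a n z) = (\<integral>\<^sup>+y. ennreal (mollifier (X n) (z - y) *\<^sub>R indicat_real U y) \<partial>lebesgue)"
      unfolding a_def convolve_def
      by (rule nn_integral_eq_integral[OF i, symmetric]) (simp add: mollifier_nonneg X)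
    then show "ennreal (a n z) = (\<integral>\<^sup>+y. ennreal (mollifier (X n) (z - y)) * indicator U y \<partial>lborel)"
      by (simp add: nn_integral_completion ennreal_mult mollifier_nonneg X ennreal_indicator)
  qed
  have a1: "a n z \<le> 1" for n z
  proof -
    have "ennreal (a n z) \<le> (\<integral>\<^sup>+y. ennreal (mollifier (X n) (z - y)) \<partial>lborel)"
      unfolding a_eq by (intro nn_integral_mono) (auto simp: indicator_def)
    then show ?thesis by (simp add: nn_integral_mollifier_reflect X)
  qed
  have a_1: "a n z = 1" if "ball z (X n) \<subseteq> U" for n z
  proof -
    have "ennreal (a n z) = (\<integral>\<^sup>+y. ennreal (mollifier (X n) (z - y)) \<partial>lborel)"
      unfolding a_eq
    proof (rule nn_integral_cong)
      fix y
      show "ennreal (mollifier (X n) (z - y)) * indicator U y = ennreal (mollifier (X n) (z - y))"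
        using that mollifier_support[OF X(1), of n "z - y"]
        by (cases "y \<in> U"; cases "norm (z - y) < X n") (auto simp: dist_norm subset_iff not_less)
    qed
    then show ?thesis by (simp add: nn_integral_mollifier_reflect X)
  qed
  have a_int: "(\<integral>\<^sup>+z. ennreal (a n z) \<partial>lborel) = emeasure lborel U" for n
  proof -
    have "(\<integral>\<^sup>+z. ennreal (a n z) \<partial>lborel) = (\<integral>\<^sup>+y. (\<integral>\<^sup>+z. ennreal (mollifier (X n) (z - y)) * indicator U y \<partial>lborel) \<partial>lborel)"
      unfolding a_eq by (rule lborel_pair.Fubini') measurable
    then show ?thesis by (simp add: nn_integral_multc nn_integral_mollifier_shift X)
  qed
  let ?d = "\<lambda>n. \<integral>\<^sup>+z. ennreal \<bar>a n z - indicat_real U z\<bar> \<partial>lborel"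
  let ?e = "\<lambda>n. \<integral>\<^sup>+z. 2 * ennreal ((1 - a n z) * indicat_real U z) \<partial>lborel"
  have "?d n = ?e n" for n
  proof -
    have "emeasure lborel U + ?d n = (\<integral>\<^sup>+z. indicator U z \<partial>lborel) + ?d n" by simp
    also have "\<dots> = (\<integral>\<^sup>+z. indicator U z + ennreal \<bar>a n z - indicat_real U z\<bar> \<partial>lborel)"
      by (rule nn_integral_add[symmetric]) measurable
    also have "\<dots> = (\<integral>\<^sup>+z. ennreal (a n z) + 2 * ennreal ((1 - a n z) * indicat_real U z) \<partial>lborel)"
    proof (rule nn_integral_cong)
      fix z
      show "indicator U z + ennreal \<bar>a n z - indicat_real U z\<bar> = ennreal (a n z) + 2 * ennreal ((1 - a n z) * indicat_real U z)"
      proof (cases "z \<in> U")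
        case True
        have "ennreal 1 + ennreal (1 - a n z) = ennreal (a n z) + ennreal 2 * ennreal (1 - a n z)"
          using a0[of n z] a1[of n z] by (simp del: ennreal_1 ennreal_numeral flip: ennreal_plus ennreal_mult)
        then show ?thesis using True a0[of n z] a1[of n z] by (simp add: abs_if)
      qed (use a0[of n z] in simp)
    qed
    also have "\<dots> = (\<integral>\<^sup>+z. ennreal (a n z) \<partial>lborel) + ?e n"
      by (rule nn_integral_add) measurable
    finally have "emeasure lborel U + ?d n = emeasure lborel U + ?e n" by (simp add: a_int)
    then show ?thesis using U by (auto simp: ennreal_add_left_cancel)
  qed
  moreover have "?e \<longlonglongrightarrow> (\<integral>\<^sup>+(z::'a). 0 \<partial>lborel)"
  proof (rule nn_integral_dominated_convergence[where w="\<lambda>z. 2 * indicator U z"])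
    show "AE z in lborel. 2 * ennreal ((1 - a n z) * indicat_real U z) \<le> 2 * indicator U z" for n
      using a0 a1 by (auto simp: indicator_def ennreal_le_1 intro!: mult_left_mono[where c=2 and b="1::ennreal", simplified])
    show "(\<integral>\<^sup>+z. 2 * indicator U z \<partial>lborel) < \<infinity>"
      using U by (simp add: nn_integral_cmult ennreal_mult_less_top)
    have "(\<lambda>n. 2 * ennreal ((1 - a n z) * indicat_real U z)) \<longlonglongrightarrow> 0" for z
    proof (cases "z \<in> U")
      case True
      then obtain r where r: "0 < r" "ball z r \<subseteq> U" using U by (meson open_contains_ball)
      have "\<forall>\<^sub>F n in sequentially. X n < r" using X(2) r by (auto simp: order_tendsto_iff)
      then have "\<forall>\<^sub>F n in sequentially. 2 * ennreal ((1 - a n z) * indicat_real U z) = 0"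
      proof eventually_elim
        case (elim n)
        then have "ball z (X n) \<subseteq> U" using r by (meson less_imp_le order_trans subset_ball)
        then show ?case by (simp add: a_1)
      qed
      then show ?thesis by (rule tendsto_eventually)
    qed simp
    then show "AE z in lborel. (\<lambda>n. 2 * ennreal ((1 - a n z) * indicat_real U z)) \<longlonglongrightarrow> 0" by simp
  qed measurable
  ultimately show ?thesis by (simp add: a_def)
qed

text \<open>Induction over integrable functions. The mollification error is at most twice the L^1
  norm, so the claim passes to L^1 limits (\<open>approx\<close>); indicators of measurable sets
  then reduce to open sets by outer regularity of Lebesgue measure.\<close>

lemma mollify_L1_seq:
  fixes f :: "'a::euclidean_space \<Rightarrow> 'b::{banach, second_countable_topology}"
  assumes f: "integrable lebesgue f" and X: "\<And>n. 0 < X n" "X \<longlonglongrightarrow> (0::real)"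
  shows "(\<lambda>n. \<integral>\<^sup>+z. ennreal (norm (convolve (mollifier (X n)) f z - f z)) \<partial>lborel) \<longlonglongrightarrow> 0"
proof -
  let ?D = "\<lambda>n (f :: 'a \<Rightarrow> 'b). \<integral>\<^sup>+z. ennreal (norm (convolve (mollifier (X n)) f z - f z)) \<partial>lborel"
  have approx: "(\<lambda>n. ?D n f) \<longlonglongrightarrow> 0" if f: "integrable lebesgue f"
    and ex: "\<And>e. 0 < e \<Longrightarrow> \<exists>g. integrable lebesgue g \<and> (\<lambda>n. ?D n g) \<longlonglongrightarrow> 0 \<and>
       (\<integral>\<^sup>+x. ennreal (norm (f x - g x)) \<partial>lborel) \<le> ennreal e" for f :: "'a \<Rightarrow> 'b"
    unfolding ennreal_tendsto_0_iff
  proof (intro allI impI)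
    fix e :: real assume e: "0 < e"
    obtain g where g: "integrable lebesgue g" "(\<lambda>n. ?D n g) \<longlonglongrightarrow> 0"
      "(\<integral>\<^sup>+x. ennreal (norm (f x - g x)) \<partial>lborel) \<le> ennreal (e / 4)"
      using ex[of "e/4"] e by auto
    have "\<forall>\<^sub>F n in sequentially. ?D n g \<le> ennreal (e / 2)"
      using g(2) e unfolding ennreal_tendsto_0_iff by simp
    then show "\<forall>\<^sub>F n in sequentially. ?D n f \<le> ennreal e"
    proof eventually_elim
      case (elim n)
      have "?D n f \<le> ?D n g + ?D n (\<lambda>x. f x - g x)"
        using mollify_L1_add[OF X(1) g(1) Bochner_Integration.integrable_diff[OF f g(1)], of n] by simp
      also have "\<dots> \<le> ennreal (e / 2) + 2 * ennreal (e / 4)"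
        by (intro add_mono elim order_trans[OF mollify_L1_le[OF X(1)]] mult_left_mono g Bochner_Integration.integrable_diff f) auto
      also have "\<dots> = ennreal e" using e by (simp add: mult_2 flip: ennreal_plus)
      finally show ?case .
    qed
  qed
  from f show ?thesis
  proof (induction rule: integrable_induct)
    case (base A c)
    have iA: "integrable lebesgue (\<lambda>x. indicat_real A x *\<^sub>R c)"
      using base by (intro integrable_scaleR_left integrable_real_indicator)
    show ?case
    proof (rule approx[OF iA])
      fix e :: real assume e: "0 < e"
      \<comment> \<open>Adding 1 keeps the denominator positive when c = 0.\<close>
      define e' where "e' = e / (norm c + 1)"
      have e': "0 < e'" using e by (simp add: e'_def add_nonneg_pos)
      obtain U where U: "open U" "A \<subseteq> U" "(U - A) \<in> lmeasurable" "emeasure lebesgue (U - A) < ennreal e'"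
        using sets_lebesgue_outer_open[OF base(1) e'] by blast
      have eU: "emeasure lborel U < \<infinity>"
      proof -
        have "emeasure lebesgue U \<le> emeasure lebesgue (U - A) + emeasure lebesgue A"
          using U base by (intro order_trans[OF _ emeasure_subadditive] emeasure_mono) auto
        also have "\<dots> < \<infinity>" using U(4) base(2) by (auto intro: less_trans simp: ennreal_add_less_top)
        finally show ?thesis using U(1) by simp
      qed
      have iU: "integrable lebesgue (indicat_real U)"
        using U eU by (intro integrable_real_indicator) auto
      have "?D n (\<lambda>x. indicat_real U x *\<^sub>R c) = ennreal (norm c) * (\<integral>\<^sup>+z. ennreal \<bar>convolve (mollifier (X n)) (indicat_real U) z - indicat_real U z\<bar> \<partial>lborel)" for n
      proof -
        have [measurable]: "convolve (mollifier (X n)) (indicat_real U) \<in> borel_measurable borel"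
          by (rule convolve_measurable[OF mollifier_C0_infty[OF X(1)] iU])
        have [measurable]: "U \<in> sets borel" using U by auto
        have "convolve (mollifier (X n)) (\<lambda>x. indicat_real U x *\<^sub>R c) z = convolve (mollifier (X n)) (indicat_real U) z *\<^sub>R c" for z
          using integral_scaleR_left[OF convolve_integrable[OF mollifier_C0_infty[OF X(1)] iU, of n z], of c]
          by (simp add: convolve_def)
        then have "?D n (\<lambda>x. indicat_real U x *\<^sub>R c) = (\<integral>\<^sup>+z. ennreal (norm c) * ennreal \<bar>convolve (mollifier (X n)) (indicat_real U) z - indicat_real U z\<bar> \<partial>lborel)"
          by (intro nn_integral_cong) (simp add: mult.commute flip: scaleR_diff_left ennreal_mult)
        then show ?thesis by (subst (asm) nn_integral_cmult) auto
      qed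
      moreover have "(\<lambda>n. ennreal (norm c) * (\<integral>\<^sup>+z. ennreal \<bar>convolve (mollifier (X n)) (indicat_real U) z - indicat_real U z\<bar> \<partial>lborel)) \<longlonglongrightarrow> ennreal (norm c) * 0"
        by (intro ennreal_tendsto_cmult mollify_L1_open U eU X) auto
      ultimately have 1: "(\<lambda>n. ?D n (\<lambda>x. indicat_real U x *\<^sub>R c)) \<longlonglongrightarrow> 0" by simp
      have "(\<integral>\<^sup>+x. ennreal (norm (indicat_real A x *\<^sub>R c - indicat_real U x *\<^sub>R c)) \<partial>lebesgue) =
          (\<integral>\<^sup>+x. ennreal (norm c) * indicator (U - A) x \<partial>lebesgue)"
        using U(2) by (intro nn_integral_cong) (auto simp: indicator_def)
      also have "\<dots> = ennreal (norm c) * emeasure lebesgue (U - A)"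
        using U(3) by (simp add: nn_integral_cmult_indicator)
      also have "\<dots> \<le> ennreal (norm c) * ennreal e'"
        using U(4) by (intro mult_left_mono) auto
      also have "\<dots> \<le> ennreal e"
      proof -
        have "norm c * e \<le> e * (norm c + 1)" using e by (simp add: algebra_simps)
        then have "norm c * e' \<le> e" by (simp add: e'_def divide_le_eq add_nonneg_pos)
        then show ?thesis using e' by (simp add: ennreal_leI flip: ennreal_mult)
      qed
      finally show "\<exists>g. integrable lebesgue g \<and> (\<lambda>n. ?D n g) \<longlonglongrightarrow> 0 \<and>
         (\<integral>\<^sup>+x. ennreal (norm (indicat_real A x *\<^sub>R c - g x)) \<partial>lborel) \<le> ennreal e"
        using 1 iU by (intro exI[of _ "\<lambda>x. indicat_real U x *\<^sub>R c"]) (auto simp: nn_integral_completion)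
    qed
  next
    case (add f g)
    have "(\<lambda>n. ?D n f + ?D n g) \<longlonglongrightarrow> 0 + 0" by (intro tendsto_add add.IH)
    then have "(\<lambda>n. ?D n f + ?D n g) \<longlonglongrightarrow> 0" by simp
    then show ?case
      by (rule tendsto_sandwich[OF _ _ tendsto_const, rotated 2])
         (auto intro!: always_eventually mollify_L1_add[OF X(1)] add.hyps)
  next
    case (lim f s)
    show ?case
    proof (rule approx[OF lim.hyps(4)])
      fix e :: real assume e: "0 < e"
      have [measurable]: "f \<in> borel_measurable lebesgue" "\<And>i. s i \<in> borel_measurable lebesgue"
        using lim.hyps by auto
      have "(\<lambda>i. (\<integral>\<^sup>+x. ennreal (norm (f x - s i x)) \<partial>lebesgue)) \<longlonglongrightarrow> 0"
        by (rule nn_integral_dominated_convergence_norm[where w="\<lambda>x. 2 * norm (f x)"])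
          (use lim.hyps in \<open>auto simp: integrable_iff_bounded nn_integral_cmult ennreal_mult ennreal_mult_less_top\<close>)
      then have "\<forall>\<^sub>F i in sequentially. (\<integral>\<^sup>+x. ennreal (norm (f x - s i x)) \<partial>lebesgue) \<le> ennreal e"
        unfolding ennreal_tendsto_0_iff using e by blast
      then obtain i where "(\<integral>\<^sup>+x. ennreal (norm (f x - s i x)) \<partial>lebesgue) \<le> ennreal e"
        by (auto simp: eventually_sequentially)
      then show "\<exists>g. integrable lebesgue g \<and> (\<lambda>n. ?D n g) \<longlonglongrightarrow> 0 \<and>
         (\<integral>\<^sup>+x. ennreal (norm (f x - g x)) \<partial>lborel) \<le> ennreal e"
        using lim.hyps(1) lim.IH by (intro exI[of _ "s i"]) (auto simp: nn_integral_completion)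
    qed
  qed
qed

section \<open>Ball averages and the maximal function\<close>

definition ball_avg :: "('a::euclidean_space \<Rightarrow> 'b::real_normed_vector) \<Rightarrow> 'a \<Rightarrow> real \<Rightarrow> ennreal" where
  "ball_avg f z r = (\<integral>\<^sup>+ y. ennreal (norm (f y)) \<partial>lebesgue_on (ball z r)) / emeasure lebesgue (ball z r)"

lemma ball_avg_le_maximal_fn: "0 < r \<Longrightarrow> ball_avg f z r \<le> maximal_fn f z"
  unfolding maximal_fn_def ball_avg_def by (rule SUP_upper2[of r]) auto

lemma emeasure_ball_nonzero:
  assumes "0 < r"
  shows "emeasure lborel (ball (z::'a::euclidean_space) r) \<noteq> 0"
  by (metis assms content_ball_pos emeasure_lborel_ball_finite less_irrefl measure_def enn2real_0)

lemma ball_avg_times_measure: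
  fixes f :: "'a::euclidean_space \<Rightarrow> 'b::real_normed_vector"
  assumes "0 < r"
  shows "ball_avg f z r * emeasure lborel (ball z r) = (\<integral>\<^sup>+ y. ennreal (norm (f y)) * indicator (ball z r) y \<partial>lborel)"
proof -
  have "ball_avg f z r * emeasure lborel (ball z r) = (\<integral>\<^sup>+ y. ennreal (norm (f y)) \<partial>lebesgue_on (ball z r))"
    unfolding ball_avg_def using emeasure_ball_nonzero[OF assms, of z] emeasure_lborel_ball_finite[of z r]
    by (simp add: ennreal_divide_times ennreal_divide_self less_top)
  also have "\<dots> = (\<integral>\<^sup>+ y. ennreal (norm (f y)) * indicator (ball z r) y \<partial>lebesgue)"
    by (rule nn_integral_restrict_space) simp
  finally show ?thesis by (simp add: nn_integral_completion)
qed

lemma bump_superlevel: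
  assumes "0 < s"
  obtains r where "0 \<le> r" "\<And>x::'a::euclidean_space. s < bump x \<longleftrightarrow> norm x < r"
proof (cases "s < exp (-1)")
  case False
  have "bump x \<le> exp (-1)" for x :: 'a
  proof (cases "norm x < 1")
    case True
    then have "0 < 1 - (norm x)\<^sup>2" "1 - (norm x)\<^sup>2 \<le> 1" by (auto simp: power_less_one_iff abs_square_less_1)
    then have "1 \<le> 1 / (1 - (norm x)\<^sup>2)" by (simp add: le_divide_eq)
    then show ?thesis using True by (simp add: bump_def)
  qed (simp add: bump_def)
  then have "\<not> s < bump x" for x :: 'a using False by (meson less_le_trans)
  then show ?thesis using that[of 0] by auto
next
  case True
  have l: "ln s < -1" using True assms by (metis exp_less_cancel_iff exp_ln)
  \<comment> \<open>The radius solves exp(-1/(1 - r^2)) = s; s lies below the maximum exp(-1) of the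
    bump, so ln s < -1 and r lies strictly between 0 and 1.\<close>
  define r where "r = sqrt (1 + 1 / ln s)"
  have p: "0 < 1 + 1 / ln s" "1 + 1 / ln s < 1" using l by (auto simp: field_simps)
  have "s < bump x \<longleftrightarrow> norm x < r" for x :: 'a
  proof (cases "norm x < 1")
    case x: True
    define q where "q = 1 - (norm x)\<^sup>2"
    have q: "0 < q" using x by (auto simp: q_def power_less_one_iff abs_square_less_1)
    have "s < bump x \<longleftrightarrow> exp (ln s) < exp (- 1 / q)" using x assms by (simp add: bump_def q_def)
    also have "\<dots> \<longleftrightarrow> ln s < - 1 / q" by simp
    also have "\<dots> \<longleftrightarrow> - (1 / ln s) < q" using l q by (simp add: field_simps)
    also have "\<dots> \<longleftrightarrow> (norm x)\<^sup>2 < 1 + 1 / ln s" by (auto simp: q_def)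
    also have "\<dots> \<longleftrightarrow> norm x < r" unfolding r_def
      by (metis norm_ge_zero real_less_rsqrt real_sqrt_less_iff real_sqrt_abs abs_norm_cancel)
    finally show ?thesis .
  next
    case x: False
    have "r < 1" using p by (simp add: r_def)
    then show ?thesis using x assms by (simp add: bump_def)
  qed
  then show ?thesis using that[of r] p by (auto simp: r_def)
qed

lemma mollifier_superlevel:
  assumes "0 < h" "0 < s"
  obtains r where "{y. s < mollifier h (z - y :: 'a::euclidean_space)} = ball z r"
proof -
  let ?k = "bump_mass TYPE('a) * h ^ DIM('a)"
  have k: "0 < ?k" using assms bump_mass_pos[where 'a='a] by simp
  obtain r where r: "\<And>x::'a. s * ?k < bump x \<longleftrightarrow> norm x < r"
    by (rule bump_superlevel[of "s * ?k", where 'a='a]) (use assms k in auto)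
  have "s < mollifier h (z - y) \<longleftrightarrow> dist z y < h * r" for y
  proof -
    have "s < mollifier h (z - y) \<longleftrightarrow> s * ?k < bump ((z - y) /\<^sub>R h)"
      unfolding mollifier_eq using k by (simp only: pos_less_divide_eq)
    moreover have "norm ((z - y) /\<^sub>R h) = norm (z - y) / h" using assms by (simp add: divide_inverse)
    ultimately show ?thesis unfolding r dist_norm using assms by (simp only: pos_divide_less_eq mult.commute)
  qed
  then have "{y. s < mollifier h (z - y)} = ball z (h * r)"
    by (intro set_eqI) (simp only: mem_Collect_eq mem_ball)
  then show ?thesis by (rule that)
qed

text \<open>Layer cake: the superlevel sets of the mollifier are balls.\<close>

lemma mollify_le_maximal_fn:
  fixes f :: "'a::euclidean_space \<Rightarrow> 'b::real_normed_vector"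
  assumes h: "0 < h" and f: "f \<in> borel_measurable lebesgue"
  shows "(\<integral>\<^sup>+y. ennreal (mollifier h (z - y)) * ennreal (norm (f y)) \<partial>lborel) \<le> maximal_fn f z"
proof -
  obtain F where [measurable]: "F \<in> borel_measurable borel" and F: "AE y in lborel. ennreal (norm (f y)) = F y"
    by (rule lebesgue_measurable_norm_rep[OF f]) blast
  let ?w = "\<lambda>y. mollifier h (z - y)"
  let ?I = "\<lambda>(s::real) y. if 0 < s \<and> s < ?w y then 1 else (0::ennreal)"
  have w: "ennreal (?w y) = (\<integral>\<^sup>+s. ?I s y \<partial>lborel)" for y
  proof -
    have "(\<integral>\<^sup>+s. ?I s y \<partial>lborel) = (\<integral>\<^sup>+s. indicator {0<..<?w y} s \<partial>lborel)"
      by (intro nn_integral_cong) (auto simp: indicator_def)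
    then show ?thesis using mollifier_nonneg[OF h, of "z - y"] by simp
  qed
  have "(\<integral>\<^sup>+y. ennreal (?w y) * ennreal (norm (f y)) \<partial>lborel) = (\<integral>\<^sup>+y. ennreal (?w y) * F y \<partial>lborel)"
    by (rule nn_integral_cong_AE) (use F in auto)
  also have "\<dots> = (\<integral>\<^sup>+y. (\<integral>\<^sup>+s. ?I s y * F y \<partial>lborel) \<partial>lborel)"
    unfolding w by (simp add: nn_integral_multc)
  also have "\<dots> = (\<integral>\<^sup>+s. (\<integral>\<^sup>+y. ?I s y * F y \<partial>lborel) \<partial>lborel)"
    by (rule lborel_pair.Fubini') measurable
  \<comment> \<open>On each level s the integral of F runs over a ball, hence is an average times
    the volume of the ball. The volumes integrate back to the mass 1 of the mollifier, which leaves
    the maximal function with constant 1.\<close>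
  also have "\<dots> \<le> (\<integral>\<^sup>+s. maximal_fn f z * (\<integral>\<^sup>+y. ?I s y \<partial>lborel) \<partial>lborel)"
  proof (rule nn_integral_mono)
    fix s :: real
    show "(\<integral>\<^sup>+y. ?I s y * F y \<partial>lborel) \<le> maximal_fn f z * (\<integral>\<^sup>+y. ?I s y \<partial>lborel)"
    proof (cases "0 < s")
      case True
      obtain r where r: "{y. s < ?w y} = ball z r" by (rule mollifier_superlevel[OF h True, of z]) blast
      then have I: "?I s y = indicator (ball z r) y" for y using True by (auto simp: indicator_def)
      show ?thesis
      proof (cases "0 < r")
        case True
        have "(\<integral>\<^sup>+y. ?I s y * F y \<partial>lborel) = (\<integral>\<^sup>+ y. ennreal (norm (f y)) * indicator (ball z r) y \<partial>lborel)"
          unfolding I by (rule nn_integral_cong_AE) (use F in \<open>auto simp: mult.commute\<close>)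
        also have "\<dots> = ball_avg f z r * emeasure lborel (ball z r)"
          by (rule ball_avg_times_measure[OF True, symmetric])
        also have "\<dots> \<le> maximal_fn f z * emeasure lborel (ball z r)"
          by (intro mult_right_mono ball_avg_le_maximal_fn True) simp
        also have "emeasure lborel (ball z r) = (\<integral>\<^sup>+y. ?I s y \<partial>lborel)"
          unfolding I by simp
        finally show ?thesis .
      next
        case False
        then show ?thesis unfolding I by (simp add: ball_empty)
      qed
    qed simp
  qed
  also have "\<dots> = maximal_fn f z * (\<integral>\<^sup>+s. (\<integral>\<^sup>+y. ?I s y \<partial>lborel) \<partial>lborel)"
    by (rule nn_integral_cmult) measurable
  also have "(\<integral>\<^sup>+s. (\<integral>\<^sup>+y. ?I s y \<partial>lborel) \<partial>lborel) = (\<integral>\<^sup>+y. (\<integral>\<^sup>+s. ?I s y \<partial>lborel) \<partial>lborel)"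
    by (rule lborel_pair.Fubini') measurable
  also have "\<dots> = 1"
    unfolding w[symmetric] by (rule nn_integral_mollifier_reflect[OF h])
  finally show ?thesis by simp
qed

section \<open>Distributional symmetric gradients\<close>

lemma mollifier_test_function:
  assumes "0 < h" "cball y h \<subseteq> G"
  shows "(\<lambda>x. mollifier h (y - x :: 'a::euclidean_space)) \<in> C0_infty G"
proof (rule C0_inftyI[of _ "cball y h"])
  show "smooth (\<lambda>x. mollifier h (y - x))"
    using smooth_affine[OF C0_inftyD(1)[OF mollifier_C0_infty[OF assms(1)]] bounded_linear_minus[OF bounded_linear_ident], of y]
    by simp
  show "mollifier h (y - x) = 0" if "x \<notin> cball y h" for x
    using that by (intro mollifier_support assms(1)) (simp add: dist_norm)
qed (use assms in auto)

lemma loc_integrable_C0_infty: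
  fixes f :: "'a::euclidean_space \<Rightarrow> 'b::{banach, second_countable_topology}"
  assumes f: "loc_integrable G f" and w: "w \<in> C0_infty G"
  shows "integrable lebesgue (\<lambda>x. w x *\<^sub>R f x)"
proof -
  let ?K = "closed_supp w"
  define g where "g x = indicat_real ?K x *\<^sub>R f x" for x
  have i: "integrable lebesgue g"
    using f C0_inftyD(2,3)[OF w] unfolding loc_integrable_def set_integrable_def g_def by blast
  obtain B where B: "0 < B" "\<And>x. norm (w x) \<le> B" by (rule C0_infty_bounded[OF w]) blast
  have [measurable]: "w \<in> borel_measurable lebesgue"
    by (intro continuous_lebesgue_measurable smooth_continuous C0_inftyD(1)[OF w])
  have [measurable]: "g \<in> borel_measurable lebesgue" using i by auto
  have "integrable lebesgue (\<lambda>x. w x *\<^sub>R g x)"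
    by (rule Bochner_Integration.integrable_bound[of _ "\<lambda>y. B *\<^sub>R g y"])
       (use i B in \<open>auto intro!: mult_right_mono\<close>)
  also have "(\<lambda>x. w x *\<^sub>R g x) = (\<lambda>x. w x *\<^sub>R f x)"
    using C0_inftyD(4)[OF w] by (auto simp: fun_eq_iff indicator_def g_def)
  finally show ?thesis .
qed

lemma loc_integrable_bounded_linear:
  fixes f :: "'a::euclidean_space \<Rightarrow> 'b::{banach, second_countable_topology}"
    and L :: "'b \<Rightarrow> 'c::{banach, second_countable_topology}"
  assumes "bounded_linear L" "loc_integrable G f"
  shows "loc_integrable G (\<lambda>x. L (f x))"
  unfolding loc_integrable_def set_integrable_def
proof (intro allI impI)
  fix K assume "compact K \<and> K \<subseteq> G"
  then have "integrable lebesgue (\<lambda>x. L (indicat_real K x *\<^sub>R f x))"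
    using assms by (intro integrable_bounded_linear[OF assms(1)]) (auto simp: loc_integrable_def set_integrable_def)
  then show "integrable lebesgue (\<lambda>x. indicat_real K x *\<^sub>R L (f x))"
    by (simp add: linear_scale[OF bounded_linear.linear[OF assms(1)]])
qed

lemma loc_integrable_diff:
  fixes f :: "'a::euclidean_space \<Rightarrow> 'b::{banach, second_countable_topology}"
  assumes "loc_integrable G f" "loc_integrable G g"
  shows "loc_integrable G (\<lambda>x. f x - g x)"
  using assms unfolding loc_integrable_def by (auto intro: set_integral_diff)

text \<open>By Lindelof, countably many of the given balls cover G, so the exceptional null sets can
  be united.\<close>

lemma AE_open_locally:
  fixes G :: "'a::euclidean_space set"
  assumes "\<And>x. x \<in> G \<Longrightarrow> \<exists>r>0. AE y in M. y \<in> ball x r \<longrightarrow> P y"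
  shows "AE y in M. y \<in> G \<longrightarrow> P y"
proof -
  have "\<forall>x\<in>G. \<exists>r. 0 < r \<and> (AE y in M. y \<in> ball x r \<longrightarrow> P y)" using assms by blast
  from bchoice[OF this] obtain r
    where r: "\<forall>x\<in>G. 0 < r x \<and> (AE y in M. y \<in> ball x (r x) \<longrightarrow> P y)" by blast
  obtain F where F: "F \<subseteq> (\<lambda>x. ball x (r x)) ` G" "countable F" "\<Union>F = \<Union>((\<lambda>x. ball x (r x)) ` G)"
    by (rule Lindelof[of "(\<lambda>x. ball x (r x)) ` G"]) auto
  have "AE y in M. \<forall>S\<in>F. y \<in> S \<longrightarrow> P y"
    unfolding AE_ball_countable[OF F(2)] using F(1) r by blast
  moreover have "G \<subseteq> \<Union>F" unfolding F(3) using r by force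
  ultimately show ?thesis by (auto elim!: eventually_mono)
qed

text \<open>Only mollifiers of radius 1/(n+1) with centres in a dense set D are tested, so that
  countably many test functions suffice when D is countable. The mollification of f, cut off to a
  closed ball, is continuous, so its vanishing extends from D to the half ball; L^1 convergence then
  gives f = 0 there.\<close>

lemma fundamental_lemma_mollifier:
  fixes f :: "'a::euclidean_space \<Rightarrow> 'b::{banach, second_countable_topology}"
  assumes G: "open G" and f: "loc_integrable G f" and D: "closure D = UNIV"
    and zero: "\<And>y n. y \<in> D \<Longrightarrow> cball y (1 / Suc n) \<subseteq> G \<Longrightarrow> (LINT x|lebesgue. mollifier (1 / Suc n) (y - x) *\<^sub>R f x) = 0"
  shows "AE x in lborel. x \<in> G \<longrightarrow> f x = 0"
proof (rule AE_open_locally)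
  fix x0 assume "x0 \<in> G"
  then obtain r where r: "0 < r" "cball x0 r \<subseteq> G" using G unfolding open_contains_cball by blast
  define g where "g x = indicat_real (cball x0 r) x *\<^sub>R f x" for x
  have g: "integrable lebesgue g"
    using f r(2) unfolding loc_integrable_def set_integrable_def g_def by simp
  let ?B = "ball x0 (r / 2)"
  let ?h = "\<lambda>n. 1 / real (Suc n)"
  have conv0: "convolve (mollifier (?h n)) g z = 0" if n: "?h n < r / 2" and z: "z \<in> ?B" for n z
  proof -
    have *: "convolve (mollifier (?h n)) g y = 0" if y: "y \<in> D \<inter> ?B" for y
    proof -
      have sub: "cball y (?h n) \<subseteq> cball x0 r"
      proof
        fix x assume "x \<in> cball y (?h n)"
        then have "dist x0 x < r / 2 + r / 2"
          using y n dist_triangle[of x0 x y] by (auto simp del: of_nat_Suc)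
        then show "x \<in> cball x0 r" by simp
      qed
      have eq: "mollifier (?h n) (y - x) *\<^sub>R g x = mollifier (?h n) (y - x) *\<^sub>R f x" for x
        using sub mollifier_support[of "?h n" "y - x"]
        by (cases "norm (y - x) < ?h n") (auto simp: g_def dist_norm subset_iff indicator_def simp del: of_nat_Suc)
      show ?thesis unfolding convolve_def eq by (rule zero) (use y sub r in auto)
    qed
    have "continuous_on UNIV (convolve (mollifier (?h n)) g)"
      by (intro smooth_continuous convolve_smooth mollifier_C0_infty g) simp
    then have "closed {y. convolve (mollifier (?h n)) g y = 0}"
      by (intro closed_Collect_eq continuous_on_const)
    moreover have "D \<inter> ?B \<subseteq> {y. convolve (mollifier (?h n)) g y = 0}" using * by auto
    ultimately have "closure (?B \<inter> D) \<subseteq> {y. convolve (mollifier (?h n)) g y = 0}"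
      by (simp add: closure_minimal Int_commute)
    moreover have "closure (?B \<inter> D) = closure ?B"
      by (rule closure_open_Int_superset) (simp_all add: D)
    ultimately show ?thesis using z closure_subset[of ?B] by auto
  qed
  have lim: "(\<lambda>n. \<integral>\<^sup>+z. ennreal (norm (convolve (mollifier (?h n)) g z - g z)) \<partial>lborel) \<longlonglongrightarrow> 0"
    by (rule mollify_L1_seq[OF g]) (use lim_1_over_n[THEN LIMSEQ_Suc] in auto)
  have "(\<integral>\<^sup>+z. ennreal (norm (g z)) * indicator ?B z \<partial>lborel) \<le> 0"
  proof (rule tendsto_lowerbound[OF lim])
    have "\<forall>\<^sub>F n in sequentially. ?h n < r / 2"
      using order_tendstoD(2)[OF lim_1_over_n[THEN LIMSEQ_Suc], of "r/2"] r by simp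
    then show "\<forall>\<^sub>F n in sequentially. (\<integral>\<^sup>+z. ennreal (norm (g z)) * indicator ?B z \<partial>lborel) \<le>
        (\<integral>\<^sup>+z. ennreal (norm (convolve (mollifier (?h n)) g z - g z)) \<partial>lborel)"
      by eventually_elim (intro nn_integral_mono, auto simp: indicator_def conv0 simp del: of_nat_Suc)
  qed simp
  then have "(\<integral>\<^sup>+z. ennreal (norm (g z)) * indicator ?B z \<partial>lebesgue) = 0"
    by (simp add: nn_integral_completion)
  then have "AE z in lebesgue. ennreal (norm (g z)) * indicator ?B z = 0"
  proof (subst (asm) nn_integral_0_iff_AE)
    have [measurable]: "?B \<in> sets lebesgue" by simp
    show "(\<lambda>z. ennreal (norm (g z)) * indicator ?B z) \<in> borel_measurable lebesgue"
      using borel_measurable_integrable[OF g] by measurable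
  qed
  then have "AE z in lborel. ennreal (norm (g z)) * indicator ?B z = 0"
    by (simp add: AE_completion_iff)
  then have "AE z in lborel. z \<in> ?B \<longrightarrow> f z = 0"
    by eventually_elim (use r in \<open>auto simp: g_def indicator_def split: if_splits\<close>)
  then show "\<exists>r>0. AE y in lborel. y \<in> ball x0 r \<longrightarrow> f y = 0"
    using r by (intro exI[of _ "r/2"]) auto
qed

lemma set_lebesgue_integral_C0:
  assumes "\<And>x. x \<notin> G \<Longrightarrow> g x = 0"
  shows "(LINT x:G|lebesgue. g x) = (LINT x|lebesgue. g x)"
  unfolding set_lebesgue_integral_def
  by (rule Bochner_Integration.integral_cong) (use assms in \<open>auto simp: indicator_def\<close>)

lemma C0_infty_outside: "w \<in> C0_infty G \<Longrightarrow> x \<notin> G \<Longrightarrow> w x = 0"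
  "w \<in> C0_infty G \<Longrightarrow> x \<notin> G \<Longrightarrow> frechet_derivative w (at x) b = 0"
  using C0_inftyD(3,4)[of w G] closed_supp_deriv[of x w] by blast+

lemma has_distr_sym_grad_iff:
  "has_distr_sym_grad e G u E \<longleftrightarrow> loc_integrable G u \<and> loc_integrable G E \<and>
     (\<forall>\<zeta> :: 'a::euclidean_space \<Rightarrow> real. \<zeta> \<in> C0_infty G \<longrightarrow> (\<forall>i j.
        (LINT z|lebesgue. E z $ i $ j * \<zeta> z) =
        - (LINT z|lebesgue. (u z $ j * frechet_derivative \<zeta> (at z) (e i)
                                + u z $ i * frechet_derivative \<zeta> (at z) (e j)) / 2)))"
proof -
  have "(LINT z:G|lebesgue. E z $ i $ j * \<zeta> z) = (LINT z|lebesgue. E z $ i $ j * \<zeta> z)"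
    "(LINT z:G|lebesgue. (u z $ j * frechet_derivative \<zeta> (at z) (e i)
                                + u z $ i * frechet_derivative \<zeta> (at z) (e j)) / 2)
     = (LINT z|lebesgue. (u z $ j * frechet_derivative \<zeta> (at z) (e i)
                                + u z $ i * frechet_derivative \<zeta> (at z) (e j)) / 2)"
    if "\<zeta> \<in> C0_infty G" for i j and \<zeta> :: "'a \<Rightarrow> real"
    by (intro set_lebesgue_integral_C0; simp add: C0_infty_outside[OF that])+
  then show ?thesis unfolding has_distr_sym_grad_def by auto
qed

lemma has_distr_sym_gradD:
  assumes "has_distr_sym_grad e G u E" "\<zeta> \<in> C0_infty G"
  shows "(LINT z|lebesgue. E z $ i $ j * \<zeta> z) =
        - (LINT z|lebesgue. (u z $ j * frechet_derivative \<zeta> (at z) (e i)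
                                + u z $ i * frechet_derivative \<zeta> (at z) (e j)) / 2)"
  using assms unfolding has_distr_sym_grad_iff by blast

lemma bounded_linear_entry: "bounded_linear (\<lambda>E :: real^'n^'m. E $ i $ j)"
  by (rule bounded_linear_compose[OF bounded_linear_vec_nth bounded_linear_vec_nth])

text \<open>The fundamental lemma applied to each matrix entry. The restricted class of test
  functions is what the time slices can afford; with D = UNIV it yields the usual
  uniqueness.\<close>

lemma has_distr_sym_grad_unique_mollifier:
  fixes E E' :: "'a::euclidean_space \<Rightarrow> real^'d::finite^'d"
  assumes G: "open G" and E: "loc_integrable G E" and E': "loc_integrable G E'" and D: "closure D = UNIV"
    and eq: "\<And>y n i j. y \<in> D \<Longrightarrow> cball y (1 / Suc n) \<subseteq> G \<Longrightarrow>
      (LINT x|lebesgue. E x $ i $ j * mollifier (1 / Suc n) (y - x)) = (LINT x|lebesgue. E' x $ i $ j * mollifier (1 / Suc n) (y - x))"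
  shows "AE x in lborel. x \<in> G \<longrightarrow> E x = E' x"
proof -
  have "AE x in lborel. x \<in> G \<longrightarrow> E x $ i $ j - E' x $ i $ j = 0" for i j
  proof (rule fundamental_lemma_mollifier[OF G _ D])
    note c = loc_integrable_bounded_linear[OF bounded_linear_entry[of i j] E]
      loc_integrable_bounded_linear[OF bounded_linear_entry[of i j] E']
    show "loc_integrable G (\<lambda>x. E x $ i $ j - E' x $ i $ j)"
      by (intro loc_integrable_diff c)
    fix y n assume y: "y \<in> D" "cball y (1 / Suc n) \<subseteq> G"
    let ?w = "\<lambda>x. mollifier (1 / Suc n) (y - x)"
    have w: "?w \<in> C0_infty G" by (rule mollifier_test_function) (use y in auto)
    have "(LINT x|lebesgue. ?w x *\<^sub>R (E x $ i $ j) - ?w x *\<^sub>R (E' x $ i $ j)) = 0"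
      using eq[OF y, of i j]
      by (subst Bochner_Integration.integral_diff[OF c(1)[THEN loc_integrable_C0_infty[OF _ w]] c(2)[THEN loc_integrable_C0_infty[OF _ w]]])
         (simp add: mult.commute)
    then show "(LINT x|lebesgue. ?w x *\<^sub>R (E x $ i $ j - E' x $ i $ j)) = 0"
      by (simp add: right_diff_distrib)
  qed
  then have "AE x in lborel. \<forall>i j. x \<in> G \<longrightarrow> E x $ i $ j - E' x $ i $ j = 0"
    unfolding AE_all_countable by blast
  then show ?thesis by eventually_elim (auto simp: vec_eq_iff)
qed

lemma has_distr_sym_grad_unique:
  fixes E E' :: "'a::euclidean_space \<Rightarrow> real^'d::finite^'d"
  assumes "open G" "has_distr_sym_grad e G u E" "has_distr_sym_grad e G u E'"
  shows "AE x in lborel. x \<in> G \<longrightarrow> E x = E' x"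
proof (rule has_distr_sym_grad_unique_mollifier[OF assms(1) _ _ closure_UNIV])
  show "loc_integrable G E" "loc_integrable G E'" using assms by (auto simp: has_distr_sym_grad_def)
  fix y n i j assume "cball y (1 / Suc n) \<subseteq> G"
  then have w: "(\<lambda>x. mollifier (1 / Suc n) (y - x)) \<in> C0_infty G"
    by (intro mollifier_test_function) auto
  show "(LINT x|lebesgue. E x $ i $ j * mollifier (1 / Suc n) (y - x)) = (LINT x|lebesgue. E' x $ i $ j * mollifier (1 / Suc n) (y - x))"
    by (rule trans[OF has_distr_sym_gradD[OF assms(2) w] has_distr_sym_gradD[OF assms(3) w, symmetric]])
qed

lemma has_distr_sym_grad_distr_sym_grad:
  "has_distr_sym_grad e G u E \<Longrightarrow> has_distr_sym_grad e G u (distr_sym_grad e G u)"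
  unfolding distr_sym_grad_def by (rule someI[of "has_distr_sym_grad e G u"])

lemma distr_sym_grad_eq_AE:
  assumes "open G" "has_distr_sym_grad e G u E"
  shows "AE x in lborel. x \<in> G \<longrightarrow> distr_sym_grad e G u x = E x"
  by (rule has_distr_sym_grad_unique[OF assms(1) has_distr_sym_grad_distr_sym_grad assms(2)]) (rule assms)

section \<open>Luxemburg norms\<close>

lemma zero_ext_measurable:
  fixes f :: "'a::euclidean_space \<Rightarrow> 'b::euclidean_space"
  assumes "G \<in> sets lebesgue" "f \<in> borel_measurable (lebesgue_on G)"
  shows "zero_ext G f \<in> borel_measurable lebesgue"
  unfolding zero_ext_def[abs_def] using borel_measurable_if[OF assms(1), of f] assms(2) by simp

lemma modular_eq:
  assumes "G \<in> sets lebesgue"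
  shows "modular G p f = (\<integral>\<^sup>+ x. ennreal (norm (f x) powr p x) * indicator G x \<partial>lborel)"
proof -
  have "modular G p f = (\<integral>\<^sup>+ x. ennreal (norm (f x) powr p x) * indicator G x \<partial>lebesgue)"
    unfolding modular_def by (rule nn_integral_restrict_space) (use assms in simp)
  then show ?thesis by (simp add: nn_integral_completion)
qed

lemma modular_mono_AE:
  assumes "G \<in> sets lebesgue" "AE x in lborel. x \<in> G \<longrightarrow> norm (f x) powr p x \<le> norm (g x) powr p x"
  shows "modular G p f \<le> modular G p g"
  unfolding modular_eq[OF assms(1)]
proof (rule nn_integral_mono_AE)
  show "AE x in lborel. ennreal (norm (f x) powr p x) * indicator G x \<le> ennreal (norm (g x) powr p x) * indicator G x"
    using assms(2) by eventually_elim (auto simp: indicator_def ennreal_leI)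
qed

lemma lux_norm_le:
  "0 < l \<Longrightarrow> modular G p (\<lambda>x. f x /\<^sub>R l) \<le> 1 \<Longrightarrow> lux_norm G p f \<le> ennreal l"
  unfolding lux_norm_def by (rule Inf_lower) auto

text \<open>For exponents at least 1 the modular does not increase with the scale, so every scale
  above the infimum is admissible. The strict inequality avoids asking whether the infimum is
  attained.\<close>

lemma lux_norm_less:
  assumes G: "G \<in> sets lebesgue" and p: "\<And>x. x \<in> G \<Longrightarrow> 1 \<le> p x" and l: "lux_norm G p f < ennreal l"
  shows "modular G p (\<lambda>x. f x /\<^sub>R l) \<le> 1"
proof -
  obtain k where k: "0 < k" "modular G p (\<lambda>x. f x /\<^sub>R k) \<le> 1" "ennreal k < ennreal l"
    using l unfolding lux_norm_def Inf_less_iff by auto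
  have kl: "k \<le> l" using k by (simp add: ennreal_less_iff)
  have "modular G p (\<lambda>x. f x /\<^sub>R l) \<le> modular G p (\<lambda>x. f x /\<^sub>R k)"
  proof (rule modular_mono_AE[OF G], rule AE_I2, rule impI)
    fix x assume x: "x \<in> G"
    have "norm (f x) / l \<le> norm (f x) / k" using k kl by (intro divide_left_mono) auto
    then show "norm (f x /\<^sub>R l) powr p x \<le> norm (f x /\<^sub>R k) powr p x"
      using p[OF x] k kl by (intro powr_mono2) (auto simp: divide_inverse mult.commute)
  qed
  then show ?thesis using k(2) by (rule order_trans)
qed

lemma lux_norm_cong_AE:
  assumes G: "G \<in> sets lebesgue" and "AE x in lborel. x \<in> G \<longrightarrow> norm (f x) = norm (g x)"
  shows "lux_norm G p f = lux_norm G p g"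
proof -
  have "modular G p (\<lambda>x. f x /\<^sub>R l) = modular G p (\<lambda>x. g x /\<^sub>R l)" for l
    by (rule antisym; rule modular_mono_AE[OF G]) (use assms(2) in \<open>eventually_elim, simp\<close>)+
  then show ?thesis by (simp add: lux_norm_def)
qed

lemma ennreal_mult_InfI:
  assumes K: "0 < K" and le: "\<And>l. l \<in> S \<Longrightarrow> x \<le> ennreal K * l"
  shows "x \<le> ennreal K * Inf S"
proof -
  have "x / ennreal K \<le> Inf S"
    by (rule Inf_greatest, rule divide_le_posI_ennreal) (use K le in \<open>auto simp: mult.commute\<close>)
  then have "ennreal K * (x / ennreal K) \<le> ennreal K * Inf S" by (rule mult_left_mono) simp
  moreover have "ennreal K * (x / ennreal K) = x"
    using K by (simp add: ennreal_times_divide mult.commute[of "ennreal K"] ennreal_mult_divide_eq)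
  ultimately show ?thesis by simp
qed

text \<open>The passage from modulars to norms: by homogeneity it is enough to treat functions
  scaled to modular at most 1, where the averaging estimates hold.\<close>

lemma lux_norm_comparison:
  assumes K: "0 < K"
    and le: "\<And>l. 0 < l \<Longrightarrow> modular G p (\<lambda>x. f x /\<^sub>R l) \<le> 1 \<Longrightarrow> modular G' p' (\<lambda>x. g x /\<^sub>R (K * l)) \<le> 1"
  shows "lux_norm G' p' g \<le> ennreal K * lux_norm G p f"
  unfolding lux_norm_def[of G p f]
proof (rule ennreal_mult_InfI[OF K])
  fix l assume "l \<in> {ennreal l | l. 0 < l \<and> modular G p (\<lambda>x. f x /\<^sub>R l) \<le> 1}"
  then obtain k where k: "l = ennreal k" "0 < k" "modular G p (\<lambda>x. f x /\<^sub>R k) \<le> 1" by blast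
  then have "lux_norm G' p' g \<le> ennreal (K * k)" using K le by (intro lux_norm_le) auto
  then show "lux_norm G' p' g \<le> ennreal K * l" using K k by (simp add: ennreal_mult)
qed

text \<open>For m \<ge> 1 and p \<ge> 1 one has (1/m)^p \<le> 1/m, so enlarging the scale by m
  divides the modular by at least m.\<close>

lemma modular_scale_le:
  assumes f: "f \<in> borel_measurable (lebesgue_on G)" and pm: "p \<in> borel_measurable (lebesgue_on G)"
    and p: "\<And>x. x \<in> G \<Longrightarrow> 1 \<le> p x" and m: "1 \<le> m" and l: "0 < l"
    and le: "modular G p (\<lambda>x. f x /\<^sub>R l) \<le> ennreal m"
  shows "modular G p (\<lambda>x. f x /\<^sub>R (m * l)) \<le> 1"
proof -
  note [measurable] = f pm
  have "modular G p (\<lambda>x. f x /\<^sub>R (m * l)) \<le> (\<integral>\<^sup>+ x. ennreal (1 / m) * ennreal (norm (f x /\<^sub>R l) powr p x) \<partial>lebesgue_on G)"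
    unfolding modular_def
  proof (rule nn_integral_mono)
    fix x assume "x \<in> space (lebesgue_on G)"
    then have x: "x \<in> G" using assms by simp
    have "norm (f x /\<^sub>R (m * l)) = (1 / m) * norm (f x /\<^sub>R l)"
      using m l by (simp add: divide_inverse)
    then have "norm (f x /\<^sub>R (m * l)) powr p x = (1 / m) powr p x * norm (f x /\<^sub>R l) powr p x"
      using m l by (simp only: powr_mult[of "1 / m"])
    also have "\<dots> \<le> (1 / m) powr 1 * norm (f x /\<^sub>R l) powr p x"
      using m p[OF x] by (intro mult_right_mono powr_mono') auto
    finally show "ennreal (norm (f x /\<^sub>R (m * l)) powr p x) \<le> ennreal (1 / m) * ennreal (norm (f x /\<^sub>R l) powr p x)"
      using m by (simp add: ennreal_leI flip: ennreal_mult)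
  qed
  also have "\<dots> = ennreal (1 / m) * (\<integral>\<^sup>+ x. ennreal (norm (f x /\<^sub>R l) powr p x) \<partial>lebesgue_on G)"
    by (rule nn_integral_cmult) measurable
  also have "\<dots> \<le> ennreal (1 / m) * ennreal m"
    using le unfolding modular_def by (rule mult_left_mono) simp
  finally show ?thesis using m by (simp flip: ennreal_mult)
qed

lemma powr_le_max:
  assumes "1 \<le> p" "p \<le> P" "0 \<le> (x::real)"
  shows "x powr p \<le> max 1 x powr P"
  by (rule order_trans[OF powr_mono2[of p x "max 1 x"] powr_mono]) (use assms in auto)

text \<open>The upper bound P on the exponent makes a change of scale cost a finite factor; this
  lets modulars that tend to 0 force norms that tend to 0.\<close>

lemma modular_div_le:
  assumes f: "f \<in> borel_measurable (lebesgue_on G)" and pm: "p \<in> borel_measurable (lebesgue_on G)"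
    and p: "\<And>x. x \<in> G \<Longrightarrow> 1 \<le> p x" "\<And>x. x \<in> G \<Longrightarrow> p x \<le> P" and l: "0 < l"
  shows "modular G p (\<lambda>x. f x /\<^sub>R l) \<le> ennreal (max 1 (1 / l) powr P) * modular G p f"
proof -
  note [measurable] = f pm
  have "modular G p (\<lambda>x. f x /\<^sub>R l) \<le> (\<integral>\<^sup>+ x. ennreal (max 1 (1 / l) powr P) * ennreal (norm (f x) powr p x) \<partial>lebesgue_on G)"
    unfolding modular_def
  proof (rule nn_integral_mono)
    fix x assume "x \<in> space (lebesgue_on G)"
    then have x: "x \<in> G" by simp
    have "norm (f x /\<^sub>R l) = (1 / l) * norm (f x)" using l by (simp add: divide_inverse)
    then have "norm (f x /\<^sub>R l) powr p x = (1 / l) powr p x * norm (f x) powr p x"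
      using l by (simp only: powr_mult[of "1 / l"])
    also have "\<dots> \<le> max 1 (1 / l) powr P * norm (f x) powr p x"
      using l p[OF x] by (intro mult_right_mono powr_le_max) auto
    finally show "ennreal (norm (f x /\<^sub>R l) powr p x) \<le> ennreal (max 1 (1 / l) powr P) * ennreal (norm (f x) powr p x)"
      by (simp add: ennreal_leI flip: ennreal_mult)
  qed
  then show ?thesis unfolding modular_def by (subst (asm) nn_integral_cmult) auto
qed

lemma lux_norm_tendsto_0I:
  fixes f :: "'c \<Rightarrow> 'a::euclidean_space \<Rightarrow> 'b::real_normed_vector"
  assumes "\<And>l. 0 < l \<Longrightarrow> ((\<lambda>h. modular G p (\<lambda>x. f h x /\<^sub>R l)) \<longlongrightarrow> 0) F"
  shows "((\<lambda>h. lux_norm G p (f h)) \<longlongrightarrow> 0) F"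
  unfolding ennreal_tendsto_0_iff
proof (intro allI impI)
  fix e :: real assume e: "0 < e"
  have "\<forall>\<^sub>F h in F. modular G p (\<lambda>x. f h x /\<^sub>R e) < 1"
    using assms[OF e] by (auto simp: order_tendsto_iff)
  then show "\<forall>\<^sub>F h in F. lux_norm G p (f h) \<le> ennreal e"
    by eventually_elim (intro lux_norm_le e less_imp_le)
qed

lemma norm_div_scaleR: "0 < c \<Longrightarrow> norm (v /\<^sub>R c) = norm v / c"
  by (simp add: divide_inverse_commute)

text \<open>A crude triangle inequality is enough for limits. One factor 2 stems from |f + g| \<le>
  2 max(|f|, |g|), the other from the two modulars adding up to 2.\<close>

lemma lux_norm_add:
  assumes G: "G \<in> sets lebesgue" and f: "f \<in> borel_measurable (lebesgue_on G)" and g: "g \<in> borel_measurable (lebesgue_on G)"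
    and pm: "p \<in> borel_measurable (lebesgue_on G)" and p: "\<And>x. x \<in> G \<Longrightarrow> 1 \<le> p x"
    and a: "lux_norm G p f < ennreal a" "lux_norm G p g < ennreal a"
  shows "lux_norm G p (\<lambda>x. f x + g x :: 'b::euclidean_space) \<le> ennreal (4 * a)"
proof -
  note [measurable] = f g pm
  have a0: "0 < a" using a(1) by (cases "0 < a") (auto simp: ennreal_neg not_less)
  have "modular G p (\<lambda>x. (f x + g x) /\<^sub>R (2 * a)) \<le>
      (\<integral>\<^sup>+ x. ennreal (norm (f x /\<^sub>R a) powr p x) + ennreal (norm (g x /\<^sub>R a) powr p x) \<partial>lebesgue_on G)"
    unfolding modular_def
  proof (rule nn_integral_mono)
    fix x assume "x \<in> space (lebesgue_on G)"
    then have x: "x \<in> G" by simp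
    let ?m = "max (norm (f x /\<^sub>R a)) (norm (g x /\<^sub>R a))"
    have "norm (f x) / a \<le> ?m" "norm (g x) / a \<le> ?m"
      unfolding norm_div_scaleR[OF a0] by (rule max.cobounded1, rule max.cobounded2)
    then have "norm (f x) \<le> ?m * a" "norm (g x) \<le> ?m * a" unfolding pos_divide_le_eq[OF a0] by blast+
    then have "norm (f x + g x) \<le> ?m * (2 * a)" using norm_triangle_ineq[of "f x" "g x"] by linarith
    then have "norm ((f x + g x) /\<^sub>R (2 * a)) \<le> ?m"
      using a0 by (subst norm_div_scaleR) (simp_all only: pos_divide_le_eq mult_pos_pos zero_less_numeral)
    then have "norm ((f x + g x) /\<^sub>R (2 * a)) powr p x \<le> ?m powr p x"
      using p[OF x] by (intro powr_mono2) auto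
    also have "\<dots> \<le> norm (f x /\<^sub>R a) powr p x + norm (g x /\<^sub>R a) powr p x"
      by (cases "norm (f x /\<^sub>R a) \<le> norm (g x /\<^sub>R a)") (simp_all add: max_def)
    finally show "ennreal (norm ((f x + g x) /\<^sub>R (2 * a)) powr p x) \<le>
       ennreal (norm (f x /\<^sub>R a) powr p x) + ennreal (norm (g x /\<^sub>R a) powr p x)"
      by (simp add: ennreal_leI flip: ennreal_plus)
  qed
  also have "\<dots> = modular G p (\<lambda>x. f x /\<^sub>R a) + modular G p (\<lambda>x. g x /\<^sub>R a)"
    unfolding modular_def by (rule nn_integral_add) measurable
  also have "\<dots> \<le> 1 + 1"
    by (intro add_mono lux_norm_less[OF G p] a)
  finally have "modular G p (\<lambda>x. (f x + g x) /\<^sub>R (2 * a)) \<le> ennreal 2" by simp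
  then have "modular G p (\<lambda>x. (f x + g x) /\<^sub>R (2 * (2 * a))) \<le> 1"
    using a0 by (intro modular_scale_le[OF _ pm p]) auto
  then show ?thesis using a0 by (intro lux_norm_le) auto
qed

lemma lux_norm_tendsto_0_add:
  fixes f g :: "'c \<Rightarrow> 'a::euclidean_space \<Rightarrow> 'b::euclidean_space"
  assumes G: "G \<in> sets lebesgue" and fg: "\<forall>\<^sub>F h in F. f h \<in> borel_measurable (lebesgue_on G)" "\<forall>\<^sub>F h in F. g h \<in> borel_measurable (lebesgue_on G)"
    and pm: "p \<in> borel_measurable (lebesgue_on G)" and p: "\<And>x. x \<in> G \<Longrightarrow> 1 \<le> p x"
    and "((\<lambda>h. lux_norm G p (f h)) \<longlongrightarrow> 0) F" "((\<lambda>h. lux_norm G p (g h)) \<longlongrightarrow> 0) F"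
  shows "((\<lambda>h. lux_norm G p (\<lambda>x. f h x + g h x)) \<longlongrightarrow> 0) F"
  unfolding ennreal_tendsto_0_iff
proof (intro allI impI)
  fix e :: real assume e: "0 < e"
  then have e4: "0 < ennreal (e / 4)" by simp
  have "\<forall>\<^sub>F h in F. lux_norm G p (f h) < ennreal (e / 4)" "\<forall>\<^sub>F h in F. lux_norm G p (g h) < ennreal (e / 4)"
    using assms(6,7) e4 by (auto simp: order_tendsto_iff)
  with fg show "\<forall>\<^sub>F h in F. lux_norm G p (\<lambda>x. f h x + g h x) \<le> ennreal e"
  proof eventually_elim
    case (elim h)
    show ?case using lux_norm_add[OF G elim(1,2) pm p elim(3,4)] by simp
  qed
qed

text \<open>Absolute continuity of the norm, by dominated convergence in the modular. It serves for
  the tails {|f| > m} in the truncation and for the shrinking strips along the boundary.\<close>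

lemma lux_norm_restrict_tendsto_0:
  fixes f :: "'a::euclidean_space \<Rightarrow> 'b::euclidean_space"
  assumes G: "G \<in> sets lebesgue" and f: "f \<in> Lvar G p" and pm: "p \<in> borel_measurable (lebesgue_on G)"
    and p: "\<And>x. x \<in> G \<Longrightarrow> 1 \<le> p x" "\<And>x. x \<in> G \<Longrightarrow> p x \<le> P"
    and A: "\<And>n. A n \<in> sets lebesgue" "\<And>x. x \<in> G \<Longrightarrow> \<forall>\<^sub>F n in sequentially. x \<notin> A n"
  shows "(\<lambda>n. lux_norm G p (\<lambda>x. indicat_real (A n) x *\<^sub>R f x)) \<longlonglongrightarrow> 0"
proof (rule lux_norm_tendsto_0I)
  fix l :: real assume l: "0 < l"
  have [measurable]: "f \<in> borel_measurable (lebesgue_on G)" "p \<in> borel_measurable (lebesgue_on G)"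
    and fin: "modular G p f < \<infinity>" using f pm by (auto simp: Lvar_def)
  have [measurable]: "(\<lambda>x. indicat_real (A n) x) \<in> borel_measurable (lebesgue_on G)" for n
    using A(1)[of n] by (intro measurable_restrict_space1) simp
  let ?c = "ennreal (max 1 (1 / l) powr P)"
  have "(\<lambda>n. modular G p (\<lambda>x. indicat_real (A n) x *\<^sub>R f x)) \<longlonglongrightarrow> (\<integral>\<^sup>+ x. 0 \<partial>lebesgue_on G)"
    unfolding modular_def
  proof (rule nn_integral_dominated_convergence[where w="\<lambda>x. ennreal (norm (f x) powr p x)"])
    show "AE x in lebesgue_on G. ennreal (norm (indicat_real (A n) x *\<^sub>R f x) powr p x) \<le> ennreal (norm (f x) powr p x)" for n
      by (rule AE_I2) (auto simp: indicator_def)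
    show "(\<integral>\<^sup>+ x. ennreal (norm (f x) powr p x) \<partial>lebesgue_on G) < \<infinity>" using fin by (simp add: modular_def)
    show "AE x in lebesgue_on G. (\<lambda>n. ennreal (norm (indicat_real (A n) x *\<^sub>R f x) powr p x)) \<longlonglongrightarrow> 0"
    proof (rule AE_I2)
      fix x assume "x \<in> space (lebesgue_on G)"
      then have "\<forall>\<^sub>F n in sequentially. x \<notin> A n" using A(2) by simp
      then have "\<forall>\<^sub>F n in sequentially. ennreal (norm (indicat_real (A n) x *\<^sub>R f x) powr p x) = 0"
        by eventually_elim simp
      then show "(\<lambda>n. ennreal (norm (indicat_real (A n) x *\<^sub>R f x) powr p x)) \<longlonglongrightarrow> 0" by (rule tendsto_eventually)
    qed
  qed measurable
  then have "(\<lambda>n. ?c * modular G p (\<lambda>x. indicat_real (A n) x *\<^sub>R f x)) \<longlonglongrightarrow> ?c * 0"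
    by (intro ennreal_tendsto_cmult) auto
  then have c: "(\<lambda>n. ?c * modular G p (\<lambda>x. indicat_real (A n) x *\<^sub>R f x)) \<longlonglongrightarrow> 0" by simp
  have le: "modular G p (\<lambda>x. (indicat_real (A n) x *\<^sub>R f x) /\<^sub>R l) \<le> ?c * modular G p (\<lambda>x. indicat_real (A n) x *\<^sub>R f x)" for n
    by (rule modular_div_le[OF _ pm p l]) measurable
  show "(\<lambda>n. modular G p (\<lambda>x. (indicat_real (A n) x *\<^sub>R f x) /\<^sub>R l)) \<longlonglongrightarrow> 0"
    by (rule tendsto_sandwich[OF always_eventually always_eventually tendsto_const c]) (rule allI, rule zero_le, rule allI, rule le)
qed

section \<open>Averages over balls with variable exponents\<close>

lemma P_logD:
  assumes "q \<in> P_log G"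
  shows "q \<in> borel_measurable (lebesgue_on G)" "x \<in> G \<Longrightarrow> 1 \<le> q x"
    "\<exists>Q\<ge>1. \<forall>x\<in>G. q x \<le> Q"
    "\<exists>c>0. \<forall>x\<in>G. \<forall>y\<in>G. x \<noteq> y \<longrightarrow> \<bar>q x - q y\<bar> \<le> c / ln (exp 1 + 1 / norm (x - y))"
proof -
  show "q \<in> borel_measurable (lebesgue_on G)" "x \<in> G \<Longrightarrow> 1 \<le> q x"
    "\<exists>c>0. \<forall>x\<in>G. \<forall>y\<in>G. x \<noteq> y \<longrightarrow> \<bar>q x - q y\<bar> \<le> c / ln (exp 1 + 1 / norm (x - y))"
    using assms unfolding P_log_def by blast+
  have "bounded (q ` G)" using assms unfolding P_log_def by blast
  then obtain Q where "\<And>x. x \<in> G \<Longrightarrow> \<bar>q x\<bar> \<le> Q" by (auto simp: bounded_iff)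
  then show "\<exists>Q\<ge>1. \<forall>x\<in>G. q x \<le> Q" by (intro exI[of _ "max 1 Q"]) fastforce
qed

lemma ln_exp1_ge_1: "0 \<le> (t::real) \<Longrightarrow> 1 \<le> ln (exp 1 + t)"
  by (subst ln_exp[of 1, symmetric], subst ln_le_cancel_iff) (auto intro: add_pos_nonneg)

text \<open>Log-Hoelder continuity makes \<open>b powr q\<close> vary by a bounded factor over a ball of radius \<open>R\<close>,
  as long as \<open>b\<close> is at most of order \<open>1 + R^(-n)\<close>.\<close>

lemma log_hoelder_powr_bound:
  fixes x y :: "'a::euclidean_space"
  assumes c: "0 < c" and lh: "x \<noteq> y \<Longrightarrow> \<bar>s - t\<bar> \<le> c / ln (exp 1 + 1 / norm (x - y))"
    and st: "x = y \<Longrightarrow> s = t" and R: "dist x y < R" and w: "0 < w"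
    and b: "1 \<le> b" "b \<le> 1 + 1 / (w * R ^ n)"
  shows "b powr (s - t) \<le> exp (c * (ln (1 + 1 / w) + real n))"
proof -
  have R0: "0 < R" using R zero_le_dist[of x y] by linarith
  let ?L = "ln (exp 1 + 1 / R)"
  have L1: "1 \<le> ?L" using R0 by (intro ln_exp1_ge_1) simp
  \<comment> \<open>The log-Hoelder bound increases with the distance, so it may be evaluated at
    R.\<close>
  have d: "\<bar>s - t\<bar> \<le> c / ?L"
  proof (cases "x = y")
    case True
    then show ?thesis using st c L1 by simp
  next
    case False
    have "ln (exp 1 + 1 / R) \<le> ln (exp 1 + 1 / norm (x - y))"
      using R False R0 by (subst ln_le_cancel_iff) (auto simp: dist_norm frac_le add_pos_pos)
    then have "c / ln (exp 1 + 1 / norm (x - y)) \<le> c / ?L"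
      using c L1 by (intro divide_left_mono) auto
    then show ?thesis using lh[OF False] by linarith
  qed
  \<comment> \<open>Separating the factor (1 + 1/R)^n bounds ln b by a multiple of ln(e + 1/R),
    exactly the quantity by which the oscillation of the exponent is divided.\<close>
  have "1 / (w * R ^ n) = 1 / w * (1 / R) ^ n" by (simp add: power_one_over divide_inverse power_inverse)
  also have "1 + \<dots> \<le> (1 + 1 / w) * (1 + 1 / R) ^ n"
  proof -
    have "1 \<le> (1 + 1 / R) ^ n" "(1 / R) ^ n \<le> (1 + 1 / R) ^ n"
      using R0 by (auto intro!: one_le_power power_mono)
    then show ?thesis using w by (simp add: distrib_right add_mono mult_left_mono divide_right_mono)
  qed
  finally have b2: "b \<le> (1 + 1 / w) * (1 + 1 / R) ^ n" using b by linarith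
  have p1: "0 < 1 + 1 / w" "0 < 1 + 1 / R" using w R0 by (auto intro: add_pos_pos)
  have "ln b \<le> ln ((1 + 1 / w) * (1 + 1 / R) ^ n)"
    using b2 b p1 by (subst ln_le_cancel_iff) auto
  also have "\<dots> = ln (1 + 1 / w) + real n * ln (1 + 1 / R)"
    using p1 by (simp add: ln_mult ln_realpow)
  also have "\<dots> \<le> ln (1 + 1 / w) * ?L + real n * ?L"
  proof (intro add_mono mult_left_mono)
    have "0 \<le> ln (1 + 1 / w)" using w by simp
    then show "ln (1 + 1 / w) \<le> ln (1 + 1 / w) * ?L" using L1 mult_left_mono[of 1 ?L "ln (1 + 1/w)"] by simp
    have "(1::real) \<le> exp 1" using exp_ge_add_one_self[of "1::real"] by linarith
    then show "ln (1 + 1 / R) \<le> ?L" using R0 by (subst ln_le_cancel_iff) (auto intro!: add_pos_pos)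
  qed simp
  finally have lb: "ln b \<le> (ln (1 + 1 / w) + real n) * ?L" by (simp add: distrib_right)
  have lb0: "0 \<le> ln b" using b by simp
  have "(s - t) * ln b \<le> (c / ?L) * ((ln (1 + 1 / w) + real n) * ?L)"
    using d lb lb0 c L1 by (intro mult_mono) auto
  also have "\<dots> = c * (ln (1 + 1 / w) + real n)" using L1 by simp
  finally show ?thesis using b by (simp add: powr_def)
qed

lemma unit_ball_vol_gt_0: "0 < unit_ball_vol (real n)"
  by simp

text \<open>\<open>H\<close> is a measurable stand-in for g^q, and b is at most half the average of
  g over the ball. From g \<le> 1 + g^q and the integral bound on \<open>H\<close> one gets b \<le>
  1 + 1/|B|, so the exponent can be frozen at x. The part of the ball with g \<le> b contributes at
  most b |B|, half of the left side, and is absorbed; on the rest g is at most K b^(1 - q(x))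
  g^q.\<close>

lemma averaging_pointwise:
  fixes g :: "'a::euclidean_space \<Rightarrow> real" and H :: "'a \<Rightarrow> ennreal"
  assumes x: "x \<in> G" and c: "0 < c" and R: "0 < R"
    and lh: "\<And>y. y \<in> G \<Longrightarrow> x \<noteq> y \<Longrightarrow> \<bar>q x - q y\<bar> \<le> c / ln (exp 1 + 1 / norm (x - y))"
    and q: "\<And>y. y \<in> G \<Longrightarrow> 1 \<le> q y"
    and [measurable]: "g \<in> borel_measurable lebesgue" "H \<in> borel_measurable lebesgue"
    and g0: "\<And>y. 0 \<le> g y" "\<And>y. y \<notin> G \<Longrightarrow> g y = 0" and H: "\<And>y. y \<in> G \<Longrightarrow> H y = ennreal (g y powr q y)"
    and H1: "(\<integral>\<^sup>+ y. H y \<partial>lebesgue) \<le> 1"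
    and b: "1 \<le> b"
    and le: "ennreal (2 * b) * emeasure lebesgue (ball x R) \<le> (\<integral>\<^sup>+ y. ennreal (g y) * indicator (ball x R) y \<partial>lebesgue)"
  shows "ennreal (b powr q x) * emeasure lebesgue (ball x R) \<le>
     ennreal (exp (c * (ln (1 + 1 / unit_ball_vol (real DIM('a))) + real DIM('a)))) * (\<integral>\<^sup>+ y. H y * indicator (ball x R) y \<partial>lebesgue)"
proof -
  let ?w = "unit_ball_vol (real DIM('a))"
  let ?B = "ball x R"
  define K where "K = exp (c * (ln (1 + 1 / ?w) + real DIM('a)))"
  define V where "V = ?w * R ^ DIM('a)"
  have w: "0 < ?w" by (rule unit_ball_vol_gt_0)
  have V: "0 < V" using R w by (simp add: V_def)
  have eV: "emeasure lebesgue ?B = ennreal V" using R by (simp add: emeasure_ball V_def)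
  have [measurable]: "?B \<in> sets lebesgue" by simp
  have JH: "(\<integral>\<^sup>+ y. H y * indicator ?B y \<partial>lebesgue) \<le> 1"
    by (rule order_trans[OF nn_integral_mono H1]) (auto simp: indicator_def)
  then obtain j where j: "(\<integral>\<^sup>+ y. H y * indicator ?B y \<partial>lebesgue) = ennreal j" "0 \<le> j" "j \<le> 1"
    by (cases "\<integral>\<^sup>+ y. H y * indicator ?B y \<partial>lebesgue") (auto simp: top_unique)
  have gH: "ennreal (g y) \<le> 1 + H y" for y
  proof (cases "y \<in> G \<and> 1 < g y")
    case True
    then have "g y powr 1 \<le> g y powr q y" using q[of y] by (intro powr_mono) auto
    then have "ennreal (g y) \<le> H y" using True g0(1)[of y] H[of y] by (auto intro: ennreal_leI)
    then show ?thesis by (rule order_trans) simp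
  next
    case False
    then have "g y \<le> 1" using g0(2)[of y] by auto
    then have "ennreal (g y) \<le> 1" by simp
    then show ?thesis by (rule order_trans) simp
  qed
  have "ennreal (2 * b) * ennreal V \<le> (\<integral>\<^sup>+ y. indicator ?B y + H y * indicator ?B y \<partial>lebesgue)"
    unfolding eV[symmetric] by (rule order_trans[OF le nn_integral_mono]) (auto simp: indicator_def gH)
  also have "\<dots> = ennreal V + ennreal j"
    by (subst nn_integral_add) (auto simp: j eV)
  finally have "ennreal (2 * b * V) \<le> ennreal (V + j)"
    using b V j by (simp add: ennreal_mult ennreal_plus)
  then have "2 * b * V \<le> V + j" using V j by (subst (asm) ennreal_le_iff) auto
  then have "2 * b * V \<le> V + 1" using j by simp
  then have "2 * b \<le> (V + 1) / V" using V by (simp add: le_divide_eq)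
  then have b2: "b \<le> 1 + 1 / (?w * R ^ DIM('a))"
    using V b by (simp add: V_def[symmetric] add_divide_distrib)
  have bK: "b powr (q x - q y) \<le> K" if "y \<in> G" "dist x y < R" for y
    unfolding K_def by (rule log_hoelder_powr_bound[OF c lh[OF that(1)] _ that(2) w b b2]) auto
  define d where "d = b powr (1 - q x) * K"
  have d0: "0 \<le> d" by (simp add: d_def K_def)
  have gd: "ennreal (g y) * indicator ?B y \<le> ennreal b * indicator ?B y + ennreal d * (H y * indicator ?B y)" for y
  proof (cases "y \<in> ?B \<and> y \<in> G \<and> b < g y")
    case True
    \<comment> \<open>The exponent 1 - q y is at most 0, so g y > b allows the second factor to be
      replaced by a power of b; replacing q y by q x in it then costs the factor K.\<close>
    have "g y = g y powr q y * g y powr (1 - q y)" using True b by (simp flip: powr_add)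
    also have "\<dots> \<le> g y powr q y * b powr (1 - q y)"
      using True b q[of y] by (intro mult_left_mono powr_mono2') auto
    also have "b powr (1 - q y) = b powr (1 - q x) * b powr (q x - q y)" using b by (simp flip: powr_add)
    also have "g y powr q y * \<dots> \<le> g y powr q y * d"
      unfolding d_def using True by (intro mult_left_mono bK) auto
    finally have "ennreal (g y) \<le> ennreal (d * g y powr q y)" by (intro ennreal_leI) (simp add: mult.commute)
    then have "ennreal (g y) \<le> ennreal d * H y" using True H[of y] d0 by (simp add: ennreal_mult)
    then show ?thesis using True by (auto intro: order_trans)
  next
    case False
    then have "y \<in> ?B \<Longrightarrow> g y \<le> b" using g0(2)[of y] b by force
    then show ?thesis by (auto simp: indicator_def intro: order_trans[OF ennreal_leI])
  qed
  have "ennreal (2 * b) * ennreal V \<le> (\<integral>\<^sup>+ y. ennreal b * indicator ?B y + ennreal d * (H y * indicator ?B y) \<partial>lebesgue)"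
    unfolding eV[symmetric] by (rule order_trans[OF le nn_integral_mono]) (rule gd)
  also have "\<dots> = ennreal b * ennreal V + ennreal d * ennreal j"
    by (subst nn_integral_add) (auto simp: j eV nn_integral_cmult)
  finally have "ennreal (2 * b * V) \<le> ennreal (b * V + d * j)"
    using b V j d0 by (simp add: ennreal_mult ennreal_plus)
  then have "2 * b * V \<le> b * V + d * j" using V j b d0 by (subst (asm) ennreal_le_iff) auto
  then have "b * V \<le> d * j" by (simp add: algebra_simps)
  then have "b powr (q x - 1) * (b * V) \<le> b powr (q x - 1) * (d * j)" by (rule mult_left_mono) simp
  moreover have "b powr (q x - 1) * (b * V) = b powr q x * V"
    using b by (simp add: powr_diff)
  moreover have "b powr (q x - 1) * (d * j) = K * j"
  proof -
    have "b powr (q x - 1) * b powr (1 - q x) = 1" using b by (simp flip: powr_add)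
    then show ?thesis by (simp add: d_def mult.assoc[symmetric])
  qed
  ultimately have "ennreal (b powr q x * V) \<le> ennreal (K * j)" by (intro ennreal_leI) simp
  then show ?thesis using V j by (simp add: eV j K_def ennreal_mult)
qed

section \<open>Averages over balls in the Luxemburg norm, uniformly in the radius\<close>

lemma zero_ext_scaleR: "zero_ext G (\<lambda>x. a *\<^sub>R f x) = (\<lambda>x. a *\<^sub>R (zero_ext G f x :: 'b::real_vector))"
  by (auto simp: zero_ext_def)

lemma bounded_measure_finite:
  fixes G :: "'a::euclidean_space set"
  assumes "G \<in> sets lebesgue" "bounded G"
  shows "emeasure lebesgue G = ennreal (measure lebesgue G)"
proof -
  have "G \<in> lmeasurable" using assms by (rule bounded_set_imp_lmeasurable[rotated])
  then show ?thesis by (simp add: emeasure_eq_measure2 fmeasurableD2 emeasure_eq_ennreal_measure)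
qed

lemma nn_integral_ball_average:
  fixes H :: "'a::euclidean_space \<Rightarrow> ennreal"
  assumes [measurable]: "H \<in> borel_measurable borel" and R: "0 < R"
  shows "(\<integral>\<^sup>+x. (\<integral>\<^sup>+y. H y * indicator (ball x R) y \<partial>lborel) \<partial>lborel)
    = ennreal (unit_ball_vol (real DIM('a)) * R ^ DIM('a)) * (\<integral>\<^sup>+y. H y \<partial>lborel)"
proof -
  have i: "indicator (ball x R) y = (if norm (x - y) < R then 1 else 0 :: ennreal)" for x y :: 'a
    by (auto simp: indicator_def dist_norm)
  have i2: "indicator (ball y R) x = (if norm (x - y) < R then 1 else 0 :: ennreal)" for x y :: 'a
    by (auto simp: indicator_def dist_norm norm_minus_commute)
  have "(\<integral>\<^sup>+x. (\<integral>\<^sup>+y. H y * indicator (ball x R) y \<partial>lborel) \<partial>lborel)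
      = (\<integral>\<^sup>+y. (\<integral>\<^sup>+x. H y * (if norm (x - y) < R then 1 else 0) \<partial>lborel) \<partial>lborel)"
    unfolding i by (rule lborel_pair.Fubini') measurable
  also have "\<dots> = (\<integral>\<^sup>+y. H y * emeasure lborel (ball y R) \<partial>lborel)"
    unfolding i2[symmetric] by (intro nn_integral_cong nn_integral_cmult_indicator) simp
  also have "\<dots> = (\<integral>\<^sup>+y. ennreal (unit_ball_vol (real DIM('a)) * R ^ DIM('a)) * H y \<partial>lborel)"
    using R by (simp add: emeasure_ball mult.commute)
  finally show ?thesis by (simp add: nn_integral_cmult)
qed

text \<open>Where b < 1, b^q \<le> 1 contributes at most the measure of G. Elsewhere the pointwise
  bound holds, and Fubini turns the integral over x of the integrals over balls into the volume of
  one ball times a modular at most 1; that volume cancels, so the bound is free of R.\<close>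

lemma averaging_modular:
  fixes f :: "'a::euclidean_space \<Rightarrow> 'b::euclidean_space" and b :: "'a \<Rightarrow> real"
  assumes G: "G \<in> sets lebesgue" "bounded G" and c: "0 < c"
    and lh: "\<And>x y. x \<in> G \<Longrightarrow> y \<in> G \<Longrightarrow> x \<noteq> y \<Longrightarrow> \<bar>q x - q y\<bar> \<le> c / ln (exp 1 + 1 / norm (x - y))"
    and q: "\<And>y. y \<in> G \<Longrightarrow> 1 \<le> q y" and qm: "q \<in> borel_measurable (lebesgue_on G)"
    and R: "0 < R" and f: "f \<in> borel_measurable (lebesgue_on G)" and f1: "modular G q f \<le> 1"
    and b0: "\<And>x. 0 \<le> b x" and b: "\<And>x. x \<in> G \<Longrightarrow> ennreal (2 * b x) \<le> ball_avg (zero_ext G f) x R"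
  shows "(\<integral>\<^sup>+x. ennreal (b x powr q x) * indicator G x \<partial>lborel)
    \<le> ennreal (measure lebesgue G + exp (c * (ln (1 + 1 / unit_ball_vol (real DIM('a))) + real DIM('a))))"
proof -
  let ?K = "exp (c * (ln (1 + 1 / unit_ball_vol (real DIM('a))) + real DIM('a)))"
  define V where "V = unit_ball_vol (real DIM('a)) * R ^ DIM('a)"
  have V: "0 < V" using R by (simp add: V_def)
  have eV: "emeasure lborel (ball x R) = ennreal V" for x :: 'a using R by (simp add: emeasure_ball V_def)
  let ?F = "zero_ext G f"
  define H where "H y = ennreal (zero_ext G (\<lambda>x. norm (f x) powr q x) y)" for y
  note [measurable] = f qm
  have Fm: "?F \<in> borel_measurable lebesgue" by (rule zero_ext_measurable[OF G(1) f])
  have "zero_ext G (\<lambda>x. norm (f x) powr q x) \<in> borel_measurable lebesgue"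
    by (rule zero_ext_measurable[OF G(1)]) measurable
  then have Hm: "H \<in> borel_measurable lebesgue" unfolding H_def[abs_def] by measurable
  have H1: "(\<integral>\<^sup>+y. H y \<partial>lebesgue) \<le> 1"
  proof -
    have "(\<integral>\<^sup>+y. H y \<partial>lebesgue) = modular G q f"
      unfolding modular_eq[OF G(1)] H_def
      by (simp add: nn_integral_completion) (rule nn_integral_cong, simp add: zero_ext_def)
    then show ?thesis using f1 by simp
  qed
  \<comment> \<open>Exchanging the order of integration calls for a Borel version of
    \<open>H\<close>.\<close>
  obtain H' where H'm [measurable]: "H' \<in> borel_measurable borel" and H': "AE y in lborel. H y = H' y"
    using completion_ex_borel_measurable[OF Hm] by auto
  have H'1: "(\<integral>\<^sup>+y. H' y \<partial>lborel) \<le> 1"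
    using H1 nn_integral_cong_AE[OF H'] by (simp add: nn_integral_completion)
  have pt: "ennreal (b x powr q x) \<le> 1 + ennreal (?K / V) * (\<integral>\<^sup>+y. H' y * indicator (ball x R) y \<partial>lborel)" if x: "x \<in> G" for x
  proof (cases "1 \<le> b x")
    case False
    then have "b x powr q x \<le> 1 powr q x" using b0[of x] q[OF x] by (intro powr_mono2) auto
    then have "ennreal (b x powr q x) \<le> 1" by simp
    then show ?thesis by (rule order_trans) simp
  next
    case True
    have "ennreal (b x powr q x) * emeasure lebesgue (ball x R) \<le> ennreal ?K * (\<integral>\<^sup>+ y. H y * indicator (ball x R) y \<partial>lebesgue)"
    proof (rule averaging_pointwise[OF x c R lh[OF x] q _ Hm _ _ _ H1 True, where g="\<lambda>y. norm (?F y)"])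
      show "(\<lambda>y. norm (?F y)) \<in> borel_measurable lebesgue" using Fm by measurable
      have "ennreal (2 * b x) * emeasure lebesgue (ball x R) \<le> ball_avg ?F x R * emeasure lebesgue (ball x R)"
        by (rule mult_right_mono[OF b[OF x]]) simp
      also have "\<dots> = (\<integral>\<^sup>+ y. ennreal (norm (?F y)) * indicator (ball x R) y \<partial>lebesgue)"
        using ball_avg_times_measure[OF R, of ?F x] by (simp add: nn_integral_completion)
      finally show "ennreal (2 * b x) * emeasure lebesgue (ball x R) \<le> \<dots>" .
    qed (auto simp: zero_ext_def H_def)
    also have "(\<integral>\<^sup>+ y. H y * indicator (ball x R) y \<partial>lebesgue) = (\<integral>\<^sup>+ y. H' y * indicator (ball x R) y \<partial>lborel)"
      unfolding nn_integral_completion by (rule nn_integral_cong_AE) (use H' in auto)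
    finally have "ennreal (1 / V) * (ennreal (b x powr q x) * ennreal V) \<le>
        ennreal (1 / V) * (ennreal ?K * (\<integral>\<^sup>+ y. H' y * indicator (ball x R) y \<partial>lborel))"
      by (intro mult_left_mono) (auto simp: eV)
    moreover have "ennreal (1 / V) * (ennreal (b x powr q x) * ennreal V) = ennreal (b x powr q x)"
      using V by (simp flip: ennreal_mult)
    moreover have "ennreal (1 / V) * (ennreal ?K * J) = ennreal (?K / V) * J" for J
      using V by (simp add: mult.assoc[symmetric] flip: ennreal_mult)
    ultimately have "ennreal (b x powr q x) \<le> ennreal (?K / V) * (\<integral>\<^sup>+ y. H' y * indicator (ball x R) y \<partial>lborel)"
      by simp
    then show ?thesis by (rule order_trans) simp
  qed
  have [measurable]: "(\<lambda>x. \<integral>\<^sup>+y. H' y * indicator (ball x R) y \<partial>lborel) \<in> borel_measurable borel"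
  proof -
    have i: "indicator (ball x R) y = (if norm (x - y) < R then 1 else 0 :: ennreal)" for x y :: 'a
      by (auto simp: indicator_def dist_norm)
    show ?thesis unfolding i by measurable
  qed
  have "(\<integral>\<^sup>+x. ennreal (b x powr q x) * indicator G x \<partial>lebesgue) \<le>
     (\<integral>\<^sup>+x. indicator G x + ennreal (?K / V) * (\<integral>\<^sup>+y. H' y * indicator (ball x R) y \<partial>lborel) \<partial>lebesgue)"
    by (rule nn_integral_mono) (use pt in \<open>auto simp: indicator_def\<close>)
  also have "\<dots> = (\<integral>\<^sup>+x. indicator G x \<partial>lebesgue) + (\<integral>\<^sup>+x. ennreal (?K / V) * (\<integral>\<^sup>+y. H' y * indicator (ball x R) y \<partial>lborel) \<partial>lebesgue)"
    by (rule nn_integral_add) (use G(1) in \<open>auto intro!: measurable_completion\<close>)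
  also have "(\<integral>\<^sup>+x. indicator G x \<partial>lebesgue) = emeasure lebesgue G"
    using G(1) by (rule nn_integral_indicator)
  also have "(\<integral>\<^sup>+x. ennreal (?K / V) * (\<integral>\<^sup>+y. H' y * indicator (ball x R) y \<partial>lborel) \<partial>lebesgue)
     = (\<integral>\<^sup>+x. ennreal (?K / V) * (\<integral>\<^sup>+y. H' y * indicator (ball x R) y \<partial>lborel) \<partial>lborel)"
    by (rule nn_integral_completion)
  also have "(\<integral>\<^sup>+x. ennreal (?K / V) * (\<integral>\<^sup>+y. H' y * indicator (ball x R) y \<partial>lborel) \<partial>lborel)
     = ennreal (?K / V) * (ennreal V * (\<integral>\<^sup>+y. H' y \<partial>lborel))"
    by (subst nn_integral_cmult) (auto simp: nn_integral_ball_average[OF H'm R] V_def)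
  also have "\<dots> \<le> ennreal (?K / V) * (ennreal V * 1)"
    by (intro mult_left_mono H'1) auto
  also have "\<dots> = ennreal ?K" using V by (simp flip: ennreal_mult)
  finally show ?thesis
    by (simp add: nn_integral_completion bounded_measure_finite[OF G] ennreal_plus add_left_mono)
qed

text \<open>\<open>K\<close> depends on G and q only and serves all radii. In
  \<open>K = 2 * m\<close> the 2 makes up for \<open>averaging_modular\<close> bounding half the
  average, and m is the modular bound obtained there, brought down to 1 by enlarging the
  scale.\<close>

lemma averaging_lux_norm:
  assumes G: "G \<in> sets lebesgue" "bounded G" and q: "q \<in> P_log G"
  obtains K where "0 < K" "\<And>R C (f :: 'a::euclidean_space \<Rightarrow> 'b::euclidean_space) (g :: 'a \<Rightarrow> 'c::euclidean_space).
     0 < R \<Longrightarrow> 0 < C \<Longrightarrow> f \<in> borel_measurable (lebesgue_on G) \<Longrightarrow> g \<in> borel_measurable (lebesgue_on G) \<Longrightarrow>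
     \<forall>x\<in>G. ennreal (norm (g x)) \<le> ennreal C * ball_avg (zero_ext G f) x R \<Longrightarrow>
     lux_norm G q g \<le> ennreal (C * K) * lux_norm G q f"
proof -
  obtain c where c: "0 < c" "\<And>x y. x \<in> G \<Longrightarrow> y \<in> G \<Longrightarrow> x \<noteq> y \<Longrightarrow> \<bar>q x - q y\<bar> \<le> c / ln (exp 1 + 1 / norm (x - y))"
    using P_logD(4)[OF q] by blast
  define m where "m = measure lebesgue G + exp (c * (ln (1 + 1 / unit_ball_vol (real DIM('a))) + real DIM('a)))"
  have w: "0 \<le> ln (1 + 1 / unit_ball_vol (real DIM('a)))" by (rule ln_ge_zero) simp
  have "1 \<le> exp (c * (ln (1 + 1 / unit_ball_vol (real DIM('a))) + real DIM('a)))"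
    using c w by (subst one_le_exp_iff) (intro mult_nonneg_nonneg add_nonneg_nonneg, auto)
  then have m: "1 \<le> m" unfolding m_def using measure_nonneg[of lebesgue G] by linarith
  show ?thesis
  proof (rule that[of "2 * m"])
    fix R C :: real and f :: "'a \<Rightarrow> 'b" and g :: "'a \<Rightarrow> 'c"
    assume R: "0 < R" and C: "0 < C" and f: "f \<in> borel_measurable (lebesgue_on G)" and g: "g \<in> borel_measurable (lebesgue_on G)"
      and le: "\<forall>x\<in>G. ennreal (norm (g x)) \<le> ennreal C * ball_avg (zero_ext G f) x R"
    show "lux_norm G q g \<le> ennreal (C * (2 * m)) * lux_norm G q f"
    proof (rule lux_norm_comparison)
      fix l :: real assume l: "0 < l" and f1: "modular G q (\<lambda>x. f x /\<^sub>R l) \<le> 1"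
      have "(\<integral>\<^sup>+x. ennreal ((norm (g x) / (2 * C * l)) powr q x) * indicator G x \<partial>lborel) \<le> ennreal m"
        unfolding m_def
      proof (rule averaging_modular[OF G c P_logD(2)[OF q] P_logD(1)[OF q] R _ f1])
        show "(\<lambda>x. f x /\<^sub>R l) \<in> borel_measurable (lebesgue_on G)" using f by measurable
        show "0 \<le> norm (g x) / (2 * C * l)" for x using C l by simp
        fix x assume x: "x \<in> G"
        have sc: "ball_avg (zero_ext G (\<lambda>x. f x /\<^sub>R l)) x R = ennreal (1 / l) * ball_avg (zero_ext G f) x R"
        proof -
          have [measurable]: "zero_ext G f \<in> borel_measurable lebesgue" by (rule zero_ext_measurable[OF G(1) f])
          have e: "ennreal (norm (zero_ext G f y /\<^sub>R l)) = ennreal (1 / l) * ennreal (norm (zero_ext G f y))" for y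
            using l by (simp add: divide_inverse flip: ennreal_mult)
          have "(\<lambda>y. ennreal (norm (zero_ext G f y))) \<in> borel_measurable (lebesgue_on (ball x R))"
            by (intro measurable_restrict_space1) measurable
          then show ?thesis unfolding ball_avg_def zero_ext_scaleR e
            by (subst nn_integral_cmult) (auto simp: ennreal_times_divide)
        qed
        have "ennreal (2 * (norm (g x) / (2 * C * l))) = ennreal (1 / (C * l)) * ennreal (norm (g x))"
          using C l by (simp flip: ennreal_mult)
        also have "\<dots> \<le> ennreal (1 / (C * l)) * (ennreal C * ball_avg (zero_ext G f) x R)"
          using le x by (intro mult_left_mono) auto
        also have "\<dots> = ball_avg (zero_ext G (\<lambda>x. f x /\<^sub>R l)) x R"
          unfolding sc using C l by (simp add: mult.assoc[symmetric] flip: ennreal_mult)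
        finally show "ennreal (2 * (norm (g x) / (2 * C * l))) \<le> \<dots>" .
      qed auto
      then have "modular G q (\<lambda>x. g x /\<^sub>R (2 * C * l)) \<le> ennreal m"
        using C l by (simp only: modular_eq[OF G(1)] norm_div_scaleR mult_pos_pos zero_less_numeral)
      then have "modular G q (\<lambda>x. g x /\<^sub>R (m * (2 * C * l))) \<le> 1"
        using C l m by (intro modular_scale_le[OF g P_logD(1)[OF q] P_logD(2)[OF q]]) auto
      then show "modular G q (\<lambda>x. g x /\<^sub>R (C * (2 * m) * l)) \<le> 1"
        by (simp add: mult_ac)
    qed (use C m in auto)
  qed (use m in auto)
qed

text \<open>The mollifier is at most C h^(-n) and supported in the ball of radius h, whose volume is
  of order h^n.\<close>

lemma mollify_le_ball_avg:
  obtains C where "0 < C" "\<And>h (f :: 'a::euclidean_space \<Rightarrow> 'b::euclidean_space) z. 0 < h \<Longrightarrow> f \<in> borel_measurable lebesgue \<Longrightarrow>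
     (\<integral>\<^sup>+y. ennreal (mollifier h (z - y)) * ennreal (norm (f y)) \<partial>lborel) \<le> ennreal C * ball_avg f z h"
proof -
  obtain C where C: "0 < C" "\<And>h x. 0 < h \<Longrightarrow> mollifier h (x::'a) \<le> C / h ^ DIM('a)"
    by (rule mollifier_bounds) blast
  let ?w = "unit_ball_vol (real DIM('a))"
  show ?thesis
  proof (rule that[of "C * ?w"])
    fix h :: real and f :: "'a \<Rightarrow> 'b" and z assume h: "0 < h" and [measurable]: "f \<in> borel_measurable lebesgue"
    have "(\<integral>\<^sup>+y. ennreal (mollifier h (z - y)) * ennreal (norm (f y)) \<partial>lebesgue) \<le>
        (\<integral>\<^sup>+y. ennreal (C / h ^ DIM('a)) * (ennreal (norm (f y)) * indicator (ball z h) y) \<partial>lebesgue)"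
    proof (rule nn_integral_mono)
      fix y show "ennreal (mollifier h (z - y)) * ennreal (norm (f y)) \<le> ennreal (C / h ^ DIM('a)) * (ennreal (norm (f y)) * indicator (ball z h) y)"
        using mollifier_support[OF h, of "z - y"] C(2)[OF h, of "z - y"]
        by (cases "norm (z - y) < h") (auto simp: dist_norm intro!: mult_right_mono ennreal_leI)
    qed
    also have "\<dots> = ennreal (C / h ^ DIM('a)) * (\<integral>\<^sup>+y. (ennreal (norm (f y)) * indicator (ball z h) y) \<partial>lebesgue)"
    proof (rule nn_integral_cmult)
      have [measurable]: "ball z h \<in> sets lebesgue" by simp
      show "(\<lambda>y. ennreal (norm (f y)) * indicator (ball z h) y) \<in> borel_measurable lebesgue" by measurable
    qed
    also have "\<dots> = ennreal (C / h ^ DIM('a)) * (ball_avg f z h * ennreal (?w * h ^ DIM('a)))"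
      using h ball_avg_times_measure[OF h, of f z] by (simp add: nn_integral_completion emeasure_ball)
    also have "\<dots> = ennreal (C * ?w) * ball_avg f z h"
    proof -
      have "ennreal (C / h ^ DIM('a)) * ennreal (?w * h ^ DIM('a)) = ennreal (C * ?w)"
        using h C by (simp flip: ennreal_mult)
      then show ?thesis by (metis mult.assoc mult.commute)
    qed
    finally show "(\<integral>\<^sup>+y. ennreal (mollifier h (z - y)) * ennreal (norm (f y)) \<partial>lborel) \<le> ennreal (C * ?w) * ball_avg f z h"
      by (simp add: nn_integral_completion)
  qed (use C in auto)
qed

text \<open>From t \<le> 1 + t^q for q \<ge> 1; the constant 1 is integrable over the bounded set
  G.\<close>

lemma Lvar_integrable:
  fixes f :: "'a::euclidean_space \<Rightarrow> 'b::euclidean_space"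
  assumes G: "G \<in> sets lebesgue" "bounded G" and f: "f \<in> Lvar G q" and q: "\<And>x. x \<in> G \<Longrightarrow> 1 \<le> q x"
    and qm: "q \<in> borel_measurable (lebesgue_on G)"
  shows "integrable lebesgue (zero_ext G f)"
    "(\<integral>\<^sup>+x. ennreal (norm (zero_ext G f x)) \<partial>lborel) \<le> emeasure lebesgue G + modular G q f"
proof -
  have fm [measurable]: "f \<in> borel_measurable (lebesgue_on G)" and fin: "modular G q f < \<infinity>" using f by (auto simp: Lvar_def)
  note [measurable] = qm
  have "zero_ext G (\<lambda>x. norm (f x) powr q x) \<in> borel_measurable lebesgue"
    by (rule zero_ext_measurable[OF G(1)]) measurable
  note [measurable] = this G(1)
  have "(\<integral>\<^sup>+x. ennreal (norm (zero_ext G f x)) \<partial>lebesgue) \<le> (\<integral>\<^sup>+x. indicator G x + ennreal (zero_ext G (\<lambda>x. norm (f x) powr q x) x) \<partial>lebesgue)"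
  proof (rule nn_integral_mono)
    fix x
    show "ennreal (norm (zero_ext G f x)) \<le> indicator G x + ennreal (zero_ext G (\<lambda>x. norm (f x) powr q x) x)"
    proof (cases "x \<in> G")
      case True
      have "norm (f x) \<le> 1 + norm (f x) powr q x"
      proof (cases "1 \<le> norm (f x)")
        case 1: True
        have "norm (f x) powr 1 \<le> norm (f x) powr q x" using 1 q[OF True] by (intro powr_mono) auto
        then show ?thesis using 1 by simp
      next
        case False
        moreover have "0 \<le> norm (f x) powr q x" by simp
        ultimately show ?thesis by linarith
      qed
      then have "ennreal (norm (f x)) \<le> ennreal (1 + norm (f x) powr q x)" by (rule ennreal_leI)
      then show ?thesis using True by (simp add: zero_ext_def ennreal_plus)
    qed (simp add: zero_ext_def)
  qed
  also have "\<dots> = emeasure lebesgue G + (\<integral>\<^sup>+x. ennreal (zero_ext G (\<lambda>x. norm (f x) powr q x) x) \<partial>lebesgue)"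
    by (subst nn_integral_add) auto
  also have "(\<integral>\<^sup>+x. ennreal (zero_ext G (\<lambda>x. norm (f x) powr q x) x) \<partial>lebesgue) = modular G q f"
    unfolding modular_eq[OF G(1)] nn_integral_completion by (rule nn_integral_cong) (simp add: zero_ext_def)
  finally show le: "(\<integral>\<^sup>+x. ennreal (norm (zero_ext G f x)) \<partial>lborel) \<le> emeasure lebesgue G + modular G q f"
    by (simp add: nn_integral_completion)
  also have "\<dots> < \<infinity>" using fin by (simp add: bounded_measure_finite[OF G])
  finally show "integrable lebesgue (zero_ext G f)"
    unfolding integrable_lebesgue_nn_integral using zero_ext_measurable[OF G(1) fm] by auto
qed


section \<open>Boundedness and convergence of cutoff followed by mollification\<close>

lemma convolve_norm_le_bound:
  fixes f :: "'a::euclidean_space \<Rightarrow> 'b::euclidean_space"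
  assumes h: "0 < h" and B: "\<And>y. norm (f y) \<le> B"
  shows "norm (convolve (mollifier h) f z) \<le> B"
proof -
  have B0: "0 \<le> B" using B[of 0] norm_ge_zero order_trans by blast
  have "ennreal (norm (convolve (mollifier h) f z)) \<le> (\<integral>\<^sup>+y. ennreal \<bar>mollifier h (z - y)\<bar> * ennreal (norm (f y)) \<partial>lborel)"
    by (rule convolve_norm_le)
  also have "\<dots> \<le> (\<integral>\<^sup>+y. ennreal (mollifier h (z - y)) * ennreal B \<partial>lborel)"
    by (intro nn_integral_mono) (auto simp: mollifier_nonneg h B ennreal_leI intro!: mult_left_mono)
  also have "\<dots> = ennreal B"
    by (subst nn_integral_multc) (auto simp: nn_integral_mollifier_reflect h)
  finally show ?thesis using B0 by simp
qed

text \<open>The error splits into the mollification of k f - f, small because mollification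
  contracts L^1 and k f tends to f by dominated convergence, and the mollification error of the
  fixed function f.\<close>

lemma cutoff_mollify_L1_seq:
  fixes f :: "'a::euclidean_space \<Rightarrow> 'b::euclidean_space"
  assumes f: "integrable lebesgue f" and X: "\<And>n. 0 < X n" "X \<longlonglongrightarrow> (0::real)"
    and k: "\<And>n. k n \<in> borel_measurable lebesgue" "\<And>n z. 0 \<le> k n z" "\<And>n z. k n z \<le> 1"
    and kl: "AE z in lborel. f z \<noteq> 0 \<longrightarrow> (\<lambda>n. k n z) \<longlonglongrightarrow> (1::real)"
  shows "(\<lambda>n. \<integral>\<^sup>+z. ennreal (norm (convolve (mollifier (X n)) (\<lambda>z. k n z *\<^sub>R f z) z - f z)) \<partial>lborel) \<longlonglongrightarrow> 0"
proof -
  note [measurable] = k(1)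
  have [measurable]: "f \<in> borel_measurable lebesgue" using f by auto
  have ik: "integrable lebesgue (\<lambda>z. k n z *\<^sub>R f z)" for n
    by (rule Bochner_Integration.integrable_bound[OF f]) (auto simp: k mult_left_le_one_le)
  have le: "(\<integral>\<^sup>+z. ennreal (norm (convolve (mollifier (X n)) (\<lambda>z. k n z *\<^sub>R f z) z - f z)) \<partial>lborel) \<le>
     (\<integral>\<^sup>+z. ennreal (norm (f z - k n z *\<^sub>R f z)) \<partial>lebesgue) + (\<integral>\<^sup>+z. ennreal (norm (convolve (mollifier (X n)) f z - f z)) \<partial>lebesgue)" for n
  proof -
    note w = mollifier_C0_infty[OF X(1)]
    let ?g = "\<lambda>z. k n z *\<^sub>R f z - f z"
    have ig: "integrable lebesgue ?g" using ik f by auto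
    have [measurable]: "convolve (mollifier (X n)) f \<in> borel_measurable lebesgue" "convolve (mollifier (X n)) ?g \<in> borel_measurable lebesgue"
      by (intro measurable_completion; simp add: convolve_measurable[OF w] f ig)+
    have "(\<integral>\<^sup>+z. ennreal (norm (convolve (mollifier (X n)) (\<lambda>z. k n z *\<^sub>R f z) z - f z)) \<partial>lebesgue) \<le>
       (\<integral>\<^sup>+z. ennreal (norm (convolve (mollifier (X n)) ?g z)) + ennreal (norm (convolve (mollifier (X n)) f z - f z)) \<partial>lebesgue)"
    proof (rule nn_integral_mono)
      fix z
      have "convolve (mollifier (X n)) (\<lambda>z. k n z *\<^sub>R f z) z - f z = convolve (mollifier (X n)) ?g z + (convolve (mollifier (X n)) f z - f z)"
        by (simp add: convolve_diff[OF w ik f])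
      also have "norm \<dots> \<le> norm (convolve (mollifier (X n)) ?g z) + norm (convolve (mollifier (X n)) f z - f z)"
        by (rule norm_triangle_ineq)
      finally show "ennreal (norm (convolve (mollifier (X n)) (\<lambda>z. k n z *\<^sub>R f z) z - f z)) \<le>
        ennreal (norm (convolve (mollifier (X n)) ?g z)) + ennreal (norm (convolve (mollifier (X n)) f z - f z))"
        by (simp add: ennreal_leI flip: ennreal_plus)
    qed
    also have "\<dots> = (\<integral>\<^sup>+z. ennreal (norm (convolve (mollifier (X n)) ?g z)) \<partial>lebesgue) + (\<integral>\<^sup>+z. ennreal (norm (convolve (mollifier (X n)) f z - f z)) \<partial>lebesgue)"
      by (rule nn_integral_add) measurable
    also have "(\<integral>\<^sup>+z. ennreal (norm (convolve (mollifier (X n)) ?g z)) \<partial>lebesgue) \<le> (\<integral>\<^sup>+z. ennreal (norm (?g z)) \<partial>lebesgue)"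
      unfolding nn_integral_completion by (rule convolve_L1_le[OF X(1)]) (use ig in auto)
    finally show ?thesis by (simp add: nn_integral_completion norm_minus_commute add_right_mono)
  qed
  have 1: "(\<lambda>n. \<integral>\<^sup>+z. ennreal (norm (f z - k n z *\<^sub>R f z)) \<partial>lebesgue) \<longlonglongrightarrow> 0"
  proof (rule nn_integral_dominated_convergence_norm[where w="\<lambda>z. norm (f z)"])
    show "AE z in lebesgue. (\<lambda>n. k n z *\<^sub>R f z) \<longlonglongrightarrow> f z"
      unfolding AE_completion_iff using kl
    proof eventually_elim
      case (elim z)
      show ?case
      proof (cases "f z = 0")
        case False
        then show ?thesis using tendsto_scaleR[OF elim[rule_format] tendsto_const[of "f z"]] by simp
      qed simp
    qed
    show "(\<integral>\<^sup>+z. ennreal (norm (f z)) \<partial>lebesgue) < \<infinity>" using f by (simp add: integrable_iff_bounded)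
  qed (auto simp: k mult_left_le_one_le)
  have 2: "(\<lambda>n. \<integral>\<^sup>+z. ennreal (norm (convolve (mollifier (X n)) f z - f z)) \<partial>lebesgue) \<longlonglongrightarrow> 0"
    unfolding nn_integral_completion by (rule mollify_L1_seq[OF f X])
  have 3: "(\<lambda>n. (\<integral>\<^sup>+z. ennreal (norm (f z - k n z *\<^sub>R f z)) \<partial>lebesgue) + (\<integral>\<^sup>+z. ennreal (norm (convolve (mollifier (X n)) f z - f z)) \<partial>lebesgue)) \<longlonglongrightarrow> 0"
    using tendsto_add[OF 1 2] by simp
  show ?thesis
    by (rule tendsto_sandwich[OF always_eventually always_eventually tendsto_const 3]) (rule allI, rule zero_le, rule allI, rule le)
qed

lemma powr_le_linear:
  assumes "1 \<le> q" "q \<le> Q" "0 \<le> t" "t \<le> (M::real)"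
  shows "t powr q \<le> max 1 M powr Q * t"
proof (cases "t = 0")
  case False
  have "t powr q = t powr (q - 1) * t" using False assms by (simp add: powr_diff)
  also have "t powr (q - 1) \<le> max 1 M powr (q - 1)" using assms by (intro powr_mono2) auto
  also have "\<dots> \<le> max 1 M powr Q" using assms by (intro powr_mono) auto
  finally show ?thesis using assms by (simp add: mult_right_mono)
qed simp

text \<open>For a bounded function, convergence in \<open>L\<^sup>1\<close> suffices.\<close>

lemma cutoff_mollify_lux_bounded_seq:
  fixes f :: "'a::euclidean_space \<Rightarrow> 'b::euclidean_space"
  assumes G: "G \<in> sets lebesgue" "bounded G" and q: "q \<in> P_log G"
    and f: "f \<in> borel_measurable (lebesgue_on G)" and B: "\<And>x. x \<in> G \<Longrightarrow> norm (f x) \<le> B" "0 \<le> B"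
    and X: "\<And>n. 0 < X n" "X \<longlonglongrightarrow> (0::real)"
    and k: "\<And>n. k n \<in> borel_measurable lebesgue" "\<And>n z. 0 \<le> k n z" "\<And>n z. k n z \<le> 1"
    and kl: "AE z in lborel. z \<in> G \<longrightarrow> (\<lambda>n. k n z) \<longlonglongrightarrow> (1::real)"
  shows "(\<lambda>n. lux_norm G q (\<lambda>z. convolve (mollifier (X n)) (\<lambda>z. k n z *\<^sub>R zero_ext G f z) z - f z)) \<longlonglongrightarrow> 0"
proof (rule lux_norm_tendsto_0I)
  fix l :: real assume l: "0 < l"
  let ?f = "zero_ext G f"
  let ?S = "\<lambda>n. convolve (mollifier (X n)) (\<lambda>z. k n z *\<^sub>R ?f z)"
  have fB: "norm (?f x) \<le> B" for x using B by (auto simp: zero_ext_def)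
  have fm: "?f \<in> borel_measurable lebesgue" by (rule zero_ext_measurable[OF G(1) f])
  have fi: "integrable lebesgue ?f"
    unfolding integrable_lebesgue_nn_integral
  proof (intro conjI fm)
    have "(\<integral>\<^sup>+x. ennreal (norm (?f x)) \<partial>lebesgue) \<le> (\<integral>\<^sup>+x. ennreal B * indicator G x \<partial>lebesgue)"
      by (intro nn_integral_mono) (auto simp: zero_ext_def B ennreal_leI)
    also have "\<dots> = ennreal B * emeasure lebesgue G" by (rule nn_integral_cmult_indicator[OF G(1)])
    also have "\<dots> < \<infinity>" by (simp add: bounded_measure_finite[OF G] ennreal_mult_less_top)
    finally show "(\<integral>\<^sup>+x. ennreal (norm (?f x)) \<partial>lborel) < \<infinity>" by (simp add: nn_integral_completion)
  qed
  obtain Q where Q: "\<And>x. x \<in> G \<Longrightarrow> q x \<le> Q" using P_logD(3)[OF q] by blast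
  have "AE z in lborel. ?f z \<noteq> 0 \<longrightarrow> (\<lambda>n. k n z) \<longlonglongrightarrow> 1"
    using kl by eventually_elim (auto simp: zero_ext_def split: if_splits)
  from cutoff_mollify_L1_seq[OF fi X k this]
  have L1: "(\<lambda>n. \<integral>\<^sup>+z. ennreal (norm (?S n z - ?f z)) \<partial>lborel) \<longlonglongrightarrow> 0" .
  \<comment> \<open>The function and its smoothing are bounded by B, so t = |S - f| / l lies in
    [0, 2 B / l], where t^q is at most max(1, 2 B / l)^Q times t; the remaining 1/l comes from t
    itself.\<close>
  define c where "c = max 1 (2 * B / l) powr Q / l"
  have c: "0 \<le> c" using l by (simp add: c_def)
  have le: "modular G q (\<lambda>z. (?S n z - f z) /\<^sub>R l) \<le> ennreal c * (\<integral>\<^sup>+z. ennreal (norm (?S n z - ?f z)) \<partial>lborel)" for n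
  proof -
    have [measurable]: "(\<lambda>z. k n z *\<^sub>R ?f z) \<in> borel_measurable lebesgue" using k(1) fm by measurable
    have "integrable lebesgue (\<lambda>z. k n z *\<^sub>R ?f z)"
      by (rule Bochner_Integration.integrable_bound[OF fi]) (auto simp: k mult_left_le_one_le)
    then have [measurable]: "?S n \<in> borel_measurable lebesgue"
      by (intro measurable_completion) (simp add: convolve_measurable[OF mollifier_C0_infty[OF X(1)]])
    note [measurable] = fm
    have "modular G q (\<lambda>z. (?S n z - f z) /\<^sub>R l) \<le> (\<integral>\<^sup>+z. ennreal c * ennreal (norm (?S n z - ?f z)) \<partial>lborel)"
      unfolding modular_eq[OF G(1)]
    proof (rule nn_integral_mono)
      fix z
      show "ennreal (norm ((?S n z - f z) /\<^sub>R l) powr q z) * indicator G z \<le> ennreal c * ennreal (norm (?S n z - ?f z))"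
      proof (cases "z \<in> G")
        case True
        have "norm (k n z *\<^sub>R ?f z) \<le> B" for z
          using fB[of z] k(2,3)[of n z] by (simp add: mult_le_one order_trans[OF mult_left_le_one_le])
        then have "norm (?S n z) \<le> B" by (rule convolve_norm_le_bound[OF X(1)])
        then have n: "norm (?S n z - f z) \<le> 2 * B"
          using B(1)[OF True] norm_triangle_ineq4[of "?S n z" "f z"] by linarith
        have "(norm (?S n z - f z) / l) powr q z \<le> max 1 (2 * B / l) powr Q * (norm (?S n z - f z) / l)"
          by (rule powr_le_linear) (use n l P_logD(2)[OF q True] Q[OF True] in \<open>auto intro!: divide_right_mono\<close>)
        also have "\<dots> = c * norm (?S n z - f z)" by (simp add: c_def)
        finally show ?thesis unfolding norm_div_scaleR[OF l] using True c
          by (simp add: zero_ext_def ennreal_leI flip: ennreal_mult)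
      qed simp
    qed
    also have "\<dots> = (\<integral>\<^sup>+z. ennreal c * ennreal (norm (?S n z - ?f z)) \<partial>lebesgue)"
      by (rule nn_integral_completion[symmetric])
    also have "\<dots> = ennreal c * (\<integral>\<^sup>+z. ennreal (norm (?S n z - ?f z)) \<partial>lebesgue)"
      by (rule nn_integral_cmult) measurable
    finally show ?thesis by (simp only: nn_integral_completion)
  qed
  have "(\<lambda>n. ennreal c * (\<integral>\<^sup>+z. ennreal (norm (?S n z - ?f z)) \<partial>lborel)) \<longlonglongrightarrow> ennreal c * 0"
    by (intro ennreal_tendsto_cmult L1) simp
  then have lim: "(\<lambda>n. ennreal c * (\<integral>\<^sup>+z. ennreal (norm (?S n z - ?f z)) \<partial>lborel)) \<longlonglongrightarrow> 0" by simp
  show "(\<lambda>n. modular G q (\<lambda>z. (?S n z - f z) /\<^sub>R l)) \<longlonglongrightarrow> 0"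
    by (rule tendsto_sandwich[OF always_eventually always_eventually tendsto_const lim]) (rule allI, rule zero_le, rule allI, rule le)
qed

lemma cutoff_integrable:
  fixes f :: "'a::euclidean_space \<Rightarrow> 'b::euclidean_space" and k :: "'a \<Rightarrow> real"
  assumes "integrable lebesgue f" "k \<in> borel_measurable lebesgue" "\<And>z. 0 \<le> k z" "\<And>z. k z \<le> 1"
  shows "integrable lebesgue (\<lambda>z. k z *\<^sub>R f z)"
proof -
  note [measurable] = assms(2)
  have [measurable]: "f \<in> borel_measurable lebesgue" using assms(1) by auto
  show ?thesis
    by (rule Bochner_Integration.integrable_bound[OF assms(1)]) (auto simp: assms(3,4) mult_left_le_one_le)
qed

lemma cutoff_mollify_norm_le:
  fixes f :: "'a::euclidean_space \<Rightarrow> 'b::euclidean_space"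
  assumes h: "0 < h" and k: "\<And>z. 0 \<le> k z" "\<And>z. k z \<le> 1"
  shows "ennreal (norm (convolve (mollifier h) (\<lambda>z. k z *\<^sub>R f z) z)) \<le>
    (\<integral>\<^sup>+y. ennreal (mollifier h (z - y)) * ennreal (norm (f y)) \<partial>lborel)"
proof -
  have "ennreal (norm (convolve (mollifier h) (\<lambda>z. k z *\<^sub>R f z) z)) \<le>
      (\<integral>\<^sup>+y. ennreal \<bar>mollifier h (z - y)\<bar> * ennreal (norm (k y *\<^sub>R f y)) \<partial>lborel)"
    by (rule convolve_norm_le)
  also have "\<dots> \<le> (\<integral>\<^sup>+y. ennreal (mollifier h (z - y)) * ennreal (norm (f y)) \<partial>lborel)"
  proof (rule nn_integral_mono)
    fix y
    have "norm (k y *\<^sub>R f y) \<le> norm (f y)" using k[of y] by (simp add: mult_left_le_one_le)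
    then show "ennreal \<bar>mollifier h (z - y)\<bar> * ennreal (norm (k y *\<^sub>R f y)) \<le> ennreal (mollifier h (z - y)) * ennreal (norm (f y))"
      unfolding abs_of_nonneg[OF mollifier_nonneg[OF h]] by (rule mult_left_mono[OF ennreal_leI]) simp
  qed
  finally show ?thesis .
qed

lemma cutoff_mollify_lux_le:
  assumes G: "G \<in> sets lebesgue" "bounded G" and q: "q \<in> P_log G"
  obtains K where "0 < K" "\<And>h k (f :: 'a::euclidean_space \<Rightarrow> 'b::euclidean_space). 0 < h \<Longrightarrow> f \<in> Lvar G q \<Longrightarrow> k \<in> borel_measurable lebesgue \<Longrightarrow>
     \<forall>z. 0 \<le> k z \<and> k z \<le> 1 \<Longrightarrow>
     lux_norm G q (convolve (mollifier h) (\<lambda>z. k z *\<^sub>R zero_ext G f z)) \<le> ennreal K * lux_norm G q f"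
proof -
  obtain K where K: "0 < K" "\<And>R C (f::'a \<Rightarrow> 'b) (g::'a \<Rightarrow> 'b). 0 < R \<Longrightarrow> 0 < C \<Longrightarrow> f \<in> borel_measurable (lebesgue_on G) \<Longrightarrow> g \<in> borel_measurable (lebesgue_on G) \<Longrightarrow>
     \<forall>x\<in>G. ennreal (norm (g x)) \<le> ennreal C * ball_avg (zero_ext G f) x R \<Longrightarrow>
     lux_norm G q g \<le> ennreal (C * K) * lux_norm G q f"
  proof (rule averaging_lux_norm[OF G q, where 'b='b and 'c='b], goal_cases)
    case 1
    show ?case by (rule 1(1)[OF 1(2) 1(3)])
  qed
  obtain C where C: "0 < C" "\<And>h (f::'a \<Rightarrow> 'b) z. 0 < h \<Longrightarrow> f \<in> borel_measurable lebesgue \<Longrightarrow>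
     (\<integral>\<^sup>+y. ennreal (mollifier h (z - y)) * ennreal (norm (f y)) \<partial>lborel) \<le> ennreal C * ball_avg f z h"
  proof (rule mollify_le_ball_avg[where 'a='a and 'b='b], goal_cases)
    case 1
    show ?case by (rule 1(1)[OF 1(2) 1(3)])
  qed
  show ?thesis
  proof (rule that[of "C * K"])
    fix h :: real and k :: "'a \<Rightarrow> real" and f :: "'a \<Rightarrow> 'b"
    assume h: "0 < h" and f: "f \<in> Lvar G q" and k: "k \<in> borel_measurable lebesgue" "\<forall>z. 0 \<le> k z \<and> k z \<le> 1"
    have fm: "f \<in> borel_measurable (lebesgue_on G)" using f by (simp add: Lvar_def)
    have i: "integrable lebesgue (\<lambda>z. k z *\<^sub>R zero_ext G f z)"
      using k by (intro cutoff_integrable Lvar_integrable(1)[OF G f P_logD(2)[OF q] P_logD(1)[OF q]]) auto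
    show "lux_norm G q (convolve (mollifier h) (\<lambda>z. k z *\<^sub>R zero_ext G f z)) \<le> ennreal (C * K) * lux_norm G q f"
    proof (rule K(2)[OF h C(1) fm])
      show "convolve (mollifier h) (\<lambda>z. k z *\<^sub>R zero_ext G f z) \<in> borel_measurable (lebesgue_on G)"
        by (intro measurable_restrict_space1 measurable_completion)
           (simp add: convolve_measurable[OF mollifier_C0_infty[OF h] i])
      show "\<forall>x\<in>G. ennreal (norm (convolve (mollifier h) (\<lambda>z. k z *\<^sub>R zero_ext G f z) x)) \<le> ennreal C * ball_avg (zero_ext G f) x h"
      proof
        fix x
        show "ennreal (norm (convolve (mollifier h) (\<lambda>z. k z *\<^sub>R zero_ext G f z) x)) \<le> ennreal C * ball_avg (zero_ext G f) x h"
        using k(2) by (intro order_trans[OF cutoff_mollify_norm_le[OF h] C(2)[OF h]] zero_ext_measurable[OF G(1) fm]) auto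
      qed
    qed
  qed (use C K in auto)
qed

lemma Lvar_restrict:
  fixes f :: "'a::euclidean_space \<Rightarrow> 'b::euclidean_space"
  assumes G: "G \<in> sets lebesgue" and f: "f \<in> Lvar G q" and A: "A \<in> sets lebesgue"
  shows "(\<lambda>x. indicat_real A x *\<^sub>R f x) \<in> Lvar G q"
proof -
  have [measurable]: "f \<in> borel_measurable (lebesgue_on G)" and fin: "modular G q f < \<infinity>" using f by (auto simp: Lvar_def)
  have [measurable]: "indicat_real A \<in> borel_measurable (lebesgue_on G)"
    using A by (intro measurable_restrict_space1) simp
  have "modular G q (\<lambda>x. indicat_real A x *\<^sub>R f x) \<le> modular G q f"
    by (rule modular_mono_AE[OF G]) (auto simp: indicator_def)
  then have "modular G q (\<lambda>x. indicat_real A x *\<^sub>R f x) < \<infinity>" using fin by (rule order_le_less_trans)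
  then show ?thesis by (simp add: Lvar_def)
qed

text \<open>f is split at a height m into a bounded part s and a tail r. The bound K for the
  smoothing of r is uniform in n, so m can be fixed before n tends to infinity.\<close>

lemma cutoff_mollify_lux_seq:
  fixes f :: "'a::euclidean_space \<Rightarrow> 'b::euclidean_space"
  assumes G: "G \<in> sets lebesgue" "bounded G" and q: "q \<in> P_log G" and f: "f \<in> Lvar G q"
    and X: "\<And>n. 0 < X n" "X \<longlonglongrightarrow> (0::real)"
    and k: "\<And>n. k n \<in> borel_measurable lebesgue" "\<And>n z. 0 \<le> k n z" "\<And>n z. k n z \<le> 1"
    and kl: "AE z in lborel. z \<in> G \<longrightarrow> (\<lambda>n. k n z) \<longlonglongrightarrow> (1::real)"
  shows "(\<lambda>n. lux_norm G q (\<lambda>z. convolve (mollifier (X n)) (\<lambda>z. k n z *\<^sub>R zero_ext G f z) z - f z)) \<longlonglongrightarrow> 0"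
  unfolding ennreal_tendsto_0_iff
proof (intro allI impI)
  fix e :: real assume e: "0 < e"
  note p = P_logD(2)[OF q] and pm = P_logD(1)[OF q]
  obtain Q where Q: "\<And>x. x \<in> G \<Longrightarrow> q x \<le> Q" using P_logD(3)[OF q] by blast
  obtain K where K: "0 < K" "\<And>h k (f :: 'a \<Rightarrow> 'b). 0 < h \<Longrightarrow> f \<in> Lvar G q \<Longrightarrow> k \<in> borel_measurable lebesgue \<Longrightarrow>
     \<forall>z. 0 \<le> k z \<and> k z \<le> 1 \<Longrightarrow>
     lux_norm G q (convolve (mollifier h) (\<lambda>z. k z *\<^sub>R zero_ext G f z)) \<le> ennreal K * lux_norm G q f"
  proof (rule cutoff_mollify_lux_le[OF G q, where 'b='b], goal_cases)
    case 1
    show ?case by (rule 1(1)[OF 1(2) 1(3)])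
  qed
  have fm: "f \<in> borel_measurable (lebesgue_on G)" using f by (simp add: Lvar_def)
  have zm: "zero_ext G f \<in> borel_measurable lebesgue" by (rule zero_ext_measurable[OF G(1) fm])
  define A where "A m = {x. real m < norm (zero_ext G f x)}" for m :: nat
  have Am: "A m \<in> sets lebesgue" for m
  proof -
    have "{x \<in> space lebesgue. real m < norm (zero_ext G f x)} \<in> sets lebesgue" using zm by measurable
    then show ?thesis by (simp add: A_def)
  qed
  have "(\<lambda>m. lux_norm G q (\<lambda>x. indicat_real (A m) x *\<^sub>R f x)) \<longlonglongrightarrow> 0"
  proof (rule lux_norm_restrict_tendsto_0[OF G(1) f pm p Q Am])
    fix x
    obtain m0 :: nat where "norm (zero_ext G f x) < real m0" using reals_Archimedean2 by blast
    then show "\<forall>\<^sub>F m in sequentially. x \<notin> A m"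
      by (intro eventually_sequentiallyI[of m0]) (auto simp: A_def)
  qed
  \<comment> \<open>Two applications of the crude triangle inequality: the two tail terms below a
    add up to at most 4 a < 5 a, and joining them with the bounded part gives 4 times 5 a =
    e.\<close>
  define a where "a = e / 20"
  have a: "0 < a" using e by (simp add: a_def)
  then have "0 < ennreal (a / (K + 1))" using K by simp
  with \<open>(\<lambda>m. lux_norm G q (\<lambda>x. indicat_real (A m) x *\<^sub>R f x)) \<longlonglongrightarrow> 0\<close>
  have "\<forall>\<^sub>F m in sequentially. lux_norm G q (\<lambda>x. indicat_real (A m) x *\<^sub>R f x) < ennreal (a / (K + 1))"
    unfolding order_tendsto_iff by blast
  \<comment> \<open>The bound a / (K + 1) makes the tail as well as K times the tail smaller than
    a.\<close>
  then obtain m where m: "lux_norm G q (\<lambda>x. indicat_real (A m) x *\<^sub>R f x) < ennreal (a / (K + 1))"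
    by (auto simp: eventually_sequentially)
  define r where "r x = indicat_real (A m) x *\<^sub>R f x" for x
  define s where "s x = indicat_real (- A m) x *\<^sub>R f x" for x
  have fsr: "f x = s x + r x" for x by (simp add: r_def s_def indicator_def)
  have rL: "r \<in> Lvar G q" unfolding r_def[abs_def] by (rule Lvar_restrict[OF G(1) f Am])
  have sL: "s \<in> Lvar G q" unfolding s_def[abs_def] by (rule Lvar_restrict[OF G(1) f]) (use Am in \<open>simp add: Compl_in_sets_lebesgue\<close>)
  have rm [measurable]: "r \<in> borel_measurable (lebesgue_on G)" and sm [measurable]: "s \<in> borel_measurable (lebesgue_on G)"
    using rL sL by (auto simp: Lvar_def)
  have lr: "ennreal K * lux_norm G q r < ennreal a" "lux_norm G q r < ennreal a"
  proof -
    have r: "lux_norm G q r < ennreal (a / (K + 1))" using m by (simp add: r_def[abs_def])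
    have "ennreal K * lux_norm G q r \<le> ennreal K * ennreal (a / (K + 1))" using r by (intro mult_left_mono) auto
    also have "\<dots> < ennreal a" using K a by (simp add: field_simps ennreal_less_iff flip: ennreal_mult)
    finally show "ennreal K * lux_norm G q r < ennreal a" .
    have "ennreal (a / (K + 1)) \<le> ennreal a" using K a by (intro ennreal_leI) (simp add: divide_le_eq)
    then show "lux_norm G q r < ennreal a" using r by (rule order_less_le_trans[rotated])
  qed
  let ?S = "\<lambda>n f. convolve (mollifier (X n)) (\<lambda>z. k n z *\<^sub>R zero_ext G f z)"
  have Sm [measurable]: "?S n g \<in> borel_measurable (lebesgue_on G)" and Si: "integrable lebesgue (\<lambda>z. k n z *\<^sub>R zero_ext G g z)"
    if "g \<in> Lvar G q" for n and g :: "'a \<Rightarrow> 'b"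
  proof -
    show i: "integrable lebesgue (\<lambda>z. k n z *\<^sub>R zero_ext G g z)"
      using k by (intro cutoff_integrable Lvar_integrable(1)[OF G that p pm]) auto
    show "?S n g \<in> borel_measurable (lebesgue_on G)"
      by (intro measurable_restrict_space1 measurable_completion)
         (simp add: convolve_measurable[OF mollifier_C0_infty[OF X(1)] i])
  qed
  have "(\<lambda>n. lux_norm G q (\<lambda>z. ?S n s z - s z)) \<longlonglongrightarrow> 0"
  proof (rule cutoff_mollify_lux_bounded_seq[OF G q sm _ _ X k kl])
    show "norm (s x) \<le> real m" if "x \<in> G" for x
      using that by (auto simp: s_def A_def indicator_def zero_ext_def not_less)
  qed auto
  moreover have "0 < ennreal (5 * a)" using a by simp
  ultimately have "\<forall>\<^sub>F n in sequentially. lux_norm G q (\<lambda>z. ?S n s z - s z) < ennreal (5 * a)"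
    unfolding order_tendsto_iff by blast
  then show "\<forall>\<^sub>F n in sequentially. lux_norm G q (\<lambda>z. ?S n f z - f z) \<le> ennreal e"
  proof eventually_elim
    case (elim n)
    have "lux_norm G q (?S n r) \<le> ennreal K * lux_norm G q r"
      by (rule K(2)[OF X(1) rL k(1)]) (use k in auto)
    then have 1: "lux_norm G q (?S n r) < ennreal a" using lr by (simp add: order_le_less_trans)
    have 2: "lux_norm G q (\<lambda>z. - r z) < ennreal a"
      using lr(2) lux_norm_cong_AE[OF G(1), of "\<lambda>z. - r z" r q] by simp
    have "lux_norm G q (\<lambda>z. ?S n r z + - r z) \<le> ennreal (4 * a)"
      by (rule lux_norm_add[OF G(1) Sm[OF rL] _ pm p 1 2]) measurable
    also have "\<dots> < ennreal (5 * a)" using a by (simp add: ennreal_less_iff)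
    finally have 3: "lux_norm G q (\<lambda>z. ?S n r z + - r z) < ennreal (5 * a)" .
    have m3: "(\<lambda>z. ?S n r z + - r z) \<in> borel_measurable (lebesgue_on G)" and m4: "(\<lambda>z. ?S n s z - s z) \<in> borel_measurable (lebesgue_on G)"
      using Sm[OF rL] Sm[OF sL] by measurable
    have "lux_norm G q (\<lambda>z. (?S n s z - s z) + (?S n r z + - r z)) \<le> ennreal (4 * (5 * a))"
      by (rule lux_norm_add[OF G(1) m4 m3 pm p elim 3])
    moreover have "(?S n s z - s z) + (?S n r z + - r z) = ?S n f z - f z" for z
    proof -
      have "(\<lambda>z. k n z *\<^sub>R zero_ext G f z) = (\<lambda>z. k n z *\<^sub>R zero_ext G s z + k n z *\<^sub>R zero_ext G r z)"
        by (auto simp: zero_ext_def fsr scaleR_add_right)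
      then have "?S n f z = ?S n s z + ?S n r z"
        by (simp add: convolve_add[OF mollifier_C0_infty[OF X(1)] Si[OF sL] Si[OF rL]])
      then show ?thesis by (simp add: fsr)
    qed
    ultimately show ?case by (simp add: a_def)
  qed
qed

section \<open>The cutoffs and their commutator\<close>

text \<open>A ball is connected, so one that meets both \<Omega> and its complement meets the
  frontier; a ball of radius equal to the distance cannot.\<close>

lemma infdist_frontier_ball:
  fixes x y :: "'a::euclidean_space"
  assumes "x \<in> \<Omega>" "dist x y < infdist x (frontier \<Omega>)"
  shows "y \<in> \<Omega>"
proof (rule ccontr)
  assume y: "y \<notin> \<Omega>"
  let ?B = "ball x (infdist x (frontier \<Omega>))"
  have "?B \<inter> frontier \<Omega> \<noteq> {}"
  proof (rule connected_Int_frontier)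
    have "0 < infdist x (frontier \<Omega>)" using assms(2) by (rule order_le_less_trans[OF zero_le_dist])
    then have "x \<in> ?B" by simp
    then show "?B \<inter> \<Omega> \<noteq> {}" using assms(1) by blast
    show "?B - \<Omega> \<noteq> {}" using assms(2) y by auto
  qed simp
  then obtain w where "w \<in> frontier \<Omega>" "dist x w < infdist x (frontier \<Omega>)" by auto
  then show False using infdist_le[of w "frontier \<Omega>" x] by simp
qed

locale bounded_open =
  fixes \<Omega> :: "(real^'d::finite) set"
  assumes open_dom: "open \<Omega>" and bounded_dom: "bounded \<Omega>"
begin

abbreviation "bd x \<equiv> infdist x (frontier \<Omega>)"

lemma compact_inner: "0 < \<delta> \<Longrightarrow> compact {x \<in> \<Omega>. \<delta> \<le> bd x}"
proof -
  assume d: "0 < \<delta>"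
  have "{x \<in> \<Omega>. \<delta> \<le> bd x} = closure \<Omega> \<inter> {x. \<delta> \<le> bd x}"
  proof -
    have "x \<in> \<Omega>" if "x \<in> closure \<Omega>" "\<delta> \<le> bd x" for x
    proof (rule ccontr)
      assume "x \<notin> \<Omega>"
      then have "x \<in> frontier \<Omega>" using that(1) open_dom by (simp add: frontier_def interior_open)
      then show False using that(2) d by simp
    qed
    then show ?thesis using closure_subset[of \<Omega>] by blast
  qed
  moreover have "closed {x. \<delta> \<le> bd x}"
    by (intro closed_Collect_le continuous_intros)
  moreover have "compact (closure \<Omega>)" using bounded_dom by simp
  ultimately show ?thesis by (simp add: compact_Int_closed)
qed

lemma inner_part_open: "open (inner_part \<Omega> \<delta>)"
proof -
  have "inner_part \<Omega> \<delta> = \<Omega> \<inter> {x. \<delta> < bd x}" by (auto simp: inner_part_def)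
  moreover have "open {x. \<delta> < bd x}" by (intro open_Collect_less continuous_intros)
  ultimately show ?thesis using open_dom by auto
qed

lemma inner_part_integrable: "integrable lebesgue (indicat_real (inner_part \<Omega> \<delta>))"
proof -
  have s: "inner_part \<Omega> \<delta> \<in> sets lebesgue" using inner_part_open by auto
  have "bounded (inner_part \<Omega> \<delta>)" using bounded_dom by (rule bounded_subset) (auto simp: inner_part_def)
  then show ?thesis using bounded_measure_finite[OF s] s by (intro integrable_real_indicator) auto
qed

lemma eta_smooth: "0 < h \<Longrightarrow> smooth (eta \<Omega> h)"
  unfolding eta_def by (intro convolve_smooth mollifier_C0_infty inner_part_integrable) simp

lemma eta_nonneg: "0 < h \<Longrightarrow> 0 \<le> eta \<Omega> h x"
  unfolding eta_def convolve_def by (rule integral_nonneg_AE) (auto simp: mollifier_nonneg)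

lemma eta_le_1: "0 < h \<Longrightarrow> eta \<Omega> h x \<le> 1"
  using convolve_norm_le_bound[of "h / 2" "indicat_real (inner_part \<Omega> (5 * h / 2))" 1 x]
  by (simp add: eta_def indicator_def abs_le_iff)

text \<open>The smoothed indicator begins at distance 5h/2 and the mollifier spreads by h/2, so
  \<open>eta\<close> vanishes up to distance 2h. Likewise it equals 1 beyond 5h/2 + h/2 = 3h, and
  its gradient is confined to the strip in between.\<close>

lemma eta_support:
  assumes h: "0 < h" and nz: "eta \<Omega> h x \<noteq> 0"
  shows "x \<in> \<Omega>" "2 * h < bd x"
proof -
  have "\<exists>y. norm (x - y) < h / 2 \<and> y \<in> inner_part \<Omega> (5 * h / 2)"
  proof (rule ccontr)
    assume "\<not> ?thesis"
    then have z: "mollifier (h / 2) (x - y) *\<^sub>R indicat_real (inner_part \<Omega> (5 * h / 2)) y = 0" for y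
      using mollifier_support[of "h / 2" "x - y"] h by (cases "norm (x - y) < h / 2") auto
    show False using nz unfolding eta_def convolve_def z by simp
  qed
  then obtain y where y: "dist y x < h / 2" "y \<in> \<Omega>" "5 * h / 2 < bd y"
    by (auto simp: inner_part_def dist_norm norm_minus_commute)
  then show "2 * h < bd x" using infdist_triangle[of y "frontier \<Omega>" x] by linarith
  show "x \<in> \<Omega>" by (rule infdist_frontier_ball[OF y(2)]) (use y h in linarith)
qed

lemma eta_closed_supp: "0 < h \<Longrightarrow> closed_supp (eta \<Omega> h) \<subseteq> {x \<in> \<Omega>. 2 * h \<le> bd x}"
  by (rule closed_supp_subset[OF compact_imp_closed[OF compact_inner]])
     (use eta_support in \<open>force+\<close>)

lemma eta_eq_1:
  assumes h: "0 < h" and x: "x \<in> \<Omega>" "3 * h < bd x"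
  shows "eta \<Omega> h x = 1"
proof -
  have e: "mollifier (h / 2) (x - y) *\<^sub>R indicat_real (inner_part \<Omega> (5 * h / 2)) y = mollifier (h / 2) (x - y)" for y
  proof (cases "norm (x - y) < h / 2")
    case True
    then have d: "dist x y < h / 2" by (simp add: dist_norm)
    have "y \<in> \<Omega>" by (rule infdist_frontier_ball[OF x(1)]) (use d x h in linarith)
    moreover have "5 * h / 2 < bd y" using d x(2) infdist_triangle[of x "frontier \<Omega>" y] by linarith
    ultimately show ?thesis by (simp add: inner_part_def)
  qed (use mollifier_support[of "h / 2" "x - y"] h in auto)
  have "eta \<Omega> h x = (LINT y|lebesgue. mollifier (h / 2) (x - y))"
    unfolding eta_def convolve_def e ..
  moreover have "(LINT y|lebesgue. mollifier (h / 2) (x - y)) = (LINT y|lborel. mollifier (h / 2) (x - y))"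
    by (rule integral_completion) measurable
  moreover have "\<dots> = 1"
    using h nn_integral_mollifier_reflect[of "h / 2" x]
    by (subst integral_eq_nn_integral) (auto simp: mollifier_nonneg)
  ultimately show ?thesis by simp
qed

lemma eta_deriv_nonzero:
  assumes h: "0 < h" and nz: "frechet_derivative (eta \<Omega> h) (at x) b \<noteq> 0"
  shows "x \<in> \<Omega>" "bd x \<le> 3 * h"
proof -
  show x: "x \<in> \<Omega>" using closed_supp_deriv[of x "eta \<Omega> h" b] nz eta_closed_supp[OF h] by blast
  show "bd x \<le> 3 * h"
  proof (rule ccontr)
    assume "\<not> bd x \<le> 3 * h"
    then have "x \<in> inner_part \<Omega> (3 * h)" using x by (simp add: inner_part_def)
    then have "(eta \<Omega> h has_derivative (\<lambda>v. 0)) (at x)"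
      by (rule has_derivative_transform_within_open[OF has_derivative_const[of 1] inner_part_open])
         (simp add: inner_part_def eta_eq_1 h)
    then show False using nz by (simp add: frechet_eq)
  qed
qed

text \<open>The derivative falls on the mollifier of radius h/2, of size C (h/2)^(-n-1), and is
  integrated over a ball of volume of order h^n; this leaves 1/h.\<close>

lemma eta_deriv_bound:
  "\<exists>C>0. \<forall>h>0. \<forall>x b. \<bar>frechet_derivative (eta \<Omega> h) (at x) b\<bar> \<le> C / h * norm b"
proof -
  obtain C where C: "0 < C" "\<And>h x b. 0 < h \<Longrightarrow> \<bar>frechet_derivative (mollifier h) (at (x::real^'d)) b\<bar> \<le> C / h ^ Suc DIM(real^'d) * norm b"
    by (rule mollifier_bounds) blast
  let ?n = "DIM(real^'d)"
  let ?w = "unit_ball_vol (real ?n)"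
  show ?thesis
  proof (intro exI[of _ "2 * C * ?w * 2 ^ ?n"] conjI allI impI)
    fix h :: real and x b :: "real^'d" assume h: "0 < h"
    let ?m = "mollifier (h / 2) :: real^'d \<Rightarrow> real"
    let ?I = "indicat_real (inner_part \<Omega> (5 * h / 2))"
    have h2: "0 < h / 2" using h by simp
    have "frechet_derivative (eta \<Omega> h) (at x) b = convolve (\<lambda>x. frechet_derivative ?m (at x) b) ?I x"
      unfolding eta_def by (subst frechet_eq[OF convolve_has_derivative[OF mollifier_C0_infty[OF h2] inner_part_integrable]]) simp
    then have "ennreal \<bar>frechet_derivative (eta \<Omega> h) (at x) b\<bar> \<le>
        (\<integral>\<^sup>+y. ennreal \<bar>frechet_derivative ?m (at (x - y)) b\<bar> * ennreal (norm (?I y)) \<partial>lborel)"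
      using convolve_norm_le[of "\<lambda>x. frechet_derivative ?m (at x) b" ?I x] by simp
    also have "\<dots> \<le> (\<integral>\<^sup>+y. ennreal (C / (h / 2) ^ Suc ?n * norm b) * indicator (ball x h) y \<partial>lborel)"
    proof (rule nn_integral_mono)
      fix y
      have cs: "closed_supp ?m \<subseteq> cball 0 (h / 2)"
        by (rule closed_supp_subset) (auto intro!: mollifier_support h2)
      show "ennreal \<bar>frechet_derivative ?m (at (x - y)) b\<bar> * ennreal (norm (?I y)) \<le> ennreal (C / (h / 2) ^ Suc ?n * norm b) * indicator (ball x h) y"
      proof (cases "dist x y < h")
        case True
        have "ennreal \<bar>frechet_derivative ?m (at (x - y)) b\<bar> * ennreal (norm (?I y)) \<le> ennreal \<bar>frechet_derivative ?m (at (x - y)) b\<bar> * 1"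
          by (intro mult_left_mono) (auto simp: indicator_def)
        also have "\<dots> \<le> ennreal (C / (h / 2) ^ Suc ?n * norm b)"
          using C(2)[OF h2, of "x - y" b] by (simp add: ennreal_leI del: power_Suc)
        finally show ?thesis using True by simp
      next
        case False
        then have "x - y \<notin> closed_supp ?m" using subsetD[OF cs, of "x - y"] h by (auto simp: dist_norm norm_minus_commute)
        then show ?thesis by (simp add: closed_supp_deriv)
      qed
    qed
    also have "\<dots> = ennreal (C / (h / 2) ^ Suc ?n * norm b) * ennreal (?w * h ^ ?n)"
      using h by (subst nn_integral_cmult_indicator) (auto simp: emeasure_ball)
    also have "\<dots> = ennreal (2 * C * ?w * 2 ^ ?n / h * norm b)"
      using h C by (simp add: field_simps power_divide flip: ennreal_mult)
    finally show "\<bar>frechet_derivative (eta \<Omega> h) (at x) b\<bar> \<le> 2 * C * ?w * 2 ^ ?n / h * norm b"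
      using h C by (subst (asm) ennreal_le_iff) auto
  qed (use C in auto)
qed

end

lemma integrable_loc_integrable:
  fixes f :: "'a::euclidean_space \<Rightarrow> 'b::euclidean_space"
  assumes "integrable lebesgue (zero_ext G f)"
  shows "loc_integrable G f"
  unfolding loc_integrable_def set_integrable_def
proof (intro allI impI)
  fix K assume K: "compact K \<and> K \<subseteq> G"
  then have "K \<in> sets lebesgue" using borel_compact[of K] by auto
  then have "integrable lebesgue (\<lambda>x. indicat_real K x *\<^sub>R zero_ext G f x)"
    by (rule integrable_mult_indicator[OF _ assms])
  also have "(\<lambda>x. indicat_real K x *\<^sub>R zero_ext G f x) = (\<lambda>x. indicat_real K x *\<^sub>R f x)"
    using K by (auto simp: zero_ext_def indicator_def fun_eq_iff)
  finally show "integrable lebesgue (\<lambda>x. indicat_real K x *\<^sub>R f x)" .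
qed

lemma C0_infty_mult_integrable:
  fixes f :: "'a::euclidean_space \<Rightarrow> 'b::euclidean_space"
  assumes "w \<in> C0_infty UNIV" "integrable lebesgue f"
  shows "integrable lebesgue (\<lambda>x. w x *\<^sub>R f x)"
proof (rule loc_integrable_C0_infty[OF _ assms(1)])
  have "zero_ext UNIV f = f" by (simp add: zero_ext_def[abs_def])
  then show "loc_integrable UNIV f" using assms(2) integrable_loc_integrable[of UNIV f] by simp
qed

lemma st_dir_Basis: "st_dir i \<in> Basis"
  by (simp add: st_dir_def Basis_prod_def Basis_vec_def axis_index) blast

lemma space_dir_Basis: "space_dir i \<in> Basis"
  by (simp add: space_dir_def Basis_vec_def) blast

lemma norm_matrix_le_sum:
  fixes A :: "real^'n::finite^'m::finite"
  shows "norm A \<le> (\<Sum>i\<in>UNIV. \<Sum>j\<in>UNIV. \<bar>A $ i $ j\<bar>)"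
proof -
  have "norm A \<le> (\<Sum>i\<in>UNIV. norm (A $ i))" unfolding norm_vec_def by (rule L2_set_le_sum) simp
  also have "\<dots> \<le> (\<Sum>i\<in>UNIV. \<Sum>j\<in>UNIV. \<bar>A $ i $ j\<bar>)"
    by (intro sum_mono norm_le_l1_cart)
  finally show ?thesis .
qed

section \<open>The space-time cutoff and the smoothing operator\<close>

locale smoothing = bounded_open \<Omega> for \<Omega> :: "(real^'d::finite) set" +
  fixes T :: real and \<phi> :: "real \<Rightarrow> real \<Rightarrow> real"
  assumes phi_C0: "\<And>h. 0 < h \<Longrightarrow> \<phi> h \<in> C0_infty {0<..<T}"
    and phi_supp: "\<And>h. 0 < h \<Longrightarrow> closed_supp (\<phi> h) \<subseteq> {2 * h<..<T - 2 * h}"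
    and phi_range: "\<And>h t. 0 < h \<Longrightarrow> 0 \<le> \<phi> h t \<and> \<phi> h t \<le> 1"
    and phi_lim: "AE t in lebesgue_on {0<..<T}. ((\<lambda>h. \<phi> h t) \<longlongrightarrow> 1) (at_right 0)"
begin

abbreviation "Q \<equiv> cylinder T \<Omega>"

text \<open>Merging both cutoffs into one smooth function with compact support in the cylinder makes
  the mollifier times \<open>cutoff\<close> an admissible test function.\<close>

definition cutoff :: "real \<Rightarrow> real \<times> (real^'d) \<Rightarrow> real" where
  "cutoff h z = eta \<Omega> h (snd z) * \<phi> h (fst z)"

text \<open>Polymorphic in the values, so that the same operator acts on u and on its matrix-valued
  symmetric gradient.\<close>

definition smoothed :: "real \<Rightarrow> (real \<times> (real^'d) \<Rightarrow> 'b::{banach,second_countable_topology}) \<Rightarrow> real \<times> (real^'d) \<Rightarrow> 'b" where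
  "smoothed h f = convolve (mollifier h) (\<lambda>z. cutoff h z *\<^sub>R zero_ext Q f z)"

lemma Q_open: "open Q" using open_dom by (simp add: cylinder_def open_Times)

lemma Q_bounded: "bounded Q" using bounded_dom by (simp add: cylinder_def bounded_Times)

lemma Q_sets: "Q \<in> sets lebesgue" using Q_open by auto

lemma R_ring_eq: "R_ring \<phi> T \<Omega> h u = smoothed h u"
  unfolding R_ring_def R_smooth_def smoothed_def
  by (rule arg_cong[where f="convolve (mollifier h)"]) (auto simp: zero_ext_def cutoff_def fun_eq_iff)

lemma cutoff_nonneg: "0 < h \<Longrightarrow> 0 \<le> cutoff h z"
  by (simp add: cutoff_def eta_nonneg phi_range)

lemma cutoff_le_1: "0 < h \<Longrightarrow> cutoff h z \<le> 1"
  unfolding cutoff_def using mult_le_one[OF eta_le_1 _ conjunct2[OF phi_range], of h] phi_range by blast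

lemma has_derivative_cutoff:
  assumes h: "0 < h"
  shows "(cutoff h has_derivative (\<lambda>v. eta \<Omega> h (snd z) * frechet_derivative (\<phi> h) (at (fst z)) (fst v)
      + frechet_derivative (eta \<Omega> h) (at (snd z)) (snd v) * \<phi> h (fst z))) (at z)"
  unfolding cutoff_def[abs_def]
  by (rule has_derivative_mult)
     (intro has_derivative_compose[OF has_derivative_snd[OF has_derivative_ident]] has_derivative_compose[OF has_derivative_fst[OF has_derivative_ident]]
       smooth_has_derivative eta_smooth C0_inftyD(1)[OF phi_C0] h)+

lemma cutoff_smooth:
  assumes h: "0 < h" shows "smooth (cutoff h)"
proof -
  have "smooth (\<lambda>z. eta \<Omega> h (0 + snd z) * \<phi> h (0 + fst z))"
    by (intro smooth_mult smooth_affine[OF eta_smooth[OF h]] smooth_affine[OF C0_inftyD(1)[OF phi_C0[OF h]]] bounded_linear_snd bounded_linear_fst)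
  then show ?thesis by (simp add: cutoff_def[abs_def])
qed

text \<open>The direction \<open>st_dir i\<close> has no time component, so \<open>\<phi> h\<close>
  is not differentiated and enters only as a factor in [0,1].\<close>

lemma cutoff_deriv:
  assumes h: "0 < h"
  shows "frechet_derivative (cutoff h) (at z) (st_dir i) = frechet_derivative (eta \<Omega> h) (at (snd z)) (axis i 1) * \<phi> h (fst z)"
proof -
  have "linear (frechet_derivative (\<phi> h) (at (fst z)))"
    by (rule has_derivative_linear[OF smooth_has_derivative[OF C0_inftyD(1)[OF phi_C0[OF h]]]])
  then show ?thesis
    unfolding frechet_eq[OF has_derivative_cutoff[OF h]] by (simp add: st_dir_def linear_0)
qed

lemma cutoff_nonzero: "0 < h \<Longrightarrow> cutoff h z \<noteq> 0 \<Longrightarrow> fst z \<in> closed_supp (\<phi> h) \<and> snd z \<in> \<Omega> \<and> 2 * h < bd (snd z)"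
  using eta_support[of h "snd z"] C0_inftyD(4)[OF phi_C0, of h "fst z"] by (auto simp: cutoff_def)

lemma cutoff_C0_infty:
  assumes h: "0 < h" shows "cutoff h \<in> C0_infty Q"
proof (rule C0_inftyI[OF cutoff_smooth[OF h]])
  show "compact (closed_supp (\<phi> h) \<times> {x \<in> \<Omega>. 2 * h \<le> bd x})"
    using h by (intro compact_Times compact_inner C0_inftyD(2)[OF phi_C0]) auto
  show "closed_supp (\<phi> h) \<times> {x \<in> \<Omega>. 2 * h \<le> bd x} \<subseteq> Q"
    using C0_inftyD(3)[OF phi_C0[OF h]] by (auto simp: cylinder_def)
  fix z assume "z \<notin> closed_supp (\<phi> h) \<times> {x \<in> \<Omega>. 2 * h \<le> bd x}"
  then show "cutoff h z = 0" using cutoff_nonzero[OF h, of z] by (cases z) fastforce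
qed

lemma cutoff_measurable: "0 < h \<Longrightarrow> cutoff h \<in> borel_measurable lebesgue"
  by (intro continuous_lebesgue_measurable smooth_continuous cutoff_smooth)

lemma cutoff_mult_integrable:
  fixes f :: "real \<times> (real^'d) \<Rightarrow> 'b::euclidean_space"
  shows "0 < h \<Longrightarrow> integrable lebesgue f \<Longrightarrow> integrable lebesgue (\<lambda>z. cutoff h z *\<^sub>R f z)"
  by (rule cutoff_integrable) (auto simp: cutoff_measurable cutoff_nonneg cutoff_le_1)

lemma smoothed_smooth:
  fixes f :: "real \<times> (real^'d) \<Rightarrow> 'b::euclidean_space"
  shows "0 < h \<Longrightarrow> integrable lebesgue (zero_ext Q f) \<Longrightarrow> smooth (smoothed h f)"
  unfolding smoothed_def by (intro convolve_smooth mollifier_C0_infty cutoff_mult_integrable)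

lemma smoothed_nonzero:
  assumes h: "0 < h" and nz: "smoothed h f z \<noteq> 0"
  obtains y where "norm (z - y) < h" "cutoff h y \<noteq> 0"
proof -
  have "\<exists>y. norm (z - y) < h \<and> cutoff h y \<noteq> 0"
  proof (rule ccontr)
    assume n: "\<not> ?thesis"
    have z: "mollifier h (z - y) *\<^sub>R (cutoff h y *\<^sub>R zero_ext Q f y) = 0" for y
    proof (cases "norm (z - y) < h")
      case True
      then have "cutoff h y = 0" using n by blast
      then show ?thesis by simp
    qed (simp add: mollifier_support[OF h])
    show False using nz unfolding smoothed_def convolve_def z by simp
  qed
  then show ?thesis using that by blast
qed

lemma smoothed_nonzero_space:
  assumes h: "0 < h" and nz: "smoothed h f z \<noteq> 0"
  shows "\<exists>s\<in>closed_supp (\<phi> h). \<bar>fst z - s\<bar> < h" "snd z \<in> inner_part \<Omega> h"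
proof -
  obtain y where y: "norm (z - y) < h" "cutoff h y \<noteq> 0" by (rule smoothed_nonzero[OF h nz])
  note c = cutoff_nonzero[OF h y(2)]
  have "\<bar>fst z - fst y\<bar> < h" using y(1) norm_fst_le[of "fst (z - y)" "snd (z - y)"]
    unfolding prod.collapse by simp
  then show "\<exists>s\<in>closed_supp (\<phi> h). \<bar>fst z - s\<bar> < h" using c by blast
  have d: "dist (snd y) (snd z) < h"
    using y(1) norm_snd_le[of "snd (z - y)" "fst (z - y)"]
    unfolding prod.collapse by (simp add: dist_norm norm_minus_commute)
  have "snd z \<in> \<Omega>" by (rule infdist_frontier_ball[of "snd y"]) (use c d h in linarith)+
  moreover have "h < bd (snd z)" using c d infdist_triangle[of "snd y" "frontier \<Omega>" "snd z"] by linarith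
  ultimately show "snd z \<in> inner_part \<Omega> h" by (simp add: inner_part_def)
qed

lemma smoothed_support:
  assumes h: "0 < h"
  shows "{z. smoothed h f z \<noteq> 0} \<subseteq> {h<..<T - h} \<times> inner_part \<Omega> h"
proof
  fix z assume "z \<in> {z. smoothed h f z \<noteq> 0}"
  then have z: "smoothed h f z \<noteq> 0" by simp
  obtain s where "s \<in> closed_supp (\<phi> h)" "\<bar>fst z - s\<bar> < h" using smoothed_nonzero_space(1)[OF h z] by blast
  moreover have "2 * h < s" "s < T - 2 * h" using phi_supp[OF h] calculation by auto
  ultimately show "z \<in> {h<..<T - h} \<times> inner_part \<Omega> h" using smoothed_nonzero_space(2)[OF h z] by (cases z) auto
qed

text \<open>Cutoff support and mollifier radius add up to a compact set common to all f. The compact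
  time support inside the open interval (2h, T - 2h) keeps the inclusion in (h, T - h) strict, while
  in space closedness yields \<open>h \<le> bd x\<close>.\<close>

lemma smoothed_compact_support:
  assumes h: "0 < h"
  obtains K where "compact K" "K \<subseteq> {h<..<T - h} \<times> {x \<in> \<Omega>. h \<le> bd x}" "\<forall>f :: real \<times> (real^'d) \<Rightarrow> 'b::{banach,second_countable_topology}. \<forall>z. z \<notin> K \<longrightarrow> smoothed h f z = 0"
proof (rule that)
  \<comment> \<open>The Minkowski sum of the compact time support with [-h, h] is compact.\<close>
  let ?A = "{s + e | s e. s \<in> closed_supp (\<phi> h) \<and> e \<in> cball 0 h}"
  let ?K = "?A \<times> {x \<in> \<Omega>. h \<le> bd x}"
  show "compact ?K"
    by (rule compact_Times[OF compact_sums[OF C0_inftyD(2)[OF phi_C0[OF h]] compact_cball] compact_inner[OF h]])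
  show "?K \<subseteq> {h<..<T - h} \<times> {x \<in> \<Omega>. h \<le> bd x}"
    using phi_supp[OF h] by (fastforce simp: subset_iff abs_le_iff)
  show "\<forall>f :: real \<times> (real^'d) \<Rightarrow> 'b. \<forall>z. z \<notin> ?K \<longrightarrow> smoothed h f z = 0"
  proof (intro allI impI, rule ccontr)
    fix f :: "real \<times> (real^'d) \<Rightarrow> 'b" and z assume z: "z \<notin> ?K" and nz: "smoothed h f z \<noteq> 0"
    obtain s where s: "s \<in> closed_supp (\<phi> h)" "\<bar>fst z - s\<bar> < h" using smoothed_nonzero_space(1)[OF h nz] by blast
    have "fst z = s + (fst z - s)" "fst z - s \<in> cball 0 h" using s by auto
    then have "fst z \<in> ?A" using s(1) by blast
    then show False using z smoothed_nonzero_space(2)[OF h nz] by (cases z) (auto simp: inner_part_def)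
  qed
qed

lemma smoothed_C0_infty:
  fixes f :: "real \<times> (real^'d) \<Rightarrow> 'b::euclidean_space"
  assumes h: "0 < h" and f: "integrable lebesgue (zero_ext Q f)"
  shows "smoothed h f \<in> C0_infty Q" "closed_supp (smoothed h f) \<subseteq> {h<..<T - h} \<times> {x \<in> \<Omega>. h \<le> infdist x (frontier \<Omega>)}"
proof -
  obtain K where K: "compact K" "K \<subseteq> {h<..<T - h} \<times> {x \<in> \<Omega>. h \<le> bd x}" "\<forall>f :: real \<times> (real^'d) \<Rightarrow> 'b. \<forall>z. z \<notin> K \<longrightarrow> smoothed h f z = 0"
    by (rule smoothed_compact_support[OF h])
  have s: "closed_supp (smoothed h f) \<subseteq> K"
    by (rule closed_supp_subset[OF compact_imp_closed[OF K(1)]]) (use K(3) in blast)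
  then show "closed_supp (smoothed h f) \<subseteq> {h<..<T - h} \<times> {x \<in> \<Omega>. h \<le> infdist x (frontier \<Omega>)}" using K(2) by blast
  have "K \<subseteq> Q" using K(2) h by (fastforce simp: cylinder_def)
  then show "smoothed h f \<in> C0_infty Q"
    by (rule C0_inftyI[OF smoothed_smooth[OF h f] K(1)]) (use K(3) in blast)
qed

text \<open>In the commutator of the symmetric gradient with the smoothing, the derivative falls on the cutoff.\<close>

definition commutator :: "real \<Rightarrow> (real \<times> (real^'d) \<Rightarrow> real^'d) \<Rightarrow> real \<times> (real^'d) \<Rightarrow> real^'d^'d" where
  "commutator h u z = (\<chi> i j. LINT y|lebesgue. mollifier h (z - y) *
     (frechet_derivative (cutoff h) (at y) (st_dir i) * zero_ext Q u y $ j +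
      frechet_derivative (cutoff h) (at y) (st_dir j) * zero_ext Q u y $ i) / 2)"

text \<open>The distributional identity is tested with \<zeta>(y), the product of the mollifier at z
  - y and the cutoff at y. A y-derivative of the mollifier is minus the z-derivative, so that part
  of the product rule reproduces the symmetric gradient of the smoothing; the other part is the
  commutator.\<close>

lemma sym_grad_smoothed:
  assumes h: "0 < h" and distr: "has_distr_sym_grad st_dir Q u E"
    and u: "integrable lebesgue (zero_ext Q u)" and E: "integrable lebesgue (zero_ext Q E)"
  shows "sym_grad st_dir (smoothed h u) z = smoothed h E z + commutator h u z"
proof -
  let ?w = "mollifier h :: real \<times> (real^'d) \<Rightarrow> real"
  let ?k = "cutoff h"
  let ?F = "zero_ext Q u"
  let ?Dw = "\<lambda>i y. frechet_derivative ?w (at (z - y)) (st_dir i)"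
  let ?Dk = "\<lambda>i y. frechet_derivative ?k (at y) (st_dir i)"
  note w = mollifier_C0_infty[OF h, where 'a="real \<times> (real^'d)"]
  note k = cutoff_C0_infty[OF h]
  define \<zeta> where "\<zeta> y = ?w (z - y) * ?k y" for y
  have d\<zeta>: "(\<zeta> has_derivative (\<lambda>v. ?w (z - y) * frechet_derivative ?k (at y) v + (- frechet_derivative ?w (at (z - y)) v) * ?k y)) (at y)" for y
  proof -
    have "((\<lambda>y. z + - y) has_derivative (\<lambda>v. - v)) (at y)"
      by (rule has_derivative_affine[OF bounded_linear_minus[OF bounded_linear_ident]])
    then have "((\<lambda>y. z - y) has_derivative (\<lambda>v. - v)) (at y)" by simp
    from has_derivative_compose[OF this smooth_has_derivative[OF C0_inftyD(1)[OF w]]]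
    have "((\<lambda>y. ?w (z - y)) has_derivative (\<lambda>v. frechet_derivative ?w (at (z - y)) (- v))) (at y)" .
    moreover have "linear (frechet_derivative ?w (at (z - y)))"
      by (rule has_derivative_linear[OF smooth_has_derivative[OF C0_inftyD(1)[OF w]]])
    ultimately have "((\<lambda>y. ?w (z - y)) has_derivative (\<lambda>v. - frechet_derivative ?w (at (z - y)) v)) (at y)"
      by (simp add: linear_neg)
    from has_derivative_mult[OF this smooth_has_derivative[OF cutoff_smooth[OF h]]]
    show ?thesis unfolding \<zeta>_def[abs_def] .
  qed
  have \<zeta>: "\<zeta> \<in> C0_infty Q"
  proof (rule C0_inftyI[OF _ C0_inftyD(2,3)[OF k]])
    have "smooth (\<lambda>y. ?w (z + - y) * ?k y)"
      by (intro smooth_mult smooth_affine[OF C0_inftyD(1)[OF w]] cutoff_smooth h bounded_linear_minus bounded_linear_ident)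
    then show "smooth \<zeta>" by (simp add: \<zeta>_def[abs_def])
    show "\<zeta> y = 0" if "y \<notin> closed_supp ?k" for y using C0_inftyD(4)[OF k that] by (simp add: \<zeta>_def)
  qed
  have D\<zeta>: "frechet_derivative \<zeta> (at y) (st_dir i) = ?w (z - y) * ?Dk i y - ?Dw i y * ?k y" for y i
    by (simp add: frechet_eq[OF d\<zeta>])
  have comp: "(\<integral>y. f y \<partial>lebesgue) $ j = (LINT y|lebesgue. f y $ j)" if "integrable lebesgue f" for f :: "real \<times> (real^'d) \<Rightarrow> real^'d" and j
    using integral_bounded_linear[OF bounded_linear_vec_nth that] by simp
  have i1: "integrable lebesgue (\<lambda>y. ?Dw i y *\<^sub>R (?k y *\<^sub>R ?F y))" for i
    by (rule convolve_integrable[OF C0_infty_deriv[OF w st_dir_Basis] cutoff_mult_integrable[OF h u]])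
  have i2: "integrable lebesgue (\<lambda>y. ?w (z - y) *\<^sub>R (?Dk i y *\<^sub>R ?F y))" for i
    by (intro convolve_integrable[OF w] C0_infty_mult_integrable u
        C0_infty_mono[OF C0_infty_deriv[OF k st_dir_Basis]]) simp
  have i1': "integrable lebesgue (\<lambda>y. ?Dw i y * (?k y * ?F y $ j))" for i j
    using integrable_bounded_linear[OF bounded_linear_vec_nth[of j] i1[of i]] by (simp add: mult.assoc)
  have i2': "integrable lebesgue (\<lambda>y. ?w (z - y) * (?Dk i y * ?F y $ j))" for i j
    using integrable_bounded_linear[OF bounded_linear_vec_nth[of j] i2[of i]] by (simp add: mult.assoc)
  have uD: "u y $ j * frechet_derivative \<zeta> (at y) (st_dir i) = ?w (z - y) * (?Dk i y * ?F y $ j) - ?Dw i y * (?k y * ?F y $ j)" for y i j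
  proof (cases "y \<in> Q")
    case True
    then show ?thesis by (simp add: D\<zeta> zero_ext_def algebra_simps)
  next
    case False
    then show ?thesis using C0_infty_outside(2)[OF \<zeta> False, of "st_dir i"] by (simp add: zero_ext_def)
  qed
  have der: "frechet_derivative (smoothed h u) (at z) (st_dir i) $ j = (LINT y|lebesgue. ?Dw i y * (?k y * ?F y $ j))" for i j
  proof -
    have "frechet_derivative (smoothed h u) (at z) (st_dir i) = convolve (\<lambda>x. frechet_derivative ?w (at x) (st_dir i)) (\<lambda>y. ?k y *\<^sub>R ?F y) z"
      unfolding smoothed_def by (simp add: frechet_eq[OF convolve_has_derivative[OF w cutoff_mult_integrable[OF h u]]])
    then show ?thesis unfolding convolve_def using comp[OF i1, of i j] by (simp add: mult.assoc)
  qed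
  have SE: "smoothed h E z $ i $ j = (LINT y|lebesgue. E y $ i $ j * \<zeta> y)" for i j
  proof -
    have i: "integrable lebesgue (\<lambda>y. ?w (z - y) *\<^sub>R (?k y *\<^sub>R zero_ext Q E y))"
      by (rule convolve_integrable[OF w cutoff_mult_integrable[OF h E]])
    have "smoothed h E z $ i $ j = (LINT y|lebesgue. (?w (z - y) *\<^sub>R (?k y *\<^sub>R zero_ext Q E y)) $ i $ j)"
      unfolding smoothed_def convolve_def using integral_bounded_linear[OF bounded_linear_entry[of i j] i] by simp
    also have "\<dots> = (LINT y|lebesgue. E y $ i $ j * \<zeta> y)"
    proof (rule Bochner_Integration.integral_cong[OF refl])
      fix y show "(?w (z - y) *\<^sub>R (?k y *\<^sub>R zero_ext Q E y)) $ i $ j = E y $ i $ j * \<zeta> y"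
        using C0_infty_outside(1)[OF \<zeta>, of y] by (cases "y \<in> Q") (auto simp: zero_ext_def \<zeta>_def)
    qed
    finally show ?thesis .
  qed
  have "sym_grad st_dir (smoothed h u) z $ i $ j = smoothed h E z $ i $ j + commutator h u z $ i $ j" for i j
  proof -
    have "smoothed h E z $ i $ j = - (LINT y|lebesgue. (u y $ j * frechet_derivative \<zeta> (at y) (st_dir i) + u y $ i * frechet_derivative \<zeta> (at y) (st_dir j)) / 2)"
      unfolding SE by (rule has_distr_sym_gradD[OF distr \<zeta>])
    also have "\<dots> = - ((LINT y|lebesgue. ?w (z - y) * (?Dk i y * ?F y $ j)) - (LINT y|lebesgue. ?Dw i y * (?k y * ?F y $ j))
       + ((LINT y|lebesgue. ?w (z - y) * (?Dk j y * ?F y $ i)) - (LINT y|lebesgue. ?Dw j y * (?k y * ?F y $ i)))) / 2"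
    proof -
      have "(LINT y|lebesgue. (?w (z - y) * (?Dk i y * ?F y $ j) - ?Dw i y * (?k y * ?F y $ j) + (?w (z - y) * (?Dk j y * ?F y $ i) - ?Dw j y * (?k y * ?F y $ i))) / 2)
        = ((LINT y|lebesgue. ?w (z - y) * (?Dk i y * ?F y $ j)) - (LINT y|lebesgue. ?Dw i y * (?k y * ?F y $ j))
         + ((LINT y|lebesgue. ?w (z - y) * (?Dk j y * ?F y $ i)) - (LINT y|lebesgue. ?Dw j y * (?k y * ?F y $ i)))) / 2"
        unfolding integral_divide_zero
        by (intro arg_cong[where f="\<lambda>x. x / 2"],
          (subst Bochner_Integration.integral_add Bochner_Integration.integral_diff; (intro Bochner_Integration.integrable_diff i1' i2')?)+,
          rule refl)
      then show ?thesis unfolding uD by (simp only: minus_divide_left)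
    qed
    finally have 1: "smoothed h E z $ i $ j = \<dots>" .
    have "commutator h u z $ i $ j = (LINT y|lebesgue. (?w (z - y) * (?Dk i y * ?F y $ j) + ?w (z - y) * (?Dk j y * ?F y $ i)) / 2)"
      unfolding commutator_def by (simp add: distrib_left)
    also have "\<dots> = ((LINT y|lebesgue. ?w (z - y) * (?Dk i y * ?F y $ j)) + (LINT y|lebesgue. ?w (z - y) * (?Dk j y * ?F y $ i))) / 2"
      by (simp add: i2')
    finally have 2: "commutator h u z $ i $ j = \<dots>" .
    have "sym_grad st_dir (smoothed h u) z $ i $ j = ((LINT y|lebesgue. ?Dw i y * (?k y * ?F y $ j)) + (LINT y|lebesgue. ?Dw j y * (?k y * ?F y $ i))) / 2"
      unfolding sym_grad_def by (simp add: der)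
    moreover have "(a + b) / 2 = - ((c - a) + (d - b)) / 2 + (c + d) / 2" for a b c d :: real
      by (simp add: field_simps)
    ultimately show ?thesis unfolding 1 2 by (simp only:)
  qed
  then show ?thesis by (simp add: vec_eq_iff)
qed

text \<open>The spatial derivative of the cutoff is at most C/h and vanishes off the strip of width
  3h. The factor d^2 comes from bounding the matrix norm by the sum over its entries.\<close>

lemma commutator_bound:
  "\<exists>C>0. \<forall>h>0. \<forall>u z. zero_ext Q u \<in> borel_measurable lebesgue \<longrightarrow> ennreal (norm (commutator h u z)) \<le> ennreal (C / h) *
     (\<integral>\<^sup>+y. ennreal (mollifier h (z - y)) * (indicator {x \<in> \<Omega>. bd x \<le> 3 * h} (snd y) * ennreal (norm (zero_ext Q u y))) \<partial>lebesgue)"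
proof -
  obtain C where C: "0 < C" "\<And>h x b. 0 < h \<Longrightarrow> \<bar>frechet_derivative (eta \<Omega> h) (at x) b\<bar> \<le> C / h * norm b"
    using eta_deriv_bound by blast
  let ?d = "real CARD('d)"
  show ?thesis
  proof (intro exI[of _ "?d * ?d * C"] conjI allI impI)
    fix h :: real and u :: "real \<times> (real^'d) \<Rightarrow> real^'d" and z assume h: "0 < h" and um [measurable]: "zero_ext Q u \<in> borel_measurable lebesgue"
    let ?N = "{x \<in> \<Omega>. bd x \<le> 3 * h}"
    let ?F = "zero_ext Q u"
    let ?Dk = "\<lambda>i y. frechet_derivative (cutoff h) (at y) (st_dir i)"
    let ?g = "\<lambda>i j y. mollifier h (z - y) * (?Dk i y * ?F y $ j + ?Dk j y * ?F y $ i) / 2"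
    let ?J = "\<lambda>y. ennreal (mollifier h (z - y)) * (indicator ?N (snd y) * ennreal (norm (?F y)))"
    have Dk: "\<bar>?Dk i y\<bar> \<le> C / h * indicat_real ?N (snd y)" for i y
    proof (cases "frechet_derivative (eta \<Omega> h) (at (snd y)) (axis i 1) = 0")
      case True
      then show ?thesis using C h by (simp add: cutoff_deriv)
    next
      case False
      have "\<bar>?Dk i y\<bar> = \<bar>frechet_derivative (eta \<Omega> h) (at (snd y)) (axis i 1)\<bar> * \<phi> h (fst y)"
        using phi_range[OF h, of "fst y"] by (simp add: cutoff_deriv h abs_mult)
      also have "\<dots> \<le> (C / h * 1) * 1"
        using phi_range[OF h, of "fst y"] C(2)[OF h, of "snd y" "axis i 1"] C(1) h by (intro mult_mono) (auto simp: norm_axis_1)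
      finally show ?thesis using eta_deriv_nonzero[OF h False] by simp
    qed
    have g: "ennreal \<bar>?g i j y\<bar> \<le> ennreal (C / h) * ?J y" for i j y
    proof -
      have m0: "0 \<le> mollifier h (z - y)" by (rule mollifier_nonneg[OF h])
      have Ch: "0 \<le> C / h" using C h by simp
      have p: "\<bar>?Dk i y * ?F y $ j\<bar> \<le> C / h * indicat_real ?N (snd y) * norm (?F y)" for i j
        unfolding abs_mult by (intro mult_mono Dk component_le_norm_cart mult_nonneg_nonneg[OF Ch]) auto
      have "\<bar>?Dk i y * ?F y $ j + ?Dk j y * ?F y $ i\<bar> / 2 \<le> C / h * indicat_real ?N (snd y) * norm (?F y)"
      proof -
        have "\<bar>a + b\<bar> / 2 \<le> c" if "\<bar>a\<bar> \<le> c" "\<bar>b\<bar> \<le> c" for a b c :: real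
          using that abs_triangle_ineq[of a b] by (simp add: field_simps)
        from this[OF p p] show ?thesis .
      qed
      then have "mollifier h (z - y) * (\<bar>?Dk i y * ?F y $ j + ?Dk j y * ?F y $ i\<bar> / 2) \<le> mollifier h (z - y) * (C / h * indicat_real ?N (snd y) * norm (?F y))"
        by (rule mult_left_mono[OF _ m0])
      then have "\<bar>?g i j y\<bar> \<le> C / h * (mollifier h (z - y) * (indicat_real ?N (snd y) * norm (?F y)))"
        using m0 by (simp add: abs_mult mult_ac)
      then have "ennreal \<bar>?g i j y\<bar> \<le> ennreal (C / h * (mollifier h (z - y) * (indicat_real ?N (snd y) * norm (?F y))))"
        by (rule ennreal_leI)
      also have "\<dots> = ennreal (C / h) * ?J y"
      proof -
        have i0: "0 \<le> indicat_real ?N (snd y)" by simp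
        show ?thesis
          using Ch m0 i0 by (simp only: ennreal_mult mult_nonneg_nonneg norm_ge_zero ennreal_indicator)
      qed
      finally show ?thesis .
    qed
    have J: "(\<integral>\<^sup>+y. ennreal (C / h) * ?J y \<partial>lebesgue) \<le> ennreal (C / h) * (\<integral>\<^sup>+y. ?J y \<partial>lebesgue)"
    proof (rule eq_refl, rule nn_integral_cmult)
      have "?N = \<Omega> \<inter> {x. bd x \<le> 3 * h}" by auto
      moreover have "closed {x. bd x \<le> 3 * h}" by (intro closed_Collect_le continuous_intros)
      ultimately have [measurable]: "?N \<in> sets borel" using open_dom by auto
      have [measurable]: "(\<lambda>y. indicator ?N (snd y) :: ennreal) \<in> borel_measurable (lebesgue :: (real \<times> (real^'d)) measure)"
        by (intro measurable_completion) (simp flip: borel_prod)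
      have [measurable]: "(\<lambda>y. mollifier h (z - y)) \<in> borel_measurable lebesgue"
        by (intro measurable_completion) simp
      show "?J \<in> borel_measurable lebesgue" by measurable
    qed
    have e: "ennreal \<bar>commutator h u z $ i $ j\<bar> \<le> ennreal (C / h) * (\<integral>\<^sup>+y. ?J y \<partial>lebesgue)" for i j
    proof (cases "integrable lebesgue (?g i j)")
      case True
      have "ennreal \<bar>commutator h u z $ i $ j\<bar> \<le> (\<integral>\<^sup>+y. ennreal \<bar>?g i j y\<bar> \<partial>lebesgue)"
        using integral_norm_bound_ennreal[OF True] by (simp add: commutator_def)
      also have "\<dots> \<le> (\<integral>\<^sup>+y. ennreal (C / h) * ?J y \<partial>lebesgue)" by (rule nn_integral_mono) (rule g)
      also note J
      finally show ?thesis .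
    next
      \<comment> \<open>The Bochner integral of a function that is not integrable is 0.\<close>
      case False
      have "commutator h u z $ i $ j = 0"
        unfolding commutator_def vec_lambda_beta by (rule not_integrable_integral_eq[OF False])
      then show ?thesis by simp
    qed
    have "ennreal (norm (commutator h u z)) \<le> ennreal (\<Sum>i\<in>UNIV. \<Sum>j\<in>UNIV. \<bar>commutator h u z $ i $ j\<bar>)"
      by (intro ennreal_leI norm_matrix_le_sum)
    also have "\<dots> = (\<Sum>i\<in>UNIV. \<Sum>j\<in>UNIV. ennreal \<bar>commutator h u z $ i $ j\<bar>)"
      by (simp add: sum_ennreal sum_nonneg flip: sum_ennreal)
    also have "\<dots> \<le> (\<Sum>i\<in>(UNIV::'d set). \<Sum>j\<in>(UNIV::'d set). ennreal (C / h) * (\<integral>\<^sup>+y. ?J y \<partial>lebesgue))"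
      by (intro sum_mono e)
    also have "\<dots> = ennreal (?d * ?d * C / h) * (\<integral>\<^sup>+y. ?J y \<partial>lebesgue)"
      using C h by (simp add: ennreal_of_nat_eq_real_of_nat mult.assoc[symmetric] flip: ennreal_mult)
    finally show "ennreal (norm (commutator h u z)) \<le> ennreal (?d * ?d * C / h) * (\<integral>\<^sup>+y. ?J y \<partial>lebesgue)" .
  qed (use C in auto)
qed

end

section \<open>Test functions in the energy space\<close>

lemma continuous_loc_integrable:
  fixes f :: "'a::euclidean_space \<Rightarrow> 'b::euclidean_space"
  assumes "continuous_on UNIV f"
  shows "loc_integrable G f"
  unfolding loc_integrable_def
proof (intro allI impI)
  fix K assume K: "compact K \<and> K \<subseteq> G"
  have [measurable]: "f \<in> borel_measurable borel" by (rule borel_measurable_continuous_onI[OF assms])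
  have [measurable]: "K \<in> sets borel" using K borel_compact by blast
  have "set_integrable lborel K f"
    unfolding set_integrable_def
    by (rule borel_integrable_compact[OF conjunct1[OF K] continuous_on_subset[OF assms subset_UNIV]])
  then show "set_integrable lebesgue K f"
    unfolding set_integrable_def by (subst integrable_completion) auto
qed

lemma smooth_component: "smooth v \<Longrightarrow> smooth (\<lambda>x. v x $ j :: real)"
proof -
  assume "smooth v"
  then have "smooth (\<lambda>x. v x \<bullet> axis j 1)" by (simp add: smooth_iff_Ck Ck_inner Ck_const)
  then show ?thesis by (simp add: inner_axis)
qed

lemma frechet_derivative_component:
  assumes "smooth v"
  shows "frechet_derivative (\<lambda>x. v x $ j) (at x) b = frechet_derivative v (at x) b $ j"
  by (simp add: frechet_eq[OF bounded_linear.has_derivative[OF bounded_linear_vec_nth smooth_has_derivative[OF assms]]])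

lemma sym_grad_continuous:
  assumes "smooth v" "\<And>i. e i \<in> Basis"
  shows "continuous_on UNIV (sym_grad e v)"
  unfolding sym_grad_def[abs_def]
  by (intro continuous_on_vec_lambda continuous_intros smooth_continuous[OF smooth_deriv[OF assms(1)]] assms(2)) auto

lemma sym_grad_outside: "x \<notin> closed_supp v \<Longrightarrow> sym_grad e v x = 0"
  by (simp add: sym_grad_def closed_supp_deriv vec_eq_iff)

text \<open>Integration by parts: the integral of every partial derivative of \<open>v $ j\<close>
  times \<zeta> vanishes. Hence the distributional gradient of a test function can be computed
  classically.\<close>

lemma C0_infty_has_distr_sym_grad:
  fixes v :: "'a::euclidean_space \<Rightarrow> real^'d::finite"
  assumes v: "v \<in> C0_infty G" and e: "\<And>i. e i \<in> Basis"
  shows "has_distr_sym_grad e G v (sym_grad e v)"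
  unfolding has_distr_sym_grad_iff
proof (intro conjI allI impI)
  note sv = C0_inftyD(1)[OF v]
  show "loc_integrable G v" by (intro continuous_loc_integrable smooth_continuous sv)
  show "loc_integrable G (sym_grad e v)" by (intro continuous_loc_integrable sym_grad_continuous sv e)
  fix \<zeta> :: "'a \<Rightarrow> real" and i j assume z: "\<zeta> \<in> C0_infty G"
  note sz = C0_inftyD(1)[OF z]
  have p: "(\<lambda>x. a x * b x) \<in> C0_infty G" if "smooth a" "b \<in> C0_infty G" for a b :: "'a \<Rightarrow> real"
    by (rule C0_inftyI[OF smooth_mult[OF that(1) C0_inftyD(1)[OF that(2)]] C0_inftyD(2,3)[OF that(2)]])
       (simp add: C0_inftyD(4)[OF that(2)])
  have der: "frechet_derivative (\<lambda>x. v x $ j * \<zeta> x) (at x) b = v x $ j * frechet_derivative \<zeta> (at x) b + frechet_derivative v (at x) b $ j * \<zeta> x" for x b j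
    using frechet_eq[OF has_derivative_mult[OF smooth_has_derivative[OF smooth_component[OF sv]] smooth_has_derivative[OF sz]]]
    by (simp add: frechet_derivative_component[OF sv])
  have i1: "integrable lebesgue (\<lambda>x. v x $ j * frechet_derivative \<zeta> (at x) (e i))" for i j
    by (rule C0_infty_integrable(1)[OF p[OF smooth_component[OF sv] C0_infty_deriv[OF z e]]])
  have i2: "integrable lebesgue (\<lambda>x. frechet_derivative v (at x) (e i) $ j * \<zeta> x)" for i j
    by (rule C0_infty_integrable(1)[OF p[OF smooth_component[OF smooth_deriv[OF sv e]] z]])
  have I: "(LINT x|lebesgue. v x $ j * frechet_derivative \<zeta> (at x) (e i)) = - (LINT x|lebesgue. frechet_derivative v (at x) (e i) $ j * \<zeta> x)" for i j
  proof -
    have "(LINT x|lebesgue. v x $ j * frechet_derivative \<zeta> (at x) (e i) + frechet_derivative v (at x) (e i) $ j * \<zeta> x) = 0"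
      using C0_infty_deriv_integral[OF p[OF smooth_component[OF sv, of j] z], of "e i"] unfolding der .
    then show ?thesis using i1 i2 by (simp add: add_eq_0_iff)
  qed
  have "(LINT z|lebesgue. sym_grad e v z $ i $ j * \<zeta> z) = (LINT x|lebesgue. (frechet_derivative v (at x) (e i) $ j * \<zeta> x + frechet_derivative v (at x) (e j) $ i * \<zeta> x) / 2)"
    by (simp add: sym_grad_def algebra_simps add_divide_distrib)
  also have "\<dots> = ((LINT x|lebesgue. frechet_derivative v (at x) (e i) $ j * \<zeta> x) + (LINT x|lebesgue. frechet_derivative v (at x) (e j) $ i * \<zeta> x)) / 2"
    by (simp add: i2)
  also have "\<dots> = - (((LINT x|lebesgue. v x $ j * frechet_derivative \<zeta> (at x) (e i)) + (LINT x|lebesgue. v x $ i * frechet_derivative \<zeta> (at x) (e j))) / 2)"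
    unfolding I by (simp add: field_simps)
  also have "\<dots> = - (LINT z|lebesgue. (v z $ j * frechet_derivative \<zeta> (at z) (e i) + v z $ i * frechet_derivative \<zeta> (at z) (e j)) / 2)"
    by (simp add: i1)
  finally show "(LINT z|lebesgue. sym_grad e v z $ i $ j * \<zeta> z) = - (LINT z|lebesgue. (v z $ j * frechet_derivative \<zeta> (at z) (e i) + v z $ i * frechet_derivative \<zeta> (at z) (e j)) / 2)" .
qed

lemma has_distr_sym_grad_diff:
  fixes u v :: "'a::euclidean_space \<Rightarrow> real^'d::finite"
  assumes e: "\<And>i. e i \<in> Basis" and u: "has_distr_sym_grad e G u E" and v: "has_distr_sym_grad e G v E'"
  shows "has_distr_sym_grad e G (\<lambda>x. u x - v x) (\<lambda>x. E x - E' x)"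
  unfolding has_distr_sym_grad_iff
proof (intro conjI allI impI)
  have l: "loc_integrable G u" "loc_integrable G v" "loc_integrable G E" "loc_integrable G E'"
    using u v by (auto simp: has_distr_sym_grad_def)
  then show "loc_integrable G (\<lambda>x. u x - v x)" "loc_integrable G (\<lambda>x. E x - E' x)"
    by (auto intro: loc_integrable_diff)
  fix \<zeta> :: "'a \<Rightarrow> real" and i j assume z: "\<zeta> \<in> C0_infty G"
  have iE: "integrable lebesgue (\<lambda>x. F x $ i $ j * \<zeta> x)" if "loc_integrable G F" for F :: "'a \<Rightarrow> real^'d^'d"
    using loc_integrable_C0_infty[OF loc_integrable_bounded_linear[OF bounded_linear_entry[of i j] that] z]
    by (simp add: mult.commute)
  have iu: "integrable lebesgue (\<lambda>x. (f x $ j * frechet_derivative \<zeta> (at x) (e i) + f x $ i * frechet_derivative \<zeta> (at x) (e j)) / 2)" if f: "loc_integrable G f" for f :: "'a \<Rightarrow> real^'d"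
  proof -
    have "integrable lebesgue (\<lambda>x. f x $ j * frechet_derivative \<zeta> (at x) (e i))" for i j
      using loc_integrable_C0_infty[OF loc_integrable_bounded_linear[OF bounded_linear_vec_nth[of j] f] C0_infty_deriv[OF z e[of i]]]
      by (simp add: mult.commute)
    then show ?thesis by auto
  qed
  have "(LINT z|lebesgue. (E z - E' z) $ i $ j * \<zeta> z) = (LINT z|lebesgue. E z $ i $ j * \<zeta> z) - (LINT z|lebesgue. E' z $ i $ j * \<zeta> z)"
    by (simp add: left_diff_distrib Bochner_Integration.integral_diff[OF iE[OF l(3)] iE[OF l(4)]])
  also have "\<dots> = - ((LINT z|lebesgue. (u z $ j * frechet_derivative \<zeta> (at z) (e i) + u z $ i * frechet_derivative \<zeta> (at z) (e j)) / 2)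
      - (LINT z|lebesgue. (v z $ j * frechet_derivative \<zeta> (at z) (e i) + v z $ i * frechet_derivative \<zeta> (at z) (e j)) / 2))"
    unfolding has_distr_sym_gradD[OF u z] has_distr_sym_gradD[OF v z] by simp
  also have "\<dots> = - (LINT z|lebesgue. (u z $ j * frechet_derivative \<zeta> (at z) (e i) + u z $ i * frechet_derivative \<zeta> (at z) (e j)) / 2
      - (v z $ j * frechet_derivative \<zeta> (at z) (e i) + v z $ i * frechet_derivative \<zeta> (at z) (e j)) / 2)"
    by (subst Bochner_Integration.integral_diff[OF iu[OF l(1)] iu[OF l(2)]]) (rule refl)
  also have "\<dots> = - (LINT z|lebesgue. ((u z - v z) $ j * frechet_derivative \<zeta> (at z) (e i) + (u z - v z) $ i * frechet_derivative \<zeta> (at z) (e j)) / 2)"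
    by (intro arg_cong[where f=uminus] Bochner_Integration.integral_cong refl) (simp add: field_simps)
  finally show "(LINT z|lebesgue. (E z - E' z) $ i $ j * \<zeta> z) = - (LINT z|lebesgue. ((u z - v z) $ j * frechet_derivative \<zeta> (at z) (e i) + (u z - v z) $ i * frechet_derivative \<zeta> (at z) (e j)) / 2)" .
qed

lemma lux_norm_zero: "lux_norm G p (\<lambda>x::'a::euclidean_space. 0 :: 'b::real_normed_vector) = 0"
proof -
  have "((\<lambda>h::nat. lux_norm G p (\<lambda>x. 0 :: 'b)) \<longlongrightarrow> 0) sequentially"
    by (rule lux_norm_tendsto_0I) (simp add: modular_def)
  then show ?thesis using LIMSEQ_unique tendsto_const by blast
qed

text \<open>\<open>distr_sym_grad\<close> is an arbitrary choice, but the norm sees only its class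
  up to null sets, so any concrete E can replace it.\<close>

lemma lux_norm_distr_sym_grad:
  fixes E :: "'a::euclidean_space \<Rightarrow> real^'d::finite^'d"
  assumes "open G" "has_distr_sym_grad e G u E"
  shows "lux_norm G p (distr_sym_grad e G u) = lux_norm G p E"
  using distr_sym_grad_eq_AE[OF assms] assms(1) by (intro lux_norm_cong_AE) (auto elim: eventually_mono)

lemma compact_supp_Lvar:
  fixes f :: "'a::euclidean_space \<Rightarrow> 'b::euclidean_space"
  assumes G: "G \<in> sets lebesgue" and f: "continuous_on UNIV f" and K: "compact K" "\<And>x. x \<notin> K \<Longrightarrow> f x = 0"
    and q: "\<And>x. x \<in> G \<Longrightarrow> 1 \<le> q x" "\<And>x. x \<in> G \<Longrightarrow> q x \<le> P"
  shows "f \<in> Lvar G q"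
proof -
  obtain B where B: "\<And>x. x \<in> K \<Longrightarrow> norm (f x) \<le> B"
    using compact_imp_bounded[OF compact_continuous_image[OF continuous_on_subset[OF f subset_UNIV] K(1)]]
    by (auto simp: bounded_iff)
  have Ks: "K \<in> sets borel" using K borel_compact by blast
  have "modular G q f \<le> (\<integral>\<^sup>+x. ennreal (max 1 B powr P) * indicator K x \<partial>lborel)"
    unfolding modular_eq[OF G]
  proof (rule nn_integral_mono)
    fix x
    show "ennreal (norm (f x) powr q x) * indicator G x \<le> ennreal (max 1 B powr P) * indicator K x"
    proof (cases "x \<in> G \<and> x \<in> K")
      case True
      have "norm (f x) powr q x \<le> max 1 (norm (f x)) powr P"
        using q[of x] True by (intro powr_le_max) auto
      also have "\<dots> \<le> max 1 B powr P" using B[of x] True q[of x] by (intro powr_mono2) auto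
      finally show ?thesis using True by (simp add: ennreal_leI)
    next
      case False
      then show ?thesis using K(2)[of x] by (auto simp: indicator_def)
    qed
  qed
  also have "\<dots> = ennreal (max 1 B powr P) * emeasure lborel K" using Ks by (simp add: nn_integral_cmult_indicator)
  also have "\<dots> < \<infinity>" using emeasure_compact_finite[OF K(1)] by (simp add: ennreal_mult_less_top)
  finally show ?thesis
    using f by (simp add: Lvar_def measurable_restrict_space1 continuous_lebesgue_measurable)
qed

lemma C0_infty_W_eps:
  fixes v :: "'a::euclidean_space \<Rightarrow> real^'d::finite"
  assumes G: "G \<in> sets lebesgue" and v: "v \<in> C0_infty G" and e: "\<And>i. e i \<in> Basis"
    and q: "\<And>x. x \<in> G \<Longrightarrow> 1 \<le> q x" "\<And>x. x \<in> G \<Longrightarrow> q x \<le> P"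
    and p: "\<And>x. x \<in> G \<Longrightarrow> 1 \<le> p x" "\<And>x. x \<in> G \<Longrightarrow> p x \<le> P'"
  shows "v \<in> W_eps e G q p" "sym_grad e v \<in> Lvar G p"
proof -
  have 1: "v \<in> Lvar G q"
    by (rule compact_supp_Lvar[OF G smooth_continuous[OF C0_inftyD(1)[OF v]] C0_inftyD(2)[OF v] C0_inftyD(4)[OF v] q])
  show 2: "sym_grad e v \<in> Lvar G p"
    by (rule compact_supp_Lvar[OF G sym_grad_continuous[OF C0_inftyD(1)[OF v] e] C0_inftyD(2)[OF v] sym_grad_outside p])
  show "v \<in> W_eps e G q p"
    unfolding W_eps_def using 1 2 C0_infty_has_distr_sym_grad[of v G e, OF v e] by blast
qed

lemma C0_infty_X_eps:
  assumes \<Omega>: "open \<Omega>" and v: "v \<in> C0_infty \<Omega>"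
    and q: "\<And>x. x \<in> \<Omega> \<Longrightarrow> 1 \<le> q x" "\<And>x. x \<in> \<Omega> \<Longrightarrow> q x \<le> P"
    and p: "\<And>x. x \<in> \<Omega> \<Longrightarrow> 1 \<le> p x" "\<And>x. x \<in> \<Omega> \<Longrightarrow> p x \<le> P'"
  shows "v \<in> X_eps \<Omega> q p"
proof -
  have s: "\<Omega> \<in> sets lebesgue" using \<Omega> by auto
  have "has_distr_sym_grad space_dir \<Omega> (\<lambda>x. v x - v x) (\<lambda>x. sym_grad space_dir v x - sym_grad space_dir v x)"
    by (intro has_distr_sym_grad_diff C0_infty_has_distr_sym_grad v space_dir_Basis)
  then have "eps_norm space_dir \<Omega> q p (\<lambda>x. v x - v x) = 0"
    unfolding eps_norm_def by (simp add: lux_norm_distr_sym_grad[OF \<Omega>] lux_norm_zero)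
  moreover have "v \<in> W_eps space_dir \<Omega> q p"
    by (rule C0_infty_W_eps(1)[OF s v space_dir_Basis q p])
  ultimately show ?thesis
    unfolding X_eps_def using v by (auto intro!: bexI[of _ v])
qed

text \<open>Each slice of a test function on the cylinder is a test function on \<Omega> and so lies
  in the closure that defines \<open>X_eps\<close>.\<close>

lemma C0_infty_XX_eps:
  fixes \<Omega> :: "(real^'d::finite) set"
  assumes \<Omega>: "open \<Omega>" and v: "v \<in> C0_infty (cylinder T \<Omega>)" and q: "q \<in> P_log (cylinder T \<Omega>)" and p: "p \<in> P_log (cylinder T \<Omega>)"
  shows "v \<in> XX_eps T \<Omega> q p"
proof -
  let ?Q = "cylinder T \<Omega>"
  have "open ?Q" using \<Omega> by (simp add: cylinder_def open_Times)
  then have s: "?Q \<in> sets lebesgue" by auto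
  obtain P P' where P: "\<And>x. x \<in> ?Q \<Longrightarrow> q x \<le> P" and P': "\<And>x. x \<in> ?Q \<Longrightarrow> p x \<le> P'"
    using P_logD(3)[OF q] P_logD(3)[OF p] by blast
  have sl: "(\<lambda>x. v (t, x)) \<in> X_eps \<Omega> (\<lambda>x. q (t, x)) (\<lambda>x. p (t, x))" if t: "t \<in> {0<..<T}" for t
  proof (rule C0_infty_X_eps[OF \<Omega>, where P=P and P'=P'])
    show "(\<lambda>x. v (t, x)) \<in> C0_infty \<Omega>"
    proof (rule C0_inftyI)
      have "bounded_linear (\<lambda>x. (0, x) :: real \<times> (real^'d))" by (intro bounded_linear_Pair bounded_linear_zero bounded_linear_ident)
      from smooth_affine[OF C0_inftyD(1)[OF v] this, of "(t, 0)"]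
      show "smooth (\<lambda>x. v (t, x))" by simp
      show "compact (snd ` (closed_supp v \<inter> {t} \<times> UNIV))"
        by (intro compact_continuous_image compact_Int_closed C0_inftyD(2)[OF v] closed_Times continuous_intros)
      show "snd ` (closed_supp v \<inter> {t} \<times> UNIV) \<subseteq> \<Omega>" using C0_inftyD(3)[OF v] by (auto simp: cylinder_def)
      fix x assume "x \<notin> snd ` (closed_supp v \<inter> {t} \<times> UNIV)"
      then have "(t, x) \<notin> closed_supp v" by force
      then show "v (t, x) = 0" by (rule C0_inftyD(4)[OF v])
    qed
  qed (use t P P' P_logD(2)[OF q] P_logD(2)[OF p] in \<open>auto simp: cylinder_def\<close>)
  have "v \<in> W_eps st_dir ?Q q p"
    by (rule C0_infty_W_eps(1)[OF s v st_dir_Basis P_logD(2)[OF q] P P_logD(2)[OF p] P'])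
  then show ?thesis unfolding XX_eps_def using sl by (auto intro!: AE_I2)
qed

section \<open>Passage to the exponent 1, and regularity of exponents\<close>

lemma lux_norm_L1_le:
  fixes f :: "'a::euclidean_space \<Rightarrow> 'b::euclidean_space"
  assumes G: "G \<in> sets lebesgue" "bounded G" and q: "\<And>x. x \<in> G \<Longrightarrow> 1 \<le> q x" and qm: "q \<in> borel_measurable (lebesgue_on G)"
    and f: "f \<in> borel_measurable (lebesgue_on G)"
  shows "lux_norm G (\<lambda>_. 1) f \<le> ennreal (measure lebesgue G + 1) * lux_norm G q f"
proof (rule lux_norm_comparison)
  fix l :: real assume l: "0 < l" and f1: "modular G q (\<lambda>x. f x /\<^sub>R l) \<le> 1"
  have fl: "(\<lambda>x. f x /\<^sub>R l) \<in> Lvar G q" using f f1 by (auto simp: Lvar_def order_le_less_trans)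
  have "modular G (\<lambda>_. 1) (\<lambda>x. f x /\<^sub>R l) = (\<integral>\<^sup>+x. ennreal (norm (zero_ext G (\<lambda>x. f x /\<^sub>R l) x)) \<partial>lborel)"
    unfolding modular_eq[OF G(1)] by (rule nn_integral_cong) (simp add: zero_ext_def)
  also have "\<dots> \<le> emeasure lebesgue G + modular G q (\<lambda>x. f x /\<^sub>R l)"
    by (rule Lvar_integrable(2)[OF G fl q qm])
  also have "\<dots> \<le> ennreal (measure lebesgue G) + 1"
    using f1 unfolding bounded_measure_finite[OF G] by (rule add_left_mono)
  finally show "modular G (\<lambda>_. 1) (\<lambda>x. f x /\<^sub>R ((measure lebesgue G + 1) * l)) \<le> 1"
    using l by (intro modular_scale_le[OF f]) (auto simp: ennreal_plus)
qed (simp add: add_nonneg_pos)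

lemma Lvar_L1:
  fixes f :: "'a::euclidean_space \<Rightarrow> 'b::euclidean_space"
  assumes G: "G \<in> sets lebesgue" "bounded G" and q: "\<And>x. x \<in> G \<Longrightarrow> 1 \<le> q x" and qm: "q \<in> borel_measurable (lebesgue_on G)"
    and f: "f \<in> Lvar G q"
  shows "f \<in> Lvar G (\<lambda>_. 1)"
proof -
  have "modular G (\<lambda>_. 1) f = (\<integral>\<^sup>+x. ennreal (norm (zero_ext G f x)) \<partial>lborel)"
    unfolding modular_eq[OF G(1)] by (rule nn_integral_cong) (simp add: zero_ext_def)
  also have "\<dots> < \<infinity>" using Lvar_integrable(1)[OF G f q qm] by (simp add: integrable_lebesgue_nn_integral)
  finally show ?thesis using f by (simp add: Lvar_def)
qed

text \<open>The boundary estimate is formulated for exponents 1, so the slices have to be moved to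
  that space. On a bounded set the embedding has a constant, the measure of \<Omega> plus 1, so a
  test function within \<epsilon> over this constant in the original norm is within \<epsilon> in
  the new one.\<close>

lemma X_eps_L1:
  fixes \<Omega> :: "(real^'d::finite) set"
  assumes \<Omega>: "open \<Omega>" "bounded \<Omega>"
    and q: "\<And>x. x \<in> \<Omega> \<Longrightarrow> 1 \<le> q x" "q \<in> borel_measurable (lebesgue_on \<Omega>)"
    and p: "\<And>x. x \<in> \<Omega> \<Longrightarrow> 1 \<le> p x" "p \<in> borel_measurable (lebesgue_on \<Omega>)"
    and u: "u \<in> X_eps \<Omega> q p"
  shows "u \<in> X_eps \<Omega> (\<lambda>_. 1) (\<lambda>_. 1)"
proof -
  have s: "\<Omega> \<in> sets lebesgue" using \<Omega> by auto
  obtain E where E: "E \<in> Lvar \<Omega> p" "has_distr_sym_grad space_dir \<Omega> u E" and uL: "u \<in> Lvar \<Omega> q"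
    using u by (auto simp: X_eps_def W_eps_def)
  have "u \<in> W_eps space_dir \<Omega> (\<lambda>_. 1) (\<lambda>_. 1)"
    unfolding W_eps_def using E Lvar_L1[OF s \<Omega>(2) q uL] Lvar_L1[OF s \<Omega>(2) p E(1)] by blast
  moreover have "\<exists>v\<in>C0_infty \<Omega>. eps_norm space_dir \<Omega> (\<lambda>_. 1) (\<lambda>_. 1) (\<lambda>x. u x - v x) < \<epsilon>" if e: "0 < \<epsilon>" for \<epsilon>
  proof -
    let ?K = "measure lebesgue \<Omega> + 1"
    have K: "0 < ?K" by (simp add: add_nonneg_pos)
    have "0 < \<epsilon> / ennreal ?K" using e by (simp add: ennreal_zero_less_divide)
    then obtain v where v: "v \<in> C0_infty \<Omega>" "eps_norm space_dir \<Omega> q p (\<lambda>x. u x - v x) < \<epsilon> / ennreal ?K"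
      using u unfolding X_eps_def by blast
    let ?E = "\<lambda>x. E x - sym_grad space_dir v x"
    have d: "has_distr_sym_grad space_dir \<Omega> (\<lambda>x. u x - v x) ?E"
      by (intro has_distr_sym_grad_diff C0_infty_has_distr_sym_grad v E space_dir_Basis)
    have um [measurable]: "u \<in> borel_measurable (lebesgue_on \<Omega>)" "E \<in> borel_measurable (lebesgue_on \<Omega>)"
      using uL E by (auto simp: Lvar_def)
    have [measurable]: "v \<in> borel_measurable (lebesgue_on \<Omega>)" "sym_grad space_dir v \<in> borel_measurable (lebesgue_on \<Omega>)"
      by (intro measurable_restrict_space1 continuous_lebesgue_measurable smooth_continuous sym_grad_continuous C0_inftyD(1)[OF v(1)] space_dir_Basis)+
    have m: "(\<lambda>x. u x - v x) \<in> borel_measurable (lebesgue_on \<Omega>)" "?E \<in> borel_measurable (lebesgue_on \<Omega>)"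
      by measurable
    have "eps_norm space_dir \<Omega> (\<lambda>_. 1) (\<lambda>_. 1) (\<lambda>x. u x - v x) \<le>
        ennreal ?K * lux_norm \<Omega> q (\<lambda>x. u x - v x) + ennreal ?K * lux_norm \<Omega> p ?E"
      unfolding eps_norm_def lux_norm_distr_sym_grad[OF \<Omega>(1) d]
      by (intro add_mono lux_norm_L1_le[OF s \<Omega>(2)] q p m)
    also have "\<dots> = eps_norm space_dir \<Omega> q p (\<lambda>x. u x - v x) * ennreal ?K"
      unfolding eps_norm_def lux_norm_distr_sym_grad[OF \<Omega>(1) d] by (simp add: distrib_left mult.commute)
    also have "\<dots> < \<epsilon>"
    proof -
      have "eps_norm space_dir \<Omega> q p (\<lambda>x. u x - v x) * ennreal ?K < \<epsilon> / ennreal ?K * ennreal ?K"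
        by (rule ennreal_mult_strict_right_mono[OF v(2)]) (simp_all only: ennreal_less_zero_iff K ennreal_less_top)
      also have "\<dots> = \<epsilon>" using K by (simp add: ennreal_divide_times ennreal_divide_self)
      finally show ?thesis .
    qed
    finally show ?thesis using v(1) by blast
  qed
  ultimately show ?thesis by (simp add: X_eps_def)
qed

text \<open>Joint Lebesgue measurability says nothing about an individual time slice of an exponent;
  continuity makes every slice measurable.\<close>

lemma P_log_continuous:
  fixes q :: "'a::euclidean_space \<Rightarrow> real"
  assumes q: "q \<in> P_log G"
  shows "continuous_on G q"
  unfolding continuous_on_iff
proof (intro ballI allI impI)
  fix x and e :: real assume x: "x \<in> G" and e: "0 < e"
  obtain c where c: "0 < c" "\<And>x y. x \<in> G \<Longrightarrow> y \<in> G \<Longrightarrow> x \<noteq> y \<Longrightarrow> \<bar>q x - q y\<bar> \<le> c / ln (exp 1 + 1 / norm (x - y))"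
    using P_logD(4)[OF q] by blast
  show "\<exists>d>0. \<forall>y\<in>G. dist y x < d \<longrightarrow> dist (q y) (q x) < e"
  \<comment> \<open>For |x - y| < exp(-c/e) the denominator ln(exp 1 + 1/|x - y|) exceeds
    c/e.\<close>
  proof (intro exI[of _ "exp (- (c / e))"] conjI ballI impI)
    fix y assume y: "y \<in> G" "dist y x < exp (- (c / e))"
    show "dist (q y) (q x) < e"
    proof (cases "x = y")
      case False
      then have n: "0 < norm (x - y)" "norm (x - y) < exp (- (c / e))" using y by (auto simp: dist_norm norm_minus_commute)
      have "exp (c / e) < 1 / norm (x - y)"
        using n by (simp add: exp_minus field_simps)
      also have "\<dots> < exp 1 + 1 / norm (x - y)" by simp
      finally have "c / e < ln (exp 1 + 1 / norm (x - y))"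
        using exp_gt_zero[of "c / e"] by (subst ln_exp[symmetric], subst ln_less_cancel_iff) (simp_all add: order_less_trans[of 0 "exp (c / e)"])
      moreover have "0 < c / e" using c e by simp
      ultimately have L: "c < ln (exp 1 + 1 / norm (x - y)) * e" "0 < ln (exp 1 + 1 / norm (x - y))"
        using pos_divide_less_eq[OF e, of c] by (blast intro: order_less_trans)+
      then have "c / ln (exp 1 + 1 / norm (x - y)) < e"
        by (simp only: pos_divide_less_eq mult.commute)
      then show ?thesis using c(2)[OF x y(1) False] by (simp add: dist_real_def abs_minus_commute)
    qed (use e in simp)
  qed simp
qed

section \<open>Time slices\<close>

lemma AE_lebesgue_on:
  assumes "A \<in> sets lebesgue"
  shows "(AE x in lebesgue_on A. P x) \<longleftrightarrow> (AE x in lborel. x \<in> A \<longrightarrow> P x)"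
  using assms by (subst AE_restrict_space_iff) (auto simp: AE_completion_iff)

lemma AE_slice:
  assumes "AE z in (lborel :: (real \<times> 'a::euclidean_space) measure). P z"
  shows "AE t in lborel. AE x in lborel. P (t, x)"
proof -
  have "AE z in lborel \<Otimes>\<^sub>M lborel. P z" unfolding lborel_prod by (rule assms)
  then show ?thesis by (rule lborel_pair.AE_pair)
qed

lemma lebesgue_measurable_AE_cong:
  fixes f g :: "'a::euclidean_space \<Rightarrow> 'b::topological_space"
  assumes g: "g \<in> borel_measurable lebesgue" and eq: "AE x in lborel. f x = g x"
  shows "f \<in> borel_measurable lebesgue"
proof (rule measurableI)
  fix A :: "'b set" assume A: "A \<in> sets borel"
  have c: "complete_measure lebesgue" by (rule completion.complete_measure_axioms)
  show "f -` A \<inter> space lebesgue \<in> sets lebesgue"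
  proof (rule complete_measure.in_sets_AE[OF c])
    show "AE x in lebesgue. x \<in> g -` A \<inter> space lebesgue \<longleftrightarrow> x \<in> f -` A \<inter> space lebesgue"
      unfolding AE_completion_iff using eq by eventually_elim auto
    show "g -` A \<inter> space lebesgue \<in> sets lebesgue" using g A by (rule measurable_sets)
  qed auto
qed auto

lemma integrable_lebesgue_AE_cong:
  fixes f g :: "'a::euclidean_space \<Rightarrow> 'b::{banach, second_countable_topology}"
  assumes g: "integrable lebesgue g" and eq: "AE x in lborel. f x = g x"
  shows "integrable lebesgue f" "integral\<^sup>L lebesgue f = integral\<^sup>L lebesgue g"
proof -
  have m: "f \<in> borel_measurable lebesgue"
    by (rule lebesgue_measurable_AE_cong[OF _ eq]) (use g in auto)
  have ae: "AE x in lebesgue. f x = g x" using eq by (simp add: AE_completion_iff)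
  show "integrable lebesgue f"
    using integrable_cong_AE[OF m _ ae] g by auto
  show "integral\<^sup>L lebesgue f = integral\<^sup>L lebesgue g"
    by (rule integral_cong_AE[OF m _ ae]) (use g in auto)
qed

text \<open>Lebesgue measure on the product is the completion of the Borel product, so Fubini is
  applied to a Borel version of F; for almost every t its slice agrees with that of F almost
  everywhere.\<close>

lemma slice_integral:
  fixes F :: "real \<times> 'a::euclidean_space \<Rightarrow> real"
  assumes F: "integrable lebesgue F"
  shows "AE t in lborel. integrable lebesgue (\<lambda>x. F (t, x))"
    "integrable lebesgue (\<lambda>t. LINT x|lebesgue. F (t, x))"
    "(LINT t|lebesgue. LINT x|lebesgue. F (t, x)) = integral\<^sup>L lebesgue F"
proof -
  have "F \<in> borel_measurable lebesgue" using F by auto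
  then obtain F' where F'm: "F' \<in> borel_measurable lborel" and F': "AE z in lborel. F z = F' z"
    using completion_ex_borel_measurable_real by blast
  have e: "AE z in lborel. F' z = F z" using F' by eventually_elim simp
  have iF': "integrable lebesgue F'" and eF': "integral\<^sup>L lebesgue F' = integral\<^sup>L lebesgue F"
    using integrable_lebesgue_AE_cong[OF F e] by auto
  have lF': "integrable lborel F'" using iF' F'm by (simp add: integrable_completion)
  then have pF': "integrable (lborel \<Otimes>\<^sub>M lborel) F'" by (simp add: lborel_prod)
  have F'b: "(\<lambda>x. F' (t, x)) \<in> borel_measurable lborel" for t
    using F'm by (simp add: borel_prod[symmetric])
  have i1: "AE t in lborel. integrable lborel (\<lambda>x. F' (t, x))"
    by (rule lborel_pair.AE_integrable_fst'[OF pF'])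
  have s: "AE t in lborel. AE x in lborel. F (t, x) = F' (t, x)" by (rule AE_slice[OF F'])
  have both: "AE t in lborel. integrable lebesgue (\<lambda>x. F (t, x)) \<and> (LINT x|lebesgue. F (t, x)) = (LINT x|lborel. F' (t, x))"
    using i1 s
  proof eventually_elim
    case (elim t)
    then have "integrable lebesgue (\<lambda>x. F' (t, x))" using F'b by (simp add: integrable_completion)
    from integrable_lebesgue_AE_cong[OF this elim(2)] show ?case
      using F'b by (simp add: integral_completion)
  qed
  then show "AE t in lborel. integrable lebesgue (\<lambda>x. F (t, x))" by eventually_elim simp
  have i2: "integrable lborel (\<lambda>t. LINT x|lborel. F' (t, x))"
    by (rule lborel_pair.integrable_fst'[OF pF'])
  then have i3: "integrable lebesgue (\<lambda>t. LINT x|lborel. F' (t, x))"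
    by (subst integrable_completion) auto
  have ae: "AE t in lborel. (LINT x|lebesgue. F (t, x)) = (LINT x|lborel. F' (t, x))"
    using both by eventually_elim simp
  show "integrable lebesgue (\<lambda>t. LINT x|lebesgue. F (t, x))"
    by (rule integrable_lebesgue_AE_cong(1)[OF i3 ae])
  have "(LINT t|lebesgue. LINT x|lebesgue. F (t, x)) = (LINT t|lebesgue. LINT x|lborel. F' (t, x))"
    by (rule integrable_lebesgue_AE_cong(2)[OF i3 ae])
  also have "\<dots> = (LINT t|lborel. LINT x|lborel. F' (t, x))"
    using i2 by (intro integral_completion) auto
  also have "\<dots> = integral\<^sup>L (lborel \<Otimes>\<^sub>M lborel) F'" by (rule lborel_pair.integral_fst'[OF pF'])
  also have "\<dots> = integral\<^sup>L lborel F'" by (simp add: lborel_prod)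
  also have "\<dots> = integral\<^sup>L lebesgue F" using F'm eF' by (simp add: integral_completion)
  finally show "(LINT t|lebesgue. LINT x|lebesgue. F (t, x)) = integral\<^sup>L lebesgue F" .
qed

lemma slice_integrable:
  fixes F :: "real \<times> 'a::euclidean_space \<Rightarrow> 'b::euclidean_space"
  assumes F: "integrable lebesgue F"
  shows "AE t in lborel. integrable lebesgue (\<lambda>x. F (t, x))"
proof -
  have "AE t in lborel. integrable lebesgue (\<lambda>x. F (t, x) \<bullet> b)" for b
    by (rule slice_integral(1)) (use F in auto)
  then have "AE t in lborel. \<forall>b\<in>Basis. integrable lebesgue (\<lambda>x. F (t, x) \<bullet> b)"
    by (intro AE_ball_countable[THEN iffD2]) (auto intro: countable_finite)
  then show ?thesis
  proof eventually_elim
    case (elim t)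
    then have "integrable lebesgue (\<lambda>x. \<Sum>b\<in>Basis. (F (t, x) \<bullet> b) *\<^sub>R b)" by auto
    then show ?case by (simp add: euclidean_representation)
  qed
qed

lemma bounded_continuous_mult_integrable:
  fixes f :: "'a::euclidean_space \<Rightarrow> 'b::euclidean_space"
  assumes w: "continuous_on UNIV w" "\<And>x. \<bar>w x\<bar> \<le> B" and f: "integrable lebesgue f"
  shows "integrable lebesgue (\<lambda>x. w x *\<^sub>R f x)"
proof -
  have [measurable]: "w \<in> borel_measurable lebesgue" by (rule continuous_lebesgue_measurable[OF w(1)])
  have [measurable]: "f \<in> borel_measurable lebesgue" using f by auto
  have B: "0 \<le> B" using w(2) abs_ge_zero order_trans by blast
  show ?thesis
    by (rule Bochner_Integration.integrable_bound[of _ "\<lambda>y. B *\<^sub>R f y"])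
       (use f w B in \<open>auto intro!: mult_right_mono\<close>)
qed

section \<open>The commutator near the boundary\<close>

text \<open>Dyadic decomposition of the ball around the singularity.\<close>

lemma riesz_kernel_integral:
  "\<exists>\<kappa>>0. \<forall>R>0. (\<integral>\<^sup>+x. ennreal (norm (x :: 'a::euclidean_space) powr (1 - real DIM('a))) * indicator (ball 0 R) x \<partial>lborel) \<le> ennreal (\<kappa> * R)"
proof -
  let ?n = "DIM('a)"
  let ?w = "unit_ball_vol (real ?n)"
  obtain m where m: "?n = Suc m" using DIM_positive[where 'a='a] gr0_implies_Suc by blast
  show ?thesis
  proof (intro exI[of _ "?w * 2 ^ m * 2"] conjI allI impI)
    fix R :: real assume R: "0 < R"
    have le_suminf: "f k \<le> suminf f" for f :: "nat \<Rightarrow> ennreal" and k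
      using sum_le_suminf[OF summableI, of "{k}" f] by simp
    have e: "t powr (1 - real ?n) = 1 / t ^ m" if "0 < t" for t :: real
      using that by (simp add: m powr_minus_divide powr_realpow)
    have "(\<integral>\<^sup>+x. ennreal (norm (x::'a) powr (1 - real ?n)) * indicator (ball 0 R) x \<partial>lborel) \<le>
        (\<integral>\<^sup>+x. (\<Sum>k. ennreal (1 / (R / 2 ^ Suc k) ^ m) * indicator (ball (0::'a) (R / 2 ^ k)) x) \<partial>lborel)"
    proof (rule nn_integral_mono)
      fix x :: 'a
      show "ennreal (norm x powr (1 - real ?n)) * indicator (ball 0 R) x \<le> (\<Sum>k. ennreal (1 / (R / 2 ^ Suc k) ^ m) * indicator (ball 0 (R / 2 ^ k)) x)"
      proof (cases "0 < norm x \<and> norm x < R")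
        case True
        have "\<exists>k. R / 2 ^ k \<le> norm x"
        proof -
          obtain k where "R / norm x < 2 ^ k" using real_arch_pow[of 2 "R / norm x"] by auto
          then have "R / 2 ^ k \<le> norm x" using True by (simp add: field_simps)
          then show ?thesis by blast
        qed
        \<comment> \<open>Minimality places x in the dyadic shell between R/2^K and
          R/2^(K-1).\<close>
        define K where "K = (LEAST k. R / 2 ^ k \<le> norm x)"
        have K: "R / 2 ^ K \<le> norm x" unfolding K_def by (rule LeastI_ex) fact
        have "K \<noteq> 0" using K True by (cases K) auto
        then obtain k where k: "K = Suc k" using not0_implies_Suc by blast
        have "\<not> R / 2 ^ k \<le> norm x" by (rule not_less_Least) (simp add: k K_def[symmetric])
        then have x: "norm x < R / 2 ^ k" "R / 2 ^ Suc k \<le> norm x" using K k by auto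
        have "norm x powr (1 - real ?n) = 1 / norm x ^ m" using True by (simp add: e)
        also have "\<dots> \<le> 1 / (R / 2 ^ Suc k) ^ m"
          using x R True by (intro divide_left_mono power_mono mult_pos_pos zero_less_power) auto
        finally have "ennreal (norm x powr (1 - real ?n)) * indicator (ball 0 R) x \<le> ennreal (1 / (R / 2 ^ Suc k) ^ m) * indicator (ball 0 (R / 2 ^ k)) x"
          using True x by (simp add: ennreal_leI)
        also have "\<dots> \<le> (\<Sum>k. ennreal (1 / (R / 2 ^ Suc k) ^ m) * indicator (ball 0 (R / 2 ^ k)) x)"
          by (rule le_suminf[where f="\<lambda>k. ennreal (1 / (R / 2 ^ Suc k) ^ m) * indicator (ball 0 (R / 2 ^ k)) x"])
        finally show ?thesis .
      qed auto
    qed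
    \<comment> \<open>On the k-th ball the kernel bound (R/2^(k+1))^(1-n) times the volume w
      (R/2^k)^n equals w 2^(n-1) R 2^(-k); the geometric series then adds the factor 2.\<close>
    also have "\<dots> = (\<Sum>k. ennreal (?w * 2 ^ m * R * (1 / 2) ^ k))"
    proof (subst nn_integral_suminf)
      have "(\<integral>\<^sup>+x. ennreal (1 / (R / 2 ^ Suc k) ^ m) * indicator (ball (0::'a) (R / 2 ^ k)) x \<partial>lborel) = ennreal (?w * 2 ^ m * R * (1 / 2) ^ k)" for k
      proof -
        have "1 / (R / 2 ^ Suc k) ^ m * (?w * (R / 2 ^ k) ^ ?n) = ?w * 2 ^ m * R * (1 / 2) ^ k"
          using R by (simp add: m power_divide power_mult_distrib field_simps)
        then show ?thesis
          using R by (subst nn_integral_cmult_indicator) (auto simp: emeasure_ball simp flip: ennreal_mult)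
      qed
      then show "(\<Sum>k. \<integral>\<^sup>+x. ennreal (1 / (R / 2 ^ Suc k) ^ m) * indicator (ball (0::'a) (R / 2 ^ k)) x \<partial>lborel) = (\<Sum>k. ennreal (?w * 2 ^ m * R * (1 / 2) ^ k))"
        by simp
    qed (intro borel_measurable_times_ennreal borel_measurable_const borel_measurable_indicator, simp)
    also have "\<dots> = ennreal (\<Sum>k. ?w * 2 ^ m * R * (1 / 2) ^ k)"
      using R by (intro suminf_ennreal2 summable_mult summable_geometric) auto
    also have "(\<Sum>k. ?w * 2 ^ m * R * (1 / 2 :: real) ^ k) = ?w * 2 ^ m * 2 * R"
      using suminf_geometric[of "1/2 :: real"] by (subst suminf_mult) (auto intro!: summable_geometric)
    finally show "(\<integral>\<^sup>+x. ennreal (norm (x::'a) powr (1 - real ?n)) * indicator (ball 0 R) x \<partial>lborel) \<le> ennreal (?w * 2 ^ m * 2 * R)" .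
  qed simp
qed

context smoothing
begin

text \<open>For a fixed test function \<psi> on \<Omega>, products \<theta>(t) \<psi>(x) are
  admissible on the cylinder, and the fundamental lemma in t separates the slices. The exceptional
  set of times obtained this way depends on \<psi>.\<close>

lemma slice_test:
  assumes distr: "has_distr_sym_grad st_dir Q u E"
    and u: "integrable lebesgue (zero_ext Q u)" and E: "integrable lebesgue (zero_ext Q E)" and \<psi>: "\<psi> \<in> C0_infty \<Omega>"
  shows "AE t in lborel. t \<in> {0<..<T} \<longrightarrow> (LINT x|lebesgue. E (t, x) $ i $ j * \<psi> x) =
    - (LINT x|lebesgue. (u (t, x) $ j * frechet_derivative \<psi> (at x) (space_dir i) + u (t, x) $ i * frechet_derivative \<psi> (at x) (space_dir j)) / 2)"
proof -
  note s\<psi> = C0_inftyD(1)[OF \<psi>]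
  let ?D = "\<lambda>i x. frechet_derivative \<psi> (at x) (space_dir i)"
  let ?u = "zero_ext Q u"
  let ?E = "zero_ext Q E"
  \<comment> \<open>The defect of the identity on slices, extended by 0 so that it is integrable on
    the whole space-time; its slice integrals are to vanish.\<close>
  define g where "g z = ?E z $ i $ j * \<psi> (snd z) + (?u z $ j * ?D i (snd z) + ?u z $ i * ?D j (snd z)) / 2" for z
  have b: "integrable lebesgue (\<lambda>z. f z * w (snd z))" if w: "w \<in> C0_infty \<Omega>" and f: "integrable lebesgue f" for f :: "real \<times> (real^'d) \<Rightarrow> real" and w :: "real^'d \<Rightarrow> real"
  proof -
    obtain B where B: "0 < B" "\<And>x. norm (w x) \<le> B" by (rule C0_infty_bounded[OF w]) blast
    have "continuous_on UNIV (\<lambda>z::real \<times> (real^'d). w (snd z))"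
      by (rule continuous_on_compose2[OF smooth_continuous[OF C0_inftyD(1)[OF w], of UNIV]]) (auto intro: continuous_intros)
    from bounded_continuous_mult_integrable[OF this _ f, of B] B show ?thesis by (simp add: mult.commute)
  qed
  have b': "integrable lebesgue (\<lambda>x. f x * w x)" if "w \<in> C0_infty \<Omega>" "integrable lebesgue f" for f w :: "real^'d \<Rightarrow> real"
    using C0_infty_mult_integrable[OF C0_infty_mono[OF that(1) subset_UNIV] that(2)] by (simp add: mult.commute)
  have D: "?D i \<in> C0_infty \<Omega>" for i by (rule C0_infty_deriv[OF \<psi> space_dir_Basis])
  have iE: "integrable lebesgue (\<lambda>z. ?E z $ i $ j)" by (rule integrable_bounded_linear[OF bounded_linear_entry E])
  have iu: "integrable lebesgue (\<lambda>z. ?u z $ j)" for j by (rule integrable_bounded_linear[OF bounded_linear_vec_nth u])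
  have ig: "integrable lebesgue g"
    unfolding g_def[abs_def] by (intro Bochner_Integration.integrable_add integrable_divide_zero b \<psi> D iE iu)
  have zero: "AE t in lborel. t \<in> {0<..<T} \<longrightarrow> (LINT x|lebesgue. g (t, x)) = 0"
  proof (rule fundamental_lemma_mollifier[OF open_greaterThanLessThan _ closure_UNIV])
    have "loc_integrable UNIV (\<lambda>t. LINT x|lebesgue. g (t, x))"
      using slice_integral(2)[OF ig] by (intro integrable_loc_integrable) (simp add: zero_ext_def[abs_def])
    then show "loc_integrable {0<..<T} (\<lambda>t. LINT x|lebesgue. g (t, x))" by (simp add: loc_integrable_def)
    fix y n assume "cball y (1 / real (Suc n)) \<subseteq> {0<..<T}"
    then have th: "(\<lambda>t. mollifier (1 / real (Suc n)) (y - t)) \<in> C0_infty {0<..<T}"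
      by (intro mollifier_test_function) auto
    define \<theta> where "\<theta> t = mollifier (1 / real (Suc n)) (y - t)" for t
    have \<theta>: "\<theta> \<in> C0_infty {0<..<T}" using th by (simp add: \<theta>_def[abs_def])
    define \<zeta> where "\<zeta> z = \<theta> (fst z) * \<psi> (snd z)" for z :: "real \<times> (real^'d)"
    have \<zeta>: "\<zeta> \<in> C0_infty Q"
    proof (rule C0_inftyI)
      have "smooth (\<lambda>z. \<theta> (0 + fst z) * \<psi> (0 + snd z))"
        by (intro smooth_mult smooth_affine[OF C0_inftyD(1)[OF \<theta>]] smooth_affine[OF s\<psi>] bounded_linear_snd bounded_linear_fst)
      then show "smooth \<zeta>" by (simp add: \<zeta>_def[abs_def])
      show "compact (closed_supp \<theta> \<times> closed_supp \<psi>)" by (intro compact_Times C0_inftyD(2)[OF \<theta>] C0_inftyD(2)[OF \<psi>])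
      show "closed_supp \<theta> \<times> closed_supp \<psi> \<subseteq> Q" using C0_inftyD(3)[OF \<theta>] C0_inftyD(3)[OF \<psi>] by (auto simp: cylinder_def)
      fix z assume "z \<notin> closed_supp \<theta> \<times> closed_supp \<psi>"
      then have "fst z \<notin> closed_supp \<theta> \<or> snd z \<notin> closed_supp \<psi>" by (cases z) auto
      then show "\<zeta> z = 0" using C0_inftyD(4)[OF \<theta>] C0_inftyD(4)[OF \<psi>] by (auto simp: \<zeta>_def)
    qed
    have D\<zeta>: "frechet_derivative \<zeta> (at z) (st_dir i) = \<theta> (fst z) * ?D i (snd z)" for z i
    proof -
      have "((\<lambda>z. \<theta> (fst z) * \<psi> (snd z)) has_derivative (\<lambda>v. \<theta> (fst z) * frechet_derivative \<psi> (at (snd z)) (snd v) + frechet_derivative \<theta> (at (fst z)) (fst v) * \<psi> (snd z))) (at z)"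
        by (rule has_derivative_mult)
           (intro has_derivative_compose[OF has_derivative_snd[OF has_derivative_ident]] has_derivative_compose[OF has_derivative_fst[OF has_derivative_ident]]
             smooth_has_derivative C0_inftyD(1)[OF \<theta>] s\<psi>)+
      moreover have "linear (frechet_derivative \<theta> (at (fst z)))"
        by (rule has_derivative_linear[OF smooth_has_derivative[OF C0_inftyD(1)[OF \<theta>]]])
      ultimately show ?thesis
        unfolding \<zeta>_def[abs_def] by (simp add: frechet_eq st_dir_def space_dir_def linear_0)
    qed
    have \<theta>g: "\<theta> (fst z) * g z = E z $ i $ j * \<zeta> z + (u z $ j * frechet_derivative \<zeta> (at z) (st_dir i) + u z $ i * frechet_derivative \<zeta> (at z) (st_dir j)) / 2" for z
    proof (cases "z \<in> Q")
      case True
      then show ?thesis unfolding D\<zeta> by (simp add: g_def zero_ext_def \<zeta>_def algebra_simps add_divide_distrib)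
    next
      case False
      then show ?thesis by (simp add: g_def zero_ext_def C0_infty_outside[OF \<zeta> False])
    qed
    have l: "loc_integrable Q u" "loc_integrable Q E" using distr by (auto simp: has_distr_sym_grad_def)
    have j1: "integrable lebesgue (\<lambda>z. E z $ i $ j * \<zeta> z)"
      using loc_integrable_C0_infty[OF loc_integrable_bounded_linear[OF bounded_linear_entry[of i j] l(2)] \<zeta>] by (simp add: mult.commute)
    have j2: "integrable lebesgue (\<lambda>z. u z $ j * frechet_derivative \<zeta> (at z) (st_dir i))" for i j
      using loc_integrable_C0_infty[OF loc_integrable_bounded_linear[OF bounded_linear_vec_nth[of j] l(1)] C0_infty_deriv[OF \<zeta> st_dir_Basis[of i]]]
      by (simp add: mult.commute)
    have i\<theta>: "integrable lebesgue (\<lambda>z. \<theta> (fst z) * g z)"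
      unfolding \<theta>g by (intro Bochner_Integration.integrable_add integrable_divide_zero j1 j2)
    have "(LINT z|lebesgue. \<theta> (fst z) * g z) = 0"
      unfolding \<theta>g by (subst Bochner_Integration.integral_add) (auto simp: has_distr_sym_gradD[OF distr \<zeta>] j1 j2)
    then have "(LINT t|lebesgue. LINT x|lebesgue. \<theta> t * g (t, x)) = 0"
      using slice_integral(3)[OF i\<theta>] by simp
    then show "(LINT t|lebesgue. mollifier (1 / real (Suc n)) (y - t) *\<^sub>R (LINT x|lebesgue. g (t, x))) = 0"
      by (simp add: \<theta>_def)
  qed
  show ?thesis using zero slice_integrable[OF u] slice_integrable[OF E]
  proof eventually_elim
    case (elim t)
    show ?case
    proof
      assume t: "t \<in> {0<..<T}"
      have k1: "integrable lebesgue (\<lambda>x. ?E (t, x) $ i $ j * \<psi> x)"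
        by (intro b'[OF \<psi>] integrable_bounded_linear[OF bounded_linear_entry elim(3)])
      have k2: "integrable lebesgue (\<lambda>x. ?u (t, x) $ j * ?D i x)" for i j
        by (intro b'[OF D] integrable_bounded_linear[OF bounded_linear_vec_nth elim(2)])
      have "0 = (LINT x|lebesgue. ?E (t, x) $ i $ j * \<psi> x + (?u (t, x) $ j * ?D i x + ?u (t, x) $ i * ?D j x) / 2)"
        using elim(1) t by (simp add: g_def)
      also have "\<dots> = (LINT x|lebesgue. ?E (t, x) $ i $ j * \<psi> x) + (LINT x|lebesgue. (?u (t, x) $ j * ?D i x + ?u (t, x) $ i * ?D j x) / 2)"
        by (intro Bochner_Integration.integral_add k1 integrable_divide_zero Bochner_Integration.integrable_add k2)
      also have "(\<lambda>x. ?E (t, x) $ i $ j * \<psi> x) = (\<lambda>x. E (t, x) $ i $ j * \<psi> x)"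
        using t C0_infty_outside(1)[OF \<psi>] by (auto simp: fun_eq_iff zero_ext_def cylinder_def)
      also have "(\<lambda>x. (?u (t, x) $ j * ?D i x + ?u (t, x) $ i * ?D j x) / 2) = (\<lambda>x. (u (t, x) $ j * ?D i x + u (t, x) $ i * ?D j x) / 2)"
        using t C0_infty_outside(2)[OF \<psi>] by (auto simp: fun_eq_iff zero_ext_def cylinder_def)
      finally show "(LINT x|lebesgue. E (t, x) $ i $ j * \<psi> x) = - (LINT x|lebesgue. (u (t, x) $ j * ?D i x + u (t, x) $ i * ?D j x) / 2)"
        by simp
    qed
  qed
qed

text \<open>By \<open>sl\<close> almost every slice has some symmetric gradient; it remains to
  identify it with the slice of E. Countably many mollifiers, with centres in a countable dense set,
  give one null set of times outside of which both agree on all of them, and uniqueness against this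
  family suffices.\<close>

lemma slice_distr_sym_grad:
  assumes distr: "has_distr_sym_grad st_dir Q u E"
    and u: "integrable lebesgue (zero_ext Q u)" and E: "integrable lebesgue (zero_ext Q E)"
    and sl: "AE t in lborel. t \<in> {0<..<T} \<longrightarrow> (\<exists>F. has_distr_sym_grad space_dir \<Omega> (\<lambda>x. u (t, x)) F)"
  shows "AE t in lborel. t \<in> {0<..<T} \<longrightarrow> (AE x in lborel. x \<in> \<Omega> \<longrightarrow> distr_sym_grad space_dir \<Omega> (\<lambda>x. u (t, x)) x = E (t, x))"
proof -
  obtain D :: "(real^'d) set" where D: "countable D" "closure D = UNIV"
  proof -
    obtain D :: "(real^'d) set" where D: "countable D" "\<And>U. open U \<Longrightarrow> U \<noteq> {} \<Longrightarrow> \<exists>d\<in>D. d \<in> U"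
      by (rule countable_dense_setE) blast
    have "x \<in> closure D" for x
      unfolding closure_iff_nhds_not_empty using D(2) by blast
    then show ?thesis using that D(1) by blast
  qed
  let ?P = "\<lambda>t y n. cball y (1 / real (Suc n)) \<subseteq> \<Omega> \<longrightarrow> (\<forall>i j. t \<in> {0<..<T} \<longrightarrow>
      (LINT x|lebesgue. E (t, x) $ i $ j * mollifier (1 / real (Suc n)) (y - x)) =
      - (LINT x|lebesgue. (u (t, x) $ j * frechet_derivative (\<lambda>x. mollifier (1 / real (Suc n)) (y - x)) (at x) (space_dir i)
        + u (t, x) $ i * frechet_derivative (\<lambda>x. mollifier (1 / real (Suc n)) (y - x)) (at x) (space_dir j)) / 2))"
  have "AE t in lborel. \<forall>y\<in>D. \<forall>n. ?P t y n"
    unfolding AE_ball_countable[OF D(1)] AE_all_countable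
  proof (intro ballI allI)
    fix y n
    show "AE t in lborel. ?P t y n"
    proof (cases "cball y (1 / real (Suc n)) \<subseteq> \<Omega>")
      case True
      then have "(\<lambda>x. mollifier (1 / real (Suc n)) (y - x)) \<in> C0_infty \<Omega>" by (intro mollifier_test_function) auto
      note t = slice_test[OF distr u E this]
      have "AE t in lborel. \<forall>i j. t \<in> {0<..<T} \<longrightarrow> (LINT x|lebesgue. E (t, x) $ i $ j * mollifier (1 / real (Suc n)) (y - x)) =
        - (LINT x|lebesgue. (u (t, x) $ j * frechet_derivative (\<lambda>x. mollifier (1 / real (Suc n)) (y - x)) (at x) (space_dir i)
        + u (t, x) $ i * frechet_derivative (\<lambda>x. mollifier (1 / real (Suc n)) (y - x)) (at x) (space_dir j)) / 2)"
        unfolding AE_all_countable by (intro allI t)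
      then show ?thesis by (rule eventually_mono) blast
    qed simp
  qed
  then show ?thesis using sl slice_integrable[OF E]
  proof eventually_elim
    case (elim t)
    show ?case
    proof
      assume t: "t \<in> {0<..<T}"
      obtain F where "has_distr_sym_grad space_dir \<Omega> (\<lambda>x. u (t, x)) F" using elim(2) t by blast
      then have d: "has_distr_sym_grad space_dir \<Omega> (\<lambda>x. u (t, x)) (distr_sym_grad space_dir \<Omega> (\<lambda>x. u (t, x)))"
        by (rule has_distr_sym_grad_distr_sym_grad)
      show "AE x in lborel. x \<in> \<Omega> \<longrightarrow> distr_sym_grad space_dir \<Omega> (\<lambda>x. u (t, x)) x = E (t, x)"
      proof (rule has_distr_sym_grad_unique_mollifier[OF open_dom _ _ D(2)])
        show "loc_integrable \<Omega> (distr_sym_grad space_dir \<Omega> (\<lambda>x. u (t, x)))"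
          using d by (simp add: has_distr_sym_grad_def)
        have "zero_ext \<Omega> (\<lambda>x. E (t, x)) = (\<lambda>x. zero_ext Q E (t, x))"
          using t by (auto simp: zero_ext_def cylinder_def)
        then show "loc_integrable \<Omega> (\<lambda>x. E (t, x))"
          using elim(3) by (intro integrable_loc_integrable) simp
        fix y n i j assume y: "y \<in> D" "cball y (1 / real (Suc n)) \<subseteq> \<Omega>"
        then have w: "(\<lambda>x. mollifier (1 / real (Suc n)) (y - x)) \<in> C0_infty \<Omega>" by (intro mollifier_test_function) auto
        show "(LINT x|lebesgue. distr_sym_grad space_dir \<Omega> (\<lambda>x. u (t, x)) x $ i $ j * mollifier (1 / real (Suc n)) (y - x)) =
           (LINT x|lebesgue. E (t, x) $ i $ j * mollifier (1 / real (Suc n)) (y - x))"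
          unfolding has_distr_sym_gradD[OF d w] using elim(1) y t by simp
      qed
    qed
  qed
qed

end

section \<open>The boundary estimate on time slices and the commutator\<close>

lemma Lvar_AE_cong:
  fixes f g :: "'a::euclidean_space \<Rightarrow> 'b::euclidean_space"
  assumes G: "G \<in> sets lebesgue" and g: "g \<in> Lvar G p" and eq: "AE x in lborel. x \<in> G \<longrightarrow> f x = g x"
  shows "f \<in> Lvar G p"
proof -
  have "AE x in lborel. zero_ext G f x = zero_ext G g x"
    using eq by eventually_elim (simp add: zero_ext_def)
  then have "zero_ext G f \<in> borel_measurable lebesgue"
    using g by (intro lebesgue_measurable_AE_cong[OF zero_ext_measurable[OF G, of g]]) (auto simp: Lvar_def)
  then have "f \<in> borel_measurable (lebesgue_on G)"
    using borel_measurable_if[OF G, of f] by (simp add: zero_ext_def[abs_def])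
  moreover have "modular G p f \<le> modular G p g"
    by (rule modular_mono_AE[OF G]) (use eq in \<open>eventually_elim, simp\<close>)
  ultimately show ?thesis using g by (auto simp: Lvar_def order_le_less_trans)
qed

lemma nn_integral_lborel_slices:
  fixes f :: "real \<times> 'a::euclidean_space \<Rightarrow> ennreal"
  assumes "f \<in> borel_measurable borel"
  shows "(\<integral>\<^sup>+z. f z \<partial>lborel) = (\<integral>\<^sup>+t. (\<integral>\<^sup>+x. f (t, x) \<partial>lborel) \<partial>lborel)"
proof -
  have "f \<in> borel_measurable (lborel \<Otimes>\<^sub>M lborel)" using assms by (simp add: lborel_prod)
  from lborel.nn_integral_fst[OF this] show ?thesis by (simp add: lborel_prod)
qed

lemma Collect_le_borel: "{x::'a::euclidean_space. infdist x S \<le> c} \<in> sets borel"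
  by (intro borel_closed closed_Collect_le continuous_intros)

context smoothing
begin

lemma near_boundary_borel [measurable]: "{x \<in> \<Omega>. bd x \<le> c} \<in> sets borel"
proof -
  have "{x \<in> \<Omega>. bd x \<le> c} = \<Omega> \<inter> {x. bd x \<le> c}" by auto
  then show ?thesis using open_dom Collect_le_borel[of "frontier \<Omega>" c] by auto
qed

lemma XX_epsD:
  assumes q: "q \<in> P_log Q" and p: "p \<in> P_log Q" and u: "u \<in> XX_eps T \<Omega> q p"
  shows "u \<in> Lvar Q q" "distr_sym_grad st_dir Q u \<in> Lvar Q p"
    "has_distr_sym_grad st_dir Q u (distr_sym_grad st_dir Q u)"
    "integrable lebesgue (zero_ext Q u)" "integrable lebesgue (zero_ext Q (distr_sym_grad st_dir Q u))"
    "AE t in lborel. t \<in> {0<..<T} \<longrightarrow> (\<lambda>x. u (t, x)) \<in> X_eps \<Omega> (\<lambda>x. q (t, x)) (\<lambda>x. p (t, x))"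
proof -
  obtain E where E: "E \<in> Lvar Q p" "has_distr_sym_grad st_dir Q u E" and uL: "u \<in> Lvar Q q"
    using u by (auto simp: XX_eps_def W_eps_def)
  show "u \<in> Lvar Q q" by fact
  show "has_distr_sym_grad st_dir Q u (distr_sym_grad st_dir Q u)"
    by (rule has_distr_sym_grad_distr_sym_grad[OF E(2)])
  show EL: "distr_sym_grad st_dir Q u \<in> Lvar Q p"
    by (rule Lvar_AE_cong[OF Q_sets E(1) distr_sym_grad_eq_AE[OF Q_open E(2)]])
  show "integrable lebesgue (zero_ext Q u)"
    by (rule Lvar_integrable(1)[OF Q_sets Q_bounded uL P_logD(2)[OF q] P_logD(1)[OF q]])
  show "integrable lebesgue (zero_ext Q (distr_sym_grad st_dir Q u))"
    by (rule Lvar_integrable(1)[OF Q_sets Q_bounded EL P_logD(2)[OF p] P_logD(1)[OF p]])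
  show "AE t in lborel. t \<in> {0<..<T} \<longrightarrow> (\<lambda>x. u (t, x)) \<in> X_eps \<Omega> (\<lambda>x. q (t, x)) (\<lambda>x. p (t, x))"
    using u by (simp add: XX_eps_def AE_lebesgue_on)
qed

lemma slice_exponent:
  assumes "q \<in> P_log Q" "t \<in> {0<..<T}"
  shows "x \<in> \<Omega> \<Longrightarrow> 1 \<le> q (t, x)" "(\<lambda>x. q (t, x)) \<in> borel_measurable (lebesgue_on \<Omega>)"
proof -
  show "x \<in> \<Omega> \<Longrightarrow> 1 \<le> q (t, x)" using P_logD(2)[OF assms(1)] assms(2) by (auto simp: cylinder_def)
  have "continuous_on \<Omega> (\<lambda>x. q (t, x))"
    by (rule continuous_on_compose2[OF P_log_continuous[OF assms(1)]])
       (use assms(2) in \<open>auto simp: cylinder_def intro!: continuous_intros\<close>)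
  then show "(\<lambda>x. q (t, x)) \<in> borel_measurable (lebesgue_on \<Omega>)"
    using open_dom by (intro continuous_imp_measurable_on_sets_lebesgue) auto
qed

text \<open>Almost every slice lies in the space with exponents 1, where the boundary estimate
  applies, and its symmetric gradient may be replaced under the integral by the slice of the
  space-time gradient.\<close>

lemma slice_estimate:
  assumes be: "boundary_estimate \<Omega> h0 c0" and q: "q \<in> P_log Q" and p: "p \<in> P_log Q" and u: "u \<in> XX_eps T \<Omega> q p"
  shows "AE t in lborel. t \<in> {0<..<T} \<longrightarrow> (AE x in lborel. x \<in> \<Omega> \<and> bd x \<le> h0 \<longrightarrow>
     ennreal (norm (u (t, x))) \<le> ennreal c0 * (\<integral>\<^sup>+y. ennreal (norm (distr_sym_grad st_dir Q u (t, y)) * norm (x - y) powr (1 - real CARD('d)))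
        * indicator (ball x (2 * bd x) \<inter> \<Omega>) y \<partial>lborel))"
proof -
  let ?E = "distr_sym_grad st_dir Q u"
  note X = XX_epsD[OF q p u]
  have "AE t in lborel. t \<in> {0<..<T} \<longrightarrow> (AE x in lborel. x \<in> \<Omega> \<longrightarrow> distr_sym_grad space_dir \<Omega> (\<lambda>x. u (t, x)) x = ?E (t, x))"
  proof (rule slice_distr_sym_grad[OF X(3,4,5)])
    show "AE t in lborel. t \<in> {0<..<T} \<longrightarrow> (\<exists>F. has_distr_sym_grad space_dir \<Omega> (\<lambda>x. u (t, x)) F)"
      using X(6) by eventually_elim (auto simp: X_eps_def W_eps_def)
  qed
  with X(6) show ?thesis
  proof eventually_elim
    case (elim t)
    show ?case
    proof
      assume t: "t \<in> {0<..<T}"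
      have "(\<lambda>x. u (t, x)) \<in> X_eps \<Omega> (\<lambda>x. q (t, x)) (\<lambda>x. p (t, x))" using elim(1) t by blast
      from X_eps_L1[OF open_dom bounded_dom slice_exponent[OF q t] slice_exponent[OF p t] this]
      have u1: "(\<lambda>x. u (t, x)) \<in> X_eps \<Omega> (\<lambda>_. 1) (\<lambda>_. 1)" .
      have b: "AE x in lebesgue_on \<Omega>. bd x \<le> h0 \<longrightarrow> ennreal (norm (u (t, x))) \<le> ennreal c0 *
         (\<integral>\<^sup>+ y. ennreal (norm (distr_sym_grad space_dir \<Omega> (\<lambda>x. u (t, x)) y) * norm (x - y) powr (1 - real CARD('d)))
          \<partial>lebesgue_on (ball x (2 * bd x) \<inter> \<Omega>))"
        by (rule bspec[OF be[unfolded boundary_estimate_def] u1])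
      have eqE: "AE x in lborel. x \<in> \<Omega> \<longrightarrow> distr_sym_grad space_dir \<Omega> (\<lambda>x. u (t, x)) x = ?E (t, x)" using elim(2) t by blast
      have I: "(\<integral>\<^sup>+ y. ennreal (norm (distr_sym_grad space_dir \<Omega> (\<lambda>x. u (t, x)) y) * norm (x - y) powr (1 - real CARD('d)))
          \<partial>lebesgue_on (ball x (2 * bd x) \<inter> \<Omega>)) = (\<integral>\<^sup>+y. ennreal (norm (?E (t, y)) * norm (x - y) powr (1 - real CARD('d)))
        * indicator (ball x (2 * bd x) \<inter> \<Omega>) y \<partial>lborel)" for x
      proof -
        have "ball x (2 * bd x) \<inter> \<Omega> \<in> sets lebesgue" using open_dom by auto
        then have "(\<integral>\<^sup>+ y. ennreal (norm (distr_sym_grad space_dir \<Omega> (\<lambda>x. u (t, x)) y) * norm (x - y) powr (1 - real CARD('d)))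
          \<partial>lebesgue_on (ball x (2 * bd x) \<inter> \<Omega>)) = (\<integral>\<^sup>+y. ennreal (norm (distr_sym_grad space_dir \<Omega> (\<lambda>x. u (t, x)) y) * norm (x - y) powr (1 - real CARD('d)))
        * indicator (ball x (2 * bd x) \<inter> \<Omega>) y \<partial>lebesgue)"
          by (intro nn_integral_restrict_space) simp
        also have "\<dots> = (\<integral>\<^sup>+y. ennreal (norm (distr_sym_grad space_dir \<Omega> (\<lambda>x. u (t, x)) y) * norm (x - y) powr (1 - real CARD('d)))
        * indicator (ball x (2 * bd x) \<inter> \<Omega>) y \<partial>lborel)" by (rule nn_integral_completion)
        also have "\<dots> = (\<integral>\<^sup>+y. ennreal (norm (?E (t, y)) * norm (x - y) powr (1 - real CARD('d)))
        * indicator (ball x (2 * bd x) \<inter> \<Omega>) y \<partial>lborel)"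
          by (rule nn_integral_cong_AE) (use eqE in \<open>eventually_elim, auto simp: indicator_def\<close>)
        finally show ?thesis .
      qed
      have "\<Omega> \<in> sets lebesgue" using open_dom by auto
      from b[unfolded AE_lebesgue_on[OF this] I]
      show "AE x in lborel. x \<in> \<Omega> \<and> bd x \<le> h0 \<longrightarrow>
         ennreal (norm (u (t, x))) \<le> ennreal c0 * (\<integral>\<^sup>+y. ennreal (norm (?E (t, y)) * norm (x - y) powr (1 - real CARD('d)))
        * indicator (ball x (2 * bd x) \<inter> \<Omega>) y \<partial>lborel)"
        by eventually_elim blast
    qed
  qed
qed

text \<open>The strip restricts space only. It is carried through the commutator estimate because
  the norm of the restricted gradient, not that of the full one, tends to 0 with the width
  c.\<close>

definition boundary_part :: "real \<Rightarrow> (real \<times> (real^'d) \<Rightarrow> 'b::real_normed_vector) \<Rightarrow> real \<times> (real^'d) \<Rightarrow> 'b" where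
  "boundary_part c f z = indicat_real (UNIV \<times> {x \<in> \<Omega>. bd x \<le> c}) z *\<^sub>R f z"

lemma boundary_strip_sets: "UNIV \<times> {x \<in> \<Omega>. bd x \<le> c} \<in> sets (lebesgue :: (real \<times> (real^'d)) measure)"
proof -
  have "UNIV \<times> {x \<in> \<Omega>. bd x \<le> c} \<in> sets (borel :: (real \<times> (real^'d)) measure)"
    unfolding borel_prod[symmetric] by (intro pair_measureI) measurable
  then show ?thesis by simp
qed

text \<open>The boundary estimate holds on almost every time slice; integrating the Riesz kernel over a ball of
  radius of order \<open>h\<close> gains the factor \<open>h\<close> that cancels the size \<open>1 / h\<close> of the gradient of the cutoff.\<close>

lemma commutator_integral_bound:
  assumes be: "boundary_estimate \<Omega> h0 c0" and c0: "0 < c0"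
  shows "\<exists>C>0. \<forall>h q p u z. 0 < h \<longrightarrow> 3 * h \<le> h0 \<longrightarrow> q \<in> P_log Q \<longrightarrow> p \<in> P_log Q \<longrightarrow> u \<in> XX_eps T \<Omega> q p \<longrightarrow>
    (\<integral>\<^sup>+y. ennreal (mollifier h (z - y)) * (indicator {x \<in> \<Omega>. bd x \<le> 3 * h} (snd y) * ennreal (norm (zero_ext Q u y))) \<partial>lebesgue)
    \<le> ennreal (C * h) * ball_avg (zero_ext Q (boundary_part (9 * h) (distr_sym_grad st_dir Q u))) z (8 * h)"
proof -
  let ?n = "DIM(real \<times> (real^'d))"
  obtain C0 where C0: "0 < C0" "\<And>h x. 0 < h \<Longrightarrow> mollifier h (x :: real \<times> (real^'d)) \<le> C0 / h ^ ?n"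
    by (rule mollifier_bounds[where 'a="real \<times> (real^'d)"]) blast
  obtain \<kappa> where \<kappa>: "0 < \<kappa>" "\<And>R. 0 < R \<Longrightarrow> (\<integral>\<^sup>+x. ennreal (norm (x :: real^'d) powr (1 - real DIM(real^'d))) * indicator (ball 0 R) x \<partial>lborel) \<le> ennreal (\<kappa> * R)"
    using riesz_kernel_integral[where 'a="real^'d"] by blast
  let ?w = "unit_ball_vol (real ?n)"
  \<comment> \<open>C0 h^(-n) bounds the mollifier, c0 belongs to the boundary estimate, 6 \<kappa>
    h is the Riesz integral over radius 6h and w (8h)^n the volume of the averaging ball; one power
    of h remains.\<close>
  define C where "C = C0 * c0 * \<kappa> * 6 * ?w * 8 ^ ?n"
  show ?thesis
  proof (intro exI[of _ C] conjI allI impI)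
    show "0 < C" using C0 c0 \<kappa> by (simp add: C_def)
    fix h :: real and q p :: "real \<times> (real^'d) \<Rightarrow> real" and u :: "real \<times> (real^'d) \<Rightarrow> real^'d" and z :: "real \<times> (real^'d)"
    assume h: "0 < h" "3 * h \<le> h0" and q: "q \<in> P_log Q" and p: "p \<in> P_log Q" and u: "u \<in> XX_eps T \<Omega> q p"
    let ?E = "distr_sym_grad st_dir Q u"
    let ?N = "{x \<in> \<Omega>. bd x \<le> 3 * h}"
    let ?EA = "zero_ext Q (boundary_part (9 * h) ?E)"
    let ?U = "zero_ext Q u"
    note X = XX_epsD[OF q p u]
    have Um: "?U \<in> borel_measurable lebesgue" using X(4) by auto
    have EAm: "?EA \<in> borel_measurable lebesgue"
      unfolding boundary_part_def[abs_def]
      by (rule zero_ext_measurable[OF Q_sets]) (use Lvar_restrict[OF Q_sets X(2) boundary_strip_sets] in \<open>simp add: Lvar_def\<close>)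
    obtain U' where [measurable]: "U' \<in> borel_measurable borel" and U': "AE y in lborel. ennreal (norm (?U y)) = U' y"
      by (rule lebesgue_measurable_norm_rep[OF Um]) blast
    obtain e where [measurable]: "e \<in> borel_measurable borel" and e: "AE y in lborel. ennreal (norm (?EA y)) = e y"
      by (rule lebesgue_measurable_norm_rep[OF EAm]) blast
    \<comment> \<open>The Riesz kernel truncated at 6h, which covers the balls of radius 2
      \<open>bd x\<close> for all x in the strip \<open>bd x\<close> \<le> 3h.\<close>
    define K where "K v = ennreal (norm v powr (1 - real CARD('d))) * (if norm v < 6 * h then 1 else 0)" for v :: "real^'d"
    have Km [measurable]: "K \<in> borel_measurable borel" unfolding K_def[abs_def] by measurable
    let ?M = "ennreal (C0 / h ^ ?n * c0)"
    let ?i = "\<lambda>t y. if norm (z - (t, y)) < 8 * h then 1 else (0::ennreal)"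
    have [measurable]: "(\<lambda>x. U' (t, x)) \<in> borel_measurable borel" "(\<lambda>x. e (t, x)) \<in> borel_measurable borel" for t
      by (rule measurable_compose[of "\<lambda>x. (t, x)" borel borel]; simp add: borel_measurable_continuous_onI continuous_intros)+
    have KI: "(\<integral>\<^sup>+x. K (x - y) \<partial>lborel) \<le> ennreal (\<kappa> * (6 * h))" for y
    proof -
      have "(\<integral>\<^sup>+x. K (x - y) \<partial>lborel) = (\<integral>\<^sup>+x. K x \<partial>lborel)"
        using nn_integral_lborel_affine[OF Km, of 1 "-y"] by simp
      also have "\<dots> = (\<integral>\<^sup>+x. ennreal (norm (x :: real^'d) powr (1 - real DIM(real^'d))) * indicator (ball 0 (6 * h)) x \<partial>lborel)"
        by (rule nn_integral_cong) (simp add: K_def indicator_def)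
      also have "\<dots> \<le> ennreal (\<kappa> * (6 * h))" using \<kappa>(2)[of "6 * h"] h by simp
      finally show ?thesis .
    qed
    have inner: "(\<integral>\<^sup>+x. ennreal (mollifier h (z - (t, x))) * (indicator ?N x * U' (t, x)) \<partial>lborel) \<le>
        ?M * ennreal (\<kappa> * (6 * h)) * (\<integral>\<^sup>+y. ?i t y * e (t, y) \<partial>lborel)"
      if t1: "AE x in lborel. ennreal (norm (?U (t, x))) = U' (t, x)" and t2: "AE x in lborel. ennreal (norm (?EA (t, x))) = e (t, x)"
        and t3: "t \<in> {0<..<T} \<longrightarrow> (AE x in lborel. x \<in> \<Omega> \<and> bd x \<le> h0 \<longrightarrow>
     ennreal (norm (u (t, x))) \<le> ennreal c0 * (\<integral>\<^sup>+y. ennreal (norm (?E (t, y)) * norm (x - y) powr (1 - real CARD('d)))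
        * indicator (ball x (2 * bd x) \<inter> \<Omega>) y \<partial>lborel))" for t
    proof (cases "t \<in> {0<..<T}")
      case False
      have "(\<integral>\<^sup>+x. ennreal (mollifier h (z - (t, x))) * (indicator ?N x * U' (t, x)) \<partial>lborel) = (\<integral>\<^sup>+(x::real^'d). 0 \<partial>lborel)"
      proof (rule nn_integral_cong_AE)
        show "AE x in lborel. ennreal (mollifier h (z - (t, x))) * (indicator ?N x * U' (t, x)) = 0"
          using t1 by eventually_elim (use False in \<open>auto simp: zero_ext_def cylinder_def\<close>)
      qed
      then show ?thesis by simp
    next
      case True
      have "(\<integral>\<^sup>+x. ennreal (mollifier h (z - (t, x))) * (indicator ?N x * U' (t, x)) \<partial>lborel) \<le>
          (\<integral>\<^sup>+x. (\<integral>\<^sup>+y. ?M * (K (x - y) * (?i t y * e (t, y))) \<partial>lborel) \<partial>lborel)"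
      proof (rule nn_integral_mono_AE)
        show "AE x in lborel. ennreal (mollifier h (z - (t, x))) * (indicator ?N x * U' (t, x)) \<le> (\<integral>\<^sup>+y. ?M * (K (x - y) * (?i t y * e (t, y))) \<partial>lborel)"
          using t1 t3[rule_format, OF True]
        proof eventually_elim
          case (elim x)
          show ?case
          proof (cases "x \<in> ?N \<and> norm (z - (t, x)) < h")
            case x: True
            have U'x: "U' (t, x) = ennreal (norm (u (t, x)))"
              using elim(1) True x by (simp add: zero_ext_def cylinder_def)
            have "ennreal (mollifier h (z - (t, x))) * (indicator ?N x * U' (t, x)) \<le>
              ennreal (C0 / h ^ ?n) * (ennreal c0 * (\<integral>\<^sup>+y. ennreal (norm (?E (t, y)) * norm (x - y) powr (1 - real CARD('d)))
                * indicator (ball x (2 * bd x) \<inter> \<Omega>) y \<partial>lborel))"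
            proof (rule mult_mono)
              show "ennreal (mollifier h (z - (t, x))) \<le> ennreal (C0 / h ^ ?n)"
                by (rule ennreal_leI[OF C0(2)[OF h(1)]])
              have "bd x \<le> h0" "x \<in> \<Omega>" using x h by auto
              then show "indicator ?N x * U' (t, x) \<le> ennreal c0 * (\<integral>\<^sup>+y. ennreal (norm (?E (t, y)) * norm (x - y) powr (1 - real CARD('d)))
                * indicator (ball x (2 * bd x) \<inter> \<Omega>) y \<partial>lborel)"
                using elim(2) x unfolding U'x by simp
            qed simp_all
            also have "\<dots> = ?M * (\<integral>\<^sup>+y. ennreal (norm (?E (t, y)) * norm (x - y) powr (1 - real CARD('d)))
                * indicator (ball x (2 * bd x) \<inter> \<Omega>) y \<partial>lborel)"
              using C0 c0 h by (simp only: mult.assoc[symmetric] ennreal_mult divide_nonneg_nonneg less_imp_le zero_le_power)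
            also have "\<dots> \<le> ?M * (\<integral>\<^sup>+y. K (x - y) * (?i t y * e (t, y)) \<partial>lborel)"
            proof (intro mult_left_mono nn_integral_mono_AE)
              show "AE y in lborel. ennreal (norm (?E (t, y)) * norm (x - y) powr (1 - real CARD('d))) * indicator (ball x (2 * bd x) \<inter> \<Omega>) y \<le> K (x - y) * (?i t y * e (t, y))"
                using t2
              proof eventually_elim
                case (elim y)
                show ?case
                proof (cases "y \<in> ball x (2 * bd x) \<inter> \<Omega>")
                  case y: True
                  \<comment> \<open>The source of both radii: y is at distance at most 3h + 6h = 9h
                    from the frontier, and (t, y) is closer to z than h + 6h < 8h.\<close>
                  have d: "norm (x - y) < 6 * h" using y x by (auto simp: dist_norm)
                  have "bd y \<le> bd x + dist y x" by (rule infdist_triangle)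
                  then have "bd y \<le> 9 * h" using y x by (auto simp: dist_commute)
                  then have ey: "e (t, y) = ennreal (norm (?E (t, y)))"
                    using elim[symmetric] y True by (simp add: zero_ext_def cylinder_def boundary_part_def)
                  have "norm (z - (t, y)) \<le> norm (z - (t, x)) + norm ((t, x) - (t, y))"
                    using dist_triangle[of z "(t, y)" "(t, x)"] unfolding dist_norm .
                  moreover have "norm ((t, x) - (t, y)) = norm (x - y)" by (simp add: norm_Pair)
                  ultimately have "norm (z - (t, y)) < 8 * h" using x d h by linarith
                  then show ?thesis using y d by (simp add: K_def ey ennreal_mult mult.commute)
                qed simp
              qed
            qed simp
            also have "\<dots> = (\<integral>\<^sup>+y. ?M * (K (x - y) * (?i t y * e (t, y))) \<partial>lborel)"
              by (rule nn_integral_cmult[symmetric]) measurable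
            finally show ?thesis .
          next
            case False
            then have z: "ennreal (mollifier h (z - (t, x))) * (indicator ?N x * U' (t, x)) = 0"
              using mollifier_support[OF h(1), of "z - (t, x)"] by (auto simp: not_less)
            show ?thesis unfolding z by simp
          qed
        qed
      qed
      \<comment> \<open>With y fixed, integrating the kernel in x produces the factor 6 \<kappa> h
        independently of y; this is the gained power of h.\<close>
      also have "\<dots> = (\<integral>\<^sup>+y. (\<integral>\<^sup>+x. ?M * (K (x - y) * (?i t y * e (t, y))) \<partial>lborel) \<partial>lborel)"
        by (rule lborel_pair.Fubini') measurable
      also have "\<dots> = (\<integral>\<^sup>+y. ?M * (\<integral>\<^sup>+x. K (x - y) \<partial>lborel) * (?i t y * e (t, y)) \<partial>lborel)"
        by (intro nn_integral_cong) (simp add: nn_integral_cmult nn_integral_multc mult.assoc)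
      also have "\<dots> \<le> (\<integral>\<^sup>+y. ?M * ennreal (\<kappa> * (6 * h)) * (?i t y * e (t, y)) \<partial>lborel)"
        by (intro nn_integral_mono mult_right_mono mult_left_mono KI) auto
      also have "\<dots> = ?M * ennreal (\<kappa> * (6 * h)) * (\<integral>\<^sup>+y. ?i t y * e (t, y) \<partial>lborel)"
        by (rule nn_integral_cmult) measurable
      finally show ?thesis .
    qed
    have "(\<integral>\<^sup>+y. ennreal (mollifier h (z - y)) * (indicator ?N (snd y) * ennreal (norm (?U y))) \<partial>lebesgue)
        = (\<integral>\<^sup>+y. ennreal (mollifier h (z - y)) * (indicator ?N (snd y) * U' y) \<partial>lborel)"
      unfolding nn_integral_completion by (rule nn_integral_cong_AE) (use U' in auto)
    also have "\<dots> = (\<integral>\<^sup>+t. (\<integral>\<^sup>+x. ennreal (mollifier h (z - (t, x))) * (indicator ?N x * U' (t, x)) \<partial>lborel) \<partial>lborel)"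
    proof -
      have [measurable]: "(\<lambda>y. indicator ?N (snd y) :: ennreal) \<in> borel_measurable (borel :: (real \<times> (real^'d)) measure)"
        unfolding borel_prod[symmetric] by measurable
      show ?thesis by (subst nn_integral_lborel_slices) simp_all
    qed
    also have "\<dots> \<le> (\<integral>\<^sup>+t. ?M * ennreal (\<kappa> * (6 * h)) * (\<integral>\<^sup>+y. ?i t y * e (t, y) \<partial>lborel) \<partial>lborel)"
    proof (rule nn_integral_mono_AE)
      show "AE t in lborel. (\<integral>\<^sup>+x. ennreal (mollifier h (z - (t, x))) * (indicator ?N x * U' (t, x)) \<partial>lborel) \<le> ?M * ennreal (\<kappa> * (6 * h)) * (\<integral>\<^sup>+y. ?i t y * e (t, y) \<partial>lborel)"
        using AE_slice[OF U'] AE_slice[OF e] slice_estimate[OF be q p u] by eventually_elim (rule inner)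
    qed
    also have "\<dots> = ?M * ennreal (\<kappa> * (6 * h)) * (\<integral>\<^sup>+t. (\<integral>\<^sup>+y. ?i t y * e (t, y) \<partial>lborel) \<partial>lborel)"
    proof (rule nn_integral_cmult)
      have "(\<lambda>y. (if norm (z - y) < 8 * h then 1 else 0) * e y) \<in> borel_measurable (lborel \<Otimes>\<^sub>M lborel)"
        by (simp add: lborel_prod)
      from lborel.borel_measurable_nn_integral_fst[OF this]
      show "(\<lambda>t. \<integral>\<^sup>+y. ?i t y * e (t, y) \<partial>lborel) \<in> borel_measurable lborel" by simp
    qed
    also have "(\<integral>\<^sup>+t. (\<integral>\<^sup>+y. ?i t y * e (t, y) \<partial>lborel) \<partial>lborel) = (\<integral>\<^sup>+y. (if norm (z - y) < 8 * h then 1 else 0) * e y \<partial>lborel)"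
      by (subst nn_integral_lborel_slices) simp_all
    also have "\<dots> = (\<integral>\<^sup>+y. ennreal (norm (?EA y)) * indicator (ball z (8 * h)) y \<partial>lborel)"
      by (rule nn_integral_cong_AE) (use e in \<open>eventually_elim, auto simp: dist_norm indicator_def\<close>)
    also have "\<dots> = ball_avg ?EA z (8 * h) * emeasure lborel (ball z (8 * h))"
      using h by (intro ball_avg_times_measure[symmetric]) simp
    also have "emeasure lborel (ball z (8 * h)) = ennreal (?w * (8 * h) ^ ?n)"
      using h by (intro emeasure_ball) simp
    also have "?M * ennreal (\<kappa> * (6 * h)) * (ball_avg ?EA z (8 * h) * ennreal (?w * (8 * h) ^ ?n)) =
        (?M * ennreal (\<kappa> * (6 * h)) * ennreal (?w * (8 * h) ^ ?n)) * ball_avg ?EA z (8 * h)"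
      by (simp only: mult_ac)
    also have "?M * ennreal (\<kappa> * (6 * h)) * ennreal (?w * (8 * h) ^ ?n) = ennreal (C0 / h ^ ?n * c0 * (\<kappa> * (6 * h)) * (?w * (8 * h) ^ ?n))"
      using C0 c0 \<kappa> h by (subst ennreal_mult[symmetric] | simp)+
    also have "C0 / h ^ ?n * c0 * (\<kappa> * (6 * h)) * (?w * (8 * h) ^ ?n) = C * h"
      using h by (simp add: C_def power_mult_distrib)
    finally show "(\<integral>\<^sup>+y. ennreal (mollifier h (z - y)) * (indicator ?N (snd y) * ennreal (norm (?U y))) \<partial>lebesgue)
      \<le> ennreal (C * h) * ball_avg ?EA z (8 * h)" .
  qed
qed

end

section \<open>Bounds and convergence of the smoothing\<close>

lemma AE_fst_lborel:
  assumes "AE t in (lborel :: real measure). P t"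
  shows "AE z in (lborel :: (real \<times> 'a::euclidean_space) measure). P (fst z)"
proof -
  obtain N where N: "N \<in> null_sets lborel" "{t \<in> space lborel. \<not> P t} \<subseteq> N"
    using assms unfolding eventually_ae_filter by blast
  have "emeasure (lborel \<Otimes>\<^sub>M lborel) (N \<times> (UNIV :: 'a set)) = emeasure lborel N * emeasure lborel (UNIV :: 'a set)"
    using N by (intro lborel.emeasure_pair_measure_Times) auto
  then have "N \<times> (UNIV :: 'a set) \<in> null_sets (lborel \<Otimes>\<^sub>M lborel)"
    using N by (auto simp: null_sets_def)
  then have "N \<times> (UNIV :: 'a set) \<in> null_sets lborel" by (simp only: lborel_prod)
  then show ?thesis by (rule AE_I') (use N(2) in auto)
qed

lemma ball_avg_mono:
  assumes "\<And>y. norm (f y) \<le> norm (g y)"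
  shows "ball_avg f z r \<le> ball_avg g z r"
  unfolding ball_avg_def by (intro divide_right_mono_ennreal nn_integral_mono ennreal_leI assms)

text \<open>Brings the averages of radius h from the mollifier to the radius 8h of the commutator
  bound, at the price of the ratio of the volumes.\<close>

lemma ball_avg_enlarge:
  fixes f :: "'a::euclidean_space \<Rightarrow> 'b::real_normed_vector"
  assumes h: "0 < h"
  shows "ball_avg f z h \<le> ennreal (8 ^ DIM('a)) * ball_avg f z (8 * h)"
proof -
  define V where "V = unit_ball_vol (real DIM('a)) * h ^ DIM('a)"
  have V: "0 < V" using h by (simp add: V_def)
  have eV: "emeasure lborel (ball z h) = ennreal V" unfolding V_def using h by (intro emeasure_ball) simp
  have eV8: "emeasure lborel (ball z (8 * h)) = ennreal (8 ^ DIM('a)) * ennreal V"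
    unfolding V_def using h by (simp add: emeasure_ball power_mult_distrib mult_ac flip: ennreal_mult)
  have "ball_avg f z h * ennreal V \<le> ball_avg f z (8 * h) * (ennreal (8 ^ DIM('a)) * ennreal V)"
  proof -
    have h8: "0 < 8 * h" using h by simp
    show ?thesis
      unfolding eV8[symmetric] unfolding eV[symmetric] ball_avg_times_measure[OF h] ball_avg_times_measure[OF h8]
      by (rule nn_integral_mono) (use h in \<open>auto simp: indicator_def\<close>)
  qed
  then have "(ball_avg f z h * ennreal V) * ennreal (1 / V) \<le> (ball_avg f z (8 * h) * (ennreal (8 ^ DIM('a)) * ennreal V)) * ennreal (1 / V)"
    by (rule mult_right_mono) simp
  moreover have "ennreal V * ennreal (1 / V) = 1" using V by (simp flip: ennreal_mult)
  ultimately show ?thesis by (simp only: mult.assoc mult_1_right) (simp only: mult.commute)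
qed

context bounded_open
begin

text \<open>\<open>infdist\<close> to the empty set is 0, so the frontier must be known to be
  nonempty: a bounded set is not the whole space.\<close>

lemma bd_pos: "x \<in> \<Omega> \<Longrightarrow> 0 < bd x"
proof -
  assume x: "x \<in> \<Omega>"
  have "\<Omega> \<noteq> UNIV" using bounded_dom not_bounded_UNIV by metis
  then have "frontier \<Omega> \<noteq> {}" using x frontier_eq_empty[of \<Omega>] by blast
  moreover have "x \<notin> frontier \<Omega>" using x open_dom by (simp add: frontier_def interior_open)
  ultimately show ?thesis using infdist_pos_not_in_closed[OF frontier_closed] by blast
qed

end

context smoothing
begin

lemma smoothed_norm_le:
  fixes f :: "real \<times> (real^'d) \<Rightarrow> 'b::euclidean_space"
  assumes "0 < h"
  shows "ennreal (norm (smoothed h f z)) \<le> (\<integral>\<^sup>+y. ennreal (mollifier h (z - y)) * ennreal (norm (zero_ext Q f y)) \<partial>lborel)"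
  unfolding smoothed_def by (rule cutoff_mollify_norm_le[OF assms]) (simp_all add: cutoff_nonneg cutoff_le_1 assms)

lemma smoothed_lux_le:
  assumes q: "q \<in> P_log Q"
  shows "\<exists>K>0. \<forall>h>0. \<forall>f\<in>Lvar Q q. lux_norm Q q (smoothed h f :: real \<times> (real^'d) \<Rightarrow> 'b::euclidean_space) \<le> ennreal K * lux_norm Q q f"
proof (rule cutoff_mollify_lux_le[OF Q_sets Q_bounded q, where 'b='b])
  fix K :: real
  assume K: "0 < K" and le: "\<And>h k (f :: real \<times> (real^'d) \<Rightarrow> 'b). 0 < h \<Longrightarrow> f \<in> Lvar Q q \<Longrightarrow> k \<in> borel_measurable lebesgue \<Longrightarrow>
     \<forall>z. 0 \<le> k z \<and> k z \<le> 1 \<Longrightarrow> lux_norm Q q (convolve (mollifier h) (\<lambda>z. k z *\<^sub>R zero_ext Q f z)) \<le> ennreal K * lux_norm Q q f"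
  have "lux_norm Q q (smoothed h f) \<le> ennreal K * lux_norm Q q f" if "0 < h" "f \<in> Lvar Q q" for h and f :: "real \<times> (real^'d) \<Rightarrow> 'b"
    unfolding smoothed_def[abs_def]
    by (rule le[OF that(1) that(2) cutoff_measurable[OF that(1)]]) (simp add: cutoff_nonneg cutoff_le_1 that)
  then show ?thesis using K by blast
qed

text \<open>At a fixed point of \<Omega> the spatial cutoff equals 1 as soon as 3 X n is below the
  distance to the frontier; the null set comes from the time cutoff alone.\<close>

lemma cutoff_tendsto_1:
  assumes X: "\<And>n. 0 < X n" "X \<longlonglongrightarrow> (0::real)"
  shows "AE z in lborel. z \<in> Q \<longrightarrow> (\<lambda>n. cutoff (X n) z) \<longlonglongrightarrow> 1"
proof -
  have Xr: "filterlim X (at_right 0) sequentially"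
  proof -
    have "X n \<noteq> 0" for n using X(1)[of n] by simp
    then show ?thesis unfolding filterlim_at using X by (auto intro: always_eventually)
  qed
  have "AE t in lborel. t \<in> {0<..<T} \<longrightarrow> ((\<lambda>h. \<phi> h t) \<longlongrightarrow> 1) (at_right 0)"
    using phi_lim by (subst (asm) AE_lebesgue_on) auto
  from AE_fst_lborel[OF this, where 'a="real^'d"] show ?thesis
  proof eventually_elim
    case (elim z)
    show ?case
    proof
      assume z: "z \<in> Q"
      then have "(\<lambda>n. \<phi> (X n) (fst z)) \<longlonglongrightarrow> 1"
        using elim filterlim_compose[OF _ Xr] by (auto simp: cylinder_def)
      moreover have "(\<lambda>n. eta \<Omega> (X n) (snd z)) \<longlonglongrightarrow> 1"
      proof (rule tendsto_eventually)
        have s: "snd z \<in> \<Omega>" using z by (auto simp: cylinder_def)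
        then have "\<forall>\<^sub>F n in sequentially. X n < bd (snd z) / 3"
          using order_tendstoD(2)[OF X(2), of "bd (snd z) / 3"] bd_pos by simp
        then show "\<forall>\<^sub>F n in sequentially. eta \<Omega> (X n) (snd z) = 1"
          by eventually_elim (rule eta_eq_1[OF X(1) s], simp)
      qed
      ultimately show "(\<lambda>n. cutoff (X n) z) \<longlonglongrightarrow> 1"
        unfolding cutoff_def using tendsto_mult[of "\<lambda>n. eta \<Omega> (X n) (snd z)" 1 sequentially "\<lambda>n. \<phi> (X n) (fst z)" 1] by simp
    qed
  qed
qed

lemma smoothed_lux_tendsto:
  fixes f :: "real \<times> (real^'d) \<Rightarrow> 'b::euclidean_space"
  assumes q: "q \<in> P_log Q" and f: "f \<in> Lvar Q q"
  shows "((\<lambda>h. lux_norm Q q (\<lambda>z. smoothed h f z - f z)) \<longlongrightarrow> 0) (at_right 0)"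
proof (rule tendsto_at_right_0_sequentially)
  fix X :: "nat \<Rightarrow> real" assume X: "\<And>n. 0 < X n" "X \<longlonglongrightarrow> 0"
  show "(\<lambda>n. lux_norm Q q (\<lambda>z. smoothed (X n) f z - f z)) \<longlonglongrightarrow> 0"
    unfolding smoothed_def
    by (rule cutoff_mollify_lux_seq[OF Q_sets Q_bounded q f X])
       (simp_all add: cutoff_measurable cutoff_nonneg cutoff_le_1 X cutoff_tendsto_1)
qed

lemma smoothed_measurable:
  fixes f :: "real \<times> (real^'d) \<Rightarrow> 'b::euclidean_space"
  assumes "0 < h" "integrable lebesgue (zero_ext Q f)"
  shows "smoothed h f \<in> borel_measurable (lebesgue_on Q)"
  by (intro measurable_restrict_space1 continuous_lebesgue_measurable smooth_continuous smoothed_smooth assms)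

lemma boundary_part_norm_le: "norm (boundary_part c f z) \<le> norm (f z)"
  by (simp add: boundary_part_def indicator_def)

text \<open>The factor 1/h from the gradient of the cutoff cancels the factor h from the Riesz
  kernel.\<close>

lemma commutator_le_ball_avg:
  assumes be: "boundary_estimate \<Omega> h0 c0" and c0: "0 < c0"
  shows "\<exists>C>0. \<forall>h q p u z. 0 < h \<longrightarrow> 3 * h \<le> h0 \<longrightarrow> q \<in> P_log Q \<longrightarrow> p \<in> P_log Q \<longrightarrow> u \<in> XX_eps T \<Omega> q p \<longrightarrow>
    ennreal (norm (commutator h u z)) \<le> ennreal C * ball_avg (zero_ext Q (boundary_part (9 * h) (distr_sym_grad st_dir Q u))) z (8 * h)"
proof -
  obtain C where C: "0 < C" and CI: "\<forall>h q p u z. 0 < h \<longrightarrow> 3 * h \<le> h0 \<longrightarrow> q \<in> P_log Q \<longrightarrow> p \<in> P_log Q \<longrightarrow> u \<in> XX_eps T \<Omega> q p \<longrightarrow>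
    (\<integral>\<^sup>+y. ennreal (mollifier h (z - y)) * (indicator {x \<in> \<Omega>. bd x \<le> 3 * h} (snd y) * ennreal (norm (zero_ext Q u y))) \<partial>lebesgue)
    \<le> ennreal (C * h) * ball_avg (zero_ext Q (boundary_part (9 * h) (distr_sym_grad st_dir Q u))) z (8 * h)"
    using commutator_integral_bound[OF be c0] by (elim exE conjE)
  obtain C' where C': "0 < C'" and CI': "\<forall>h>0. \<forall>u z. zero_ext Q u \<in> borel_measurable lebesgue \<longrightarrow> ennreal (norm (commutator h u z)) \<le> ennreal (C' / h) *
     (\<integral>\<^sup>+y. ennreal (mollifier h (z - y)) * (indicator {x \<in> \<Omega>. bd x \<le> 3 * h} (snd y) * ennreal (norm (zero_ext Q u y))) \<partial>lebesgue)"
    using commutator_bound by (elim exE conjE)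
  show ?thesis
  proof (intro exI[of _ "C' * C"] conjI allI impI)
    fix h :: real and q p :: "real \<times> (real^'d) \<Rightarrow> real" and u :: "real \<times> (real^'d) \<Rightarrow> real^'d" and z :: "real \<times> (real^'d)"
    assume h: "0 < h" "3 * h \<le> h0" and q: "q \<in> P_log Q" and p: "p \<in> P_log Q" and u: "u \<in> XX_eps T \<Omega> q p"
    let ?A = "ball_avg (zero_ext Q (boundary_part (9 * h) (distr_sym_grad st_dir Q u))) z (8 * h)"
    have "zero_ext Q u \<in> borel_measurable lebesgue" using XX_epsD(4)[OF q p u] by auto
    from CI'[rule_format, OF h(1) this] have "ennreal (norm (commutator h u z)) \<le> ennreal (C' / h) *
     (\<integral>\<^sup>+y. ennreal (mollifier h (z - y)) * (indicator {x \<in> \<Omega>. bd x \<le> 3 * h} (snd y) * ennreal (norm (zero_ext Q u y))) \<partial>lebesgue)" .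
    also have "\<dots> \<le> ennreal (C' / h) * (ennreal (C * h) * ?A)"
      by (rule mult_left_mono[OF CI[rule_format, OF h q p u]]) simp
    also have "\<dots> = (ennreal (C' / h) * ennreal (C * h)) * ?A" by (rule mult.assoc[symmetric])
    also have "ennreal (C' / h) * ennreal (C * h) = ennreal (C' * C)" using h C C' by (simp flip: ennreal_mult)
    finally show "ennreal (norm (commutator h u z)) \<le> ennreal (C' * C) * ?A" .
  qed (use C C' in simp)
qed

text \<open>The smoothing of the gradient and the commutator are put on the same average. C is
  chosen before the exponents and u, as the constant in (ii) must be.\<close>

lemma sym_grad_smoothed_le_ball_avg:
  assumes be: "boundary_estimate \<Omega> h0 c0" and c0: "0 < c0"
  shows "\<exists>C>0. \<forall>h q p u z. 0 < h \<longrightarrow> 3 * h \<le> h0 \<longrightarrow> q \<in> P_log Q \<longrightarrow> p \<in> P_log Q \<longrightarrow> u \<in> XX_eps T \<Omega> q p \<longrightarrow>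
    ennreal (norm (sym_grad st_dir (smoothed h u) z)) \<le> ennreal C * ball_avg (zero_ext Q (distr_sym_grad st_dir Q u)) z (8 * h)"
proof -
  let ?n = "DIM(real \<times> (real^'d))"
  obtain C where C: "0 < C" and CI: "\<forall>h q p u z. 0 < h \<longrightarrow> 3 * h \<le> h0 \<longrightarrow> q \<in> P_log Q \<longrightarrow> p \<in> P_log Q \<longrightarrow> u \<in> XX_eps T \<Omega> q p \<longrightarrow>
    ennreal (norm (commutator h u z)) \<le> ennreal C * ball_avg (zero_ext Q (boundary_part (9 * h) (distr_sym_grad st_dir Q u))) z (8 * h)"
    using commutator_le_ball_avg[OF be c0] by (elim exE conjE)
  show ?thesis
  proof (rule mollify_le_ball_avg[where 'a="real \<times> (real^'d)" and 'b="real^'d^'d"])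
    fix C' :: real
    assume C': "0 < C'" and CI': "\<And>h (f :: real \<times> (real^'d) \<Rightarrow> real^'d^'d) z. 0 < h \<Longrightarrow> f \<in> borel_measurable lebesgue \<Longrightarrow>
     (\<integral>\<^sup>+y. ennreal (mollifier h (z - y)) * ennreal (norm (f y)) \<partial>lborel) \<le> ennreal C' * ball_avg f z h"
    show ?thesis
    proof (intro exI[of _ "C' * 8 ^ ?n + C"] conjI allI impI)
      fix h :: real and q p :: "real \<times> (real^'d) \<Rightarrow> real" and u :: "real \<times> (real^'d) \<Rightarrow> real^'d" and z :: "real \<times> (real^'d)"
      assume h: "0 < h" "3 * h \<le> h0" and q: "q \<in> P_log Q" and p: "p \<in> P_log Q" and u: "u \<in> XX_eps T \<Omega> q p"
      let ?E = "distr_sym_grad st_dir Q u"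
      let ?A = "ball_avg (zero_ext Q ?E) z (8 * h)"
      note X = XX_epsD[OF q p u]
      have "ennreal (norm (smoothed h ?E z)) \<le> ennreal C' * ball_avg (zero_ext Q ?E) z h"
        by (rule order_trans[OF smoothed_norm_le[OF h(1)] CI'[OF h(1)]]) (use X(5) in auto)
      also have "\<dots> \<le> ennreal C' * (ennreal (8 ^ ?n) * ?A)"
        by (intro mult_left_mono ball_avg_enlarge h) simp
      also have "\<dots> = ennreal (C' * 8 ^ ?n) * ?A" using C' by (simp only: mult.assoc[symmetric]) (simp flip: ennreal_mult)
      finally have 1: "ennreal (norm (smoothed h ?E z)) \<le> ennreal (C' * 8 ^ ?n) * ?A" .
      have "ennreal (norm (commutator h u z)) \<le> ennreal C * ball_avg (zero_ext Q (boundary_part (9 * h) ?E)) z (8 * h)"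
        by (rule CI[rule_format, OF h q p u])
      also have "\<dots> \<le> ennreal C * ?A"
        by (intro mult_left_mono ball_avg_mono) (auto simp: zero_ext_def boundary_part_norm_le)
      finally have 2: "ennreal (norm (commutator h u z)) \<le> ennreal C * ?A" .
      have "norm (sym_grad st_dir (smoothed h u) z) \<le> norm (smoothed h ?E z) + norm (commutator h u z)"
        unfolding sym_grad_smoothed[OF h(1) X(3,4,5)] by (rule norm_triangle_ineq)
      then have "ennreal (norm (sym_grad st_dir (smoothed h u) z)) \<le> ennreal (norm (smoothed h ?E z)) + ennreal (norm (commutator h u z))"
        by (simp add: ennreal_leI flip: ennreal_plus)
      also have "\<dots> \<le> ennreal (C' * 8 ^ ?n) * ?A + ennreal C * ?A" by (rule add_mono[OF 1 2])
      also have "\<dots> = ennreal (C' * 8 ^ ?n + C) * ?A" using C C' by (simp add: distrib_right ennreal_plus)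
      finally show "ennreal (norm (sym_grad st_dir (smoothed h u) z)) \<le> ennreal (C' * 8 ^ ?n + C) * ?A" .
    qed (use C C' in \<open>simp add: add_pos_pos\<close>)
  qed
qed

lemma sym_grad_smoothed_measurable:
  assumes "0 < h" "integrable lebesgue (zero_ext Q u)"
  shows "sym_grad st_dir (smoothed h u) \<in> borel_measurable (lebesgue_on Q)"
  by (intro measurable_restrict_space1 continuous_lebesgue_measurable sym_grad_continuous smoothed_smooth assms st_dir_Basis)

text \<open>K is allowed to depend on p, through the averaging bound, but is chosen before q, u and
  h.\<close>

lemma sym_grad_smoothed_lux_le:
  assumes be: "boundary_estimate \<Omega> h0 c0" and c0: "0 < c0" and p: "p \<in> P_log Q"
  shows "\<exists>K>0. \<forall>h q u. 0 < h \<longrightarrow> 3 * h \<le> h0 \<longrightarrow> q \<in> P_log Q \<longrightarrow> u \<in> XX_eps T \<Omega> q p \<longrightarrow>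
    lux_norm Q p (sym_grad st_dir (smoothed h u)) \<le> ennreal K * lux_norm Q p (distr_sym_grad st_dir Q u)"
proof -
  obtain C where C: "0 < C" and CI: "\<forall>h q p u z. 0 < h \<longrightarrow> 3 * h \<le> h0 \<longrightarrow> q \<in> P_log Q \<longrightarrow> p \<in> P_log Q \<longrightarrow> u \<in> XX_eps T \<Omega> q p \<longrightarrow>
    ennreal (norm (sym_grad st_dir (smoothed h u) z)) \<le> ennreal C * ball_avg (zero_ext Q (distr_sym_grad st_dir Q u)) z (8 * h)"
    using sym_grad_smoothed_le_ball_avg[OF be c0] by (elim exE conjE)
  show ?thesis
  proof (rule averaging_lux_norm[OF Q_sets Q_bounded p, where 'b="real^'d^'d" and 'c="real^'d^'d"])
    fix K :: real
    assume K: "0 < K" and le: "\<And>R C (f :: real \<times> (real^'d) \<Rightarrow> real^'d^'d) (g :: real \<times> (real^'d) \<Rightarrow> real^'d^'d).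
     0 < R \<Longrightarrow> 0 < C \<Longrightarrow> f \<in> borel_measurable (lebesgue_on Q) \<Longrightarrow> g \<in> borel_measurable (lebesgue_on Q) \<Longrightarrow>
     \<forall>x\<in>Q. ennreal (norm (g x)) \<le> ennreal C * ball_avg (zero_ext Q f) x R \<Longrightarrow>
     lux_norm Q p g \<le> ennreal (C * K) * lux_norm Q p f"
    show ?thesis
    proof (intro exI[of _ "C * K"] conjI allI impI)
      fix h q u assume h: "0 < h" "3 * h \<le> h0" and q: "q \<in> P_log Q" and u: "u \<in> XX_eps T \<Omega> q p"
      note X = XX_epsD[OF q p u]
      show "lux_norm Q p (sym_grad st_dir (smoothed h u)) \<le> ennreal (C * K) * lux_norm Q p (distr_sym_grad st_dir Q u)"
      proof (rule le)
        show "0 < 8 * h" using h by simp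
        show "\<forall>z\<in>Q. ennreal (norm (sym_grad st_dir (smoothed h u) z)) \<le> ennreal C * ball_avg (zero_ext Q (distr_sym_grad st_dir Q u)) z (8 * h)"
          by (intro ballI CI[rule_format, OF h q p u])
      qed (use C X sym_grad_smoothed_measurable[OF h(1) X(4)] in \<open>auto simp: Lvar_def\<close>)
    qed (use C K in simp)
  qed
qed

lemma commutator_lux_tendsto:
  assumes be: "boundary_estimate \<Omega> h0 c0" and c0: "0 < c0" and h0: "0 < h0" and q: "q \<in> P_log Q" and p: "p \<in> P_log Q" and u: "u \<in> XX_eps T \<Omega> q p"
    and X: "\<And>n. 0 < X n" "X \<longlonglongrightarrow> (0::real)"
  shows "(\<lambda>n. lux_norm Q p (commutator (X n) u)) \<longlonglongrightarrow> 0"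
proof -
  let ?E = "distr_sym_grad st_dir Q u"
  note XD = XX_epsD[OF q p u]
  obtain C where C: "0 < C" and CI: "\<forall>h q p u z. 0 < h \<longrightarrow> 3 * h \<le> h0 \<longrightarrow> q \<in> P_log Q \<longrightarrow> p \<in> P_log Q \<longrightarrow> u \<in> XX_eps T \<Omega> q p \<longrightarrow>
    ennreal (norm (commutator h u z)) \<le> ennreal C * ball_avg (zero_ext Q (boundary_part (9 * h) (distr_sym_grad st_dir Q u))) z (8 * h)"
    using commutator_le_ball_avg[OF be c0] by (elim exE conjE)
  obtain P where P: "\<And>x. x \<in> Q \<Longrightarrow> p x \<le> P" using P_logD(3)[OF p] by blast
  have lim: "(\<lambda>n. lux_norm Q p (boundary_part (9 * X n) ?E)) \<longlonglongrightarrow> 0"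
    unfolding boundary_part_def[abs_def]
  proof (rule lux_norm_restrict_tendsto_0[OF Q_sets XD(2) P_logD(1)[OF p] P_logD(2)[OF p] P boundary_strip_sets])
    fix z assume "z \<in> Q"
    then have "0 < bd (snd z) / 9" using bd_pos by (auto simp: cylinder_def)
    then have "\<forall>\<^sub>F n in sequentially. X n < bd (snd z) / 9" using order_tendstoD(2)[OF X(2)] by blast
    then show "\<forall>\<^sub>F n in sequentially. z \<notin> UNIV \<times> {x \<in> \<Omega>. bd x \<le> 9 * X n}"
      by eventually_elim (cases z, simp)
  qed
  show ?thesis
  proof (rule averaging_lux_norm[OF Q_sets Q_bounded p, where 'b="real^'d^'d" and 'c="real^'d^'d"])
    fix K :: real
    assume K: "0 < K" and le: "\<And>R C (f :: real \<times> (real^'d) \<Rightarrow> real^'d^'d) (g :: real \<times> (real^'d) \<Rightarrow> real^'d^'d).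
     0 < R \<Longrightarrow> 0 < C \<Longrightarrow> f \<in> borel_measurable (lebesgue_on Q) \<Longrightarrow> g \<in> borel_measurable (lebesgue_on Q) \<Longrightarrow>
     \<forall>x\<in>Q. ennreal (norm (g x)) \<le> ennreal C * ball_avg (zero_ext Q f) x R \<Longrightarrow>
     lux_norm Q p g \<le> ennreal (C * K) * lux_norm Q p f"
    have "(\<lambda>n. ennreal (C * K) * lux_norm Q p (boundary_part (9 * X n) ?E)) \<longlonglongrightarrow> ennreal (C * K) * 0"
      by (intro ennreal_tendsto_cmult lim) simp
    then have l0: "(\<lambda>n. ennreal (C * K) * lux_norm Q p (boundary_part (9 * X n) ?E)) \<longlonglongrightarrow> 0" by simp
    have "\<forall>\<^sub>F n in sequentially. X n < h0 / 3" using order_tendstoD(2)[OF X(2), of "h0 / 3"] h0 by simp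
    then have ev: "\<forall>\<^sub>F n in sequentially. lux_norm Q p (commutator (X n) u) \<le> ennreal (C * K) * lux_norm Q p (boundary_part (9 * X n) ?E)"
    proof eventually_elim
      case (elim n)
      have m: "commutator (X n) u \<in> borel_measurable (lebesgue_on Q)"
      proof -
        have [measurable]: "sym_grad st_dir (smoothed (X n) u) \<in> borel_measurable (lebesgue_on Q)" "smoothed (X n) ?E \<in> borel_measurable (lebesgue_on Q)"
          by (rule sym_grad_smoothed_measurable[OF X(1) XD(4)], rule smoothed_measurable[OF X(1) XD(5)])
        \<comment> \<open>Measurability of the commutator, an array of parameter integrals, is read
          off from this difference of two continuous functions.\<close>
        have "commutator (X n) u = (\<lambda>z. sym_grad st_dir (smoothed (X n) u) z - smoothed (X n) ?E z)"
          by (simp add: sym_grad_smoothed[OF X(1) XD(3,4,5)])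
        then show ?thesis by simp
      qed
      show ?case
      proof (rule le[OF _ C _ m])
        show "0 < 8 * X n" using X by simp
        show "boundary_part (9 * X n) ?E \<in> borel_measurable (lebesgue_on Q)"
          using Lvar_restrict[OF Q_sets XD(2) boundary_strip_sets] by (simp add: Lvar_def boundary_part_def[abs_def])
        show "\<forall>z\<in>Q. ennreal (norm (commutator (X n) u z)) \<le> ennreal C * ball_avg (zero_ext Q (boundary_part (9 * X n) ?E)) z (8 * X n)"
          using elim by (intro ballI CI[rule_format, OF X(1) _ q p u]) simp
      qed
    qed
    show ?thesis
      by (rule tendsto_sandwich[OF always_eventually ev tendsto_const l0]) (rule allI, rule zero_le)
  qed
qed

text \<open>For functions vanishing off the cylinder the extended exponent is never felt outside, so
  the first inequality of each chain in (iii) is an equality term by term.\<close>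

lemma lux_norm_zero_outside:
  assumes "\<And>z. z \<notin> Q \<Longrightarrow> f z = 0" "\<And>z. z \<in> Q \<Longrightarrow> q' z = q z"
  shows "lux_norm UNIV q' f = lux_norm Q q f"
proof -
  have lebesgue_UNIV: "UNIV \<in> sets (lebesgue :: (real \<times> (real^'d)) measure)" by simp
  have "modular UNIV q' (\<lambda>x. f x /\<^sub>R l) = modular Q q (\<lambda>x. f x /\<^sub>R l)" for l
    unfolding modular_eq[OF Q_sets] modular_eq[OF lebesgue_UNIV]
    by (rule nn_integral_cong) (use assms in \<open>auto simp: indicator_def\<close>)
  then show ?thesis by (simp add: lux_norm_def)
qed

text \<open>The gradient of the error is the smoothing error of the symmetric gradient plus the
  commutator. Both tend to 0, the first as for any function in the Lebesgue space, the second by the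
  shrinking strips.\<close>

lemma XX_norm_smoothed_diff_tendsto:
  assumes be: "boundary_estimate \<Omega> h0 c0" and c0: "0 < c0" and h0: "0 < h0" and q: "q \<in> P_log Q" and p: "p \<in> P_log Q" and u: "u \<in> XX_eps T \<Omega> q p"
  shows "((\<lambda>h. XX_norm T \<Omega> q p (\<lambda>z. smoothed h u z - u z)) \<longlongrightarrow> 0) (at_right 0)"
proof (rule tendsto_at_right_0_sequentially)
  let ?E = "distr_sym_grad st_dir Q u"
  note XD = XX_epsD[OF q p u]
  fix X :: "nat \<Rightarrow> real" assume X: "\<And>n. 0 < X n" "X \<longlonglongrightarrow> 0"
  have Xr: "filterlim X (at_right 0) sequentially"
  proof -
    have "X n \<noteq> 0" for n using X(1)[of n] by simp
    then show ?thesis unfolding filterlim_at using X by (auto intro: always_eventually)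
  qed
  have 1: "(\<lambda>n. lux_norm Q q (\<lambda>z. smoothed (X n) u z - u z)) \<longlonglongrightarrow> 0"
    by (rule filterlim_compose[OF smoothed_lux_tendsto[OF q XD(1)] Xr])
  have 2: "(\<lambda>n. lux_norm Q p (\<lambda>z. smoothed (X n) ?E z - ?E z)) \<longlonglongrightarrow> 0"
    by (rule filterlim_compose[OF smoothed_lux_tendsto[OF p XD(2)] Xr])
  have Em [measurable]: "?E \<in> borel_measurable (lebesgue_on Q)" using XD(2) by (simp add: Lvar_def)
  have m1 [measurable]: "smoothed (X n) ?E \<in> borel_measurable (lebesgue_on Q)" "sym_grad st_dir (smoothed (X n) u) \<in> borel_measurable (lebesgue_on Q)" for n
    by (rule smoothed_measurable[OF X(1) XD(5)], rule sym_grad_smoothed_measurable[OF X(1) XD(4)])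
  have c: "commutator (X n) u = (\<lambda>z. sym_grad st_dir (smoothed (X n) u) z - smoothed (X n) ?E z)" for n
    by (simp add: sym_grad_smoothed[OF X(1) XD(3,4,5)])
  have "(\<lambda>n. lux_norm Q p (\<lambda>z. (smoothed (X n) ?E z - ?E z) + commutator (X n) u z)) \<longlonglongrightarrow> 0"
  proof (rule lux_norm_tendsto_0_add[OF Q_sets _ _ P_logD(1)[OF p] P_logD(2)[OF p] 2 commutator_lux_tendsto[OF be c0 h0 q p u X]])
    show "\<forall>\<^sub>F n in sequentially. (\<lambda>z. smoothed (X n) ?E z - ?E z) \<in> borel_measurable (lebesgue_on Q)"
      by (intro always_eventually allI) measurable
    show "\<forall>\<^sub>F n in sequentially. commutator (X n) u \<in> borel_measurable (lebesgue_on Q)"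
      unfolding c by (intro always_eventually allI) measurable
  qed
  moreover have "lux_norm Q p (distr_sym_grad st_dir Q (\<lambda>z. smoothed (X n) u z - u z)) = lux_norm Q p (\<lambda>z. (smoothed (X n) ?E z - ?E z) + commutator (X n) u z)" for n
  proof -
    have "has_distr_sym_grad st_dir Q (\<lambda>z. smoothed (X n) u z - u z) (\<lambda>z. sym_grad st_dir (smoothed (X n) u) z - ?E z)"
      by (intro has_distr_sym_grad_diff C0_infty_has_distr_sym_grad smoothed_C0_infty(1) X XD st_dir_Basis)
    from lux_norm_distr_sym_grad[OF Q_open this] show ?thesis by (simp add: c)
  qed
  ultimately have 3: "(\<lambda>n. lux_norm Q p (distr_sym_grad st_dir Q (\<lambda>z. smoothed (X n) u z - u z))) \<longlonglongrightarrow> 0" by simp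
  show "(\<lambda>n. XX_norm T \<Omega> q p (\<lambda>z. smoothed (X n) u z - u z)) \<longlonglongrightarrow> 0"
    unfolding XX_norm_def eps_norm_def using tendsto_add[OF 1 3] by simp
qed

end

text \<open>The representatives chosen for the gradients of u - v and v - u are unrelated choices;
  they are opposite only almost everywhere, so the symmetry goes through concrete gradients E and
  F.\<close>

lemma eps_norm_minus_commute:
  fixes u v :: "'a::euclidean_space \<Rightarrow> real^'d::finite"
  assumes G: "open G" and e: "\<And>i. e i \<in> Basis" and u: "has_distr_sym_grad e G u E" and v: "has_distr_sym_grad e G v F"
  shows "eps_norm e G q p (\<lambda>x. u x - v x) = eps_norm e G q p (\<lambda>x. v x - u x)"
proof -
  have s: "G \<in> sets lebesgue" using G by auto
  have "lux_norm G q (\<lambda>x. u x - v x) = lux_norm G q (\<lambda>x. v x - u x)"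
    "lux_norm G p (\<lambda>x. E x - F x) = lux_norm G p (\<lambda>x. F x - E x)"
    by (auto intro!: lux_norm_cong_AE[OF s] simp: norm_minus_commute)
  then show ?thesis
    unfolding eps_norm_def lux_norm_distr_sym_grad[OF G has_distr_sym_grad_diff[OF e u v]]
      lux_norm_distr_sym_grad[OF G has_distr_sym_grad_diff[OF e v u]] by simp
qed

section \<open>Linearity of the smoothing and assembly of the four assertions\<close>

context smoothing
begin

lemma smoothed_add:
  fixes u v :: "real \<times> (real^'d) \<Rightarrow> 'b::euclidean_space"
  assumes h: "0 < h" and "integrable lebesgue (zero_ext Q u)" "integrable lebesgue (zero_ext Q v)"
  shows "smoothed h (\<lambda>z. u z + v z) = (\<lambda>z. smoothed h u z + smoothed h v z)"
proof
  fix z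
  have "(\<lambda>z. cutoff h z *\<^sub>R zero_ext Q (\<lambda>z. u z + v z) z) = (\<lambda>z. cutoff h z *\<^sub>R zero_ext Q u z + cutoff h z *\<^sub>R zero_ext Q v z)"
    by (auto simp: zero_ext_def scaleR_add_right)
  then show "smoothed h (\<lambda>z. u z + v z) z = smoothed h u z + smoothed h v z"
    unfolding smoothed_def by (simp add: convolve_add[OF mollifier_C0_infty[OF h]] cutoff_mult_integrable assms)
qed

lemma smoothed_scaleR: "smoothed h (\<lambda>z. a *\<^sub>R u z) = (\<lambda>z. a *\<^sub>R smoothed h u z)"
proof
  fix z
  have "(\<lambda>z. cutoff h z *\<^sub>R zero_ext Q (\<lambda>z. a *\<^sub>R u z) z) = (\<lambda>z. a *\<^sub>R (cutoff h z *\<^sub>R zero_ext Q u z))"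
    by (auto simp: zero_ext_def)
  then show "smoothed h (\<lambda>z. a *\<^sub>R u z) z = a *\<^sub>R smoothed h u z"
    unfolding smoothed_def by (simp only: convolve_scaleR)
qed

end

theorem proposition5p18:
  fixes \<Omega> :: "(real^'d::finite) set" and T h0 c0 h1 :: real and \<phi> :: "real \<Rightarrow> real \<Rightarrow> real"
  assumes "2 \<le> CARD('d)"
    and "bounded \<Omega>" and "lipschitz_domain \<Omega>"
    and "0 < T"
    and "0 < h0" and "0 < c0" and "boundary_estimate \<Omega> h0 c0" and "h1 = h0 / 4"
    and "\<And>h. 0 < h \<Longrightarrow> \<phi> h \<in> C0_infty {0<..<T}"
    and "\<And>h. 0 < h \<Longrightarrow> closed_supp (\<phi> h) \<subseteq> {2 * h<..<T - 2 * h}"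
    and "\<And>h t. 0 < h \<Longrightarrow> 0 \<le> \<phi> h t \<and> \<phi> h t \<le> 1"
    and "AE t in lebesgue_on {0<..<T}. ((\<lambda>h. \<phi> h t) \<longlongrightarrow> 1) (at_right 0)"
  shows "\<exists>cd::real. 0 < cd \<and> (\<forall>q p.
    q \<in> P_log (cylinder T \<Omega>) \<and> p \<in> P_log (cylinder T \<Omega>) \<and>
    1 < ess_minus (cylinder T \<Omega>) q \<and> 1 < ess_minus (cylinder T \<Omega>) p \<longrightarrow>
    \<comment> \<open>(i)\<close>
    (\<forall>u \<in> XX_eps T \<Omega> q p. \<forall>h>0.
       R_ring \<phi> T \<Omega> h u \<in> C0_infty (cylinder T \<Omega>) \<and>
       {z. R_ring \<phi> T \<Omega> h u z \<noteq> 0} \<subseteq> {h<..<T - h} \<times> inner_part \<Omega> h \<and>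
       closed_supp (R_ring \<phi> T \<Omega> h u) \<subseteq> {h<..<T - h} \<times> {x \<in> \<Omega>. h \<le> infdist x (frontier \<Omega>)}) \<and>
    \<comment> \<open>(ii)\<close>
    (\<forall>u \<in> XX_eps T \<Omega> q p.
       (AE z in lebesgue_on (cylinder T \<Omega>).
          (SUP h\<in>{0<..}. ennreal (norm (R_ring \<phi> T \<Omega> h u z)))
          \<le> 2 * maximal_fn (zero_ext (cylinder T \<Omega>) u) z) \<and>
       (AE z in lebesgue_on (cylinder T \<Omega>).
          (SUP h\<in>{0<..<h1}. ennreal (norm (sym_grad st_dir (R_ring \<phi> T \<Omega> h u) z)))
          \<le> ennreal cd *
             maximal_fn (zero_ext (cylinder T \<Omega>) (distr_sym_grad st_dir (cylinder T \<Omega>) u)) z)) \<and>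
    \<comment> \<open>(iii)\<close>
    (\<forall>q' \<in> P_log UNIV.
       (\<forall>z \<in> cylinder T \<Omega>. q' z = q z) \<and>
       (\<forall>z. ess_minus (cylinder T \<Omega>) q \<le> ereal (q' z) \<and>
            ereal (q' z) \<le> ess_plus (cylinder T \<Omega>) q) \<longrightarrow>
       (\<exists>cq::real. 0 < cq \<and> (\<forall>u \<in> XX_eps T \<Omega> q p.
          (SUP h\<in>{0<..}. lux_norm (cylinder T \<Omega>) q (R_ring \<phi> T \<Omega> h u))
            \<le> (SUP h\<in>{0<..}. lux_norm UNIV q' (R_ring \<phi> T \<Omega> h u)) \<and>
          (SUP h\<in>{0<..}. lux_norm UNIV q' (R_ring \<phi> T \<Omega> h u))
            \<le> ennreal cq * lux_norm (cylinder T \<Omega>) q u))) \<and>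
    (\<forall>p' \<in> P_log UNIV.
       (\<forall>z \<in> cylinder T \<Omega>. p' z = p z) \<and>
       (\<forall>z. ess_minus (cylinder T \<Omega>) p \<le> ereal (p' z) \<and>
            ereal (p' z) \<le> ess_plus (cylinder T \<Omega>) p) \<longrightarrow>
       (\<exists>cp::real. 0 < cp \<and> (\<forall>u \<in> XX_eps T \<Omega> q p.
          (SUP h\<in>{0<..<h1}. lux_norm (cylinder T \<Omega>) p (sym_grad st_dir (R_ring \<phi> T \<Omega> h u)))
            \<le> (SUP h\<in>{0<..<h1}. lux_norm UNIV p' (sym_grad st_dir (R_ring \<phi> T \<Omega> h u))) \<and>
          (SUP h\<in>{0<..<h1}. lux_norm UNIV p' (sym_grad st_dir (R_ring \<phi> T \<Omega> h u)))
            \<le> ennreal cp *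
               lux_norm (cylinder T \<Omega>) p (distr_sym_grad st_dir (cylinder T \<Omega>) u)))) \<and>
    (\<forall>h\<in>{0<..<h1}.
       (\<forall>u \<in> XX_eps T \<Omega> q p. R_ring \<phi> T \<Omega> h u \<in> XX_eps T \<Omega> q p) \<and>
       (\<forall>u \<in> XX_eps T \<Omega> q p. \<forall>v \<in> XX_eps T \<Omega> q p.
          R_ring \<phi> T \<Omega> h (\<lambda>z. u z + v z) = (\<lambda>z. R_ring \<phi> T \<Omega> h u z + R_ring \<phi> T \<Omega> h v z)) \<and>
       (\<forall>a. \<forall>u \<in> XX_eps T \<Omega> q p.
          R_ring \<phi> T \<Omega> h (\<lambda>z. a *\<^sub>R u z) = (\<lambda>z. a *\<^sub>R R_ring \<phi> T \<Omega> h u z)) \<and>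
       (\<exists>C::real. 0 < C \<and> (\<forall>u \<in> XX_eps T \<Omega> q p.
          XX_norm T \<Omega> q p (R_ring \<phi> T \<Omega> h u) \<le> ennreal C * XX_norm T \<Omega> q p u))) \<and>
    \<comment> \<open>(iv)\<close>
    (\<forall>u \<in> XX_eps T \<Omega> q p.
       ((\<lambda>h. XX_norm T \<Omega> q p (\<lambda>z. R_ring \<phi> T \<Omega> h u z - u z)) \<longlongrightarrow> 0) (at_right 0)) \<and>
    C0_infty (cylinder T \<Omega>) \<subseteq> XX_eps T \<Omega> q p \<and>
    (\<forall>u \<in> XX_eps T \<Omega> q p. \<forall>\<epsilon>>0. \<exists>v \<in> C0_infty (cylinder T \<Omega>).
       XX_norm T \<Omega> q p (\<lambda>z. u z - v z) < \<epsilon>))"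
proof -
  have "open \<Omega>" using assms(3) by (simp add: lipschitz_domain_def)
  then interpret smoothing \<Omega> T \<phi>
    by unfold_locales (use assms in auto)
  note be = assms(7) and c0 = assms(6) and h0 = assms(5)
  \<comment> \<open>This constant becomes c_d; it is fixed here, before any exponent or function is
    introduced.\<close>
  obtain C where C: "0 < C" and CI: "\<forall>h q p u z. 0 < h \<longrightarrow> 3 * h \<le> h0 \<longrightarrow> q \<in> P_log Q \<longrightarrow> p \<in> P_log Q \<longrightarrow> u \<in> XX_eps T \<Omega> q p \<longrightarrow>
    ennreal (norm (sym_grad st_dir (smoothed h u) z)) \<le> ennreal C * ball_avg (zero_ext Q (distr_sym_grad st_dir Q u)) z (8 * h)"
    using sym_grad_smoothed_le_ball_avg[OF be c0] by (elim exE conjE)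
  \<comment> \<open>h < h0/4 places the strip of width 3h, where the cutoff varies, inside the range
    of the boundary estimate.\<close>
  have h1: "0 < h" "3 * h \<le> h0" if "h \<in> {0<..<h1}" for h
    using that assms(8) by auto
  show ?thesis
  proof (rule exI[of _ C], rule conjI, rule C, intro allI, rule impI, goal_cases)
    case (1 q p)
    then have q: "q \<in> P_log Q" and p: "p \<in> P_log Q" by auto
    note XD = XX_epsD[OF q p]
    obtain Kq where Kq: "0 < Kq" "\<forall>h>0. \<forall>f\<in>Lvar Q q. lux_norm Q q (smoothed h f :: real \<times> (real^'d) \<Rightarrow> real^'d) \<le> ennreal Kq * lux_norm Q q f"
      using smoothed_lux_le[OF q, where 'b="real^'d"] by (elim exE conjE)
    obtain Kp where Kp: "0 < Kp" "\<forall>h q u. 0 < h \<longrightarrow> 3 * h \<le> h0 \<longrightarrow> q \<in> P_log Q \<longrightarrow> u \<in> XX_eps T \<Omega> q p \<longrightarrow>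
      lux_norm Q p (sym_grad st_dir (smoothed h u)) \<le> ennreal Kp * lux_norm Q p (distr_sym_grad st_dir Q u)"
      using sym_grad_smoothed_lux_le[OF be c0 p] by (elim exE conjE)
    have C0: "smoothed h u \<in> C0_infty Q" if "0 < h" "u \<in> XX_eps T \<Omega> q p" for h u
      by (rule smoothed_C0_infty(1)[OF that(1) XD(4)[OF that(2)]])
    have out: "smoothed h u z = 0" "sym_grad st_dir (smoothed h u) z = 0" if "0 < h" "u \<in> XX_eps T \<Omega> q p" "z \<notin> Q" for h u z
      using C0_infty_outside[OF C0[OF that(1,2)] that(3)] by (auto simp: sym_grad_def vec_eq_iff)

    have i: "\<forall>u \<in> XX_eps T \<Omega> q p. \<forall>h>0.
       R_ring \<phi> T \<Omega> h u \<in> C0_infty Q \<and>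
       {z. R_ring \<phi> T \<Omega> h u z \<noteq> 0} \<subseteq> {h<..<T - h} \<times> inner_part \<Omega> h \<and>
       closed_supp (R_ring \<phi> T \<Omega> h u) \<subseteq> {h<..<T - h} \<times> {x \<in> \<Omega>. h \<le> infdist x (frontier \<Omega>)}"
      unfolding R_ring_eq using C0 smoothed_support smoothed_C0_infty(2)[OF _ XD(4)] by blast

    \<comment> \<open>Both estimates hold at every point: the first already with constant 1, the
      second because a single average of radius 8h is below the maximal function.\<close>
    have ii: "\<forall>u \<in> XX_eps T \<Omega> q p.
       (AE z in lebesgue_on Q. (SUP h\<in>{0<..}. ennreal (norm (R_ring \<phi> T \<Omega> h u z))) \<le> 2 * maximal_fn (zero_ext Q u) z) \<and>
       (AE z in lebesgue_on Q. (SUP h\<in>{0<..<h1}. ennreal (norm (sym_grad st_dir (R_ring \<phi> T \<Omega> h u) z)))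
          \<le> ennreal C * maximal_fn (zero_ext Q (distr_sym_grad st_dir Q u)) z)"
    proof (intro ballI conjI AE_I2 SUP_least; unfold R_ring_eq)
      fix u z and h :: real assume u: "u \<in> XX_eps T \<Omega> q p"
      {
        assume "h \<in> {0<..}"
        then have h: "0 < h" by simp
        have "ennreal (norm (smoothed h u z)) \<le> 1 * maximal_fn (zero_ext Q u) z"
          using order_trans[OF smoothed_norm_le[OF h] mollify_le_maximal_fn[OF h borel_measurable_integrable[OF XD(4)[OF u]]]] by simp
        also have "\<dots> \<le> 2 * maximal_fn (zero_ext Q u) z" by (rule mult_right_mono) simp_all
        finally show "ennreal (norm (smoothed h u z)) \<le> 2 * maximal_fn (zero_ext Q u) z" .
      }
      {
        assume h: "h \<in> {0<..<h1}"
        have "ennreal (norm (sym_grad st_dir (smoothed h u) z)) \<le> ennreal C * ball_avg (zero_ext Q (distr_sym_grad st_dir Q u)) z (8 * h)"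
          by (rule CI[rule_format, OF h1[OF h] q p u])
        also have "\<dots> \<le> ennreal C * maximal_fn (zero_ext Q (distr_sym_grad st_dir Q u)) z"
          using h1(1)[OF h] by (intro mult_left_mono ball_avg_le_maximal_fn) simp_all
        finally show "ennreal (norm (sym_grad st_dir (smoothed h u) z)) \<le> ennreal C * maximal_fn (zero_ext Q (distr_sym_grad st_dir Q u)) z" .
      }
    qed

    have iiiq: "\<forall>q' \<in> P_log UNIV. (\<forall>z \<in> Q. q' z = q z) \<and>
       (\<forall>z. ess_minus Q q \<le> ereal (q' z) \<and> ereal (q' z) \<le> ess_plus Q q) \<longrightarrow>
       (\<exists>cq::real. 0 < cq \<and> (\<forall>u \<in> XX_eps T \<Omega> q p.
          (SUP h\<in>{0<..}. lux_norm Q q (R_ring \<phi> T \<Omega> h u)) \<le> (SUP h\<in>{0<..}. lux_norm UNIV q' (R_ring \<phi> T \<Omega> h u)) \<and>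
          (SUP h\<in>{0<..}. lux_norm UNIV q' (R_ring \<phi> T \<Omega> h u)) \<le> ennreal cq * lux_norm Q q u))"
    proof (intro ballI impI)
      fix q' assume "(\<forall>z \<in> Q. q' z = q z) \<and> (\<forall>z. ess_minus Q q \<le> ereal (q' z) \<and> ereal (q' z) \<le> ess_plus Q q)"
      then have eq: "lux_norm UNIV q' (smoothed h u) = lux_norm Q q (smoothed h u)" if "0 < h" "u \<in> XX_eps T \<Omega> q p" for h u
        using out(1)[OF that] by (intro lux_norm_zero_outside) auto
      show "\<exists>cq::real. 0 < cq \<and> (\<forall>u \<in> XX_eps T \<Omega> q p.
          (SUP h\<in>{0<..}. lux_norm Q q (R_ring \<phi> T \<Omega> h u)) \<le> (SUP h\<in>{0<..}. lux_norm UNIV q' (R_ring \<phi> T \<Omega> h u)) \<and>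
          (SUP h\<in>{0<..}. lux_norm UNIV q' (R_ring \<phi> T \<Omega> h u)) \<le> ennreal cq * lux_norm Q q u)"
        unfolding R_ring_eq
      proof (intro exI[of _ Kq] conjI ballI Kq(1))
        fix u assume u: "u \<in> XX_eps T \<Omega> q p"
        show "(SUP h\<in>{0<..}. lux_norm Q q (smoothed h u)) \<le> (SUP h\<in>{0<..}. lux_norm UNIV q' (smoothed h u))"
          by (intro SUP_mono) (use eq[OF _ u] in \<open>metis greaterThan_iff order_refl\<close>)
        show "(SUP h\<in>{0<..}. lux_norm UNIV q' (smoothed h u)) \<le> ennreal Kq * lux_norm Q q u"
          using eq u Kq(2) XD(1)[OF u] by (intro SUP_least) simp
      qed
    qed

    have iiip: "\<forall>p' \<in> P_log UNIV. (\<forall>z \<in> Q. p' z = p z) \<and>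
       (\<forall>z. ess_minus Q p \<le> ereal (p' z) \<and> ereal (p' z) \<le> ess_plus Q p) \<longrightarrow>
       (\<exists>cp::real. 0 < cp \<and> (\<forall>u \<in> XX_eps T \<Omega> q p.
          (SUP h\<in>{0<..<h1}. lux_norm Q p (sym_grad st_dir (R_ring \<phi> T \<Omega> h u))) \<le> (SUP h\<in>{0<..<h1}. lux_norm UNIV p' (sym_grad st_dir (R_ring \<phi> T \<Omega> h u))) \<and>
          (SUP h\<in>{0<..<h1}. lux_norm UNIV p' (sym_grad st_dir (R_ring \<phi> T \<Omega> h u))) \<le> ennreal cp * lux_norm Q p (distr_sym_grad st_dir Q u)))"
    proof (intro ballI impI)
      fix p' assume "(\<forall>z \<in> Q. p' z = p z) \<and> (\<forall>z. ess_minus Q p \<le> ereal (p' z) \<and> ereal (p' z) \<le> ess_plus Q p)"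
      then have eq: "lux_norm UNIV p' (sym_grad st_dir (smoothed h u)) = lux_norm Q p (sym_grad st_dir (smoothed h u))" if "h \<in> {0<..<h1}" "u \<in> XX_eps T \<Omega> q p" for h u
        using out(2)[OF h1(1)[OF that(1)] that(2)] by (intro lux_norm_zero_outside) auto
      show "\<exists>cp::real. 0 < cp \<and> (\<forall>u \<in> XX_eps T \<Omega> q p.
          (SUP h\<in>{0<..<h1}. lux_norm Q p (sym_grad st_dir (R_ring \<phi> T \<Omega> h u))) \<le> (SUP h\<in>{0<..<h1}. lux_norm UNIV p' (sym_grad st_dir (R_ring \<phi> T \<Omega> h u))) \<and>
          (SUP h\<in>{0<..<h1}. lux_norm UNIV p' (sym_grad st_dir (R_ring \<phi> T \<Omega> h u))) \<le> ennreal cp * lux_norm Q p (distr_sym_grad st_dir Q u))"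
        unfolding R_ring_eq
      proof (intro exI[of _ Kp] conjI ballI Kp(1))
        fix u assume u: "u \<in> XX_eps T \<Omega> q p"
        show "(SUP h\<in>{0<..<h1}. lux_norm Q p (sym_grad st_dir (smoothed h u))) \<le> (SUP h\<in>{0<..<h1}. lux_norm UNIV p' (sym_grad st_dir (smoothed h u)))"
          by (intro SUP_mono) (use eq[OF _ u] in \<open>metis order_refl\<close>)
        show "(SUP h\<in>{0<..<h1}. lux_norm UNIV p' (sym_grad st_dir (smoothed h u))) \<le> ennreal Kp * lux_norm Q p (distr_sym_grad st_dir Q u)"
        proof (rule SUP_least)
          fix h assume h: "h \<in> {0<..<h1}"
          show "lux_norm UNIV p' (sym_grad st_dir (smoothed h u)) \<le> ennreal Kp * lux_norm Q p (distr_sym_grad st_dir Q u)"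
            unfolding eq[OF h u] by (rule Kp(2)[rule_format, OF h1[OF h] q u])
        qed
      qed
    qed

    have iiib: "\<forall>h\<in>{0<..<h1}.
       (\<forall>u \<in> XX_eps T \<Omega> q p. R_ring \<phi> T \<Omega> h u \<in> XX_eps T \<Omega> q p) \<and>
       (\<forall>u \<in> XX_eps T \<Omega> q p. \<forall>v \<in> XX_eps T \<Omega> q p.
          R_ring \<phi> T \<Omega> h (\<lambda>z. u z + v z) = (\<lambda>z. R_ring \<phi> T \<Omega> h u z + R_ring \<phi> T \<Omega> h v z)) \<and>
       (\<forall>a. \<forall>u \<in> XX_eps T \<Omega> q p. R_ring \<phi> T \<Omega> h (\<lambda>z. a *\<^sub>R u z) = (\<lambda>z. a *\<^sub>R R_ring \<phi> T \<Omega> h u z)) \<and>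
       (\<exists>C::real. 0 < C \<and> (\<forall>u \<in> XX_eps T \<Omega> q p. XX_norm T \<Omega> q p (R_ring \<phi> T \<Omega> h u) \<le> ennreal C * XX_norm T \<Omega> q p u))"
      unfolding R_ring_eq
    proof (intro ballI conjI allI)
      fix h assume "h \<in> {0<..<h1}"
      note h = h1[OF this]
      show "smoothed h u \<in> XX_eps T \<Omega> q p" if "u \<in> XX_eps T \<Omega> q p" for u
        by (rule C0_infty_XX_eps[OF open_dom C0[OF h(1) that] q p])
      show "smoothed h (\<lambda>z. u z + v z) = (\<lambda>z. smoothed h u z + smoothed h v z)" if "u \<in> XX_eps T \<Omega> q p" "v \<in> XX_eps T \<Omega> q p" for u v
        using smoothed_add[OF h(1) XD(4)[OF that(1)] XD(4)[OF that(2)]] .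
      show "smoothed h (\<lambda>z. a *\<^sub>R u z) = (\<lambda>z. a *\<^sub>R smoothed h u z)" for a and u :: "real \<times> (real^'d) \<Rightarrow> real^'d"
        by (rule smoothed_scaleR)
      show "\<exists>C::real. 0 < C \<and> (\<forall>u \<in> XX_eps T \<Omega> q p. XX_norm T \<Omega> q p (smoothed h u) \<le> ennreal C * XX_norm T \<Omega> q p u)"
      proof (intro exI[of _ "Kq + Kp"] conjI ballI)
        fix u assume u: "u \<in> XX_eps T \<Omega> q p"
        let ?a = "lux_norm Q q u" and ?b = "lux_norm Q p (distr_sym_grad st_dir Q u)"
        have "XX_norm T \<Omega> q p (smoothed h u) = lux_norm Q q (smoothed h u) + lux_norm Q p (sym_grad st_dir (smoothed h u))"
          unfolding XX_norm_def eps_norm_def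
            lux_norm_distr_sym_grad[OF Q_open C0_infty_has_distr_sym_grad[OF C0[OF h(1) u] st_dir_Basis]] ..
        also have "\<dots> \<le> ennreal Kq * ?a + ennreal Kp * ?b"
          using Kq(2) h XD(1)[OF u] by (intro add_mono Kp(2)[rule_format, OF h q u]) simp
        also have "\<dots> \<le> ennreal (Kq + Kp) * ?a + ennreal (Kq + Kp) * ?b"
          using Kq(1) Kp(1) by (intro add_mono mult_right_mono ennreal_leI) simp_all
        also have "\<dots> = ennreal (Kq + Kp) * XX_norm T \<Omega> q p u"
          unfolding XX_norm_def eps_norm_def by (rule distrib_left[symmetric])
        finally show "XX_norm T \<Omega> q p (smoothed h u) \<le> ennreal (Kq + Kp) * XX_norm T \<Omega> q p u" .
      qed (use Kq Kp in simp)
    qed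

    have iva: "\<forall>u \<in> XX_eps T \<Omega> q p. ((\<lambda>h. XX_norm T \<Omega> q p (\<lambda>z. R_ring \<phi> T \<Omega> h u z - u z)) \<longlongrightarrow> 0) (at_right 0)"
      unfolding R_ring_eq using XX_norm_smoothed_diff_tendsto[OF be c0 h0 q p] by blast
    have ivb: "C0_infty Q \<subseteq> XX_eps T \<Omega> q p"
      using C0_infty_XX_eps[OF open_dom _ q p] by blast
    have ivc: "\<forall>u \<in> XX_eps T \<Omega> q p. \<forall>\<epsilon>>0. \<exists>v \<in> C0_infty Q. XX_norm T \<Omega> q p (\<lambda>z. u z - v z) < \<epsilon>"
    proof (intro ballI allI impI)
      fix u and \<epsilon> :: ennreal assume u: "u \<in> XX_eps T \<Omega> q p" and "0 < \<epsilon>"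
      then have "\<forall>\<^sub>F h in at_right 0. XX_norm T \<Omega> q p (\<lambda>z. smoothed h u z - u z) < \<epsilon>"
        using order_tendstoD(2)[OF XX_norm_smoothed_diff_tendsto[OF be c0 h0 q p u]] by blast
      then have "\<forall>\<^sub>F h in at_right 0. 0 < h \<and> XX_norm T \<Omega> q p (\<lambda>z. smoothed h u z - u z) < \<epsilon>"
        using eventually_at_right_less[of "0::real"] by eventually_elim simp
      then obtain h where h: "0 < h" "XX_norm T \<Omega> q p (\<lambda>z. smoothed h u z - u z) < \<epsilon>"
        using eventually_happens'[OF trivial_limit_at_right_real] by blast
      have "XX_norm T \<Omega> q p (\<lambda>z. u z - smoothed h u z) = XX_norm T \<Omega> q p (\<lambda>z. smoothed h u z - u z)"
        unfolding XX_norm_def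
        by (rule eps_norm_minus_commute[OF Q_open st_dir_Basis XD(3)[OF u] C0_infty_has_distr_sym_grad[OF C0[OF h(1) u] st_dir_Basis]])
      then show "\<exists>v \<in> C0_infty Q. XX_norm T \<Omega> q p (\<lambda>z. u z - v z) < \<epsilon>"
        using h(2) by (intro bexI[OF _ C0[OF h(1) u]]) simp
    qed
    show ?case
      by (intro conjI i ii iiiq iiip iiib iva ivb ivc)
  qed
qed

end
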